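(* Let $\mathbb{K}$ be a field of characteristic zero, and use the notation of the context. (a) For every finite nonempty set $I$, the map $\xi_I\colon \Phi_{I,*}\to\widehat{\Phi}_{I,*}$ is injective, and its image is a subcomplex of $\widehat{\Phi}_{I,*}$ (so, identifying $\Phi_{I,*}$ with this image, $\Phi_{I,*}$ becomes a chain complex). (b) With respect to the maps $\alpha_*\colon\Phi_{I,*}\to\Phi_{J,*}$ attached to maps $\alpha\colon I\to J$ of finite nonempty sets, $\Phi_{I,*}$ is a covariant functor of $I$ (with values in chain complexes over $\mathbb{K}$), and every map $\alpha_*\colon\Phi_{I,*}\to\Phi_{J,*}$ is a quasi-isomorphism. (c) For the singleton $1=\{0\}$ we have $\Phi_{1,*}=\mathbb{K}$, concentrated in degree zero.
   Context: For a finite nonempty set $I$ put $\widetilde P_I=\mathbb{K}[t_i\mid i\in I]$, $P_I=\widetilde P_I/(1-\sum_i t_i)$, $W_I=\mathbb{K}\{dt_i\mid i\in I\}/(\sum_i dt_i)$, $\Omega^*_I=P_I\otimes_{\mathbb{K}}\Lambda^*(W_I)$ with the de Rham differential $d$. A map $\alpha\colon I\to J$ induces $\alpha^*\colon P_J\to P_I$, $\alpha^*\colon W_J\to W_I$ and $\alpha^*\colon\Omega_J^*\to\Omega_I^*$ by $\alpha^*(t_j)=\sum_{\alpha(i)=j}t_i$; for an inclusion $J\subseteq I$ this is written $\mathrm{res}^I_J\colon\Omega^*_I\to\Omega^*_J$. Put $\widehat\Phi_{I,k}=\mathrm{Hom}_{\mathbb{K}}(\Omega^k_I,\mathbb{K})$,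 a chain complex under the differential dual to $d$, with sign convention $(\partial\phi)(\omega)=(-1)^{k+1}\phi(d\omega)$ for $\phi\in\widehat\Phi_{I,k+1}$, $\omega\in\Omega^k_I$. Put $W_I^\vee=\mathrm{Hom}_{\mathbb{K}}(W_I,\mathbb{K})$, $\Theta_{I,m}=P_I\otimes\Lambda^m(W_I^\vee)$ and $\Phi_{I,m}=\bigoplus_{\emptyset\ne J\subseteq I}\Theta_{J,m}$, with inclusions $i_J\colon\Theta_{J,m}\to\Phi_{I,m}$. Pairing: $\langle\cdot,\cdot\rangle_I\colon\Theta_{I,m}\otimes\Omega_I^m\to P_I$ is the $P_I$-bilinear map with $\langle \alpha_1\wedge\dots\wedge\alpha_m,\omega_1\wedge\dots\wedge\omega_m\rangle_I=(-1)^{m(m-1)/2}\det(\langle\alpha_i,\omega_j\rangle)$ for $\alpha_i\in W_I^\vee$, $\omega_j\in W_I$. Integral: for $\nu\colon I\to\mathbb{N}$ write $t^{[\nu]}=\prod_i t_i^{\nu_i}/\nu_i!$ and $|\nu|=\sum_i\nu_i$; $\int_I\colon P_I\to\mathbb{K}$ is the (well-defined) linear map with $\int_I t^{[\nu]}=1/(|I|-1+|\nu|)!$. The map $\xi_I\colon\Phi_{I,m}\to\widehat\Phi_{I,m}$ is given by $\xi_I(i_J(\alpha))(\omega)=\int_J\langle\alpha,\mathrm{res}^I_J(\omega)\rangle_J$. Pushforward: for a surjective map $\sigma\colon I\to J$ and $\nu\colon I\to\mathbb{Z}$ put $(\sigma_*\nu)(j)=\sum_{\sigma(i)=j}\nu(i)$.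 The linear map $\sigma_*\colon\widetilde P_I\to\widetilde P_J$, $\sigma_*(t^{[\nu]})=t^{[\sigma_*(\nu+1)-1]}$, induces a map $\sigma_*\colon P_I\to P_J$. Tensoring it with the dual $\sigma_*\colon\Lambda^*(W_I^\vee)\to\Lambda^*(W_J^\vee)$ of $\sigma^*\colon\Lambda^*(W_J)\to\Lambda^*(W_I)$ gives $\sigma_*\colon\Theta_{I,*}\to\Theta_{J,*}$. For an arbitrary map $\alpha\colon I\to I'$ define $\alpha_*\colon\Phi_{I,*}\to\Phi_{I',*}$ by $\alpha_*(i_J(\theta))=i_{\alpha(J)}((\alpha|_J)_*(\theta))$ for $\theta\in\Theta_{J,*}$, where $\alpha|_J$ is regarded as a surjection $J\to\alpha(J)$. *)

theory Defs
  imports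
    "HOL-Library.Poly_Mapping"
    "HOL-Library.Set_Algebras"
    "HOL-Library.FuncSet"
    "HOL-Algebra.Module"
    "HOL-Algebra.AbelCoset"
    "Jordan_Normal_Form.Determinant"
begin

section \<open>Linear algebra over a field given as a type\<close>

text \<open>The field as a ring, and at the same time as a module over itself.\<close>

definition ground :: "('k::field, 'k) module" where
  "ground = \<lparr>carrier = UNIV, monoid.mult = (*), monoid.one = 1, zero = 0, add = (+), module.smult = (*)\<rparr>"

definition lin_map :: "('k::field, 'v) module \<Rightarrow> ('k, 'w) module \<Rightarrow> ('v \<Rightarrow> 'w) \<Rightarrow> bool" where
  "lin_map M N f \<longleftrightarrow>
     f \<in> carrier M \<rightarrow> carrier N \<and>
     (\<forall>x\<in>carrier M. \<forall>y\<in>carrier M. f (x \<oplus>\<^bsub>M\<^esub> y) = f x \<oplus>\<^bsub>N\<^esub> f y) \<and>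
     (\<forall>c. \<forall>x\<in>carrier M. f (c \<odot>\<^bsub>M\<^esub> x) = c \<odot>\<^bsub>N\<^esub> f x)"

definition lin_iso :: "('k::field, 'v) module \<Rightarrow> ('k, 'w) module \<Rightarrow> ('v \<Rightarrow> 'w) \<Rightarrow> bool" where
  "lin_iso M N f \<longleftrightarrow> lin_map M N f \<and> bij_betw f (carrier M) (carrier N)"

text \<open>\<open>Hom(M, K)\<close>; functionals are made unique as HOL functions by being \<open>extensional\<close>.
  The fields \<open>mult\<close> and \<open>one\<close> of a module record play no role.\<close>

definition dual_module :: "('k::field, 'v) module \<Rightarrow> ('k, 'v \<Rightarrow> 'k) module" where
  "dual_module M =
     \<lparr>carrier = {f \<in> extensional (carrier M). lin_map M ground f},
      monoid.mult = undefined, monoid.one = undefined,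
      zero = (\<lambda>x\<in>carrier M. 0),
      add = (\<lambda>f g. \<lambda>x\<in>carrier M. f x + g x),
      module.smult = (\<lambda>c f. \<lambda>x\<in>carrier M. c * f x)\<rparr>"

text \<open>The free vector space on a set of basis elements of type \<open>'x\<close> is \<open>'x \<Rightarrow>\<^sub>0 'k\<close>.\<close>

definition scale :: "'k::field \<Rightarrow> ('x \<Rightarrow>\<^sub>0 'k) \<Rightarrow> ('x \<Rightarrow>\<^sub>0 'k)" where
  "scale c x = Poly_Mapping.map ((*) c) x"

lemma lookup_scale [simp]: "Poly_Mapping.lookup (scale c x) b = c * Poly_Mapping.lookup x b"
  by (simp add: scale_def map.rep_eq when_def)

interpretation free: vector_space "scale :: 'k::field \<Rightarrow> ('x \<Rightarrow>\<^sub>0 'k) \<Rightarrow> ('x \<Rightarrow>\<^sub>0 'k)"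
  by unfold_locales (auto intro!: poly_mapping_eqI simp: lookup_add algebra_simps)

abbreviation basis :: "'x \<Rightarrow> ('x \<Rightarrow>\<^sub>0 'k::field)" where
  "basis b \<equiv> Poly_Mapping.single b 1"

definition lin_ext :: "('x \<Rightarrow> ('y \<Rightarrow>\<^sub>0 'k)) \<Rightarrow> ('x \<Rightarrow>\<^sub>0 'k::field) \<Rightarrow> ('y \<Rightarrow>\<^sub>0 'k)" where
  "lin_ext f x = (\<Sum>b\<in>Poly_Mapping.keys x. scale (Poly_Mapping.lookup x b) (f b))"


subsection \<open>Subquotients, tensor products and exterior powers\<close>

text \<open>All vector spaces below are presented as \<open>S/U\<close> with \<open>U \<subseteq> S\<close> subspaces of a free space, and are
  written as the pair \<open>(S, U)\<close>. The vector space itself is the set of cosets \<open>x + U\<close> with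
  \<open>x \<in> S\<close>.\<close>

type_synonym ('x, 'k) subquot = "('x \<Rightarrow>\<^sub>0 'k) set \<times> ('x \<Rightarrow>\<^sub>0 'k) set"

definition quot :: "('x, 'k::field) subquot \<Rightarrow> ('k, ('x \<Rightarrow>\<^sub>0 'k) set) module" where
  "quot X =
     \<lparr>carrier = (\<lambda>x. x +o snd X) ` fst X,
      monoid.mult = undefined, monoid.one = undefined,
      zero = snd X,
      add = (\<lambda>A B. A + B),
      module.smult = (\<lambda>c A. scale c ` A + snd X)\<rparr>"

text \<open>The map of cosets induced by \<open>F\<close>, with \<open>U\<close> the relations of the target.\<close>

definition induced :: "('y \<Rightarrow>\<^sub>0 'k) set \<Rightarrow> (('x \<Rightarrow>\<^sub>0 'k::field) \<Rightarrow> ('y \<Rightarrow>\<^sub>0 'k))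
    \<Rightarrow> ('x \<Rightarrow>\<^sub>0 'k) set \<Rightarrow> ('y \<Rightarrow>\<^sub>0 'k) set" where
  "induced U F A = F ` A + U"

definition tens :: "('x \<Rightarrow>\<^sub>0 'k::field) \<Rightarrow> ('y \<Rightarrow>\<^sub>0 'k) \<Rightarrow> ('x \<times> 'y \<Rightarrow>\<^sub>0 'k)" (infixr "\<otimes>\<^sub>t" 75) where
  "x \<otimes>\<^sub>t y = (\<Sum>a\<in>Poly_Mapping.keys x. \<Sum>b\<in>Poly_Mapping.keys y.
     Poly_Mapping.single (a, b) (Poly_Mapping.lookup x a * Poly_Mapping.lookup y b))"

definition tensor_sq :: "('x, 'k::field) subquot \<Rightarrow> ('y, 'k) subquot \<Rightarrow> ('x \<times> 'y, 'k) subquot" where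
  "tensor_sq X Y =
     (free.span {x \<otimes>\<^sub>t y | x y. x \<in> fst X \<and> y \<in> fst Y},
      free.span {x \<otimes>\<^sub>t y | x y. x \<in> fst X \<and> y \<in> fst Y \<and> (x \<in> snd X \<or> y \<in> snd Y)})"

text \<open>The tensor algebra of the free space on \<open>'x\<close> has the words over \<open>'x\<close> as basis;
  \<open>word_tensor [v\<^sub>1, \<dots>, v\<^sub>m]\<close> is the tensor of the \<open>v\<^sub>i\<close>, which represents \<open>v\<^sub>1 \<and> \<dots> \<and> v\<^sub>m\<close> in the
  exterior power.\<close>

primrec word_tensor :: "('x \<Rightarrow>\<^sub>0 'k::field) list \<Rightarrow> ('x list \<Rightarrow>\<^sub>0 'k)" where
  "word_tensor [] = basis []"
| "word_tensor (v # vs) = lin_ext (\<lambda>(a, l). basis (a # l)) (v \<otimes>\<^sub>t word_tensor vs)"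

text \<open>The \<open>m\<close>-th exterior power of \<open>S/U\<close>: the \<open>m\<close>-th tensor power of \<open>S\<close> modulo all tensors with a
  repeated factor or with a factor in \<open>U\<close>.\<close>

definition ext_power :: "nat \<Rightarrow> ('x, 'k::field) subquot \<Rightarrow> ('x list, 'k) subquot" where
  "ext_power m X =
     (free.span {word_tensor vs | vs. length vs = m \<and> set vs \<subseteq> fst X},
      free.span {word_tensor vs | vs. length vs = m \<and> set vs \<subseteq> fst X \<and>
        (\<not> distinct vs \<or> set vs \<inter> snd X \<noteq> {})})"


subsection \<open>Chain complexes\<close>

text \<open>A family \<open>C\<close> of vector spaces with \<open>d m\<close> mapping \<open>C (m + 1)\<close> to \<open>C m\<close>; the differential on
  \<open>C 0\<close> is zero.\<close>

definition chain_complex ::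
  "(nat \<Rightarrow> ('k::field, 'v) module) \<Rightarrow> (nat \<Rightarrow> 'v \<Rightarrow> 'v) \<Rightarrow> bool" where
  "chain_complex C d \<longleftrightarrow>
     (\<forall>m. module ground (C m)) \<and>
     (\<forall>m. lin_map (C (Suc m)) (C m) (d m)) \<and>
     (\<forall>m. \<forall>x\<in>carrier (C (Suc (Suc m))). d m (d (Suc m) x) = \<zero>\<^bsub>C m\<^esub>)"

definition subcomplex ::
  "(nat \<Rightarrow> ('k::field, 'v) module) \<Rightarrow> (nat \<Rightarrow> 'v \<Rightarrow> 'v) \<Rightarrow> (nat \<Rightarrow> 'v set) \<Rightarrow> bool" where
  "subcomplex C d D \<longleftrightarrow>
     chain_complex C d \<and>
     (\<forall>m. submodule (D m) ground (C m)) \<and>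
     (\<forall>m. d m ` D (Suc m) \<subseteq> D m)"

definition chain_map ::
  "(nat \<Rightarrow> ('k::field, 'v) module) \<Rightarrow> (nat \<Rightarrow> 'v \<Rightarrow> 'v) \<Rightarrow>
   (nat \<Rightarrow> ('k, 'w) module) \<Rightarrow> (nat \<Rightarrow> 'w \<Rightarrow> 'w) \<Rightarrow> (nat \<Rightarrow> 'v \<Rightarrow> 'w) \<Rightarrow> bool" where
  "chain_map C d D e f \<longleftrightarrow>
     (\<forall>m. lin_map (C m) (D m) (f m)) \<and>
     (\<forall>m. \<forall>x\<in>carrier (C (Suc m)). f m (d m x) = e m (f (Suc m) x))"

definition cycles :: "(nat \<Rightarrow> ('k::field, 'v) module) \<Rightarrow> (nat \<Rightarrow> 'v \<Rightarrow> 'v) \<Rightarrow> nat \<Rightarrow> 'v set" where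
  "cycles C d m =
     (case m of 0 \<Rightarrow> carrier (C 0) | Suc n \<Rightarrow> {x \<in> carrier (C (Suc n)). d n x = \<zero>\<^bsub>C n\<^esub>})"

definition boundaries :: "(nat \<Rightarrow> ('k::field, 'v) module) \<Rightarrow> (nat \<Rightarrow> 'v \<Rightarrow> 'v) \<Rightarrow> nat \<Rightarrow> 'v set" where
  "boundaries C d m = d m ` carrier (C (Suc m))"

definition homology :: "(nat \<Rightarrow> ('k::field, 'v) module) \<Rightarrow> (nat \<Rightarrow> 'v \<Rightarrow> 'v) \<Rightarrow> nat \<Rightarrow> 'v set set" where
  "homology C d m = (\<lambda>z. boundaries C d m +>\<^bsub>C m\<^esub> z) ` cycles C d m"

text \<open>The union runs over the representatives of a homology class; for a chain map all of its members
  coincide.\<close>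

definition quasi_iso ::
  "(nat \<Rightarrow> ('k::field, 'v) module) \<Rightarrow> (nat \<Rightarrow> 'v \<Rightarrow> 'v) \<Rightarrow>
   (nat \<Rightarrow> ('k, 'w) module) \<Rightarrow> (nat \<Rightarrow> 'w \<Rightarrow> 'w) \<Rightarrow> (nat \<Rightarrow> 'v \<Rightarrow> 'w) \<Rightarrow> bool" where
  "quasi_iso C d D e f \<longleftrightarrow>
     (\<forall>m. bij_betw (\<lambda>X. \<Union>x\<in>X. boundaries D e m +>\<^bsub>D m\<^esub> f m x) (homology C d m) (homology D e m))"


section \<open>Polynomial forms on simplices\<close>

type_synonym ('a, 'k) mpoly = "('a \<Rightarrow>\<^sub>0 nat) \<Rightarrow>\<^sub>0 'k"

text \<open>Both forms and polyvector fields are represented in the free space on pairs of a monomial and a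
  word.\<close>

type_synonym ('a, 'k) pform = "(('a \<Rightarrow>\<^sub>0 nat) \<times> 'a list) \<Rightarrow>\<^sub>0 'k"

definition tvar :: "'a \<Rightarrow> ('a, 'k::field) mpoly" where
  "tvar i = basis (Poly_Mapping.single i 1)"

definition P_tilde :: "'a set \<Rightarrow> ('a, 'k::field) mpoly set" where
  "P_tilde I = {p. \<forall>\<mu>\<in>Poly_Mapping.keys p. Poly_Mapping.keys \<mu> \<subseteq> I}"

definition P_ideal :: "'a set \<Rightarrow> ('a, 'k::field) mpoly set" where
  "P_ideal I = {(1 - (\<Sum>i\<in>I. tvar i)) * q | q. q \<in> P_tilde I}"

definition P_sq :: "'a set \<Rightarrow> ('a \<Rightarrow>\<^sub>0 nat, 'k::field) subquot" where
  "P_sq I = (P_tilde I, P_ideal I)"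

text \<open>In \<open>W\<close> the basis element \<open>basis i\<close> is \<open>dt\<^sub>i\<close>.\<close>

definition W_tilde :: "'a set \<Rightarrow> ('a \<Rightarrow>\<^sub>0 'k::field) set" where
  "W_tilde I = {w. Poly_Mapping.keys w \<subseteq> I}"

definition W_rel :: "'a set \<Rightarrow> ('a \<Rightarrow>\<^sub>0 'k::field) set" where
  "W_rel I = {scale c (\<Sum>i\<in>I. basis i) | c. True}"

definition W_sq :: "'a set \<Rightarrow> ('a, 'k::field) subquot" where
  "W_sq I = (W_tilde I, W_rel I)"

text \<open>A functional on the free space on \<open>I\<close> is given by its coordinates \<open>v\<^sub>i = v(dt\<^sub>i)\<close>; the
  functionals on \<open>W\<close> are those that vanish on \<open>W_rel\<close>.\<close>

definition apply_dual :: "('a \<Rightarrow>\<^sub>0 'k::field) \<Rightarrow> ('a \<Rightarrow>\<^sub>0 'k) \<Rightarrow> 'k" where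
  "apply_dual v w = (\<Sum>i\<in>Poly_Mapping.keys w. Poly_Mapping.lookup w i * Poly_Mapping.lookup v i)"

definition W_dual_sq :: "'a set \<Rightarrow> ('a, 'k::field) subquot" where
  "W_dual_sq I = ({v. Poly_Mapping.keys v \<subseteq> I \<and> (\<forall>w\<in>W_rel I. apply_dual v w = 0)}, {0})"

definition Omega_sq :: "'a set \<Rightarrow> nat \<Rightarrow> (('a \<Rightarrow>\<^sub>0 nat) \<times> 'a list, 'k::field) subquot" where
  "Omega_sq I k = tensor_sq (P_sq I) (ext_power k (W_sq I))"

definition Omega :: "'a set \<Rightarrow> nat \<Rightarrow> ('k::field, ('a, 'k) pform set) module" where
  "Omega I k = quot (Omega_sq I k)"

text \<open>The de Rham differential on the tensor of \<open>t\<^sup>\<mu>\<close> with \<open>dt\<^sub>l\<^sub>1 \<and> \<dots> \<and> dt\<^sub>l\<^sub>k\<close>.\<close>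

definition d_form :: "('a, 'k::field) pform \<Rightarrow> ('a, 'k) pform" where
  "d_form = lin_ext (\<lambda>(\<mu>, l). \<Sum>i\<in>Poly_Mapping.keys \<mu>.
     Poly_Mapping.single (\<mu> - Poly_Mapping.single i 1, i # l) (of_nat (Poly_Mapping.lookup \<mu> i)))"

definition d_Omega :: "'a set \<Rightarrow> nat \<Rightarrow> ('a, 'k::field) pform set \<Rightarrow> ('a, 'k) pform set" where
  "d_Omega I k = induced (snd (Omega_sq I (Suc k))) d_form"

text \<open>For a map \<open>\<alpha>\<close> from \<open>I\<close> to \<open>J\<close>, \<open>pull I \<alpha>\<close> maps forms on \<open>J\<close> to forms on \<open>I\<close>.\<close>

definition pull_form :: "'a set \<Rightarrow> ('a \<Rightarrow> 'b) \<Rightarrow> ('b, 'k::field) pform \<Rightarrow> ('a, 'k) pform" where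
  "pull_form I \<alpha> = lin_ext (\<lambda>(\<mu>, l).
     (\<Prod>j\<in>Poly_Mapping.keys \<mu>. (\<Sum>i | i \<in> I \<and> \<alpha> i = j. tvar i) ^ Poly_Mapping.lookup \<mu> j)
     \<otimes>\<^sub>t word_tensor (map (\<lambda>j. \<Sum>i | i \<in> I \<and> \<alpha> i = j. basis i) l))"

definition pull :: "'a set \<Rightarrow> ('a \<Rightarrow> 'b) \<Rightarrow> nat \<Rightarrow> ('b, 'k::field) pform set \<Rightarrow> ('a, 'k) pform set" where
  "pull I \<alpha> k = induced (snd (Omega_sq I k)) (pull_form I \<alpha>)"

definition res_form :: "'a set \<Rightarrow> nat \<Rightarrow> ('a, 'k::field) pform set \<Rightarrow> ('a, 'k) pform set" where
  "res_form J k = pull J (\<lambda>j. j) k"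

definition Phi_hat :: "'a set \<Rightarrow> nat \<Rightarrow> ('k::field, ('a, 'k) pform set \<Rightarrow> 'k) module" where
  "Phi_hat I k = dual_module (Omega I k)"

definition d_Phi_hat :: "'a set \<Rightarrow> nat \<Rightarrow> (('a, 'k::field) pform set \<Rightarrow> 'k) \<Rightarrow> (('a, 'k) pform set \<Rightarrow> 'k)" where
  "d_Phi_hat I k \<phi> = (\<lambda>\<omega>\<in>carrier (Omega I k). (-1) ^ (k + 1) * \<phi> (d_Omega I k \<omega>))"


section \<open>The complex of polyvector fields\<close>

definition Theta_sq :: "'a set \<Rightarrow> nat \<Rightarrow> (('a \<Rightarrow>\<^sub>0 nat) \<times> 'a list, 'k::field) subquot" where
  "Theta_sq I m = tensor_sq (P_sq I) (ext_power m (W_dual_sq I))"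

definition Theta :: "'a set \<Rightarrow> nat \<Rightarrow> ('k::field, ('a, 'k) pform set) module" where
  "Theta I m = quot (Theta_sq I m)"

definition faces :: "'a set \<Rightarrow> 'a set set" where
  "faces I = {J. J \<noteq> {} \<and> J \<subseteq> I}"

text \<open>The direct sum over the finitely many faces \<open>J\<close> of \<open>I\<close>, as families indexed by \<open>J\<close>.\<close>

type_synonym ('a, 'k) phi = "'a set \<Rightarrow> ('a, 'k) pform set"

definition Phi :: "'a set \<Rightarrow> nat \<Rightarrow> ('k::field, ('a, 'k) phi) module" where
  "Phi I m =
     \<lparr>carrier = (\<Pi>\<^sub>E J\<in>faces I. carrier (Theta J m)),
      monoid.mult = undefined, monoid.one = undefined,
      zero = (\<lambda>J\<in>faces I. \<zero>\<^bsub>Theta J m\<^esub>),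
      add = (\<lambda>x y. \<lambda>J\<in>faces I. x J \<oplus>\<^bsub>Theta J m\<^esub> y J),
      module.smult = (\<lambda>c x. \<lambda>J\<in>faces I. c \<odot>\<^bsub>Theta J m\<^esub> x J)\<rparr>"

definition Phi_incl :: "'a set \<Rightarrow> 'a set \<Rightarrow> nat \<Rightarrow> ('a, 'k::field) pform set \<Rightarrow> ('a, 'k) phi" where
  "Phi_incl I J m \<theta> = (\<lambda>F\<in>faces I. if F = J then \<theta> else \<zero>\<^bsub>Theta F m\<^esub>)"

text \<open>For a one-point set \<open>{a}\<close>: the map of \<open>K\<close> into degree zero, \<open>c\<close> to \<open>c (1 \<otimes> 1)\<close>.\<close>

definition Phi_point :: "'a \<Rightarrow> 'k::field \<Rightarrow> ('a, 'k) phi" where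
  "Phi_point a c =
     Phi_incl {a} {a} 0 (scale c (1 \<otimes>\<^sub>t word_tensor []) +o snd (Theta_sq {a} 0))"

text \<open>The pairing on representatives, in coordinates: the words stand for tensors of the elements
  \<open>basis (l ! i)\<close> of the dual basis and \<open>dt\<close> of \<open>l' ! j\<close>. The formula for arbitrary factors is
  \<open>pair_form_word\<close> below.\<close>

definition pair_form :: "('a, 'k::field) pform \<Rightarrow> ('a, 'k) pform \<Rightarrow> ('a, 'k) mpoly" where
  "pair_form x y = lin_ext (\<lambda>((\<mu>, l), (\<nu>, l')).
     Poly_Mapping.single (\<mu> + \<nu>) ((-1) ^ (length l * (length l - 1) div 2) *
       det (mat (length l) (length l) (\<lambda>(i, j). apply_dual (basis (l ! i)) (basis (l' ! j))))))
     (x \<otimes>\<^sub>t y)"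

definition pairing :: "'a set \<Rightarrow> ('a, 'k::field) pform set \<Rightarrow> ('a, 'k) pform set \<Rightarrow> ('a, 'k) mpoly set" where
  "pairing I A B = {pair_form x y + u | x y u. x \<in> A \<and> y \<in> B \<and> u \<in> P_ideal I}"

text \<open>The divided power monomial of \<open>\<nu>\<close>.\<close>

definition fact_mon :: "('a \<Rightarrow>\<^sub>0 nat) \<Rightarrow> 'k::field_char_0" where
  "fact_mon \<nu> = (\<Prod>i\<in>Poly_Mapping.keys \<nu>. fact (Poly_Mapping.lookup \<nu> i))"

definition divided :: "('a \<Rightarrow>\<^sub>0 nat) \<Rightarrow> ('a, 'k::field_char_0) mpoly" where
  "divided \<nu> = Poly_Mapping.single \<nu> (1 / fact_mon \<nu>)"

definition simplex_integral_tilde :: "'a set \<Rightarrow> ('a, 'k::field_char_0) mpoly \<Rightarrow> 'k" where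
  "simplex_integral_tilde I p = (\<Sum>\<nu>\<in>Poly_Mapping.keys p. Poly_Mapping.lookup p \<nu> *
     (fact_mon \<nu> / fact (card I - 1 + (\<Sum>i\<in>I. Poly_Mapping.lookup \<nu> i))))"

lemma simplex_integral_tilde_divided:
  "simplex_integral_tilde I (divided \<nu>) = 1 / fact (card I - 1 + (\<Sum>i\<in>I. Poly_Mapping.lookup \<nu> i))"
  by (simp add: simplex_integral_tilde_def divided_def fact_mon_def)

text \<open>The integral takes a single value on each coset in \<open>P\<close>.\<close>

definition simplex_integral :: "'a set \<Rightarrow> ('a, 'k::field_char_0) mpoly set \<Rightarrow> 'k" where
  "simplex_integral I A = the_elem (simplex_integral_tilde I ` A)"

definition xi :: "'a set \<Rightarrow> nat \<Rightarrow> ('a, 'k::field_char_0) phi \<Rightarrow> (('a, 'k) pform set \<Rightarrow> 'k)" where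
  "xi I m x = (\<lambda>\<omega>\<in>carrier (Omega I m). \<Sum>J\<in>faces I. simplex_integral J (pairing J (x J) (res_form J m \<omega>)))"

text \<open>The differential that \<open>Phi\<close> receives from its image under \<open>xi\<close>.\<close>

definition d_Phi :: "'a set \<Rightarrow> nat \<Rightarrow> ('a, 'k::field_char_0) phi \<Rightarrow> ('a, 'k) phi" where
  "d_Phi I m x = inv_into (carrier (Phi I m)) (xi I m) (d_Phi_hat I m (xi I (Suc m) x))"


subsection \<open>Pushforward\<close>

text \<open>The exponent \<open>\<sigma>\<^sub>*(\<nu> + 1) - 1\<close>; the fibres over \<open>J\<close> are nonempty because \<open>\<sigma>\<close> is onto, so that the
  subtraction does not truncate.\<close>

definition push_exp :: "'a set \<Rightarrow> 'b set \<Rightarrow> ('a \<Rightarrow> 'b) \<Rightarrow> ('a \<Rightarrow>\<^sub>0 nat) \<Rightarrow> ('b \<Rightarrow>\<^sub>0 nat)" where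
  "push_exp I J \<sigma> \<nu> =
     (\<Sum>j\<in>J. Poly_Mapping.single j ((\<Sum>i | i \<in> I \<and> \<sigma> i = j. Poly_Mapping.lookup \<nu> i + 1) - 1))"

text \<open>In coordinates, the dual of \<open>\<sigma>\<^sup>*\<close> sends the dual basis vector of \<open>i\<close> to that of \<open>\<sigma> i\<close>, so on
  words it is \<open>map \<sigma>\<close>; see \<open>push_form_divided\<close> and \<open>apply_dual_push\<close> below.\<close>

definition push_form :: "'a set \<Rightarrow> 'b set \<Rightarrow> ('a \<Rightarrow> 'b) \<Rightarrow> ('a, 'k::field_char_0) pform \<Rightarrow> ('b, 'k) pform" where
  "push_form I J \<sigma> = lin_ext (\<lambda>(\<nu>, l).
     scale (fact_mon \<nu>) (divided (push_exp I J \<sigma> \<nu>)) \<otimes>\<^sub>t basis (map \<sigma> l))"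

definition push_Theta ::
  "'a set \<Rightarrow> 'b set \<Rightarrow> ('a \<Rightarrow> 'b) \<Rightarrow> nat \<Rightarrow> ('a, 'k::field_char_0) pform set \<Rightarrow> ('b, 'k) pform set" where
  "push_Theta I J \<sigma> m = induced (snd (Theta_sq J m)) (push_form I J \<sigma>)"

definition push ::
  "'a set \<Rightarrow> 'b set \<Rightarrow> ('a \<Rightarrow> 'b) \<Rightarrow> nat \<Rightarrow> ('a, 'k::field_char_0) phi \<Rightarrow> ('b, 'k) phi" where
  "push I J \<alpha> m x = (\<lambda>L\<in>faces J.
     \<Oplus>\<^bsub>Theta L m\<^esub>F\<in>{F \<in> faces I. \<alpha> ` F = L}. push_Theta F L \<alpha> m (x F))"

section \<open>The coordinate formulas on general decomposable elements\<close>

lemma lin_ext_superset: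
  assumes "finite A" "Poly_Mapping.keys x \<subseteq> A"
  shows "lin_ext f x = (\<Sum>b\<in>A. scale (Poly_Mapping.lookup x b) (f b))"
  unfolding lin_ext_def
  by (rule sum.mono_neutral_left[OF assms]) (auto simp: in_keys_iff)

lemma lin_ext_basis [simp]: "lin_ext f (basis b) = f b"
  by (simp add: lin_ext_def)

lemma lookup_tens [simp]:
  "Poly_Mapping.lookup (x \<otimes>\<^sub>t y) (a, b) = Poly_Mapping.lookup x a * Poly_Mapping.lookup y b"
proof -
  have "Poly_Mapping.lookup (x \<otimes>\<^sub>t y) (a, b) =
    (\<Sum>a'\<in>Poly_Mapping.keys x. \<Sum>b'\<in>Poly_Mapping.keys y.
      if a' = a \<and> b' = b then Poly_Mapping.lookup x a * Poly_Mapping.lookup y b else 0)"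
    unfolding tens_def lookup_sum by (intro sum.cong refl) (auto simp: lookup_single when_def)
  also have "\<dots> = (\<Sum>a'\<in>Poly_Mapping.keys x. if a' = a then
      (\<Sum>b'\<in>Poly_Mapping.keys y. if b' = b then Poly_Mapping.lookup x a * Poly_Mapping.lookup y b else 0) else 0)"
    by (intro sum.cong refl) auto
  also have "\<dots> = Poly_Mapping.lookup x a * Poly_Mapping.lookup y b"
    by (simp add: in_keys_iff)
  finally show ?thesis .
qed

lemma lin_ext_tens:
  "lin_ext f (x \<otimes>\<^sub>t y) = (\<Sum>a\<in>Poly_Mapping.keys x. \<Sum>b\<in>Poly_Mapping.keys y.
     scale (Poly_Mapping.lookup x a * Poly_Mapping.lookup y b) (f (a, b)))"
proof -
  have "lin_ext f (x \<otimes>\<^sub>t y) = (\<Sum>c\<in>Poly_Mapping.keys x \<times> Poly_Mapping.keys y.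
     scale (Poly_Mapping.lookup (x \<otimes>\<^sub>t y) c) (f c))"
    by (rule lin_ext_superset) (auto simp: in_keys_iff)
  then show ?thesis by (simp add: sum.cartesian_product case_prod_unfold)
     (auto intro!: sum.cong simp: lookup_tens[symmetric])
qed

lemma lin_ext_tens':
  "lin_ext f (x \<otimes>\<^sub>t y) = lin_ext (\<lambda>a. lin_ext (\<lambda>b. f (a, b)) y) x"
  unfolding lin_ext_tens by (simp add: lin_ext_def free.scale_sum_right)

lemma lin_ext_cong:
  "(\<And>b. b \<in> Poly_Mapping.keys x \<Longrightarrow> f b = g b) \<Longrightarrow> lin_ext f x = lin_ext g x"
  by (simp add: lin_ext_def)

lemma lin_ext_add: "lin_ext f (x + y) = lin_ext f x + lin_ext f y"
proof -
  let ?A = "Poly_Mapping.keys x \<union> Poly_Mapping.keys y"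
  have "Poly_Mapping.keys (x + y) \<subseteq> ?A" by (rule Poly_Mapping.keys_add)
  then show ?thesis
    by (simp add: lin_ext_superset[where A = ?A] lookup_add free.scale_left_distrib sum.distrib)
qed

lemma lin_ext_scale: "lin_ext f (scale c x) = scale c (lin_ext f x)"
proof -
  have "Poly_Mapping.keys (scale c x) \<subseteq> Poly_Mapping.keys x" by (auto simp: in_keys_iff)
  then have "lin_ext f (scale c x) =
      (\<Sum>b\<in>Poly_Mapping.keys x. scale (Poly_Mapping.lookup (scale c x) b) (f b))"
    by (intro lin_ext_superset) auto
  then show ?thesis unfolding lin_ext_def by (simp add: free.scale_sum_right)
qed

lemma lin_ext_0 [simp]: "lin_ext f 0 = 0" by (simp add: lin_ext_def)

lemma lin_ext_sum: "lin_ext f (\<Sum>a\<in>A. g a) = (\<Sum>a\<in>A. lin_ext f (g a))"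
  by (induction A rule: infinite_finite_induct) (auto simp: lin_ext_add)

lemma lin_ext_lin_ext: "lin_ext f (lin_ext g x) = lin_ext (\<lambda>b. lin_ext f (g b)) x"
  unfolding lin_ext_def[of g x] lin_ext_def[of "\<lambda>b. lin_ext f (g b)"]
  by (simp add: lin_ext_sum lin_ext_scale)

lemma lin_ext_word:
  fixes vs :: "('x \<Rightarrow>\<^sub>0 'k::field) list"
  assumes "\<And>xs v ys. length xs + length ys + 1 = length us + length vs \<Longrightarrow>
      F (xs @ v # ys) = (\<Sum>a\<in>Poly_Mapping.keys v. Poly_Mapping.lookup v a * F (xs @ basis a # ys))"
    and "us = map basis l"
  shows "lin_ext (\<lambda>l'. scale (F (map basis (l @ l'))) y) (word_tensor vs) = scale (F (us @ vs)) y"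
  using assms
proof (induction vs arbitrary: l us)
  case Nil
  then show ?case by simp
next
  case (Cons v vs)
  have "lin_ext (\<lambda>l'. scale (F (map basis (l @ l'))) y) (word_tensor (v # vs)) =
     (\<Sum>a\<in>Poly_Mapping.keys v. scale (Poly_Mapping.lookup v a)
        (lin_ext (\<lambda>l'. scale (F (map basis ((l @ [a]) @ l'))) y) (word_tensor vs)))"
    unfolding lin_ext_def[of _ "word_tensor vs"]
    by (simp add: lin_ext_lin_ext case_prod_unfold lin_ext_tens free.scale_sum_right
        lin_ext_sum lin_ext_scale mult.assoc)
  also have "\<dots> = (\<Sum>a\<in>Poly_Mapping.keys v. scale (Poly_Mapping.lookup v a) (scale (F ((us @ [basis a]) @ vs)) y))"
    by (intro sum.cong refl arg_cong[where f = "scale _"] Cons.IH) (auto intro!: Cons.prems(1) simp: Cons.prems(2))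
  also have "\<dots> = scale (\<Sum>a\<in>Poly_Mapping.keys v. Poly_Mapping.lookup v a * F (us @ basis a # vs)) y"
    by (simp add: free.scale_sum_left)
  also have "\<dots> = scale (F (us @ v # vs)) y"
    by (subst Cons.prems(1)[of us vs v]) auto
  finally show ?case .
qed

lemma word_tensor_length:
  "l \<in> Poly_Mapping.keys (word_tensor vs) \<Longrightarrow> length l = length vs"
proof (induction vs arbitrary: l)
  case (Cons v vs)
  show ?case
  proof (rule ccontr)
    assume n: "length l \<noteq> length (v # vs)"
    have "Poly_Mapping.lookup (word_tensor (v # vs)) l = 0"
      using n Cons.IH by (auto simp: lin_ext_tens lookup_sum lookup_single when_def intro!: sum.neutral)
    then show False using Cons.prems by (simp add: in_keys_iff)
  qed
qed simp

lemma scale_single [simp]: "scale c (Poly_Mapping.single b x) = Poly_Mapping.single b (c * x)"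
  by (rule poly_mapping_eqI) (simp add: lookup_single when_def)

lemma det_row_comb:
  fixes h :: "nat \<Rightarrow> nat \<Rightarrow> 'k::field"
  assumes k: "k < m" and S: "finite S"
    and hk: "\<And>j. j < m \<Longrightarrow> h k j = (\<Sum>a\<in>S. c a * g a j)"
  shows "det (mat m m (\<lambda>(i, j). h i j)) =
    (\<Sum>a\<in>S. c a * det (mat m m (\<lambda>(i, j). if i = k then g a j else h i j)))"
proof -
  have *: "(\<Prod>i = 0..<m. h i (p i)) = (\<Sum>a\<in>S. c a * (\<Prod>i = 0..<m. if i = k then g a (p i) else h i (p i)))"
    if p: "p permutes {0..<m}" for p
  proof -
    have pk: "p k < m" using p k permutes_in_image[OF p] by auto
    have kin: "k \<in> {0..<m}" using k by simp
    have "(\<Prod>i = 0..<m. h i (p i)) = (\<Sum>a\<in>S. c a * (g a (p k) * (\<Prod>i\<in>{0..<m} - {k}. h i (p i))))"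
      by (simp add: prod.remove[OF _ kin] hk[OF pk] sum_distrib_right mult.assoc)
    also have "\<dots> = (\<Sum>a\<in>S. c a * (\<Prod>i = 0..<m. if i = k then g a (p i) else h i (p i)))"
      by (intro sum.cong refl arg_cong[where f = "(*) _"]) (simp add: prod.remove[OF _ kin])
    finally show ?thesis .
  qed
  have e: "det (mat m m (\<lambda>(i, j). f i j)) = (\<Sum>p\<in>{p. p permutes {0..<m}}. signof p * (\<Prod>i = 0..<m. f i (p i)))"
    for f :: "nat \<Rightarrow> nat \<Rightarrow> 'k"
  proof -
    have "det (mat m m (\<lambda>(i, j). f i j)) = (\<Sum>p\<in>{p. p permutes {0..<m}}. signof p * (\<Prod>i = 0..<m. mat m m (\<lambda>(i, j). f i j) $$ (i, p i)))"
      by (rule det_def') auto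
    also have "\<dots> = (\<Sum>p\<in>{p. p permutes {0..<m}}. signof p * (\<Prod>i = 0..<m. f i (p i)))"
      by (intro sum.cong refl arg_cong[where f = "(*) _"] prod.cong) (auto simp: permutes_in_image dest: permutes_in_image)
    finally show ?thesis .
  qed
  have "det (mat m m (\<lambda>(i, j). h i j)) = (\<Sum>p\<in>{p. p permutes {0..<m}}. \<Sum>a\<in>S. c a *
      (signof p * (\<Prod>i = 0..<m. if i = k then g a (p i) else h i (p i))))"
    unfolding e by (intro sum.cong refl) (simp add: * sum_distrib_left mult_ac)
  also have "\<dots> = (\<Sum>a\<in>S. c a * (\<Sum>p\<in>{p. p permutes {0..<m}}.
      signof p * (\<Prod>i = 0..<m. if i = k then g a (p i) else h i (p i))))"
    by (subst sum.swap) (simp add: sum_distrib_left)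
  finally show ?thesis unfolding e .
qed

lemma det_mat_swap: "det (mat m m (\<lambda>(i, j). f i j)) = det (mat m m (\<lambda>(i, j). f j i :: 'k::field))"
proof -
  have "mat m m (\<lambda>(i, j). f j i) = transpose_mat (mat m m (\<lambda>(i, j). f i j))"
    by (rule eq_matI) auto
  then show ?thesis by (simp add: det_transpose[of _ m])
qed

lemma det_col_comb:
  fixes h :: "nat \<Rightarrow> nat \<Rightarrow> 'k::field"
  assumes "k < m" "finite S" "\<And>i. i < m \<Longrightarrow> h i k = (\<Sum>a\<in>S. c a * g a i)"
  shows "det (mat m m (\<lambda>(i, j). h i j)) =
    (\<Sum>a\<in>S. c a * det (mat m m (\<lambda>(i, j). if j = k then g a i else h i j)))"
proof -
  have "det (mat m m (\<lambda>(i, j). h j i)) =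
    (\<Sum>a\<in>S. c a * det (mat m m (\<lambda>(i, j). if i = k then g a j else h j i)))"
    by (rule det_row_comb) (use assms in auto)
  then show ?thesis
    by (subst det_mat_swap, subst (2) det_mat_swap) simp
qed

lemma apply_dual_basis_right: "apply_dual v (basis i) = Poly_Mapping.lookup v i"
  by (simp add: apply_dual_def)

lemma apply_dual_expand_left:
  "apply_dual v w = (\<Sum>a\<in>Poly_Mapping.keys v. Poly_Mapping.lookup v a * apply_dual (basis a) w)"
proof -
  let ?A = "Poly_Mapping.keys v \<union> Poly_Mapping.keys w"
  have 1: "apply_dual u w = (\<Sum>i\<in>?A. Poly_Mapping.lookup w i * Poly_Mapping.lookup u i)" for u
    unfolding apply_dual_def by (rule sum.mono_neutral_left) (auto simp: in_keys_iff)
  have 2: "apply_dual (basis a) w = Poly_Mapping.lookup w a" for a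
    by (auto simp: apply_dual_def lookup_single when_def in_keys_iff if_distrib cong: if_cong)
  show ?thesis unfolding 1[of v] 2
    by (rule sum.mono_neutral_cong_right) (auto simp: in_keys_iff)
qed

lemma apply_dual_expand_right:
  "apply_dual v w = (\<Sum>a\<in>Poly_Mapping.keys w. Poly_Mapping.lookup w a * apply_dual v (basis a))"
  unfolding apply_dual_basis_right by (simp add: apply_dual_def)

lemma pair_form_word:
  fixes p q :: "('a, 'k::field) mpoly"
  assumes "length as = m" "length ws = m"
  shows "pair_form (p \<otimes>\<^sub>t word_tensor as) (q \<otimes>\<^sub>t word_tensor ws) =
    scale ((-1) ^ (m * (m - 1) div 2) *
      det (mat m m (\<lambda>(i, j). apply_dual (as ! i) (ws ! j)))) (p * q)"
proof -
  let ?D = "\<lambda>as ws. (-1) ^ (m * (m - 1) div 2) *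
      det (mat m m (\<lambda>(i, j). apply_dual (as ! i) (ws ! j))) :: 'k"
  have left: "?D (xs @ v # ys) ws = (\<Sum>a\<in>Poly_Mapping.keys v. Poly_Mapping.lookup v a * ?D (xs @ basis a # ys) ws)"
    if "length xs + length ys + 1 = m" for xs ys v ws
  proof -
    have k: "length xs < m" using that by simp
    have "det (mat m m (\<lambda>(i, j). apply_dual ((xs @ v # ys) ! i) (ws ! j))) =
      (\<Sum>a\<in>Poly_Mapping.keys v. Poly_Mapping.lookup v a * det (mat m m (\<lambda>(i, j).
        if i = length xs then apply_dual (basis a) (ws ! j) else apply_dual ((xs @ v # ys) ! i) (ws ! j))))"
      by (rule det_row_comb[OF k]) (simp_all add: apply_dual_expand_left[of v])
    also have "\<dots> = (\<Sum>a\<in>Poly_Mapping.keys v. Poly_Mapping.lookup v a *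
        det (mat m m (\<lambda>(i, j). apply_dual ((xs @ basis a # ys) ! i) (ws ! j))))"
      by (intro sum.cong refl arg_cong[where f = "\<lambda>A. _ * det A"] eq_matI)
         (auto simp: nth_append nth_Cons')
    finally show ?thesis by (simp only: sum_distrib_left mult.left_commute)
  qed
  have right: "?D as (xs @ v # ys) = (\<Sum>a\<in>Poly_Mapping.keys v. Poly_Mapping.lookup v a * ?D as (xs @ basis a # ys))"
    if "length xs + length ys + 1 = m" for xs ys v as
  proof -
    have k: "length xs < m" using that by simp
    have "det (mat m m (\<lambda>(i, j). apply_dual (as ! i) ((xs @ v # ys) ! j))) =
      (\<Sum>a\<in>Poly_Mapping.keys v. Poly_Mapping.lookup v a * det (mat m m (\<lambda>(i, j).
        if j = length xs then apply_dual (as ! i) (basis a) else apply_dual (as ! i) ((xs @ v # ys) ! j))))"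
      by (rule det_col_comb[OF k]) (simp_all add: apply_dual_expand_right[of _ v])
    also have "\<dots> = (\<Sum>a\<in>Poly_Mapping.keys v. Poly_Mapping.lookup v a *
        det (mat m m (\<lambda>(i, j). apply_dual (as ! i) ((xs @ basis a # ys) ! j))))"
      by (intro sum.cong refl arg_cong[where f = "\<lambda>A. _ * det A"] eq_matI)
         (auto simp: nth_append nth_Cons')
    finally show ?thesis by (simp only: sum_distrib_left mult.left_commute)
  qed
  have mult: "p * q = lin_ext (\<lambda>\<mu>. lin_ext (\<lambda>\<nu>. basis (\<mu> + \<nu>)) q) p"
  proof -
    have e: "x = lin_ext basis x" for x :: "('a, 'k) mpoly"
      by (rule poly_mapping_eqI)
         (simp add: lin_ext_def lookup_sum lookup_single when_def if_distrib in_keys_iff cong: if_cong)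
    have s: "scale c x = Poly_Mapping.single 0 c * x" for c and x :: "('a, 'k) mpoly"
      by (rule poly_mapping_eqI) (simp add: scale_def mult_map_scale_conv_mult)
    have "lin_ext basis p * lin_ext basis q = lin_ext (\<lambda>\<mu>. lin_ext (\<lambda>\<nu>. basis (\<mu> + \<nu>)) q) p"
      unfolding lin_ext_def s
      by (simp add: sum_distrib_left sum_distrib_right mult_single ac_simps)
         (subst sum.swap, simp add: ac_simps)
    then show ?thesis using e[of p] e[of q] by simp
  qed
  have scale_out: "lin_ext (\<lambda>b. scale c (g b)) x = scale c (lin_ext g x)"
    for c :: 'k and g :: "'y \<Rightarrow> ('a, 'k) mpoly" and x :: "'y \<Rightarrow>\<^sub>0 'k"
    by (simp add: lin_ext_def free.scale_sum_right mult.commute)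
  let ?f = "\<lambda>\<mu> l \<nu> l'. scale (?D (map basis l) (map basis l')) (basis (\<mu> + \<nu>)) :: ('a, 'k) mpoly"
  have f: "Poly_Mapping.single (\<mu> + \<nu>) ((-1) ^ (length l * (length l - 1) div 2) *
       det (mat (length l) (length l) (\<lambda>(i, j). apply_dual (basis (l ! i)) (basis (l' ! j))))) = ?f \<mu> l \<nu> l'"
    if "l \<in> Poly_Mapping.keys (word_tensor as)" "l' \<in> Poly_Mapping.keys (word_tensor ws)" for \<mu> \<nu> l l'
  proof -
    have l: "length l = m" "length l' = m"
      using that assms word_tensor_length by metis+
    have "mat m m (\<lambda>(i, j). apply_dual (basis (l ! i)) (basis (l' ! j))) =
        (mat m m (\<lambda>(i, j). apply_dual (map basis l ! i) (map basis l' ! j)) :: 'k mat)"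
      by (rule eq_matI) (use l in auto)
    from this show ?thesis unfolding l by (simp only: scale_single mult_1_right)
  qed
  have "pair_form (p \<otimes>\<^sub>t word_tensor as) (q \<otimes>\<^sub>t word_tensor ws) =
    lin_ext (\<lambda>\<mu>. lin_ext (\<lambda>l. lin_ext (\<lambda>\<nu>. lin_ext (\<lambda>l'. ?f \<mu> l \<nu> l') (word_tensor ws)) q) (word_tensor as)) p"
    unfolding pair_form_def lin_ext_tens' by (intro lin_ext_cong) (simp only: case_prod_conv f)
  also have "\<dots> = lin_ext (\<lambda>\<mu>. lin_ext (\<lambda>l. lin_ext (\<lambda>\<nu>. scale (?D (map basis l) ws) (basis (\<mu> + \<nu>))) q) (word_tensor as)) p"
  proof -
    have "lin_ext (\<lambda>l'. scale (?D (map basis l) (map basis ([] @ l'))) (basis (\<mu> + \<nu>))) (word_tensor ws) =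
        scale (?D (map basis l) ([] @ ws)) (basis (\<mu> + \<nu>) :: ('a, 'k) mpoly)" for l \<mu> \<nu>
      by (rule lin_ext_word[where F = "\<lambda>ws. ?D (map basis l) ws"]) (rule right, use assms in simp_all)
    then show ?thesis by (simp only: append_Nil)
  qed
  also have "\<dots> = lin_ext (\<lambda>\<mu>. lin_ext (\<lambda>l. scale (?D (map basis l) ws) (lin_ext (\<lambda>\<nu>. basis (\<mu> + \<nu>)) q)) (word_tensor as)) p"
    unfolding scale_out ..
  also have "\<dots> = lin_ext (\<lambda>\<mu>. scale (?D as ws) (lin_ext (\<lambda>\<nu>. basis (\<mu> + \<nu>)) q)) p"
  proof -
    have "lin_ext (\<lambda>l. scale (?D (map basis ([] @ l)) ws) y) (word_tensor as) =
        scale (?D ([] @ as) ws) y" for y :: "('a, 'k) mpoly"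
      by (rule lin_ext_word[where F = "\<lambda>as. ?D as ws"]) (rule left, use assms in simp_all)
    then show ?thesis by (simp only: append_Nil)
  qed
  finally show ?thesis unfolding scale_out mult .
qed

lemma fact_mon_nonzero [simp]: "fact_mon \<nu> \<noteq> (0 :: 'k::field_char_0)"
  by (simp add: fact_mon_def)

lemma push_form_divided:
  "push_form I J \<sigma> (divided \<nu> \<otimes>\<^sub>t basis l) =
     (divided (push_exp I J \<sigma> \<nu>) \<otimes>\<^sub>t basis (map \<sigma> l) :: ('b, 'k::field_char_0) pform)"
proof -
  have t: "x \<otimes>\<^sub>t Poly_Mapping.single b c = lin_ext (\<lambda>a. Poly_Mapping.single (a, b) c) x"
    for x :: "'u \<Rightarrow>\<^sub>0 'k" and b :: 'v and c
    by (auto simp: tens_def lin_ext_def)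
  have 1: "divided \<nu> \<otimes>\<^sub>t basis l = scale (1 / fact_mon \<nu>) (basis (\<nu>, l) :: ('a, 'k) pform)"
    by (simp add: t divided_def lin_ext_def)
  have "push_form I J \<sigma> (basis (\<nu>, l)) =
      scale (fact_mon \<nu>) (divided (push_exp I J \<sigma> \<nu>) \<otimes>\<^sub>t basis (map \<sigma> l) :: ('b, 'k) pform)"
    unfolding push_form_def lin_ext_basis case_prod_conv t by (rule lin_ext_scale)
  moreover have "push_form I J \<sigma> (scale c x) = (scale c (push_form I J \<sigma> x) :: ('b, 'k) pform)"
    for c x by (simp only: push_form_def lin_ext_scale)
  ultimately show ?thesis
    unfolding 1 by (simp only: free.scale_scale) simp
qed

text \<open>The map on functionals that underlies \<open>push_form\<close> is dual to the one that underlies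
  \<open>pull_form\<close>.\<close>

lemma apply_dual_push:
  assumes "finite I" "Poly_Mapping.keys v \<subseteq> I"
  shows "apply_dual (lin_ext (\<lambda>i. basis (\<sigma> i)) v) (basis j) =
    apply_dual v (\<Sum>i | i \<in> I \<and> \<sigma> i = j. basis i)"
proof -
  have "apply_dual v (\<Sum>i | i \<in> I \<and> \<sigma> i = j. basis i) =
      (\<Sum>a\<in>Poly_Mapping.keys v. Poly_Mapping.lookup v a * (if \<sigma> a = j then 1 else 0))"
    unfolding apply_dual_expand_left[of v]
  proof (intro sum.cong refl arg_cong[where f = "(*) _"])
    fix a assume "a \<in> Poly_Mapping.keys v"
    then have a: "a \<in> I" using assms by auto
    have "Poly_Mapping.lookup (\<Sum>i | i \<in> I \<and> \<sigma> i = j. basis i) a = (if \<sigma> a = j then 1 else 0 :: 'b)"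
      using a assms(1) by (simp add: lookup_sum lookup_single when_def)
    then show "apply_dual (basis a) (\<Sum>i | i \<in> I \<and> \<sigma> i = j. basis i) = (if \<sigma> a = j then 1 else 0 :: 'b)"
      by (subst apply_dual_expand_right) (simp add: apply_dual_basis_right lookup_single when_def in_keys_iff if_distrib cong: if_cong)
  qed
  then show ?thesis
    by (simp add: apply_dual_basis_right lin_ext_def lookup_sum lookup_single when_def
        if_distrib cong: if_cong)
qed

end

theory Submission
  imports Defs
begin

text \<open>
  Integrated against forms, an element of \<open>\<Phi>\<^sub>I\<close> is a current on the simplex. Test forms divisible by
  \<open>\<Prod>t\<^sub>j\<close>, \<open>j \<in> J\<close>, only see the faces that contain \<open>J\<close>, so by descending induction on the size of
  \<open>J\<close> and nondegeneracy of the integral a current determines its components: this is injectivity of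
  \<open>\<xi>\<^sub>I\<close>. Stokes' formula expresses the boundary of a current through divergences on the faces and
  restrictions to facets, hence the image is a subcomplex. Pushforward is adjoint to pullback of forms,
  so functoriality and compatibility with the differentials are inherited from \<open>\<Omega>\<^sup>*\<close>.

  Fix a vertex \<open>w\<close> of \<open>I\<close>. A cycle is moved off the faces other than \<open>{w}\<close>, the largest first, by
  boundaries of fields on the joins \<open>J \<union> {w}\<close>. What remains is a multiple of the point \<open>w\<close> in degree
  zero, detected by the value of the current on the form 1. Pushforward preserves that value, hence
  induces isomorphisms in homology.
\<close>

section \<open>Linear maps on free spaces\<close>

text \<open>Two obstacles shape the proof. All spaces are quotients, and partial derivatives do not
  preserve the ideal of \<open>1 - \<Sum>t_i\<close>. Computations are therefore made with
  representatives: an element of \<open>Theta J m\<close> is replaced by the alternating family of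
  its pairings with the forms \<open>dt_l\<close>, and a congruence modulo the ideal is turned into
  an equation by eliminating one variable \<open>t_a\<close> before differentiating. Only such
  normal forms allow a primitive to be written down by integrating in \<open>t_w\<close>; the same
  \<open>t_a\<close> has to serve for a face \<open>J\<close> and for its join
  \<open>J \<union> {w}\<close>, because both are filled at once.

  The pushforward is given by divided powers of monomials, and this formula does not show that it
  respects the ideals or the boundary. Both facts are deduced from its adjunction with the pullback
  together with nondegeneracy of the integral. Characteristic zero enters through the factorials of
  the integral, through the averages \<open>1/m!\<close> that rebuild a polyvector field from its
  pairings, and through antiderivatives.\<close>

lemma free_linearI:
  fixes f :: "('x \<Rightarrow>\<^sub>0 'k::field) \<Rightarrow> ('y \<Rightarrow>\<^sub>0 'k)"
  assumes "\<And>x y. f (x + y) = f x + f y" "\<And>c x. f (scale c x) = scale c (f x)"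
  shows "Vector_Spaces.linear scale scale f"
  by (simp add: Vector_Spaces.linear_iff assms free.vector_space_axioms)

lemma free_functionalI:
  fixes f :: "('x \<Rightarrow>\<^sub>0 'k::field) \<Rightarrow> 'k"
  assumes "\<And>x y. f (x + y) = f x + f y" "\<And>c x. f (scale c x) = c * f x"
  shows "Vector_Spaces.linear scale (*) f"
proof -
  have "vector_space ((*) :: 'k \<Rightarrow> 'k \<Rightarrow> 'k)" by unfold_locales (auto simp: algebra_simps)
  then show ?thesis by (simp add: Vector_Spaces.linear_iff assms free.vector_space_axioms)
qed

lemma linear_add: "Vector_Spaces.linear s1 s2 f \<Longrightarrow> f (x + y) = f x + f y"
  and linear_scale: "Vector_Spaces.linear s1 s2 f \<Longrightarrow> f (s1 c x) = s2 c (f x)"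
  by (simp_all add: Vector_Spaces.linear_iff)

lemma linear_0: "Vector_Spaces.linear s1 s2 f \<Longrightarrow> f 0 = 0"
  using linear_add[of s1 s2 f 0 0] by simp

lemma linear_uminus: "Vector_Spaces.linear s1 s2 f \<Longrightarrow> f (- x) = - f x"
  using linear_add[of s1 s2 f x "- x"] linear_0[of s1 s2 f] by (simp add: eq_neg_iff_add_eq_0 add.commute)

lemma linear_diff: "Vector_Spaces.linear s1 s2 f \<Longrightarrow> f (x - y) = f x - f y"
  using linear_add[of s1 s2 f x "- y"] linear_uminus[of s1 s2 f y] by simp

lemma linear_sum: "Vector_Spaces.linear s1 s2 f \<Longrightarrow> f (sum g A) = (\<Sum>a\<in>A. f (g a))"
  by (induction A rule: infinite_finite_induct) (simp_all add: linear_0 linear_add)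

lemma linear_comp:
  "Vector_Spaces.linear s1 s2 f \<Longrightarrow> Vector_Spaces.linear s2 s3 g \<Longrightarrow> Vector_Spaces.linear s1 s3 (\<lambda>x. g (f x))"
  by (simp add: Vector_Spaces.linear_iff)

lemma linear_lin_ext: "Vector_Spaces.linear scale scale (lin_ext f)"
  by (intro free_linearI) (simp_all add: lin_ext_add lin_ext_scale)

lemma linear_id: "Vector_Spaces.linear scale scale (\<lambda>x :: 'x \<Rightarrow>\<^sub>0 'k::field. x)"
  by (intro free_linearI) simp_all

lemma lin_ext_basis_id: "lin_ext basis x = x"
  by (rule poly_mapping_eqI)
     (simp add: lin_ext_def lookup_sum lookup_single when_def if_distrib in_keys_iff cong: if_cong)

lemma single_eq_scale: "Poly_Mapping.single b c = scale c (basis b)"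
  by simp

lemma expand_basis: "x = (\<Sum>b\<in>Poly_Mapping.keys x. scale (Poly_Mapping.lookup x b) (basis b))"
  using lin_ext_basis_id[of x] unfolding lin_ext_def by (rule sym)

lemma linear_expand:
  "Vector_Spaces.linear scale s f \<Longrightarrow>
    f x = (\<Sum>b\<in>Poly_Mapping.keys x. s (Poly_Mapping.lookup x b) (f (basis b)))"
  by (subst expand_basis[of x]) (simp only: linear_sum linear_scale)

lemma linear_eq_on_basis:
  assumes "Vector_Spaces.linear scale s f" "Vector_Spaces.linear scale s g"
    and "\<And>b. b \<in> Poly_Mapping.keys x \<Longrightarrow> f (basis b) = g (basis b)"
  shows "f x = g x"
  unfolding linear_expand[OF assms(1), of x] linear_expand[OF assms(2), of x]
  using assms(3) by (intro sum.cong) auto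

lemma linear_eq_on_span:
  assumes "Vector_Spaces.linear scale s f" "Vector_Spaces.linear scale s g"
    and "x \<in> free.span B" "\<And>b. b \<in> B \<Longrightarrow> f b = g b"
  shows "f x = g x"
  using assms(3)
  by (induction rule: free.span_induct_alt)
     (simp_all add: linear_0[OF assms(1)] linear_0[OF assms(2)] linear_add[OF assms(1)]
       linear_add[OF assms(2)] linear_scale[OF assms(1)] linear_scale[OF assms(2)] assms(4))

lemma linear_span_into:
  assumes "Vector_Spaces.linear scale scale f" "free.subspace T"
    and "x \<in> free.span B" "\<And>b. b \<in> B \<Longrightarrow> f b \<in> T"
  shows "f x \<in> T"
  using assms(3)
  by (induction rule: free.span_induct_alt)
     (simp_all add: linear_0[OF assms(1)] linear_add[OF assms(1)] linear_scale[OF assms(1)]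
       free.subspace_0 free.subspace_add free.subspace_scale assms)

lemma keys_scale: "Poly_Mapping.keys (scale c x) \<subseteq> Poly_Mapping.keys x"
  by (auto simp: in_keys_iff)

lemma free_subspaceI:
  "0 \<in> S \<Longrightarrow> (\<And>x y. x \<in> S \<Longrightarrow> y \<in> S \<Longrightarrow> x + y \<in> S) \<Longrightarrow> (\<And>c x. x \<in> S \<Longrightarrow> scale c x \<in> S) \<Longrightarrow> free.subspace S"
  by (simp add: free.subspace_def)


section \<open>Polynomials\<close>

lemma scale_eq_mult: "scale c p = Poly_Mapping.single 0 c * (p :: ('a, 'k::field) mpoly)"
  by (simp add: scale_def mult_map_scale_conv_mult)

lemma scale_mult_left: "scale c p * q = scale c (p * q :: ('a, 'k::field) mpoly)"
  by (simp add: scale_eq_mult mult.assoc)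

lemma scale_mult_right: "p * scale c q = scale c (p * q :: ('a, 'k::field) mpoly)"
  by (simp add: scale_eq_mult mult.left_commute)

lemma linear_mult_left: "Vector_Spaces.linear scale scale (\<lambda>p. p * q :: ('a, 'k::field) mpoly)"
  by (intro free_linearI) (simp_all only: scale_mult_left distrib_right)

lemma linear_mult_right: "Vector_Spaces.linear scale scale (\<lambda>p. q * p :: ('a, 'k::field) mpoly)"
  by (intro free_linearI) (simp_all only: scale_mult_right distrib_left)

lemma mult_basis: "basis \<mu> * basis \<nu> = (basis (\<mu> + \<nu>) :: ('a, 'k::field) mpoly)"
  by (simp add: mult_single)

text \<open>An exponent is a finite sum of unit exponents: \<open>update\<close> changes one entry
  at a time, and \<open>single\<close> reaches the new value in unit steps. Identities for monomials
  thus only need multiplication by one variable.\<close>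

lemma exp_induct [case_names zero step]:
  fixes \<mu> :: "'a \<Rightarrow>\<^sub>0 nat"
  assumes "P 0" "\<And>\<mu> i. P \<mu> \<Longrightarrow> P (\<mu> + Poly_Mapping.single i 1)"
  shows "P \<mu>"
proof -
  have single: "P (\<mu> + Poly_Mapping.single i n)" if "P \<mu>" for \<mu> i n
  proof (induction n)
    case (Suc n)
    have "\<mu> + Poly_Mapping.single i (Suc n) = (\<mu> + Poly_Mapping.single i n) + Poly_Mapping.single i 1"
      by (simp add: add.assoc single_add[symmetric])
    then show ?case using assms(2)[OF Suc] by metis
  qed (simp add: that)
  show ?thesis
  proof (induction \<mu> rule: update_induct)
    case (update f a b)
    have "Poly_Mapping.update a b f = f + Poly_Mapping.single a b"
      by (rule poly_mapping_eqI)
         (use update(1) in \<open>auto simp: lookup_update lookup_add lookup_single in_keys_iff\<close>)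
    then show ?case using single[OF update(3)] by metis
  qed (rule assms(1))
qed

lemma keys_add_nat: "Poly_Mapping.keys (\<mu> + \<nu> :: 'a \<Rightarrow>\<^sub>0 nat) = Poly_Mapping.keys \<mu> \<union> Poly_Mapping.keys \<nu>"
  by (auto simp: in_keys_iff lookup_add)

lemma P_tildeI: "(\<And>\<mu>. Poly_Mapping.lookup p \<mu> \<noteq> 0 \<Longrightarrow> Poly_Mapping.keys \<mu> \<subseteq> I) \<Longrightarrow> p \<in> P_tilde I"
  by (auto simp: P_tilde_def in_keys_iff)

lemma P_tildeD: "p \<in> P_tilde I \<Longrightarrow> Poly_Mapping.lookup p \<mu> \<noteq> 0 \<Longrightarrow> Poly_Mapping.keys \<mu> \<subseteq> I"
  by (auto simp: P_tilde_def in_keys_iff)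

section \<open>Polynomial rings on subsets of the variables\<close>

lemma subspace_P_tilde: "free.subspace (P_tilde I)"
  using Poly_Mapping.keys_add keys_scale
  by (intro free_subspaceI) (fastforce simp: P_tilde_def)+

lemmas P_tilde_closed = free.subspace_0[OF subspace_P_tilde] free.subspace_add[OF subspace_P_tilde]
  free.subspace_scale[OF subspace_P_tilde] free.subspace_diff[OF subspace_P_tilde]
  free.subspace_neg[OF subspace_P_tilde] free.subspace_sum[OF subspace_P_tilde]

lemma P_tilde_basis [simp]: "basis \<mu> \<in> (P_tilde I :: ('a, 'k::field) mpoly set) \<longleftrightarrow> Poly_Mapping.keys \<mu> \<subseteq> I"
  by (auto simp: P_tilde_def)

lemma P_tilde_tvar: "i \<in> I \<Longrightarrow> tvar i \<in> P_tilde I"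
  by (simp add: tvar_def)

lemma P_tilde_1: "1 \<in> P_tilde I"
  by (simp add: P_tilde_def)

lemma P_tilde_mult: "p \<in> P_tilde I \<Longrightarrow> q \<in> P_tilde I \<Longrightarrow> p * q \<in> P_tilde I"
  using keys_mult[of p q] by (fastforce simp: P_tilde_def keys_add_nat)

lemma P_tilde_power: "p \<in> P_tilde I \<Longrightarrow> p ^ n \<in> P_tilde I"
  by (induction n) (auto simp: P_tilde_1 P_tilde_mult)

lemma P_tilde_prod: "(\<And>a. a \<in> A \<Longrightarrow> f a \<in> P_tilde I) \<Longrightarrow> prod f A \<in> P_tilde I"
  by (induction A rule: infinite_finite_induct) (auto simp: P_tilde_1 P_tilde_mult)

lemma P_tilde_mono: "I \<subseteq> J \<Longrightarrow> P_tilde I \<subseteq> P_tilde J"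
  by (auto simp: P_tilde_def)

lemmas P_tilde_intros = P_tilde_closed P_tilde_tvar P_tilde_1 P_tilde_mult P_tilde_power P_tilde_prod

text \<open>The polynomial algebra is generated by 1 and the variables. This is the induction suited
  to algebra homomorphisms such as \<open>ev\<close> and to derivations such as \<open>pd\<close>,
  where multiplication by one variable is all that has to be checked.\<close>

lemma P_tilde_induct [consumes 1, case_names add scale one tvar]:
  fixes p :: "('a, 'k::field) mpoly"
  assumes "p \<in> P_tilde I"
    and add: "\<And>p q. p \<in> P_tilde I \<Longrightarrow> q \<in> P_tilde I \<Longrightarrow> Q p \<Longrightarrow> Q q \<Longrightarrow> Q (p + q)"
    and scale: "\<And>c p. p \<in> P_tilde I \<Longrightarrow> Q p \<Longrightarrow> Q (scale c p)"
    and one: "Q 1"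
    and tvar: "\<And>i p. i \<in> I \<Longrightarrow> p \<in> P_tilde I \<Longrightarrow> Q p \<Longrightarrow> Q (tvar i * p)"
  shows "Q p"
proof -
  have mono: "Poly_Mapping.keys \<mu> \<subseteq> I \<Longrightarrow> Q (basis \<mu>)" for \<mu>
  proof (induction \<mu> rule: exp_induct)
    case (step \<mu> i)
    then have "Poly_Mapping.keys \<mu> \<subseteq> I" "i \<in> I" by (auto simp: keys_add_nat)
    then have "Q (tvar i * basis \<mu>)" using step by (intro tvar) auto
    then show ?case by (simp add: tvar_def mult_basis add.commute)
  qed (simp add: one)
  have 0: "Q 0" using scale[OF P_tilde_1 one, of 0] by simp
  let ?t = "\<lambda>\<mu>. scale (Poly_Mapping.lookup p \<mu>) (basis \<mu>)"
  have "K \<subseteq> Poly_Mapping.keys p \<Longrightarrow> Q (sum ?t K) \<and> sum ?t K \<in> P_tilde I" if "finite K" for K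
    using that
  proof (induction K rule: finite_induct)
    case (insert \<mu> K)
    have m: "Poly_Mapping.keys \<mu> \<subseteq> I" using insert.prems assms(1) by (auto simp: P_tilde_def)
    then have "Q (?t \<mu>)" "?t \<mu> \<in> P_tilde I"
      by (auto intro!: scale mono P_tilde_closed(3) simp del: scale_single)
    then show ?case using insert by (auto intro!: add P_tilde_closed(2) simp del: scale_single)
  qed (auto simp: 0 P_tilde_closed)
  from this[of "Poly_Mapping.keys p"] show ?thesis
    using expand_basis[of p] by simp
qed

section \<open>The ideal generated by 1 minus the sum of the variables\<close>

lemma subspace_P_ideal: "free.subspace (P_ideal I :: ('a, 'b::field) mpoly set)"
proof (rule free_subspaceI)
  show "0 \<in> P_ideal I" unfolding P_ideal_def using P_tilde_closed(1) by force
  show "x + y \<in> P_ideal I" if a: "x \<in> P_ideal I" "y \<in> P_ideal I" for x y :: "('a, 'b) mpoly"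
  proof -
    obtain p q where "p \<in> P_tilde I" "q \<in> P_tilde I" and xy: "x = (1 - (\<Sum>i\<in>I. tvar i)) * p" "y = (1 - (\<Sum>i\<in>I. tvar i)) * q"
      using a by (auto simp: P_ideal_def)
    then show ?thesis unfolding P_ideal_def xy distrib_left[symmetric] using P_tilde_closed(2) by blast
  qed
  show "scale c x \<in> P_ideal I" if a: "x \<in> P_ideal I" for c and x :: "('a, 'b) mpoly"
  proof -
    obtain p where "p \<in> P_tilde I" and x: "x = (1 - (\<Sum>i\<in>I. tvar i)) * p"
      using a by (auto simp: P_ideal_def)
    then show ?thesis unfolding P_ideal_def x scale_mult_right[symmetric] using P_tilde_closed(3) by blast
  qed
qed

lemmas P_ideal_closed = free.subspace_0[OF subspace_P_ideal] free.subspace_add[OF subspace_P_ideal]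
  free.subspace_scale[OF subspace_P_ideal] free.subspace_diff[OF subspace_P_ideal]
  free.subspace_neg[OF subspace_P_ideal] free.subspace_sum[OF subspace_P_ideal]

lemma P_ideal_subset: "finite I \<Longrightarrow> p \<in> P_ideal I \<Longrightarrow> p \<in> P_tilde I"
  by (auto simp: P_ideal_def intro!: P_tilde_intros)

lemma P_ideal_mult: "p \<in> P_ideal I \<Longrightarrow> q \<in> P_tilde I \<Longrightarrow> p * q \<in> P_ideal I"
proof -
  assume "p \<in> P_ideal I" and q: "q \<in> P_tilde I"
  then obtain r where r: "r \<in> P_tilde I" and p: "p = (1 - (\<Sum>i\<in>I. tvar i)) * r"
    by (auto simp: P_ideal_def)
  show ?thesis unfolding P_ideal_def p mult.assoc using P_tilde_mult[OF r q] by blast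
qed

lemma P_ideal_mult': "p \<in> P_ideal I \<Longrightarrow> q \<in> P_tilde I \<Longrightarrow> q * p \<in> P_ideal I"
  using P_ideal_mult[of p I q] by (simp add: mult.commute)

lemma P_ideal_generator: "q \<in> P_tilde I \<Longrightarrow> (1 - (\<Sum>i\<in>I. tvar i)) * q \<in> P_ideal I"
  by (auto simp: P_ideal_def)


subsection \<open>The integral\<close>

lemma linear_integral:
  "Vector_Spaces.linear scale (*) (simplex_integral_tilde I :: ('a, 'b::field_char_0) mpoly \<Rightarrow> 'b)"
proof -
  let ?g = "\<lambda>\<nu>. fact_mon \<nu> / fact (card I - 1 + (\<Sum>i\<in>I. Poly_Mapping.lookup \<nu> i)) :: 'b"
  have s: "simplex_integral_tilde I p = (\<Sum>\<nu>\<in>A. Poly_Mapping.lookup p \<nu> * ?g \<nu>)"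
    if "finite A" "Poly_Mapping.keys p \<subseteq> A" for p A
    unfolding simplex_integral_tilde_def
    by (rule sum.mono_neutral_left) (use that in \<open>auto simp: in_keys_iff\<close>)
  show ?thesis
  proof (rule free_functionalI)
    fix x y :: "('a, 'b) mpoly"
    let ?A = "Poly_Mapping.keys x \<union> Poly_Mapping.keys y"
    have "Poly_Mapping.keys (x + y) \<subseteq> ?A" by (rule Poly_Mapping.keys_add)
    then show "simplex_integral_tilde I (x + y) = simplex_integral_tilde I x + simplex_integral_tilde I y"
      by (simp add: s[of ?A] lookup_add distrib_right add_divide_distrib sum.distrib)
  next
    fix c and x :: "('a, 'b) mpoly"
    show "simplex_integral_tilde I (scale c x) = c * simplex_integral_tilde I x"
      by (simp add: s[of "Poly_Mapping.keys x"] keys_scale sum_distrib_left mult.assoc)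
  qed
qed

lemma integral_basis:
  "simplex_integral_tilde I (basis \<mu>) = fact_mon \<mu> / fact (card I - 1 + (\<Sum>i\<in>I. Poly_Mapping.lookup \<mu> i))"
  by (simp add: simplex_integral_tilde_def)

lemma fact_mon_superset:
  "finite A \<Longrightarrow> Poly_Mapping.keys \<mu> \<subseteq> A \<Longrightarrow> fact_mon \<mu> = (\<Prod>i\<in>A. fact (Poly_Mapping.lookup \<mu> i))"
  unfolding fact_mon_def by (rule prod.mono_neutral_left) (auto simp: in_keys_iff)

lemma fact_mon_add_single:
  "fact_mon (\<mu> + Poly_Mapping.single i 1) = of_nat (Poly_Mapping.lookup \<mu> i + 1) * (fact_mon \<mu> :: 'k::field_char_0)"
proof -
  let ?A = "insert i (Poly_Mapping.keys \<mu>)"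
  have "fact_mon (\<mu> + Poly_Mapping.single i 1) = (\<Prod>j\<in>?A. fact (Poly_Mapping.lookup (\<mu> + Poly_Mapping.single i 1) j) :: 'k)"
    by (rule fact_mon_superset) (auto simp: keys_add_nat)
  moreover have "fact_mon \<mu> = (\<Prod>j\<in>?A. fact (Poly_Mapping.lookup \<mu> j) :: 'k)"
    by (rule fact_mon_superset) auto
  moreover have "(\<Prod>j\<in>?A - {i}. fact (Poly_Mapping.lookup (\<mu> + Poly_Mapping.single i 1) j) :: 'k) =
      (\<Prod>j\<in>?A - {i}. fact (Poly_Mapping.lookup \<mu> j))"
    by (intro prod.cong) (auto simp: lookup_add lookup_single)
  ultimately show ?thesis
    by (simp add: prod.remove[of ?A i] lookup_add lookup_single algebra_simps)
qed

text \<open>Multiplying \<open>t^\<mu>\<close> by \<open>t_i\<close> multiplies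
  \<open>\<mu>!\<close> by \<open>\<mu>_i + 1\<close>. These factors add up to
  \<open>|\<mu>| + |I|\<close>, the quotient of the two factorials in the denominators, so
  \<open>t^\<mu>\<close> and its product with \<open>\<Sum>t_i\<close> have equal integrals. This is
  what makes the integral well defined on cosets.\<close>

lemma integral_ideal:
  assumes "finite I" "I \<noteq> {}" "p \<in> P_ideal I"
  shows "simplex_integral_tilde I p = (0 :: 'k::field_char_0)"
proof -
  have mono: "simplex_integral_tilde I ((1 - (\<Sum>i\<in>I. tvar i)) * basis \<mu>) = (0 :: 'k)" for \<mu>
  proof -
    let ?s = "\<Sum>i\<in>I. Poly_Mapping.lookup \<mu> i" and ?n = "card I"
    have n: "?n \<ge> 1" using assms by (simp add: Suc_leI card_gt_0_iff)
    have s: "(\<Sum>j\<in>I. Poly_Mapping.lookup (\<mu> + Poly_Mapping.single i 1) j) = ?s + 1" if "i \<in> I" for i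
      using that assms(1) by (simp add: lookup_add lookup_single sum.distrib when_def)
    have sub: "card I - 1 + (?s + 1) = Suc (card I - 1 + ?s)" by simp
    have "simplex_integral_tilde I ((\<Sum>i\<in>I. tvar i) * basis \<mu>) =
        (\<Sum>i\<in>I. simplex_integral_tilde I (basis (\<mu> + Poly_Mapping.single i 1)) :: 'k)"
      by (simp add: sum_distrib_right linear_sum[OF linear_integral] tvar_def mult_basis add.commute)
    also have "\<dots> = (\<Sum>i\<in>I. of_nat (Poly_Mapping.lookup \<mu> i + 1) * fact_mon \<mu> / fact (Suc (?n - 1 + ?s)))"
      by (intro sum.cong refl) (simp only: integral_basis fact_mon_add_single s sub)
    also have "\<dots> = of_nat (?s + ?n) * fact_mon \<mu> / fact (Suc (?n - 1 + ?s))"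
      by (simp add: sum_divide_distrib[symmetric] sum_distrib_right[symmetric] sum.distrib)
    also have "?s + ?n = Suc (?n - 1 + ?s)" using n by simp
    also have "of_nat (Suc (?n - 1 + ?s)) * fact_mon \<mu> / fact (Suc (?n - 1 + ?s)) = (fact_mon \<mu> / fact (?n - 1 + ?s) :: 'k)"
    proof -
      have "fact (Suc (?n - 1 + ?s)) = (of_nat (Suc (?n - 1 + ?s)) * fact (?n - 1 + ?s) :: 'k)" by (rule fact_Suc)
      moreover have "of_nat (Suc (?n - 1 + ?s)) \<noteq> (0 :: 'k)" by (rule of_nat_neq_0)
      ultimately show ?thesis by (metis nonzero_mult_divide_mult_cancel_left)
    qed
    finally show ?thesis
      by (simp add: left_diff_distrib linear_diff[OF linear_integral] integral_basis)
  qed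
  obtain q where "p = (1 - (\<Sum>i\<in>I. tvar i)) * q" using assms(3) by (auto simp: P_ideal_def)
  moreover have "simplex_integral_tilde I ((1 - (\<Sum>i\<in>I. tvar i)) * q) = (\<lambda>_. 0) q"
    by (rule linear_eq_on_basis[of "(*)"])
       (simp_all add: linear_comp[OF linear_mult_right linear_integral] mono free_functionalI)
  ultimately show ?thesis by simp
qed


subsection \<open>Nondegeneracy of the integral\<close>

text \<open>The functional \<open>t\<^sup>\<nu> \<mapsto> \<nu>!\<close> is the integral against \<open>exp (- \<Sum>t\<^sub>i)\<close> over the cone; its annihilator
  is stable under the Euler operators \<open>t\<^sub>i \<partial>\<^sub>i\<close>, hence spanned by monomials, hence zero. On polynomials
  of a fixed degree it agrees with the integral over the simplex up to a factor.\<close>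

definition cone_integral :: "('a, 'k::field_char_0) mpoly \<Rightarrow> 'k" where
  "cone_integral p = (\<Sum>\<nu>\<in>Poly_Mapping.keys p. Poly_Mapping.lookup p \<nu> * fact_mon \<nu>)"

definition euler :: "'a \<Rightarrow> ('a, 'k::field) mpoly \<Rightarrow> ('a, 'k) mpoly" where
  "euler i = lin_ext (\<lambda>\<mu>. Poly_Mapping.single \<mu> (of_nat (Poly_Mapping.lookup \<mu> i)))"

lemma linear_cone_integral:
  "Vector_Spaces.linear scale (*) (cone_integral :: ('a, 'b::field_char_0) mpoly \<Rightarrow> 'b)"
proof -
  have s: "cone_integral p = (\<Sum>\<nu>\<in>A. Poly_Mapping.lookup p \<nu> * fact_mon \<nu> :: 'b)"
    if "finite A" "Poly_Mapping.keys p \<subseteq> A" for p :: "('a, 'b) mpoly" and A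
    unfolding cone_integral_def
    by (rule sum.mono_neutral_left) (use that in \<open>auto simp: in_keys_iff\<close>)
  show ?thesis
  proof (rule free_functionalI)
    fix x y :: "('a, 'b) mpoly"
    let ?A = "Poly_Mapping.keys x \<union> Poly_Mapping.keys y"
    have "Poly_Mapping.keys (x + y) \<subseteq> ?A" by (rule Poly_Mapping.keys_add)
    then show "cone_integral (x + y) = cone_integral x + cone_integral y"
      by (simp add: s[of ?A] lookup_add distrib_right add_divide_distrib sum.distrib)
  next
    fix c and x :: "('a, 'b) mpoly"
    show "cone_integral (scale c x) = c * cone_integral x"
      by (simp add: s[of "Poly_Mapping.keys x"] keys_scale sum_distrib_left mult.assoc)
  qed
qed

lemma cone_integral_basis: "cone_integral (basis \<mu>) = fact_mon \<mu>"
  by (simp add: cone_integral_def)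

lemma linear_euler: "Vector_Spaces.linear scale scale (euler i)"
  unfolding euler_def by (rule linear_lin_ext)

lemma lookup_euler: "Poly_Mapping.lookup (euler i p) \<mu> = of_nat (Poly_Mapping.lookup \<mu> i) * Poly_Mapping.lookup p \<mu>"
  by (auto simp: euler_def lin_ext_def lookup_sum lookup_single when_def in_keys_iff)

text \<open>Integration by parts for the weight \<open>exp (- \<Sum>t_i)\<close>: moving
  \<open>t_i d/dt_i\<close> from \<open>p\<close> to \<open>t^\<kappa>\<close> costs the factor
  \<open>t_i - \<kappa>_i - 1\<close>. On a monomial this is
  \<open>\<mu>_i = (\<mu>_i + \<kappa>_i + 1) - (\<kappa>_i + 1)\<close>.\<close>

lemma cone_integral_euler:
  "cone_integral (euler i p * basis \<kappa>) =
    cone_integral (p * basis (\<kappa> + Poly_Mapping.single i 1)) -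
    of_nat (Poly_Mapping.lookup \<kappa> i + 1) * (cone_integral (p * basis \<kappa>) :: 'k::field_char_0)"
proof (rule linear_eq_on_basis[where x = p])
  show "Vector_Spaces.linear scale (*) (\<lambda>p. cone_integral (euler i p * basis \<kappa>) :: 'k)"
    by (rule linear_comp[OF linear_euler linear_comp[OF linear_mult_left linear_cone_integral]])
  note l = linear_comp[OF linear_mult_left linear_cone_integral]
  show "Vector_Spaces.linear scale (*) (\<lambda>p. cone_integral (p * basis (\<kappa> + Poly_Mapping.single i 1)) -
    of_nat (Poly_Mapping.lookup \<kappa> i + 1) * (cone_integral (p * basis \<kappa>) :: 'k))"
    by (rule free_functionalI) (simp_all only: linear_add[OF l] linear_scale[OF l], simp_all add: algebra_simps)
  fix \<mu>
  have "euler i (basis \<mu>) = scale (of_nat (Poly_Mapping.lookup \<mu> i)) (basis \<mu> :: ('a, 'k) mpoly)"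
    by (simp add: euler_def)
  moreover have "\<mu> + (\<kappa> + Poly_Mapping.single i 1) = (\<mu> + \<kappa>) + Poly_Mapping.single i 1"
    by (simp add: add.assoc)
  ultimately show "cone_integral (euler i (basis \<mu>) * basis \<kappa>) =
    cone_integral (basis \<mu> * basis (\<kappa> + Poly_Mapping.single i 1)) -
    of_nat (Poly_Mapping.lookup \<kappa> i + 1) * (cone_integral (basis \<mu> * basis \<kappa>) :: 'k)"
    by (simp only: scale_mult_left mult_basis linear_scale[OF linear_cone_integral]
        cone_integral_basis fact_mon_add_single lookup_add)
       (simp add: algebra_simps)
qed

lemma cone_integral_nondegenerate:
  fixes p :: "('a, 'k::field_char_0) mpoly"
  assumes "p \<in> P_tilde J"
    and "\<And>\<kappa>. Poly_Mapping.keys \<kappa> \<subseteq> J \<Longrightarrow> cone_integral (p * basis \<kappa>) = 0"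
  shows "p = 0"
  using assms
proof (induction "card (Poly_Mapping.keys p)" arbitrary: p rule: less_induct)
  case less
  show ?case
  proof (rule ccontr)
    assume "p \<noteq> 0"
    then have "Poly_Mapping.keys p \<noteq> {}" by simp
    then obtain \<mu> where mu: "\<mu> \<in> Poly_Mapping.keys p" by blast
    show False
    proof (cases "Poly_Mapping.keys p = {\<mu>}")
      case True
      have "cone_integral p = Poly_Mapping.lookup p \<mu> * fact_mon \<mu>"
        by (simp add: cone_integral_def True)
      moreover have "cone_integral p = 0" using less(3)[of 0] by simp
      ultimately show False using mu by (simp add: in_keys_iff)
    next
      case False
      then obtain \<nu> where nu: "\<nu> \<in> Poly_Mapping.keys p" "\<nu> \<noteq> \<mu>" using mu by blast
      then obtain i where i: "Poly_Mapping.lookup \<nu> i \<noteq> Poly_Mapping.lookup \<mu> i"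
        using poly_mapping_eqI by metis
      then have "i \<in> Poly_Mapping.keys \<nu> \<union> Poly_Mapping.keys \<mu>" by (auto simp: in_keys_iff)
      then have iJ: "i \<in> J" using less(2) mu nu by (auto simp: P_tilde_def)
      \<comment> \<open>\<open>q\<close> loses the monomial \<open>\<mu>\<close>, while the
        coefficient at \<open>\<nu>\<close> is multiplied by \<open>\<nu>_i - \<mu>_i\<close>, which
        is nonzero. By \<open>cone_integral_euler\<close> it is still annihilated, so induction
        makes it vanish, a contradiction at \<open>\<nu>\<close>.\<close>
      define q where "q = euler i p - scale (of_nat (Poly_Mapping.lookup \<mu> i)) p"
      have l: "Poly_Mapping.lookup q \<kappa> = (of_nat (Poly_Mapping.lookup \<kappa> i) - of_nat (Poly_Mapping.lookup \<mu> i)) * Poly_Mapping.lookup p \<kappa>" for \<kappa>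
        by (simp add: q_def lookup_minus lookup_euler algebra_simps)
      have sub: "Poly_Mapping.keys q \<subseteq> Poly_Mapping.keys p - {\<mu>}"
        by (auto simp: in_keys_iff l)
      then have "card (Poly_Mapping.keys q) < card (Poly_Mapping.keys p)"
        using mu by (intro psubset_card_mono) auto
      moreover have "q \<in> P_tilde J" using sub less(2) by (auto simp: P_tilde_def)
      moreover have "cone_integral (q * basis \<kappa>) = 0" if "Poly_Mapping.keys \<kappa> \<subseteq> J" for \<kappa>
      proof -
        have "Poly_Mapping.keys (\<kappa> + Poly_Mapping.single i 1) \<subseteq> J" using that iJ by (auto simp: keys_add_nat)
        then show ?thesis
          using less(3) that
          by (simp add: q_def left_diff_distrib linear_diff[OF linear_cone_integral] scale_mult_left
              linear_scale[OF linear_cone_integral] cone_integral_euler)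
      qed
      ultimately have "q = 0" by (rule less(1))
      then have "Poly_Mapping.lookup q \<nu> = 0" by simp
      then show False using i nu by (auto simp: l in_keys_iff)
    qed
  qed
qed

section \<open>Homogeneous representatives of polynomials on a simplex\<close>

definition homogeneous :: "'a set \<Rightarrow> nat \<Rightarrow> ('a, 'k::field) mpoly set" where
  "homogeneous J d = {p \<in> P_tilde J. \<forall>\<mu>\<in>Poly_Mapping.keys p. (\<Sum>i\<in>J. Poly_Mapping.lookup \<mu> i) = d}"

lemma subspace_homogeneous: "free.subspace (homogeneous J d :: ('a, 'b::field) mpoly set)"
proof (rule free_subspaceI)
  show "x + y \<in> homogeneous J d" if "x \<in> homogeneous J d" "y \<in> homogeneous J d" for x y :: "('a, 'b) mpoly"
    using that Poly_Mapping.keys_add[of x y] by (auto simp: homogeneous_def P_tilde_closed)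
  show "scale c x \<in> homogeneous J d" if "x \<in> homogeneous J d" for c and x :: "('a, 'b) mpoly"
    using that keys_scale[of c x] by (auto simp: homogeneous_def P_tilde_closed)
qed (simp add: homogeneous_def P_tilde_closed)

lemma homogeneous_mult: "p \<in> homogeneous J d \<Longrightarrow> q \<in> homogeneous J e \<Longrightarrow> p * q \<in> homogeneous J (d + e)"
proof -
  assume p: "p \<in> homogeneous J d" and q: "q \<in> homogeneous J e"
  have "(\<Sum>i\<in>J. Poly_Mapping.lookup \<mu> i) = d + e" if a: "\<mu> \<in> Poly_Mapping.keys (p * q)" for \<mu>
  proof -
    obtain \<kappa> \<nu> where "\<kappa> \<in> Poly_Mapping.keys p" "\<nu> \<in> Poly_Mapping.keys q" "\<mu> = \<kappa> + \<nu>"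
      using a keys_mult[of p q] by blast
    then show ?thesis using p q by (auto simp: homogeneous_def lookup_add sum.distrib)
  qed
  then show ?thesis using p q by (auto simp: homogeneous_def P_tilde_mult)
qed

lemma homogeneous_basis:
  "Poly_Mapping.keys \<mu> \<subseteq> J \<Longrightarrow> basis \<mu> \<in> homogeneous J (\<Sum>i\<in>J. Poly_Mapping.lookup \<mu> i)"
  by (simp add: homogeneous_def)

lemma homogeneous_sum_tvar: "finite J \<Longrightarrow> (\<Sum>i\<in>J. tvar i) \<in> homogeneous J 1"
proof (intro free.subspace_sum[OF subspace_homogeneous])
  fix i assume "finite J" "i \<in> J"
  then show "tvar i \<in> homogeneous J 1"
    by (simp add: homogeneous_def tvar_def lookup_single when_def)
qed

lemma homogeneous_power: "p \<in> homogeneous J 1 \<Longrightarrow> p ^ n \<in> homogeneous J n"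
proof (induction n)
  case 0 show ?case using homogeneous_basis[of 0 J] by simp
next
  case (Suc n) then show ?case using homogeneous_mult[of p J 1 "p ^ n" n] by simp
qed

lemma cone_integral_homogeneous:
  assumes "p \<in> homogeneous J d"
  shows "cone_integral p = fact (card J - 1 + d) * simplex_integral_tilde J p"
  unfolding cone_integral_def simplex_integral_tilde_def sum_distrib_left
  using assms by (intro sum.cong refl) (auto simp: homogeneous_def)

text \<open>Modulo the ideal \<open>\<Sum>t_i\<close> equals 1, so each monomial may be multiplied
  by a power of it until all degrees agree.\<close>

lemma homogenize:
  fixes p :: "('a, 'k::field) mpoly"
  assumes "finite J" "p \<in> P_tilde J"
  obtains q d where "q \<in> homogeneous J d" "p - q \<in> P_ideal J"
proof -
  let ?s = "\<Sum>i\<in>J. tvar i :: ('a, 'k) mpoly"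
  let ?deg = "\<lambda>\<mu> :: 'a \<Rightarrow>\<^sub>0 nat. \<Sum>i\<in>J. Poly_Mapping.lookup \<mu> i"
  \<comment> \<open>Any common bound of the degrees will do; their sum is one and needs no case
    distinction for \<open>p = 0\<close>.\<close>
  define d where "d = (\<Sum>\<mu>\<in>Poly_Mapping.keys p. ?deg \<mu>)"
  define q where "q = (\<Sum>\<mu>\<in>Poly_Mapping.keys p. scale (Poly_Mapping.lookup p \<mu>) (basis \<mu> * ?s ^ (d - ?deg \<mu>)))"
  have le: "?deg \<mu> \<le> d" if "\<mu> \<in> Poly_Mapping.keys p" for \<mu>
    unfolding d_def by (rule member_le_sum) (use that in auto)
  have kJ: "Poly_Mapping.keys \<mu> \<subseteq> J" if "\<mu> \<in> Poly_Mapping.keys p" for \<mu>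
    using that assms(2) by (auto simp: P_tilde_def)
  have sP: "?s \<in> P_tilde J" by (intro P_tilde_intros)
  have "q \<in> homogeneous J d" unfolding q_def
  proof (intro free.subspace_sum[OF subspace_homogeneous] free.subspace_scale[OF subspace_homogeneous])
    fix \<mu> assume mu: "\<mu> \<in> Poly_Mapping.keys p"
    have "basis \<mu> * ?s ^ (d - ?deg \<mu>) \<in> homogeneous J (?deg \<mu> + (d - ?deg \<mu>))"
      by (intro homogeneous_mult homogeneous_basis homogeneous_power homogeneous_sum_tvar assms kJ[OF mu])
    then show "basis \<mu> * ?s ^ (d - ?deg \<mu>) \<in> homogeneous J d" using le[OF mu] by simp
  qed
  moreover have "p - q \<in> P_ideal J"
  proof -
    have pw: "1 - ?s ^ n \<in> P_ideal J" for n
    proof -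
      have "1 - ?s ^ n = (1 - ?s) * (\<Sum>i<n. ?s ^ i)" by (rule one_diff_power_eq)
      moreover have "(\<Sum>i<n. ?s ^ i) \<in> P_tilde J" by (intro P_tilde_intros sP)
      ultimately show ?thesis by (simp only: P_ideal_generator)
    qed
    have "p - q = (\<Sum>\<mu>\<in>Poly_Mapping.keys p. scale (Poly_Mapping.lookup p \<mu>) (basis \<mu> * (1 - ?s ^ (d - ?deg \<mu>))))"
      unfolding q_def by (subst expand_basis[of p])
        (simp only: sum_subtractf[symmetric] free.scale_right_diff_distrib[symmetric] right_diff_distrib mult_1_right)
    then show ?thesis
      by (auto intro!: P_ideal_closed P_ideal_mult' pw simp: kJ simp del: scale_single)
  qed
  ultimately show thesis by (rule that)
qed

text \<open>The exponent of the product of the \<open>t_j\<close> with \<open>j \<in> J\<close>, a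
  monomial that vanishes on exactly those faces that do not contain \<open>J\<close>.\<close>

definition face_monomial :: "'a set \<Rightarrow> ('a \<Rightarrow>\<^sub>0 nat)" where
  "face_monomial J = (\<Sum>i\<in>J. Poly_Mapping.single i 1)"

lemma lookup_face_monomial: "finite J \<Longrightarrow> Poly_Mapping.lookup (face_monomial J) i = (if i \<in> J then 1 else 0)"
  by (simp add: face_monomial_def lookup_sum lookup_single when_def)

lemma keys_face_monomial: "finite J \<Longrightarrow> Poly_Mapping.keys (face_monomial J) = J"
  by (auto simp: in_keys_iff lookup_face_monomial split: if_splits)

lemma lookup_mult_basis: "Poly_Mapping.lookup (p * basis \<kappa> :: ('a, 'k::field) mpoly) (\<mu> + \<kappa>) = Poly_Mapping.lookup p \<mu>"
proof -
  let ?f = "\<lambda>\<nu>. if \<nu> = \<mu> then Poly_Mapping.lookup p \<nu> else 0"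
  have "p * basis \<kappa> = (\<Sum>\<nu>\<in>Poly_Mapping.keys p. Poly_Mapping.single (\<nu> + \<kappa>) (Poly_Mapping.lookup p \<nu>))"
    by (subst expand_basis[of p]) (simp add: sum_distrib_right mult_single)
  then show ?thesis by (simp add: lookup_sum lookup_single when_def in_keys_iff)
qed

text \<open>A homogeneous representative \<open>h\<close> of \<open>f\<close> makes the simplex
  integral a multiple of the cone integral, whose nondegeneracy applies. Testing only with multiples
  of the face monomial loses nothing, since multiplication by a monomial is injective.\<close>

lemma integral_nondegenerate:
  fixes f :: "('a, 'k::field_char_0) mpoly"
  assumes J: "finite J" "J \<noteq> {}" and f: "f \<in> P_tilde J"
    and z: "\<And>g. g \<in> P_tilde J \<Longrightarrow> simplex_integral_tilde J (basis (face_monomial J) * g * f) = 0"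
  shows "f \<in> P_ideal J"
proof -
  let ?t = "basis (face_monomial J) :: ('a, 'k) mpoly"
  obtain h d where h: "h \<in> homogeneous J d" "f - h \<in> P_ideal J"
    using homogenize[OF J(1) f] by blast
  have t: "?t \<in> P_tilde J" using J(1) by (simp add: keys_face_monomial)
  have hP: "h \<in> P_tilde J" using h by (simp add: homogeneous_def)
  have "h * ?t = 0"
  proof (rule cone_integral_nondegenerate)
    show "h * ?t \<in> P_tilde J" by (intro P_tilde_mult hP t)
    fix \<kappa> :: "'a \<Rightarrow>\<^sub>0 nat" assume k: "Poly_Mapping.keys \<kappa> \<subseteq> J"
    \<comment> \<open>The three degrees fix the total degree, and with it the factorial by which the
      two integrals differ.\<close>
    have "h * ?t * basis \<kappa> \<in> homogeneous J (d + (\<Sum>i\<in>J. Poly_Mapping.lookup (face_monomial J) i) + (\<Sum>i\<in>J. Poly_Mapping.lookup \<kappa> i))"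
      by (intro homogeneous_mult h homogeneous_basis k) (simp add: keys_face_monomial J)
    note c = cone_integral_homogeneous[OF this]
    have "(f - h) * (?t * basis \<kappa>) \<in> P_ideal J"
      by (rule P_ideal_mult[OF h(2)], rule P_tilde_mult[OF t]) (simp add: k)
    from integral_ideal[OF J this]
    have "simplex_integral_tilde J (h * ?t * basis \<kappa>) = simplex_integral_tilde J (f * (?t * basis \<kappa>))"
      by (simp add: left_diff_distrib linear_diff[OF linear_integral] mult.assoc)
    also have "\<dots> = 0" using z[of "basis \<kappa>"] k by (simp only: P_tilde_basis mult_ac)
    finally show "cone_integral (h * ?t * basis \<kappa>) = 0" using c by simp
  qed
  then have "h = 0"
    using lookup_mult_basis[of h "face_monomial J"] by (intro poly_mapping_eqI) (metis lookup_zero)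
  then show ?thesis using h by simp
qed


subsection \<open>Homomorphisms, derivatives and antiderivatives\<close>

definition ev :: "('b \<Rightarrow> ('a, 'k) mpoly) \<Rightarrow> ('b, 'k::field) mpoly \<Rightarrow> ('a, 'k) mpoly" where
  "ev T = lin_ext (\<lambda>\<mu>. \<Prod>j\<in>Poly_Mapping.keys \<mu>. T j ^ Poly_Mapping.lookup \<mu> j)"

lemma linear_ev: "Vector_Spaces.linear scale scale (ev T)"
  unfolding ev_def by (rule linear_lin_ext)

lemma ev_basis: "ev T (basis \<mu>) = (\<Prod>j\<in>Poly_Mapping.keys \<mu>. T j ^ Poly_Mapping.lookup \<mu> j)"
  by (simp add: ev_def)

lemma ev_basis_superset:
  "finite A \<Longrightarrow> Poly_Mapping.keys \<mu> \<subseteq> A \<Longrightarrow> ev T (basis \<mu>) = (\<Prod>j\<in>A. T j ^ Poly_Mapping.lookup \<mu> j)"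
  unfolding ev_basis by (rule prod.mono_neutral_left) (auto simp: in_keys_iff)

lemma ev_mult: "ev T (p * q) = ev T p * ev T q"
proof -
  have b: "ev T (basis \<mu> * basis \<nu>) = ev T (basis \<mu>) * ev T (basis \<nu>)" for \<mu> \<nu>
    by (simp add: mult_basis ev_basis_superset[of "Poly_Mapping.keys \<mu> \<union> Poly_Mapping.keys \<nu>"]
        keys_add_nat lookup_add power_add prod.distrib)
  have "ev T (basis \<mu> * q) = ev T (basis \<mu>) * ev T q" for \<mu>
    by (rule linear_eq_on_basis[where x = q, OF linear_comp[OF linear_mult_right linear_ev]
          linear_comp[OF linear_ev linear_mult_right] b])
  then show ?thesis
    by (rule linear_eq_on_basis[where x = p, OF linear_comp[OF linear_mult_left linear_ev]
          linear_comp[OF linear_ev linear_mult_left]])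
qed

lemma ev_1 [simp]: "ev T 1 = 1"
  using ev_basis[of T 0] by simp

lemma ev_tvar [simp]: "ev T (tvar j) = T j"
  by (simp add: tvar_def ev_basis)

lemmas ev_simps = linear_0[OF linear_ev] linear_add[OF linear_ev] linear_diff[OF linear_ev]
  linear_scale[OF linear_ev] linear_sum[OF linear_ev] ev_mult

lemma ev_P_tilde:
  assumes "p \<in> P_tilde A" "\<And>j. j \<in> A \<Longrightarrow> T j \<in> P_tilde B"
  shows "ev T p \<in> P_tilde B"
  using assms(1) by (induction rule: P_tilde_induct) (auto simp: ev_simps assms(2) intro!: P_tilde_intros)

lemma ev_tvar_id: "p \<in> P_tilde A \<Longrightarrow> (\<And>j. j \<in> A \<Longrightarrow> T j = tvar j) \<Longrightarrow> ev T p = p"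
  by (induction rule: P_tilde_induct) (simp_all add: ev_simps)

lemma P_tilde_UNIV: "p \<in> P_tilde UNIV"
  by (simp add: P_tilde_def)

lemma ev_ev: "ev T (ev T' p) = ev (\<lambda>j. ev T (T' j)) p"
  using P_tilde_UNIV[of p] by (induction rule: P_tilde_induct) (simp_all add: ev_simps)

text \<open>Where the subtraction of exponents truncates, the coefficient \<open>\<mu>_i\<close> is
  zero.\<close>

definition pd :: "'a \<Rightarrow> ('a, 'k::field) mpoly \<Rightarrow> ('a, 'k) mpoly" where
  "pd i = lin_ext (\<lambda>\<mu>. Poly_Mapping.single (\<mu> - Poly_Mapping.single i 1) (of_nat (Poly_Mapping.lookup \<mu> i)))"

lemma linear_pd: "Vector_Spaces.linear scale scale (pd i)"
  unfolding pd_def by (rule linear_lin_ext)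

lemma pd_basis:
  "pd i (basis \<mu>) = Poly_Mapping.single (\<mu> - Poly_Mapping.single i 1) (of_nat (Poly_Mapping.lookup \<mu> i))"
  by (simp add: pd_def)

lemma exp_diff_add:
  "Poly_Mapping.lookup \<mu> i > 0 \<Longrightarrow> \<mu> - Poly_Mapping.single i 1 + Poly_Mapping.single i 1 = (\<mu> :: 'a \<Rightarrow>\<^sub>0 nat)"
  by (rule poly_mapping_eqI) (auto simp: lookup_add lookup_minus lookup_single when_def)

lemma linear_lookup: "Vector_Spaces.linear scale (*) (\<lambda>p. Poly_Mapping.lookup p b)"
  by (rule free_functionalI) (simp_all add: lookup_add)

text \<open>Read off at a fixed exponent, the derivative only shifts exponents upwards, so no
  truncated subtraction occurs; this makes coefficientwise comparisons simple.\<close>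

lemma lookup_pd:
  "Poly_Mapping.lookup (pd i p) \<mu> =
    of_nat (Poly_Mapping.lookup \<mu> i + 1) * (Poly_Mapping.lookup p (\<mu> + Poly_Mapping.single i 1) :: 'k::field)"
proof (rule linear_eq_on_basis[where x = p])
  show "Vector_Spaces.linear scale (*) (\<lambda>p. Poly_Mapping.lookup (pd i p) \<mu> :: 'k)"
    by (rule linear_comp[OF linear_pd linear_lookup])
  show "Vector_Spaces.linear scale (*) (\<lambda>p. of_nat (Poly_Mapping.lookup \<mu> i + 1) * (Poly_Mapping.lookup p (\<mu> + Poly_Mapping.single i 1) :: 'k))"
    by (rule free_functionalI) (simp_all add: lookup_add algebra_simps)
  fix \<kappa>
  show "Poly_Mapping.lookup (pd i (basis \<kappa>)) \<mu> =
      of_nat (Poly_Mapping.lookup \<mu> i + 1) * (Poly_Mapping.lookup (basis \<kappa>) (\<mu> + Poly_Mapping.single i 1) :: 'k)"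
  proof (cases "Poly_Mapping.lookup \<kappa> i = 0")
    case True
    then have "\<kappa> \<noteq> \<mu> + Poly_Mapping.single i 1" by (auto simp: lookup_add)
    then show ?thesis using True by (simp add: pd_basis lookup_single)
  next
    case False
    then have "\<kappa> - Poly_Mapping.single i 1 = \<mu> \<longleftrightarrow> \<kappa> = \<mu> + Poly_Mapping.single i 1"
      using exp_diff_add[of \<kappa> i] by auto
    then show ?thesis by (auto simp: pd_basis lookup_single when_def lookup_add)
  qed
qed

lemma pd_mult: "pd i (p * q) = pd i p * q + p * pd i (q :: ('a, 'k::field) mpoly)"
proof -
  have b1: "pd i (basis \<mu>) * basis \<nu> = scale (of_nat (Poly_Mapping.lookup \<mu> i)) (basis (\<mu> + \<nu> - Poly_Mapping.single i 1))"
    for \<mu> \<nu> :: "'a \<Rightarrow>\<^sub>0 nat"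
  proof (cases "Poly_Mapping.lookup \<mu> i = 0")
    case False
    have "\<mu> - Poly_Mapping.single i 1 + \<nu> = \<mu> + \<nu> - Poly_Mapping.single i 1"
      by (rule poly_mapping_eqI) (use False in \<open>auto simp: lookup_add lookup_minus lookup_single when_def\<close>)
    then show ?thesis by (simp add: pd_basis mult_single)
  qed (simp add: pd_basis)
  have b: "pd i (basis \<mu> * basis \<nu>) = pd i (basis \<mu>) * basis \<nu> + basis \<mu> * (pd i (basis \<nu>) :: ('a, 'k) mpoly)" for \<mu> \<nu>
  proof -
    have "basis \<mu> * (pd i (basis \<nu>) :: ('a, 'k) mpoly) = scale (of_nat (Poly_Mapping.lookup \<nu> i)) (basis (\<mu> + \<nu> - Poly_Mapping.single i 1))"
      unfolding mult.commute[of "basis \<mu>"] b1 by (simp add: add.commute)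
    then show ?thesis unfolding b1 by (simp add: mult_basis pd_basis lookup_add single_add)
  qed
  have s: "Vector_Spaces.linear scale scale (\<lambda>p. f p + g p)"
    if "Vector_Spaces.linear scale scale f" "Vector_Spaces.linear scale scale g" for f g :: "('a, 'k) mpoly \<Rightarrow> ('a, 'k) mpoly"
    by (rule free_linearI) (simp_all add: linear_add[OF that(1)] linear_add[OF that(2)]
        linear_scale[OF that(1)] linear_scale[OF that(2)] free.scale_right_distrib)
  have "pd i (basis \<mu> * q) = pd i (basis \<mu>) * q + basis \<mu> * pd i q" for \<mu>
    by (rule linear_eq_on_basis[where x = q, OF linear_comp[OF linear_mult_right linear_pd]
          s[OF linear_mult_right linear_comp[OF linear_pd linear_mult_right]] b])
  then show ?thesis
    by (rule linear_eq_on_basis[where x = p, OF linear_comp[OF linear_mult_left linear_pd]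
          s[OF linear_comp[OF linear_pd linear_mult_left] linear_mult_left]])
qed

lemma pd_1 [simp]: "pd i 1 = 0"
  using pd_basis[of i 0] by simp

lemma pd_tvar: "pd i (tvar j) = (if i = j then 1 else 0)"
  by (auto simp: tvar_def pd_basis lookup_single)

lemmas pd_simps = linear_0[OF linear_pd] linear_add[OF linear_pd] linear_diff[OF linear_pd]
  linear_scale[OF linear_pd] linear_sum[OF linear_pd] pd_mult

lemma pd_P_tilde: "p \<in> P_tilde A \<Longrightarrow> pd i p \<in> P_tilde A"
  by (rule P_tildeI) (auto simp: lookup_pd keys_add_nat dest!: P_tildeD)

lemma pd_zero: "p \<in> P_tilde A \<Longrightarrow> i \<notin> A \<Longrightarrow> pd i p = 0"
  by (rule poly_mapping_eqI) (auto simp: lookup_pd keys_add_nat dest: P_tildeD)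

lemma pd_commute: "pd i (pd j p) = pd j (pd i p)"
  by (rule poly_mapping_eqI) (auto simp: lookup_pd lookup_add lookup_single when_def ac_simps)

text \<open>For \<open>\<alpha> = id\<close> this is the restriction to a face.\<close>

definition pull_poly :: "'a set \<Rightarrow> ('a \<Rightarrow> 'b) \<Rightarrow> ('b, 'k::field) mpoly \<Rightarrow> ('a, 'k) mpoly" where
  "pull_poly I \<alpha> = ev (\<lambda>j. \<Sum>i | i \<in> I \<and> \<alpha> i = j. tvar i)"

abbreviation rs :: "'a set \<Rightarrow> ('a, 'k::field) mpoly \<Rightarrow> ('a, 'k) mpoly" where
  "rs J \<equiv> pull_poly J (\<lambda>j. j)"

lemma linear_pull_poly: "Vector_Spaces.linear scale scale (pull_poly I \<alpha>)"
  unfolding pull_poly_def by (rule linear_ev)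

lemmas pull_poly_linear = linear_0[OF linear_pull_poly] linear_add[OF linear_pull_poly]
  linear_diff[OF linear_pull_poly] linear_scale[OF linear_pull_poly] linear_sum[OF linear_pull_poly]
  linear_uminus[OF linear_pull_poly]

lemma pull_poly_mult: "pull_poly I \<alpha> (p * q) = pull_poly I \<alpha> p * pull_poly I \<alpha> q"
  by (simp add: pull_poly_def ev_mult)

lemma pull_poly_tvar: "pull_poly I \<alpha> (tvar j) = (\<Sum>i | i \<in> I \<and> \<alpha> i = j. tvar i)"
  by (simp add: pull_poly_def)

lemma pull_poly_1 [simp]: "pull_poly I \<alpha> 1 = 1"
  by (simp add: pull_poly_def)

lemma pull_poly_P_tilde: "pull_poly I \<alpha> p \<in> P_tilde I"
  unfolding pull_poly_def
  by (rule ev_P_tilde[OF P_tilde_UNIV]) (auto intro!: P_tilde_closed P_tilde_tvar)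

lemma pull_poly_pull_poly:
  fixes p :: "('c, 'd::field) mpoly"
  assumes "finite I" "\<alpha> \<in> I \<rightarrow> J" "finite J"
  shows "pull_poly I \<alpha> (pull_poly J \<beta> p) = pull_poly I (\<beta> \<circ> \<alpha>) p"
proof -
  have "(\<Sum>j | j \<in> J \<and> \<beta> j = l. \<Sum>i | i \<in> I \<and> \<alpha> i = j. tvar i) = (\<Sum>i | i \<in> I \<and> \<beta> (\<alpha> i) = l. tvar i :: ('a, 'd) mpoly)" for l
  proof -
    have "(\<Sum>i | i \<in> I \<and> \<beta> (\<alpha> i) = l. tvar i :: ('a, 'd) mpoly) =
      (\<Sum>j\<in>{j \<in> J. \<beta> j = l}. \<Sum>i\<in>{i \<in> {i \<in> I. \<beta> (\<alpha> i) = l}. \<alpha> i = j}. tvar i)"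
      by (rule sum.group[symmetric]) (use assms in auto)
    also have "\<dots> = (\<Sum>j | j \<in> J \<and> \<beta> j = l. \<Sum>i | i \<in> I \<and> \<alpha> i = j. tvar i)"
      by (intro sum.cong refl) auto
    finally show ?thesis ..
  qed
  then show ?thesis by (simp add: pull_poly_def ev_ev ev_simps)
qed

lemma pull_poly_ideal:
  fixes p :: "('b, 'c::field) mpoly"
  assumes "finite I" "finite J" "\<alpha> \<in> I \<rightarrow> J" "p \<in> P_ideal J"
  shows "pull_poly I \<alpha> p \<in> P_ideal I"
proof -
  obtain q where p: "p = (1 - (\<Sum>j\<in>J. tvar j)) * q" using assms(4) by (auto simp: P_ideal_def)
  have "(\<Sum>j\<in>J. \<Sum>i | i \<in> I \<and> \<alpha> i = j. tvar i) = (\<Sum>i\<in>I. tvar i :: ('a, 'c) mpoly)"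
    by (rule sum.group) (use assms in auto)
  then have "pull_poly I \<alpha> p = (1 - (\<Sum>i\<in>I. tvar i)) * pull_poly I \<alpha> q"
    unfolding p by (simp add: pull_poly_mult pull_poly_linear pull_poly_tvar)
  then show ?thesis by (simp add: P_ideal_generator pull_poly_P_tilde)
qed

text \<open>The chain rule. The variable \<open>t_i\<close> occurs in the image of exactly one
  \<open>t_j\<close>, namely for \<open>j = \<alpha> i\<close>, and there with coefficient
  1.\<close>

lemma pd_pull_poly:
  fixes p :: "('b, 'c::field) mpoly"
  assumes "finite I"
  shows "pd i (pull_poly I \<alpha> p) = (if i \<in> I then pull_poly I \<alpha> (pd (\<alpha> i) p) else 0)"
  using P_tilde_UNIV[of p]
proof (induction rule: P_tilde_induct)
  case (tvar j p)
  have "pd i (\<Sum>i | i \<in> I \<and> \<alpha> i = j. tvar i) = (if i \<in> I \<and> \<alpha> i = j then 1 else (0 :: ('a, 'c) mpoly))"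
    using assms by (simp add: pd_simps pd_tvar)
  then show ?case using tvar
    by (auto simp: pull_poly_mult pull_poly_tvar pull_poly_linear pd_simps pd_tvar)
qed (auto simp: pull_poly_linear pd_simps)

lemma rs_basis: "rs J (basis \<mu>) = (if Poly_Mapping.keys \<mu> \<subseteq> J then basis \<mu> else 0)"
proof (induction \<mu> rule: exp_induct)
  case (step \<mu> i)
  have "{i'. i' \<in> J \<and> i' = i} = (if i \<in> J then {i} else {})" by auto
  then have t: "rs J (tvar i) = (if i \<in> J then tvar i else 0 :: ('a, 'b) mpoly)"
    by (simp add: pull_poly_tvar)
  have "basis (\<mu> + Poly_Mapping.single i 1) = (basis \<mu> * tvar i :: ('a, 'b) mpoly)"
    by (simp add: tvar_def mult_basis)
  then show ?case by (auto simp: pull_poly_mult step t keys_add_nat)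
qed simp

lemma lookup_rs: "Poly_Mapping.lookup (rs J p) \<mu> = (if Poly_Mapping.keys \<mu> \<subseteq> J then Poly_Mapping.lookup p \<mu> else 0 :: 'k::field)"
proof (rule linear_eq_on_basis[where x = p])
  show "Vector_Spaces.linear scale (*) (\<lambda>p. Poly_Mapping.lookup (rs J p) \<mu> :: 'k)"
    by (rule linear_comp[OF linear_pull_poly linear_lookup])
  show "Vector_Spaces.linear scale (*) (\<lambda>p. if Poly_Mapping.keys \<mu> \<subseteq> J then Poly_Mapping.lookup p \<mu> else 0 :: 'k)"
    by (rule free_functionalI) (simp_all add: lookup_add)
qed (auto simp: rs_basis lookup_single when_def)

lemma rs_id: "p \<in> P_tilde J \<Longrightarrow> rs J p = p"
  by (rule poly_mapping_eqI) (auto simp: lookup_rs dest: P_tildeD)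

lemma rs_rs: "rs J (rs K p) = rs (J \<inter> K) p"
  by (rule poly_mapping_eqI) (auto simp: lookup_rs)

lemma rs_P_tilde: "p \<in> P_tilde A \<Longrightarrow> rs J p \<in> P_tilde (A \<inter> J)"
  by (rule P_tildeI) (auto simp: lookup_rs dest!: P_tildeD split: if_splits)

lemma pd_rs: "i \<in> J \<Longrightarrow> pd i (rs J p) = rs J (pd i p)"
  by (rule poly_mapping_eqI) (auto simp: lookup_rs lookup_pd keys_add_nat)

text \<open>A normal form for classes modulo the ideal: for \<open>p \<in> P_tilde F\<close> and
  \<open>a \<in> F\<close> the result is the only representative of the class of \<open>p\<close>
  that does not involve \<open>t_a\<close>, by \<open>eliminate_cong_ideal\<close> and
  \<open>ideal_eliminated\<close>. Derivatives of normal forms are again free of \<open>t_a\<close>,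
  so a congruence between them is an equation.\<close>

definition eliminate :: "'a set \<Rightarrow> 'a \<Rightarrow> ('a, 'k::field) mpoly \<Rightarrow> ('a, 'k) mpoly" where
  "eliminate F a = ev (\<lambda>i. if i = a then 1 - (\<Sum>b\<in>F - {a}. tvar b) else tvar i)"

lemma linear_eliminate: "Vector_Spaces.linear scale scale (eliminate F a)"
  unfolding eliminate_def by (rule linear_ev)

lemma eliminate_P_tilde: "finite F \<Longrightarrow> p \<in> P_tilde F \<Longrightarrow> eliminate F a p \<in> P_tilde (F - {a})"
  unfolding eliminate_def by (erule ev_P_tilde) (auto intro!: P_tilde_intros)

lemma eliminate_id: "p \<in> P_tilde (F - {a}) \<Longrightarrow> eliminate F a p = p"
  unfolding eliminate_def by (rule ev_tvar_id) auto

text \<open>The polynomials congruent to their image are closed under the algebra operations. They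
  contain \<open>t_a\<close>, because \<open>t_a\<close> minus its substitute is minus the generator
  of the ideal.\<close>

lemma eliminate_cong_ideal:
  fixes p :: "('a, 'b::field) mpoly"
  assumes F: "finite F" "a \<in> F" and p: "p \<in> P_tilde F"
  shows "p - eliminate F a p \<in> P_ideal F"
  using p
proof (induction rule: P_tilde_induct)
  case (add p q)
  have "p + q - eliminate F a (p + q) = (p - eliminate F a p) + (q - eliminate F a q)"
    by (simp add: linear_add[OF linear_eliminate])
  then show ?case using P_ideal_closed(2)[OF add(3,4)] by metis
next
  case (scale c p)
  have "scale c p - eliminate F a (scale c p) = scale c (p - eliminate F a p)"
    by (simp add: linear_scale[OF linear_eliminate] free.scale_right_diff_distrib)
  then show ?case using P_ideal_closed(3)[OF scale(2), of c] by metis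
next
  case one
  then show ?case by (simp add: eliminate_def P_ideal_closed)
next
  case (tvar i p)
  have t: "tvar i - eliminate F a (tvar i) \<in> (P_ideal F :: ('a, 'b) mpoly set)"
  proof (cases "i = a")
    case True
    have "tvar a - (1 - (\<Sum>b\<in>F - {a}. tvar b)) = - ((1 - (\<Sum>b\<in>F. tvar b)) * (1 :: ('a, 'b) mpoly))"
      using F by (simp add: sum.remove)
    then have "tvar a - (1 - (\<Sum>b\<in>F - {a}. tvar b)) \<in> (P_ideal F :: ('a, 'b) mpoly set)"
      using P_ideal_closed(5)[OF P_ideal_generator[OF P_tilde_1]] by metis
    then show ?thesis using True by (simp add: eliminate_def)
  qed (simp add: eliminate_def P_ideal_closed)
  have e: "eliminate F a p \<in> P_tilde F"
    using eliminate_P_tilde[OF F(1) tvar(2)] P_tilde_mono[of "F - {a}" F] by blast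
  have "tvar i * p - eliminate F a (tvar i * p) =
      (tvar i - eliminate F a (tvar i)) * eliminate F a p + tvar i * (p - eliminate F a p)"
    by (simp add: eliminate_def ev_mult algebra_simps)
  then show ?case using t e tvar by (simp add: P_ideal_closed P_ideal_mult P_ideal_mult' P_tilde_tvar)
qed

lemma eliminate_ideal:
  fixes p :: "('a, 'b::field) mpoly"
  assumes "finite F" "a \<in> F" "p \<in> P_ideal F"
  shows "eliminate F a p = 0"
proof -
  obtain q where p: "p = (1 - (\<Sum>i\<in>F. tvar i)) * q" using assms(3) by (auto simp: P_ideal_def)
  have "ev (\<lambda>i. if i = a then 1 - (\<Sum>b\<in>F - {a}. tvar b) else tvar i) (1 - (\<Sum>i\<in>F. tvar i)) = (0 :: ('a, 'b) mpoly)"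
    using assms by (simp add: ev_simps sum.remove[of F a])
  then show ?thesis by (simp add: p eliminate_def ev_mult)
qed

lemma ideal_eliminated:
  assumes "finite F" "a \<in> F" "p \<in> P_ideal F" "p \<in> P_tilde (F - {a})"
  shows "p = 0"
  using eliminate_ideal[OF assms(1-3)] eliminate_id[OF assms(4)] by simp

text \<open>The antiderivative in \<open>t_w\<close> that vanishes on
  \<open>t_w = 0\<close>.\<close>

definition ad :: "'a \<Rightarrow> ('a, 'k::field) mpoly \<Rightarrow> ('a, 'k) mpoly" where
  "ad w = lin_ext (\<lambda>\<mu>. Poly_Mapping.single (\<mu> + Poly_Mapping.single w 1) (1 / of_nat (Poly_Mapping.lookup \<mu> w + 1)))"

lemma linear_ad: "Vector_Spaces.linear scale scale (ad w)"
  unfolding ad_def by (rule linear_lin_ext)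

lemmas ad_linear = linear_0[OF linear_ad] linear_add[OF linear_ad] linear_diff[OF linear_ad]
  linear_scale[OF linear_ad] linear_sum[OF linear_ad] linear_uminus[OF linear_ad]

lemma lookup_ad:
  "Poly_Mapping.lookup (ad w p) \<mu> =
    (if Poly_Mapping.lookup \<mu> w = 0 then 0
     else Poly_Mapping.lookup p (\<mu> - Poly_Mapping.single w 1) / (of_nat (Poly_Mapping.lookup \<mu> w) :: 'k::field))"
proof (rule linear_eq_on_basis[where x = p])
  show "Vector_Spaces.linear scale (*) (\<lambda>p. Poly_Mapping.lookup (ad w p) \<mu> :: 'k)"
    by (rule linear_comp[OF linear_ad linear_lookup])
  show "Vector_Spaces.linear scale (*) (\<lambda>p. if Poly_Mapping.lookup \<mu> w = 0 then 0
     else Poly_Mapping.lookup p (\<mu> - Poly_Mapping.single w 1) / (of_nat (Poly_Mapping.lookup \<mu> w) :: 'k))"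
    by (rule free_functionalI) (simp_all add: lookup_add add_divide_distrib)
  fix \<kappa>
  show "Poly_Mapping.lookup (ad w (basis \<kappa>)) \<mu> =
    (if Poly_Mapping.lookup \<mu> w = 0 then 0
     else Poly_Mapping.lookup (basis \<kappa>) (\<mu> - Poly_Mapping.single w 1) / (of_nat (Poly_Mapping.lookup \<mu> w) :: 'k))"
  proof (cases "Poly_Mapping.lookup \<mu> w = 0")
    case True
    then have "\<kappa> + Poly_Mapping.single w 1 \<noteq> \<mu>" by (auto simp: lookup_add)
    then show ?thesis using True by (simp add: ad_def lookup_single)
  next
    case False
    then have "\<kappa> + Poly_Mapping.single w 1 = \<mu> \<longleftrightarrow> \<kappa> = \<mu> - Poly_Mapping.single w 1"
      using exp_diff_add[of \<mu> w] by auto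
    then show ?thesis using False exp_diff_add[of \<mu> w]
      by (auto simp: ad_def lookup_single when_def lookup_minus)
  qed
qed

lemma pd_ad: "pd w (ad w p) = (p :: ('a, 'k::field_char_0) mpoly)"
proof -
  have "1 + of_nat n \<noteq> (0 :: 'k)" for n using of_nat_neq_0[of n] by simp
  then show ?thesis
    by (intro poly_mapping_eqI) (simp add: lookup_pd lookup_ad lookup_add)
qed

lemma pd_ad_other: "i \<noteq> w \<Longrightarrow> pd i (ad w p) = ad w (pd i p)"
proof (rule poly_mapping_eqI)
  fix \<mu> assume i: "i \<noteq> w"
  show "Poly_Mapping.lookup (pd i (ad w p)) \<mu> = Poly_Mapping.lookup (ad w (pd i p)) \<mu>"
  proof (cases "Poly_Mapping.lookup \<mu> w = 0")
    case False
    have "\<mu> + Poly_Mapping.single i 1 - Poly_Mapping.single w 1 = \<mu> - Poly_Mapping.single w 1 + Poly_Mapping.single i 1"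
      by (rule poly_mapping_eqI) (use False i in \<open>auto simp: lookup_add lookup_minus lookup_single when_def\<close>)
    then show ?thesis using False i by (simp add: lookup_pd lookup_ad lookup_add lookup_minus lookup_single when_def)
  qed (use i in \<open>simp add: lookup_pd lookup_ad lookup_add lookup_single when_def\<close>)
qed

text \<open>The fundamental theorem of calculus; \<open>rs (- {w})\<close> is the substitution
  \<open>t_w = 0\<close>.\<close>

lemma ad_pd: "ad w (pd w p) = p - rs (- {w}) (p :: ('a, 'k::field_char_0) mpoly)"
proof (rule poly_mapping_eqI)
  fix \<mu> :: "'a \<Rightarrow>\<^sub>0 nat"
  have k: "Poly_Mapping.keys \<mu> \<subseteq> - {w} \<longleftrightarrow> Poly_Mapping.lookup \<mu> w = 0" by (auto simp: in_keys_iff)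
  show "Poly_Mapping.lookup (ad w (pd w p)) \<mu> = Poly_Mapping.lookup (p - rs (- {w}) p) \<mu>"
  proof (cases "Poly_Mapping.lookup \<mu> w")
    case (Suc n)
    have "1 + of_nat n \<noteq> (0 :: 'k)" using of_nat_neq_0[of n] by simp
    then show ?thesis using Suc exp_diff_add[of \<mu> w]
      by (simp add: lookup_pd lookup_ad lookup_minus lookup_rs k in_keys_iff)
  qed (simp add: lookup_ad lookup_minus lookup_rs k in_keys_iff)
qed

lemma rs_ad: "w \<notin> J \<Longrightarrow> rs J (ad w p) = (0 :: ('a, 'k::field) mpoly)"
proof (rule poly_mapping_eqI)
  fix \<mu> :: "'a \<Rightarrow>\<^sub>0 nat" assume "w \<notin> J"
  then have "Poly_Mapping.keys \<mu> \<subseteq> J \<Longrightarrow> Poly_Mapping.lookup \<mu> w = 0" by (auto simp: in_keys_iff)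
  then show "Poly_Mapping.lookup (rs J (ad w p)) \<mu> = Poly_Mapping.lookup 0 \<mu>" by (simp add: lookup_rs lookup_ad)
qed

lemma ad_P_tilde: "p \<in> P_tilde A \<Longrightarrow> w \<in> A \<Longrightarrow> ad w p \<in> P_tilde A"
proof (rule P_tildeI)
  fix \<mu> assume p: "p \<in> P_tilde A" and w: "w \<in> A" and l: "Poly_Mapping.lookup (ad w p) \<mu> \<noteq> 0"
  then have "Poly_Mapping.lookup \<mu> w > 0" and "Poly_Mapping.lookup p (\<mu> - Poly_Mapping.single w 1) \<noteq> 0"
    by (auto simp: lookup_ad split: if_splits)
  then have "Poly_Mapping.keys (\<mu> - Poly_Mapping.single w 1 + Poly_Mapping.single w 1) \<subseteq> A"
    using p w by (auto simp: keys_add_nat dest!: P_tildeD)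
  then show "Poly_Mapping.keys \<mu> \<subseteq> A" using exp_diff_add \<open>Poly_Mapping.lookup \<mu> w > 0\<close> by metis
qed


subsection \<open>Stokes' formula\<close>

text \<open>The divergence theorem for the constant tangent vector \<open>c\<close> times
  \<open>t^\<mu>\<close>. The integral of the \<open>i\<close>-th derivative is \<open>K\<close> if
  \<open>t_i\<close> occurs in the monomial and 0 otherwise; the integral over the facet opposite to
  \<open>i\<close> is \<open>K\<close> if \<open>t_i\<close> does not occur and 0 otherwise.
  Together they contribute \<open>K\<close> times the sum of the \<open>c_i\<close>, which is
  zero.\<close>

lemma stokes_monomial:
  fixes c :: "'a \<Rightarrow> 'k::field_char_0"
  assumes J: "finite J" "J \<noteq> {}" and c: "(\<Sum>i\<in>J. c i) = 0" and mu: "Poly_Mapping.keys \<mu> \<subseteq> J"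
  shows "(\<Sum>i\<in>J. c i * simplex_integral_tilde J (pd i (basis \<mu>))) =
    - (\<Sum>i | i \<in> J \<and> J - {i} \<noteq> {}. c i * simplex_integral_tilde (J - {i}) (rs (J - {i}) (basis \<mu>)))"
proof (cases "card J = 1")
  \<comment> \<open>A vertex has no nonempty facet, and tangency forces \<open>c\<close> to vanish
    there.\<close>
  case True
  then obtain a where "J = {a}" by (auto simp: card_1_singleton_iff)
  then have "J = {a}" "c a = 0" using c by auto
  moreover have "{i \<in> {a}. {a} - {i} \<noteq> {}} = {}" by auto
  ultimately show ?thesis by simp
next
  case False
  \<comment> \<open>\<open>n\<close> is the dimension of the facets. Lowering the degree on
    \<open>J\<close> and lowering the dimension lead to the same factorial
    \<open>(n + |\<mu>|)!\<close>, hence to the common value \<open>K\<close>.\<close>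
  define n where "n = card J - 2"
  have "card J \<noteq> 0" using J by simp
  then have n: "card J = n + 2" using False by (simp add: n_def)
  define s where "s = (\<Sum>i\<in>J. Poly_Mapping.lookup \<mu> i)"
  define K where "K = (fact_mon \<mu> / fact (n + s) :: 'k)"
  have ne: "J - {i} \<noteq> {}" for i
    using card_Diff1_le[of J i] n J by (metis card.empty card_Suc_Diff1 card_Diff_singleton_if diff_add_inverse2 nat.distinct(1) One_nat_def Suc_1 add_2_eq_Suc' diff_Suc_1)
  have 1: "simplex_integral_tilde J (pd i (basis \<mu>)) = (if Poly_Mapping.lookup \<mu> i = 0 then 0 else K)" if i: "i \<in> J" for i
  proof (cases "Poly_Mapping.lookup \<mu> i = 0")
    case nz: False
    let ?\<nu> = "\<mu> - Poly_Mapping.single i 1"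
    have m: "\<mu> = ?\<nu> + Poly_Mapping.single i 1" using exp_diff_add[of \<mu> i] nz by simp
    have "fact_mon \<mu> = (of_nat (Poly_Mapping.lookup ?\<nu> i + 1) * fact_mon ?\<nu> :: 'k)"
      by (subst m) (rule fact_mon_add_single)
    moreover have "Poly_Mapping.lookup ?\<nu> i + 1 = Poly_Mapping.lookup \<mu> i" using nz by (simp add: lookup_minus)
    ultimately have f: "of_nat (Poly_Mapping.lookup \<mu> i) * fact_mon ?\<nu> = (fact_mon \<mu> :: 'k)" by metis
    have "s = (\<Sum>j\<in>J. Poly_Mapping.lookup (?\<nu> + Poly_Mapping.single i 1) j)" unfolding s_def by (simp only: m[symmetric])
    also have "\<dots> = (\<Sum>j\<in>J. Poly_Mapping.lookup ?\<nu> j) + 1"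
      using i J by (simp only: lookup_add sum.distrib) (simp add: lookup_single when_def)
    finally have s': "card J - 1 + (\<Sum>j\<in>J. Poly_Mapping.lookup ?\<nu> j) = n + s" using n by simp
    have "simplex_integral_tilde J (pd i (basis \<mu>)) = (of_nat (Poly_Mapping.lookup \<mu> i) * simplex_integral_tilde J (basis ?\<nu>) :: 'k)"
      by (simp only: pd_basis single_eq_scale[of _ "of_nat _"] linear_scale[OF linear_integral])
    then show ?thesis using nz f by (simp only: integral_basis s' K_def) simp
  qed (simp add: pd_basis linear_0[OF linear_integral])
  have 2: "simplex_integral_tilde (J - {i}) (rs (J - {i}) (basis \<mu>)) = (if Poly_Mapping.lookup \<mu> i = 0 then K else 0)"
    if i: "i \<in> J" for i
  proof (cases "Poly_Mapping.lookup \<mu> i = 0")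
    case True
    have "(\<Sum>j\<in>J - {i}. Poly_Mapping.lookup \<mu> j) = s" using True i J by (simp add: s_def sum.remove[of J i])
    moreover have "card (J - {i}) - 1 = n" using i J n by simp
    moreover have "Poly_Mapping.keys \<mu> \<subseteq> J - {i}" using mu True by (auto simp: in_keys_iff)
    ultimately show ?thesis using True by (simp add: rs_basis integral_basis K_def)
  next
    case nz: False
    then have "i \<in> Poly_Mapping.keys \<mu>" by (simp add: in_keys_iff)
    then have k: "\<not> Poly_Mapping.keys \<mu> \<subseteq> J - {i}" by auto
    show ?thesis using nz by (simp add: rs_basis k linear_0[OF linear_integral])
  qed
  have "{i. i \<in> J \<and> J - {i} \<noteq> {}} = J" using ne by auto
  moreover have "(\<Sum>i\<in>J. c i * (if Poly_Mapping.lookup \<mu> i = 0 then 0 else K)) +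
      (\<Sum>i\<in>J. c i * (if Poly_Mapping.lookup \<mu> i = 0 then K else 0)) = (\<Sum>i\<in>J. c i * K)"
    unfolding sum.distrib[symmetric] by (intro sum.cong) auto
  moreover have "(\<Sum>i\<in>J. c i * K) = 0" by (simp add: sum_distrib_right[symmetric] c)
  ultimately show ?thesis by (simp add: 1 2 eq_neg_iff_add_eq_0)
qed

text \<open>Sorted by monomials, the vector field \<open>V\<close> has a constant vector in front of
  each monomial, and the tangency condition holds coefficient by coefficient, so
  \<open>stokes_monomial\<close> applies to each of them.\<close>

lemma stokes:
  fixes V :: "'a \<Rightarrow> ('a, 'k::field_char_0) mpoly"
  assumes J: "finite J" "J \<noteq> {}" and V: "\<And>i. i \<in> J \<Longrightarrow> V i \<in> P_tilde J" and z: "(\<Sum>i\<in>J. V i) = 0"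
  shows "simplex_integral_tilde J (\<Sum>i\<in>J. pd i (V i)) =
    - (\<Sum>i | i \<in> J \<and> J - {i} \<noteq> {}. simplex_integral_tilde (J - {i}) (rs (J - {i}) (V i)))"
proof -
  define M where "M = (\<Union>i\<in>J. Poly_Mapping.keys (V i))"
  have fin: "finite M" using J by (simp add: M_def)
  have V': "V i = (\<Sum>\<mu>\<in>M. scale (Poly_Mapping.lookup (V i) \<mu>) (basis \<mu>))" if i: "i \<in> J" for i
    using lin_ext_superset[OF fin, of "V i" basis] i lin_ext_basis_id[of "V i"] by (auto simp: M_def)
  have kM: "Poly_Mapping.keys \<mu> \<subseteq> J" if "\<mu> \<in> M" for \<mu>
    using that V by (auto simp: M_def in_keys_iff dest!: P_tildeD)
  have z': "(\<Sum>i\<in>J. Poly_Mapping.lookup (V i) \<mu>) = 0" for \<mu>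
    using z by (metis lookup_sum lookup_zero)
  have lin: "f (V i) = (\<Sum>\<mu>\<in>M. Poly_Mapping.lookup (V i) \<mu> * f (basis \<mu>))"
    if "Vector_Spaces.linear scale (*) f" "i \<in> J" for f i
    by (subst V'[OF that(2)]) (simp only: linear_sum[OF that(1)] linear_scale[OF that(1)])
  have "simplex_integral_tilde J (\<Sum>i\<in>J. pd i (V i)) =
      (\<Sum>i\<in>J. \<Sum>\<mu>\<in>M. Poly_Mapping.lookup (V i) \<mu> * simplex_integral_tilde J (pd i (basis \<mu>)))"
    unfolding linear_sum[OF linear_integral]
    by (intro sum.cong refl lin linear_comp[OF linear_pd linear_integral])
  also have "\<dots> = (\<Sum>\<mu>\<in>M. \<Sum>i\<in>J. Poly_Mapping.lookup (V i) \<mu> * simplex_integral_tilde J (pd i (basis \<mu>)))"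
    by (rule sum.swap)
  also have "\<dots> = (\<Sum>\<mu>\<in>M. - (\<Sum>i | i \<in> J \<and> J - {i} \<noteq> {}.
      Poly_Mapping.lookup (V i) \<mu> * simplex_integral_tilde (J - {i}) (rs (J - {i}) (basis \<mu>))))"
    by (intro sum.cong refl stokes_monomial J z' kM)
  also have "\<dots> = - (\<Sum>i | i \<in> J \<and> J - {i} \<noteq> {}. \<Sum>\<mu>\<in>M.
      Poly_Mapping.lookup (V i) \<mu> * simplex_integral_tilde (J - {i}) (rs (J - {i}) (basis \<mu>)))"
    by (simp add: sum_negf) (rule sum.swap)
  also have "\<dots> = - (\<Sum>i | i \<in> J \<and> J - {i} \<noteq> {}. simplex_integral_tilde (J - {i}) (rs (J - {i}) (V i)))"
    by (intro arg_cong[where f = uminus] sum.cong refl lin[symmetric] linear_comp[OF linear_pull_poly linear_integral]) auto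
  finally show ?thesis .
qed


section \<open>Polyvector fields as alternating families\<close>

definition words :: "nat \<Rightarrow> 'a set \<Rightarrow> 'a list set" where
  "words m J = {l. length l = m \<and> set l \<subseteq> J}"

lemma finite_words: "finite J \<Longrightarrow> finite (words m J)"
  using finite_lists_length_eq[of J m] by (simp add: words_def conj_commute)

lemma words_Cons [simp]: "i # l \<in> words (Suc m) J \<longleftrightarrow> i \<in> J \<and> l \<in> words m J"
  by (auto simp: words_def)

lemma words_mono: "J \<subseteq> K \<Longrightarrow> l \<in> words m J \<Longrightarrow> l \<in> words m K"
  by (auto simp: words_def)

text \<open>An element of \<open>\<Theta>\<^sub>J\<close> in degree \<open>m\<close>, given by its pairings \<open>X [j\<^sub>1, \<dots>, j\<^sub>m]\<close> with
  \<open>dt\<^sub>j\<^sub>1 \<and> \<dots> \<and> dt\<^sub>j\<^sub>m\<close>. The vanishing sums express \<open>\<Sum>dt\<^sub>j = 0\<close>.\<close>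

definition alt_tan :: "nat \<Rightarrow> 'a set \<Rightarrow> ('a list \<Rightarrow> ('a, 'k::field) mpoly) \<Rightarrow> bool" where
  "alt_tan m J X \<longleftrightarrow>
     (\<forall>l\<in>words m J. X l \<in> P_tilde J) \<and>
     (\<forall>xs a b ys. xs @ a # b # ys \<in> words m J \<longrightarrow> X (xs @ a # b # ys) = - X (xs @ b # a # ys)) \<and>
     (\<forall>xs ys. length xs + length ys + 1 = m \<and> set xs \<subseteq> J \<and> set ys \<subseteq> J \<longrightarrow> (\<Sum>j\<in>J. X (xs @ j # ys)) = 0)"

lemma alt_tanI:
  assumes "\<And>l. l \<in> words m J \<Longrightarrow> X l \<in> P_tilde J"
    and "\<And>xs a b ys. xs @ a # b # ys \<in> words m J \<Longrightarrow> X (xs @ a # b # ys) = - X (xs @ b # a # ys)"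
    and "\<And>xs ys. length xs + length ys + 1 = m \<Longrightarrow> set xs \<subseteq> J \<Longrightarrow> set ys \<subseteq> J \<Longrightarrow> (\<Sum>j\<in>J. X (xs @ j # ys)) = 0"
  shows "alt_tan m J X"
  using assms by (auto simp: alt_tan_def)

lemma alt_tan_P: "alt_tan m J X \<Longrightarrow> l \<in> words m J \<Longrightarrow> X l \<in> P_tilde J"
  and alt_tan_swap: "alt_tan m J X \<Longrightarrow> xs @ a # b # ys \<in> words m J \<Longrightarrow> X (xs @ a # b # ys) = - X (xs @ b # a # ys)"
  and alt_tan_sum: "alt_tan m J X \<Longrightarrow> length xs + length ys + 1 = m \<Longrightarrow> set xs \<subseteq> J \<Longrightarrow> set ys \<subseteq> J \<Longrightarrow>
    (\<Sum>j\<in>J. X (xs @ j # ys)) = 0"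
  unfolding alt_tan_def by blast+

text \<open>\<open>a\<close> and \<open>b\<close> are exchanged across the block \<open>us\<close>
  by adjacent swaps; each letter of \<open>us\<close> costs two sign changes.\<close>

lemma alt_tan_transpose:
  assumes "alt_tan m J X" "xs @ a # us @ b # vs \<in> words m J"
  shows "X (xs @ a # us @ b # vs) = - X (xs @ b # us @ a # vs)"
  using assms(2)
proof (induction us arbitrary: xs)
  case Nil
  then show ?case using alt_tan_swap[OF assms(1), of xs a b vs] by simp
next
  case (Cons y us)
  have w: "xs @ a # y # us @ b # vs \<in> words m J" "(xs @ [y]) @ a # us @ b # vs \<in> words m J" "xs @ y # b # us @ a # vs \<in> words m J"
    using Cons.prems by (auto simp: words_def)
  have "X (xs @ a # y # us @ b # vs) = - X (xs @ y # a # us @ b # vs)" by (rule alt_tan_swap[OF assms(1) w(1)])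
  also have "X (xs @ y # a # us @ b # vs) = - X (xs @ y # b # us @ a # vs)" using Cons.IH[OF w(2)] by simp
  also have "X (xs @ y # b # us @ a # vs) = - X (xs @ b # y # us @ a # vs)" by (rule alt_tan_swap[OF assms(1) w(3)])
  finally show ?case by simp
qed

lemma mpoly_neg_self:
  fixes p :: "('a, 'k::field_char_0) mpoly"
  assumes "p = - p"
  shows "p = 0"
proof (rule poly_mapping_eqI)
  fix \<mu>
  have "Poly_Mapping.lookup p \<mu> = - Poly_Mapping.lookup p \<mu>" using assms by (metis lookup_uminus)
  then show "Poly_Mapping.lookup p \<mu> = Poly_Mapping.lookup 0 \<mu>" by simp
qed

text \<open>Exchanging the two equal letters changes the sign, and 2 is invertible.\<close>

lemma alt_tan_repeat:
  fixes X :: "'a list \<Rightarrow> ('a, 'k::field_char_0) mpoly"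
  assumes "alt_tan m J X" "a # l \<in> words m J" "a \<in> set l"
  shows "X (a # l) = 0"
proof -
  obtain us vs where l: "l = us @ a # vs" using assms(3) split_list by metis
  have "X (a # us @ a # vs) = - X (a # us @ a # vs)"
    using alt_tan_transpose[OF assms(1), of "[]" a us a vs] assms(2) l by simp
  then show ?thesis unfolding l by (rule mpoly_neg_self)
qed

lemma alt_tan_Cons:
  assumes "alt_tan (Suc m) J X" "i \<in> J"
  shows "alt_tan m J (\<lambda>l. X (i # l))"
proof (rule alt_tanI)
  show "X (i # l) \<in> P_tilde J" if "l \<in> words m J" for l using alt_tan_P[OF assms(1)] that assms(2) by simp
  show "X (i # xs @ a # b # ys) = - X (i # xs @ b # a # ys)" if "xs @ a # b # ys \<in> words m J" for xs a b ys
    using alt_tan_swap[OF assms(1), of "i # xs" a b ys] that assms(2) by (simp add: words_def)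
  show "(\<Sum>j\<in>J. X (i # xs @ j # ys)) = 0" if "length xs + length ys + 1 = m" "set xs \<subseteq> J" "set ys \<subseteq> J" for xs ys
    using alt_tan_sum[OF assms(1), of "i # xs" ys] that assms(2) by simp
qed

lemma alt_tan_linear:
  assumes "alt_tan m J X" "Vector_Spaces.linear scale scale f" "\<And>p. p \<in> P_tilde J \<Longrightarrow> f p \<in> P_tilde J"
  shows "alt_tan m J (\<lambda>l. f (X l))"
proof (rule alt_tanI)
  show "f (X (xs @ a # b # ys)) = - f (X (xs @ b # a # ys))" if "xs @ a # b # ys \<in> words m J" for xs a b ys
    by (subst alt_tan_swap[OF assms(1) that]) (rule linear_uminus[OF assms(2)])
  show "(\<Sum>j\<in>J. f (X (xs @ j # ys))) = 0" if "length xs + length ys + 1 = m" "set xs \<subseteq> J" "set ys \<subseteq> J" for xs ys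
    using alt_tan_sum[OF assms(1) that] linear_sum[OF assms(2), of "\<lambda>j. X (xs @ j # ys)" J] linear_0[OF assms(2)] by simp
qed (simp add: assms(3) alt_tan_P[OF assms(1)])

lemma alt_tan_zero: "alt_tan m J (\<lambda>l. 0)"
  by (rule alt_tanI) (auto simp: P_tilde_closed)

lemma alt_tan_add: "alt_tan m J X \<Longrightarrow> alt_tan m J Y \<Longrightarrow> alt_tan m J (\<lambda>l. X l + Y l)"
  by (rule alt_tanI) (simp_all add: P_tilde_closed alt_tan_P alt_tan_sum sum.distrib alt_tan_swap[of m J X] alt_tan_swap[of m J Y])

lemma alt_tan_scale: "alt_tan m J X \<Longrightarrow> alt_tan m J (\<lambda>l. scale c (X l))"
  by (rule alt_tan_linear) (simp_all add: free_linearI P_tilde_closed free.scale_right_distrib mult.commute)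

lemma alt_tan_diff: "alt_tan m J X \<Longrightarrow> alt_tan m J Y \<Longrightarrow> alt_tan m J (\<lambda>l. X l - Y l)"
  using alt_tan_add[OF _ alt_tan_scale[of m J Y "- 1"], of X] by simp

lemma alt_tan_sum_family: "(\<And>i. i \<in> A \<Longrightarrow> alt_tan m J (X i)) \<Longrightarrow> alt_tan m J (\<lambda>l. \<Sum>i\<in>A. X i l)"
  by (induction A rule: infinite_finite_induct) (simp_all add: alt_tan_zero alt_tan_add)

lemma alt_tan_div: "alt_tan (Suc m) J X \<Longrightarrow> alt_tan m J (\<lambda>l. \<Sum>i\<in>J. pd i (X (i # l)))"
  by (intro alt_tan_sum_family alt_tan_linear[OF _ linear_pd] alt_tan_Cons pd_P_tilde)

text \<open>The boundary term of Stokes' formula: contraction with \<open>dt_i\<close> is tangent to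
  the facet opposite to \<open>i\<close>. In the vanishing sum over the vertices of
  \<open>insert i J\<close> the letter \<open>i\<close> would occur twice in the term for
  \<open>i\<close>, so that term drops out and the sum over \<open>J\<close> vanishes.\<close>

lemma alt_tan_face:
  fixes X :: "'a list \<Rightarrow> ('a, 'k::field_char_0) mpoly"
  assumes X: "alt_tan (Suc m) (insert i J) X" and J: "finite J" "i \<notin> J"
  shows "alt_tan m J (\<lambda>l. rs J (X (i # l)))"
proof (rule alt_tanI)
  show "rs J (X (i # xs @ a # b # ys)) = - rs J (X (i # xs @ b # a # ys))" if "xs @ a # b # ys \<in> words m J" for xs a b ys
  proof -
    have "(i # xs) @ a # b # ys \<in> words (Suc m) (insert i J)" using that by (auto simp: words_def)
    from alt_tan_swap[OF X this] show ?thesis by (simp add: pull_poly_linear)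
  qed
  show "(\<Sum>j\<in>J. rs J (X (i # xs @ j # ys))) = 0" if w: "length xs + length ys + 1 = m" "set xs \<subseteq> J" "set ys \<subseteq> J" for xs ys
  proof -
    have "(\<Sum>j\<in>insert i J. X ((i # xs) @ j # ys)) = 0"
      by (rule alt_tan_sum[OF X]) (use w in auto)
    moreover have "X (i # xs @ i # ys) = 0"
      by (rule alt_tan_repeat[OF X]) (use w in \<open>auto simp: words_def\<close>)
    ultimately have "(\<Sum>j\<in>J. X (i # xs @ j # ys)) = 0" using J by simp
    then show ?thesis by (simp add: pull_poly_linear(5)[symmetric] pull_poly_linear(1))
  qed
qed (rule pull_poly_P_tilde)

text \<open>Pairings with words that leave \<open>J\<close> are zero: this is the image of a field
  under the inclusion of the tangent space of \<open>J\<close> into that of \<open>K\<close>, with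
  coefficients constant in the new variables.\<close>

lemma alt_tan_extend:
  assumes X: "alt_tan m J X" and JK: "J \<subseteq> K" "finite K"
  shows "alt_tan m K (\<lambda>l. if set l \<subseteq> J then X l else 0)"
proof (rule alt_tanI)
  show "(if set l \<subseteq> J then X l else 0) \<in> P_tilde K" if "l \<in> words m K" for l
    using alt_tan_P[OF X, of l] that P_tilde_mono[OF JK(1)] by (auto simp: words_def P_tilde_closed)
  show "(if set (xs @ a # b # ys) \<subseteq> J then X (xs @ a # b # ys) else 0) = - (if set (xs @ b # a # ys) \<subseteq> J then X (xs @ b # a # ys) else 0)"
    if "xs @ a # b # ys \<in> words m K" for xs a b ys
    using alt_tan_swap[OF X, of xs a b ys] that by (auto simp: words_def)
  show "(\<Sum>j\<in>K. if set (xs @ j # ys) \<subseteq> J then X (xs @ j # ys) else 0) = 0"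
    if "length xs + length ys + 1 = m" "set xs \<subseteq> K" "set ys \<subseteq> K" for xs ys
  proof (cases "set xs \<subseteq> J \<and> set ys \<subseteq> J")
    case True
    have "(\<Sum>j\<in>K. if set (xs @ j # ys) \<subseteq> J then X (xs @ j # ys) else 0) = (\<Sum>j\<in>J. X (xs @ j # ys))"
      by (rule sum.mono_neutral_cong_right) (use JK True in auto)
    then show ?thesis using alt_tan_sum[OF X that(1)] True by simp
  qed (auto intro!: sum.neutral split: if_splits)
qed


subsection \<open>Evaluation of families on forms\<close>

type_synonym ('a, 'k) family = "'a set \<Rightarrow> 'a list \<Rightarrow> ('a, 'k) mpoly"

definition alt_fam :: "'a set \<Rightarrow> nat \<Rightarrow> ('a, 'k::field) family \<Rightarrow> bool" where
  "alt_fam I m X \<longleftrightarrow> (\<forall>J\<in>faces I. alt_tan m J (X J))"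

text \<open>The value of the current \<open>\<xi>\<^sub>I X\<close> on the form \<open>q dt\<^sub>l\<close>.\<close>

definition Ev :: "'a set \<Rightarrow> ('a, 'k::field_char_0) family \<Rightarrow> ('a, 'k) mpoly \<Rightarrow> 'a list \<Rightarrow> 'k" where
  "Ev I X q l = (\<Sum>J | J \<in> faces I \<and> set l \<subseteq> J. simplex_integral_tilde J (rs J q * X J l))"

text \<open>Divergence and boundary terms, as Stokes' formula dictates.\<close>

definition Dv :: "'a set \<Rightarrow> nat \<Rightarrow> ('a, 'k::field) family \<Rightarrow> ('a, 'k) family" where
  "Dv I m X J l = scale ((-1) ^ m) ((\<Sum>i\<in>J. pd i (X J (i # l))) + (\<Sum>i\<in>I - J. rs J (X (insert i J) (i # l))))"

lemma finite_faces: "finite I \<Longrightarrow> finite (faces I)"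
  by (simp add: faces_def)

lemma facesD: "J \<in> faces I \<Longrightarrow> finite I \<Longrightarrow> finite J \<and> J \<noteq> {} \<and> J \<subseteq> I"
  by (auto simp: faces_def finite_subset)

lemma Ev_linear_family:
  "Ev I (\<lambda>J l. X J l - Y J l) q l = Ev I X q l - Ev I Y q l"
  "Ev I (\<lambda>J l. scale c (X J l)) q l = c * Ev I X q l"
  by (simp_all add: Ev_def right_diff_distrib linear_diff[OF linear_integral] sum_subtractf
      scale_mult_right linear_scale[OF linear_integral] sum_distrib_left)

lemma linear_Ev: "Vector_Spaces.linear scale (*) (\<lambda>q. Ev I X q l)"
  by (rule free_functionalI)
     (simp_all add: Ev_def pull_poly_linear distrib_right scale_mult_left linear_add[OF linear_integral]
       linear_scale[OF linear_integral] sum.distrib sum_distrib_left)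

text \<open>The integrals annihilate the ideals, so a current only sees the classes of its
  coefficients.\<close>

lemma Ev_cong:
  assumes "finite I" "\<And>J. J \<in> faces I \<Longrightarrow> set l \<subseteq> J \<Longrightarrow> X J l - Y J l \<in> P_ideal J"
  shows "Ev I X q l = Ev I Y q l"
proof -
  have "Ev I (\<lambda>J l. X J l - Y J l) q l = 0"
    unfolding Ev_def
  proof (rule sum.neutral, safe)
    fix J assume J: "J \<in> faces I" "set l \<subseteq> J"
    have "rs J q * (X J l - Y J l) \<in> P_ideal J"
      by (rule P_ideal_mult'[OF assms(2)[OF J] pull_poly_P_tilde])
    then show "simplex_integral_tilde J (rs J q * (X J l - Y J l)) = 0"
      using integral_ideal facesD[OF J(1) assms(1)] by blast
  qed
  then show ?thesis by (simp add: Ev_linear_family)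
qed

text \<open>Forms divisible by \<open>\<Prod>t\<^sub>j\<close>, \<open>j \<in> J\<close>, only see the faces that contain \<open>J\<close>.\<close>

lemma Ev_injective:
  fixes X :: "('a, 'k::field_char_0) family"
  assumes I: "finite I"
    and P: "\<And>J l. J \<in> faces I \<Longrightarrow> l \<in> words m J \<Longrightarrow> X J l \<in> P_tilde J"
    and z: "\<And>q l. q \<in> P_tilde I \<Longrightarrow> l \<in> words m I \<Longrightarrow> Ev I X q l = 0"
    and J: "J \<in> faces I" and l: "l \<in> words m J"
  shows "X J l \<in> P_ideal J"
  using J l
\<comment> \<open>For faces that properly contain \<open>J\<close> the coefficients are already
  known to lie in the ideals; the test polynomial \<open>?q\<close> removes all faces that do not
  contain \<open>J\<close>.\<close>
proof (induction "card I - card J" arbitrary: J rule: less_induct)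
  case less
  have fJ: "finite J" "J \<noteq> {}" "J \<subseteq> I" using facesD[OF less(2) I] by auto
  show ?case
  proof (rule integral_nondegenerate[OF fJ(1,2) P[OF less(2,3)]])
    fix g :: "('a, 'k) mpoly" assume g: "g \<in> P_tilde J"
    let ?q = "basis (face_monomial J) * g"
    have q: "?q \<in> P_tilde J" using g fJ by (auto intro: P_tilde_mult simp: keys_face_monomial)
    have "0 = Ev I X ?q l"
      by (rule z[symmetric]) (use q P_tilde_mono[OF fJ(3)] words_mono[OF fJ(3) less(3)] in auto)
    also have "\<dots> = (\<Sum>K\<in>{J}. simplex_integral_tilde K (rs K ?q * X K l))"
      unfolding Ev_def
    proof (rule sum.mono_neutral_right)
      show "\<forall>K\<in>{J. J \<in> faces I \<and> set l \<subseteq> J} - {J}. simplex_integral_tilde K (rs K ?q * X K l) = 0"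
      proof (intro ballI, rule ccontr)
        fix K assume K': "K \<in> {J. J \<in> faces I \<and> set l \<subseteq> J} - {J}" "simplex_integral_tilde K (rs K ?q * X K l) \<noteq> 0"
        then have K: "K \<in> faces I" "set l \<subseteq> K" "simplex_integral_tilde K (rs K ?q * X K l) \<noteq> 0" "K \<noteq> J" by auto
        have fK: "finite K" "K \<noteq> {}" "K \<subseteq> I" using facesD[OF K(1) I] by auto
        have "J \<subseteq> K"
        proof (rule ccontr)
          assume "\<not> J \<subseteq> K"
          then have "rs K ?q = 0" using fJ by (simp add: pull_poly_mult rs_basis keys_face_monomial)
          then show False using K(3) by (simp add: linear_0[OF linear_integral])
        qed
        have "card J < card K" "card K \<le> card I"
          using \<open>J \<subseteq> K\<close> K(4) fK I by (auto intro: psubset_card_mono card_mono)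
        then have "X K l \<in> P_ideal K"
          using less(1)[of K] K(1) words_mono[OF \<open>J \<subseteq> K\<close> less(3)] by simp
        from integral_ideal[OF fK(1,2) P_ideal_mult'[OF this pull_poly_P_tilde]] K(3) show False by blast
      qed
    qed (use I less in \<open>auto simp: finite_faces words_def\<close>)
    finally show "simplex_integral_tilde J (basis (face_monomial J) * g * X J l) = 0"
      using rs_id[OF q] by simp
  qed
qed

text \<open>The right-hand side is, up to sign, the value of the current \<open>X\<close> on
  \<open>d(q dt_l)\<close>. On each face the Leibniz rule and Stokes' formula trade the derivative
  of \<open>q\<close> for the divergence of \<open>X J\<close> and for integrals over facets. A
  facet \<open>J - {i}\<close> is then regarded as a face in its own right with \<open>i\<close>
  outside it, which yields the second sum in \<open>Dv\<close>.\<close>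

lemma Ev_Dv:
  fixes X :: "('a, 'k::field_char_0) family"
  assumes I: "finite I" and X: "alt_fam I (Suc m) X" and l: "l \<in> words m I"
  shows "Ev I (Dv I m X) q l = (-1) ^ (m + 1) * (\<Sum>i\<in>I. Ev I X (pd i q) (i # l))"
proof -
  let ?F = "{J. J \<in> faces I \<and> set l \<subseteq> J}"
  let ?b = "\<lambda>K i. simplex_integral_tilde (K - {i}) (rs (K - {i}) q * rs (K - {i}) (X K (i # l)))"
  have finF: "finite ?F" using finite_faces[OF I] by simp
  have lJ: "l \<in> words m J" if "J \<in> ?F" for J using l that by (auto simp: words_def)
  \<comment> \<open>Stokes' formula for the field with components
    \<open>rs J q * X J (i # l)\<close>; it is tangent by the vanishing sum of
    \<open>alt_tan\<close> at the first letter.\<close>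
  have per: "(\<Sum>i\<in>J. simplex_integral_tilde J (rs J (pd i q) * X J (i # l))) =
      - simplex_integral_tilde J (rs J q * (\<Sum>i\<in>J. pd i (X J (i # l)))) - (\<Sum>i | i \<in> J \<and> J - {i} \<noteq> {}. ?b J i)"
    if J: "J \<in> ?F" for J
  proof -
    have fJ: "finite J" "J \<noteq> {}" "J \<subseteq> I" using facesD[OF _ I] J by auto
    have aX: "alt_tan (Suc m) J (X J)" using X J by (simp add: alt_fam_def)
    have t: "(\<Sum>i\<in>J. X J (i # l)) = 0"
      using alt_tan_sum[OF aX, of "[]" l] lJ[OF J] by (simp add: words_def)
    have "simplex_integral_tilde J (\<Sum>i\<in>J. pd i (rs J q * X J (i # l))) =
      - (\<Sum>i | i \<in> J \<and> J - {i} \<noteq> {}. simplex_integral_tilde (J - {i}) (rs (J - {i}) (rs J q * X J (i # l))))"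
    proof (rule stokes[OF fJ(1,2)])
      show "(\<Sum>i\<in>J. rs J q * X J (i # l)) = 0" by (simp add: sum_distrib_left[symmetric] t)
    qed (use lJ[OF J] in \<open>auto intro!: P_tilde_mult pull_poly_P_tilde alt_tan_P[OF aX]\<close>)
    moreover have "rs (J - {i}) (rs J q * X J (i # l)) = rs (J - {i}) q * rs (J - {i}) (X J (i # l))" if "i \<in> J" for i
    proof -
      have "(J - {i}) \<inter> J = J - {i}" by auto
      then show ?thesis by (simp add: pull_poly_mult rs_rs)
    qed
    moreover have "(\<Sum>i\<in>J. pd i (rs J q * X J (i # l))) =
        (\<Sum>i\<in>J. rs J (pd i q) * X J (i # l)) + rs J q * (\<Sum>i\<in>J. pd i (X J (i # l)))"
      by (simp add: pd_mult pd_rs sum.distrib sum_distrib_left)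
    ultimately have "(\<Sum>i\<in>J. simplex_integral_tilde J (rs J (pd i q) * X J (i # l))) +
        simplex_integral_tilde J (rs J q * (\<Sum>i\<in>J. pd i (X J (i # l)))) = - (\<Sum>i | i \<in> J \<and> J - {i} \<noteq> {}. ?b J i)"
      by (simp add: linear_add[OF linear_integral] linear_sum[OF linear_integral])
    moreover have "a = - c - b" if "a + c = - b" for a b c :: 'k
      using arg_cong[OF that, of "\<lambda>x. x - c"] by simp
    ultimately show ?thesis by blast
  qed
  have "(\<Sum>i\<in>I. Ev I X (pd i q) (i # l)) =
      (\<Sum>J\<in>?F. \<Sum>i\<in>J. simplex_integral_tilde J (rs J (pd i q) * X J (i # l)))"
  proof -
    have "(\<Sum>i\<in>I. Ev I X (pd i q) (i # l)) =
        (\<Sum>i\<in>I. \<Sum>J\<in>?F. if i \<in> J then simplex_integral_tilde J (rs J (pd i q) * X J (i # l)) else 0)"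
      unfolding Ev_def by (intro sum.cong refl sum.mono_neutral_cong_left finF) auto
    also have "\<dots> = (\<Sum>J\<in>?F. \<Sum>i\<in>I. if i \<in> J then simplex_integral_tilde J (rs J (pd i q) * X J (i # l)) else 0)"
      by (rule sum.swap)
    also have "\<dots> = (\<Sum>J\<in>?F. \<Sum>i\<in>J. simplex_integral_tilde J (rs J (pd i q) * X J (i # l)))"
      by (intro sum.cong refl sum.mono_neutral_cong_right I) (auto dest: facesD[OF _ I])
    finally show ?thesis .
  qed
  also have "\<dots> = - (\<Sum>J\<in>?F. simplex_integral_tilde J (rs J q * (\<Sum>i\<in>J. pd i (X J (i # l))))) -
      (\<Sum>J\<in>?F. \<Sum>i | i \<in> J \<and> J - {i} \<noteq> {}. ?b J i)"
    by (simp add: per sum_subtractf sum_negf)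
  also have "(\<Sum>J\<in>?F. \<Sum>i | i \<in> J \<and> J - {i} \<noteq> {}. ?b J i) =
      (\<Sum>J\<in>?F. \<Sum>i\<in>I - J. simplex_integral_tilde J (rs J q * rs J (X (insert i J) (i # l))))"
  proof -
    have fin: "finite {i. i \<in> J \<and> J - {i} \<noteq> {}}" if "J \<in> ?F" for J using facesD[OF _ I] that by auto
    have "(\<Sum>J\<in>?F. \<Sum>i | i \<in> J \<and> J - {i} \<noteq> {}. ?b J i) = (\<Sum>(J, i)\<in>Sigma ?F (\<lambda>J. {i. i \<in> J \<and> J - {i} \<noteq> {}}). ?b J i)"
      by (rule sum.Sigma) (use finF fin in auto)
    \<comment> \<open>If \<open>i\<close> occurs in \<open>l\<close>, the facet
      \<open>J - {i}\<close> does not contain all letters of \<open>l\<close> and has no counterpart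
      in \<open>?F\<close>; the repeated letter makes such a term zero.\<close>
    also have "\<dots> = (\<Sum>(J, i)\<in>{(J, i). J \<in> ?F \<and> i \<in> J \<and> J - {i} \<noteq> {} \<and> i \<notin> set l}. ?b J i)"
    proof (rule sum.mono_neutral_right)
      show "finite (Sigma ?F (\<lambda>J. {i. i \<in> J \<and> J - {i} \<noteq> {}}))" using finF fin by auto
      show "\<forall>x\<in>Sigma ?F (\<lambda>J. {i. i \<in> J \<and> J - {i} \<noteq> {}}) - {(J, i). J \<in> ?F \<and> i \<in> J \<and> J - {i} \<noteq> {} \<and> i \<notin> set l}.
          (case x of (J, i) \<Rightarrow> ?b J i) = 0"
      proof
        fix x assume x: "x \<in> Sigma ?F (\<lambda>J. {i. i \<in> J \<and> J - {i} \<noteq> {}}) - {(J, i). J \<in> ?F \<and> i \<in> J \<and> J - {i} \<noteq> {} \<and> i \<notin> set l}"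
        obtain J i where xi: "x = (J, i)" by (cases x)
        then have "J \<in> ?F" "i \<in> J" "i \<in> set l" using x by auto
        then have "alt_tan (Suc m) J (X J)" "i # l \<in> words (Suc m) J" "i \<in> set l"
          using X lJ[of J] by (auto simp: alt_fam_def)
        then have "X J (i # l) = 0" by (rule alt_tan_repeat)
        then show "(case x of (J, i) \<Rightarrow> ?b J i) = 0"
          by (simp add: xi pull_poly_linear linear_0[OF linear_integral])
      qed
    qed auto
    \<comment> \<open>The facet becomes the summation index, and the larger face is recovered by
      inserting \<open>i\<close>.\<close>
    also have "\<dots> = (\<Sum>(J, i)\<in>Sigma ?F (\<lambda>J. I - J). simplex_integral_tilde J (rs J q * rs J (X (insert i J) (i # l))))"
    proof (rule sum.reindex_bij_witness[where j = "\<lambda>(J, i). (J - {i}, i)" and i = "\<lambda>(J, i). (insert i J, i)"], goal_cases)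
      case (2 a) then show ?case by (auto simp: faces_def)
    next
      case (4 a) then show ?case by (auto simp: faces_def)
    qed (auto simp: insert_absorb)
    also have "\<dots> = (\<Sum>J\<in>?F. \<Sum>i\<in>I - J. simplex_integral_tilde J (rs J q * rs J (X (insert i J) (i # l))))"
      by (rule sum.Sigma[symmetric]) (use finF I in auto)
    finally show ?thesis .
  qed
  finally have e: "(\<Sum>i\<in>I. Ev I X (pd i q) (i # l)) =
     - (\<Sum>J\<in>?F. simplex_integral_tilde J (rs J q * (\<Sum>i\<in>J. pd i (X J (i # l))))) -
      (\<Sum>J\<in>?F. \<Sum>i\<in>I - J. simplex_integral_tilde J (rs J q * rs J (X (insert i J) (i # l))))" .
  have "Ev I (Dv I m X) q l = (-1) ^ m * ((\<Sum>J\<in>?F. simplex_integral_tilde J (rs J q * (\<Sum>i\<in>J. pd i (X J (i # l))))) +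
      (\<Sum>J\<in>?F. \<Sum>i\<in>I - J. simplex_integral_tilde J (rs J q * rs J (X (insert i J) (i # l)))))"
  proof -
    have "simplex_integral_tilde J (rs J q * Dv I m X J l) =
        (-1) ^ m * (simplex_integral_tilde J (rs J q * (\<Sum>i\<in>J. pd i (X J (i # l)))) +
          (\<Sum>i\<in>I - J. simplex_integral_tilde J (rs J q * rs J (X (insert i J) (i # l)))))" for J
      by (simp only: Dv_def scale_mult_right linear_scale[OF linear_integral] distrib_left[of "rs J q"]
          linear_add[OF linear_integral] sum_distrib_left[of "rs J q" _ "I - J"] linear_sum[OF linear_integral])
    then show ?thesis by (simp only: Ev_def sum_distrib_left[symmetric] sum.distrib)
  qed
  moreover have "(-1) ^ m * (a + b) = (-1) ^ (m + 1) * (- a - b)" for a b :: 'k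
    by (simp add: algebra_simps)
  ultimately show ?thesis unfolding e by metis
qed

lemma alt_fam_Dv:
  fixes X :: "('a, 'k::field_char_0) family"
  assumes I: "finite I" and X: "alt_fam I (Suc m) X"
  shows "alt_fam I m (Dv I m X)"
  unfolding alt_fam_def
proof
  fix J assume J: "J \<in> faces I"
  have "alt_tan m J (\<lambda>l. rs J (X (insert i J) (i # l)))" if "i \<in> I - J" for i
    by (rule alt_tan_face) (use X J that facesD[OF J I] in \<open>auto simp: alt_fam_def faces_def\<close>)
  moreover have "alt_tan (Suc m) J (X J)" using X J by (simp add: alt_fam_def)
  ultimately show "alt_tan m J (Dv I m X J)"
    unfolding Dv_def by (intro alt_tan_scale alt_tan_add alt_tan_div alt_tan_sum_family)
qed

text \<open>Boundaries are cycles: applying \<open>Ev_Dv\<close> once more gives a double sum in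
  which the second derivatives of \<open>q\<close> are symmetric in \<open>i\<close>,
  \<open>j\<close> while \<open>X\<close> is antisymmetric in these letters. The sum equals its own
  negative.\<close>

lemma Ev_Dv_Dv:
  fixes X :: "('a, 'k::field_char_0) family"
  assumes I: "finite I" and X: "alt_fam I (Suc (Suc m)) X" and l: "l \<in> words m I"
  shows "(\<Sum>i\<in>I. Ev I (Dv I (Suc m) X) (pd i q) (i # l)) = 0"
proof -
  let ?e = "\<lambda>i j. Ev I X (pd j (pd i q)) (j # i # l)"
  have alt: "?e i j = - ?e j i" if "i \<in> I" "j \<in> I" for i j
  proof -
    have e: "simplex_integral_tilde J (rs J r * X J (j # i # l)) = - simplex_integral_tilde J (rs J r * X J (i # j # l))"
      if "J \<in> faces I" "set (i # j # l) \<subseteq> J" for J r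
    proof -
      have "X J (j # i # l) = - X J (i # j # l)"
        using alt_tan_swap[of "Suc (Suc m)" J "X J" "[]" j i l] X l that by (auto simp: alt_fam_def words_def)
      then show ?thesis by (simp add: linear_uminus[OF linear_integral])
    qed
    show ?thesis unfolding Ev_def pd_commute[of j i q] sum_negf[symmetric]
      by (rule sum.cong) (auto simp: e)
  qed
  have "(\<Sum>i\<in>I. \<Sum>j\<in>I. ?e i j) = (\<Sum>i\<in>I. \<Sum>j\<in>I. - ?e j i)" by (intro sum.cong refl alt)
  also have "\<dots> = - (\<Sum>i\<in>I. \<Sum>j\<in>I. ?e j i)" by (simp only: sum_negf)
  also have "(\<Sum>i\<in>I. \<Sum>j\<in>I. ?e j i) = (\<Sum>i\<in>I. \<Sum>j\<in>I. ?e i j)" by (rule sum.swap)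
  finally have z: "(\<Sum>i\<in>I. \<Sum>j\<in>I. ?e i j) = 0" by simp
  have s: "Ev I (Dv I (Suc m) X) (pd i q) (i # l) = (-1) ^ (Suc m + 1) * (\<Sum>j\<in>I. ?e i j)" if "i \<in> I" for i
    by (rule Ev_Dv[OF I X]) (use that l in simp)
  have "(\<Sum>i\<in>I. Ev I (Dv I (Suc m) X) (pd i q) (i # l)) = (\<Sum>i\<in>I. (-1) ^ (Suc m + 1) * (\<Sum>j\<in>I. ?e i j))"
    by (rule sum.cong[OF refl s])
  then show ?thesis by (simp only: sum_distrib_left[symmetric] z mult_zero_right)
qed


subsection \<open>Exterior product with a tangent vector\<close>

text \<open>The exterior product of the constant vector \<open>v\<close> with \<open>Z\<close>,
  expanded along the first letter: either \<open>v\<close> is paired with it or \<open>Z\<close> is.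
  The nested differences produce the alternating signs.\<close>

fun wedge :: "('a \<Rightarrow> 'k) \<Rightarrow> ('a list \<Rightarrow> ('a, 'k::field) mpoly) \<Rightarrow> 'a list \<Rightarrow> ('a, 'k) mpoly" where
  "wedge v Z [] = 0"
| "wedge v Z (i # l) = scale (v i) (Z l) - wedge v (\<lambda>l'. Z (i # l')) l"

lemma wedge_cong:
  assumes "\<And>l'. length l' + 1 = length l \<Longrightarrow> set l' \<subseteq> set l \<Longrightarrow> Z l' = Z' l'"
  shows "wedge v Z l = wedge v Z' l"
  using assms
proof (induction l arbitrary: Z Z')
  case (Cons i l)
  have "Z l = Z' l" by (rule Cons.prems) auto
  moreover have "wedge v (\<lambda>l'. Z (i # l')) l = wedge v (\<lambda>l'. Z' (i # l')) l"
    by (rule Cons.IH, rule Cons.prems) auto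
  ultimately show ?case by simp
qed simp

lemma wedge_linear:
  assumes f: "Vector_Spaces.linear scale scale f"
  shows "wedge v (\<lambda>l. f (Z l)) l = f (wedge v Z l)"
  by (induction l arbitrary: Z) (simp_all add: linear_0[OF f] linear_diff[OF f] linear_scale[OF f])

lemma wedge_sum: "wedge v (\<lambda>l'. \<Sum>i\<in>A. Z i l') l = (\<Sum>i\<in>A. wedge v (Z i) l)"
  by (induction l arbitrary: Z) (simp_all add: free.scale_sum_right sum_subtractf)

lemma wedge_zero: "wedge v (\<lambda>l. 0) l = 0"
  by (induction l) simp_all

lemma wedge_uminus: "wedge v (\<lambda>l. - Z l) l = - wedge v Z l"
  by (induction l arbitrary: Z) simp_all

text \<open>Induction on the degree with \<open>Z\<close> varying. Behind the first letter the
  conditions are the induction hypothesis for \<open>Z\<close> contracted with that letter; at the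
  first letter they follow from the conditions on \<open>Z\<close> and from the tangency of
  \<open>v\<close>.\<close>

lemma alt_tan_wedge:
  assumes "alt_tan m J Z" "(\<Sum>j\<in>J. v j) = 0"
  shows "alt_tan (Suc m) J (wedge v Z)"
  using assms(1)
proof (induction m arbitrary: Z)
  case 0
  show ?case
  proof (rule alt_tanI)
    fix l assume "l \<in> words (Suc 0) J"
    then obtain i where "l = [i]" by (auto simp: words_def length_Suc_conv)
    moreover have "Z [] \<in> P_tilde J" using 0 by (rule alt_tan_P) (simp add: words_def)
    ultimately show "wedge v Z l \<in> P_tilde J" by (simp add: P_tilde_closed)
  next
    fix xs ys :: "'a list" assume "length xs + length ys + 1 = Suc 0"
    then show "(\<Sum>j\<in>J. wedge v Z (xs @ j # ys)) = 0"
      by (simp add: free.scale_sum_left[symmetric] assms(2))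
  qed (auto simp: words_def)
next
  case (Suc n)
  have IH: "alt_tan (Suc n) J (wedge v (\<lambda>l. Z (i # l)))" if "i \<in> J" for i
    by (rule Suc.IH[OF alt_tan_Cons[OF Suc.prems that]])
  show ?case
  proof (rule alt_tanI)
    fix l assume l: "l \<in> words (Suc (Suc n)) J"
    then obtain i l' where l': "l = i # l'" by (auto simp: words_def length_Suc_conv)
    then have "Z l' \<in> P_tilde J" "wedge v (\<lambda>l. Z (i # l)) l' \<in> P_tilde J"
      using l alt_tan_P[OF Suc.prems] alt_tan_P[OF IH] by auto
    then show "wedge v Z l \<in> P_tilde J" by (simp add: l' P_tilde_closed)
  next
    fix xs a b ys assume w: "xs @ a # b # ys \<in> words (Suc (Suc n)) J"
    show "wedge v Z (xs @ a # b # ys) = - wedge v Z (xs @ b # a # ys)"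
    proof (cases xs)
      case Nil
      have "wedge v (\<lambda>l. Z (a # b # l)) ys = wedge v (\<lambda>l. - Z (b # a # l)) ys"
      proof (rule wedge_cong)
        fix l' assume "length l' + 1 = length ys" "set l' \<subseteq> set ys"
        then have "[] @ a # b # l' \<in> words (Suc n) J" using w Nil by (auto simp: words_def)
        from alt_tan_swap[OF Suc.prems this] show "Z (a # b # l') = - Z (b # a # l')" by simp
      qed
      then show ?thesis by (simp add: Nil wedge_uminus)
    next
      case (Cons c xs')
      have "xs' @ a # b # ys \<in> words (Suc n) J" "c \<in> J" using w Cons by (auto simp: words_def)
      from alt_tan_swap[OF Suc.prems this(1)] alt_tan_swap[OF IH[OF this(2)] this(1)]
      show ?thesis by (simp add: Cons)
    qed
  next
    fix xs ys assume w: "length xs + length ys + 1 = Suc (Suc n)" "set xs \<subseteq> J" "set ys \<subseteq> J"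
    show "(\<Sum>j\<in>J. wedge v Z (xs @ j # ys)) = 0"
    proof (cases xs)
      case Nil
      have "wedge v (\<lambda>l'. \<Sum>j\<in>J. Z (j # l')) ys = wedge v (\<lambda>l'. 0) ys"
      proof (rule wedge_cong)
        fix l' assume "length l' + 1 = length ys" "set l' \<subseteq> set ys"
        then show "(\<Sum>j\<in>J. Z (j # l')) = 0"
          using alt_tan_sum[OF Suc.prems, of "[]" l'] w Nil by auto
      qed
      then have "(\<Sum>j\<in>J. wedge v (\<lambda>l'. Z (j # l')) ys) = 0" by (simp only: wedge_sum wedge_zero)
      then show ?thesis by (simp add: Nil sum_subtractf free.scale_sum_left[symmetric] assms(2))
    next
      case (Cons c xs')
      have "length xs' + length ys + 1 = Suc n" "set xs' \<subseteq> J" "c \<in> J" using w Cons by auto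
      then show ?thesis
        using alt_tan_sum[OF Suc.prems, of xs' ys] alt_tan_sum[OF IH[of c], of xs' ys] w
        by (simp add: Cons sum_subtractf free.scale_sum_right[symmetric])
    qed
  qed
qed

text \<open>No derivative of \<open>v\<close> appears because its coefficients are constant. If
  \<open>Z\<close> is divergence free, its product with \<open>v\<close> is thus a primitive of the
  derivative of \<open>Z\<close> along \<open>v\<close>.\<close>

lemma div_wedge:
  "(\<Sum>i\<in>J. pd i (wedge v Z (i # l))) =
    (\<Sum>i\<in>J. scale (v i) (pd i (Z l))) - wedge v (\<lambda>l'. \<Sum>i\<in>J. pd i (Z (i # l'))) l"
  by (simp add: pd_simps sum_subtractf wedge_sum wedge_linear[OF linear_pd])


section \<open>Contraction onto a vertex\<close>

text \<open>The facet \<open>J\<close> of \<open>K = J \<union> {w}\<close> is collapsed along \<open>v = e\<^sub>w - e\<^sub>a\<close>: after elimination of \<open>t\<^sub>a\<close>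
  the field \<open>v\<close> is \<open>\<partial>/\<partial>t\<^sub>w\<close>, so that fields on \<open>J\<close> extend to \<open>K\<close> as constant along \<open>v\<close>, and fields
  on \<open>K\<close> can be integrated along \<open>v\<close> starting from \<open>t\<^sub>w = 0\<close>.\<close>

lemma fill:
  fixes A B :: "'a list \<Rightarrow> ('a, 'k::field_char_0) mpoly"
  assumes fin: "finite J" and w: "w \<notin> J" and a: "a \<in> J" and K: "K = insert w J"
    and A: "alt_tan m K A" "\<And>l. l \<in> words m K \<Longrightarrow> A l \<in> P_tilde (K - {a})"
    and B: "alt_tan m J B" "\<And>l. l \<in> words m J \<Longrightarrow> B l \<in> P_tilde (J - {a})"
    and divA: "\<And>n l. m = Suc n \<Longrightarrow> l \<in> words n K \<Longrightarrow> (\<Sum>i\<in>K. pd i (A (i # l))) = 0"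
    and divB: "\<And>n l. m = Suc n \<Longrightarrow> l \<in> words n J \<Longrightarrow> (\<Sum>i\<in>J. pd i (B (i # l))) + rs J (A (w # l)) = 0"
  obtains Y where "alt_tan (Suc m) K Y"
    and "\<And>l. l \<in> words m K \<Longrightarrow> (\<Sum>i\<in>K. pd i (Y (i # l))) = A l"
    and "\<And>l. l \<in> words m J \<Longrightarrow> rs J (Y (w # l)) = B l"
proof -
  \<comment> \<open>The primitive will be the exterior product of \<open>v\<close> and
    \<open>Z\<close>. By \<open>div_wedge\<close> this asks for a divergence free \<open>Z\<close>
    with derivative \<open>A\<close> along \<open>v\<close>, and the boundary condition asks that
    \<open>Z\<close> restrict to \<open>B\<close>. So \<open>Z\<close> is \<open>B\<close>,
    continued constantly in \<open>t_w\<close>, plus the antiderivative of \<open>A\<close> that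
    vanishes on \<open>J\<close>.\<close>
  define E where "E l = (if set l \<subseteq> J then B l else 0)" for l
  define Z where "Z l = E l + ad w (A l)" for l
  define v :: "'a \<Rightarrow> 'k" where "v j = (if j = w then 1 else if j = a then - 1 else 0)" for j
  have wa: "w \<noteq> a" using w a by auto
  have finK: "finite K" and JK: "J \<subseteq> K" and wK: "w \<in> K" using fin K by auto
  have Zalt: "alt_tan m K Z"
    unfolding Z_def E_def
    by (intro alt_tan_add alt_tan_extend B(1) JK finK alt_tan_linear[OF A(1) linear_ad] ad_P_tilde wK)
  have v0: "(\<Sum>j\<in>K. v j) = 0"
    using fin w a wa by (simp add: K v_def sum.If_cases sum.delta if_distrib)
  have Yalt: "alt_tan (Suc m) K (wedge v Z)"
    by (rule alt_tan_wedge[OF Zalt v0])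
  \<comment> \<open>Neither \<open>E\<close> nor \<open>ad w (A l)\<close> involves
    \<open>t_a\<close>, so only the derivative in \<open>t_w\<close> survives; it annihilates
    \<open>E\<close>.\<close>
  have dvZ: "(\<Sum>i\<in>K. scale (v i) (pd i (Z l))) = A l" if l: "l \<in> words m K" for l
  proof -
    have E: "E l \<in> P_tilde (J - {a})"
      using B(2)[of l] l by (auto simp: E_def words_def P_tilde_closed)
    have "Z l \<in> P_tilde (K - {a})"
      unfolding Z_def using E A(2)[OF l] wK wa P_tilde_mono[of "J - {a}" "K - {a}"] JK
      by (intro P_tilde_closed ad_P_tilde) auto
    then have za: "pd a (Z l) = 0" by (rule pd_zero) simp
    have "pd w (E l) = 0" by (rule pd_zero[OF E]) (use w in auto)
    then have zw: "pd w (Z l) = A l" by (simp add: Z_def pd_simps pd_ad)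
    have "(\<Sum>i\<in>K. scale (v i) (pd i (Z l))) = (\<Sum>i\<in>{w, a}. scale (v i) (pd i (Z l)))"
      by (rule sum.mono_neutral_right) (use finK wK a JK in \<open>auto simp: v_def\<close>)
    also have "\<dots> = A l" using wa by (simp add: v_def za zw)
    finally show ?thesis .
  qed
  \<comment> \<open>Since \<open>ad w\<close> commutes with the other derivatives,
    \<open>divA\<close> turns the divergence of the antiderivative into the value of
    \<open>A (w # l)\<close> at \<open>t_w = 0\<close>, and \<open>divB\<close> cancels it against
    the divergence of \<open>E\<close>.\<close>
  have divZ: "(\<Sum>i\<in>K. pd i (Z (i # l))) = 0" if m: "m = Suc n" and l: "l \<in> words n K" for n l
  proof -
    have Aw: "A (w # l) \<in> P_tilde K" using alt_tan_P[OF A(1)] m l wK by simp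
    have "(\<Sum>i\<in>K. pd i (A (i # l))) = pd w (A (w # l)) + (\<Sum>i\<in>J. pd i (A (i # l)))"
      using fin w by (simp add: K)
    then have dA: "(\<Sum>i\<in>J. pd i (A (i # l))) = - pd w (A (w # l))"
      using divA[OF m l] by (simp add: eq_neg_iff_add_eq_0 add.commute)
    have "(\<Sum>i\<in>J. pd i (ad w (A (i # l)))) = (\<Sum>i\<in>J. ad w (pd i (A (i # l))))"
      using w by (intro sum.cong refl pd_ad_other) auto
    also have "\<dots> = - ad w (pd w (A (w # l)))" by (simp add: ad_linear(5)[symmetric] dA ad_linear)
    finally have 1: "(\<Sum>i\<in>K. pd i (ad w (A (i # l)))) = rs (- {w}) (A (w # l))"
      using fin w by (simp add: K pd_ad ad_pd)
    have 2: "rs (- {w}) (A (w # l)) = rs J (A (w # l))"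
    proof (rule poly_mapping_eqI)
      fix \<mu>
      have "Poly_Mapping.lookup (A (w # l)) \<mu> \<noteq> 0 \<Longrightarrow> Poly_Mapping.keys \<mu> \<subseteq> - {w} \<longleftrightarrow> Poly_Mapping.keys \<mu> \<subseteq> J"
        using P_tildeD[OF Aw, of \<mu>] w by (auto simp: K)
      then show "Poly_Mapping.lookup (rs (- {w}) (A (w # l))) \<mu> = Poly_Mapping.lookup (rs J (A (w # l))) \<mu>"
        by (auto simp: lookup_rs)
    qed
    have 3: "(\<Sum>i\<in>K. pd i (E (i # l))) + rs J (A (w # l)) = 0"
    proof (cases "set l \<subseteq> J")
      case True
      then have "(\<Sum>i\<in>K. pd i (E (i # l))) = (\<Sum>i\<in>J. pd i (B (i # l)))"
        using fin w by (simp add: K E_def pd_simps cong: sum.cong)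
      then show ?thesis using divB[OF m, of l] True l by (simp add: words_def)
    next
      case False
      then have "w \<in> set l" using l by (auto simp: words_def K)
      then have "A (w # l) = 0" using alt_tan_repeat[OF A(1), of w l] m l wK by simp
      then show ?thesis using False by (simp add: E_def pd_simps pull_poly_linear)
    qed
    show ?thesis using 3 by (simp add: Z_def pd_simps sum.distrib 1 2)
  qed
  have "(\<Sum>i\<in>K. pd i (wedge v Z (i # l))) = A l" if l: "l \<in> words m K" for l
  proof -
    have "wedge v (\<lambda>l'. \<Sum>i\<in>K. pd i (Z (i # l'))) l = wedge v (\<lambda>l'. 0) l"
    proof (rule wedge_cong)
      fix l' assume "length l' + 1 = length l" "set l' \<subseteq> set l"
      then show "(\<Sum>i\<in>K. pd i (Z (i # l'))) = 0"
        using l by (intro divZ[of "length l'"]) (auto simp: words_def)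
    qed
    then show ?thesis unfolding div_wedge dvZ[OF l] by (simp add: wedge_zero)
  qed
  \<comment> \<open>As \<open>v w = 1\<close>, contraction with \<open>dt_w\<close> returns
    \<open>Z\<close> up to a term built from the components \<open>Z (w # l')\<close>, and these
    vanish on \<open>J\<close>.\<close>
  moreover have "rs J (wedge v Z (w # l)) = B l" if l: "l \<in> words m J" for l
  proof -
    have "B l \<in> P_tilde J" using alt_tan_P[OF B(1) l] .
    then have "rs J (Z l) = B l"
      using l w by (simp add: Z_def E_def words_def pull_poly_linear rs_ad rs_id)
    moreover have "rs J (wedge v (\<lambda>l'. Z (w # l')) l) = 0"
    proof -
      have "rs J (wedge v (\<lambda>l'. Z (w # l')) l) = wedge v (\<lambda>l'. rs J (Z (w # l'))) l"
        by (rule wedge_linear[OF linear_pull_poly, symmetric])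
      also have "\<dots> = wedge v (\<lambda>l'. 0) l"
        using w by (intro wedge_cong) (simp add: Z_def E_def pull_poly_linear rs_ad)
      finally show ?thesis by (simp add: wedge_zero)
    qed
    ultimately show ?thesis by (simp add: v_def pull_poly_linear)
  qed
  ultimately show thesis using that Yalt by blast
qed

text \<open>The cycle condition read on currents: the sum is the value of \<open>X\<close> on
  \<open>d(q dt_l)\<close>. In degree zero there is no condition.\<close>

definition cycle_fam :: "'a set \<Rightarrow> nat \<Rightarrow> ('a, 'k::field_char_0) family \<Rightarrow> bool" where
  "cycle_fam I m X \<longleftrightarrow> (\<forall>n. m = Suc n \<longrightarrow> (\<forall>q\<in>P_tilde I. \<forall>l\<in>words n I. (\<Sum>i\<in>I. Ev I X (pd i q) (i # l)) = 0))"

lemma Dv_zero: "Dv I m (\<lambda>J l. 0) J l = 0"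
  by (simp add: Dv_def pd_simps pull_poly_linear)

lemma Dv_add: "Dv I m (\<lambda>J l. X J l + Y J l) J l = Dv I m X J l + Dv I m Y J l"
  by (simp add: Dv_def pd_simps pull_poly_linear sum.distrib free.scale_right_distrib)

text \<open>Faces are graded by their number of vertices other than \<open>w\<close>. At level
  \<open>p + 1\<close> they come in pairs \<open>J\<close>, \<open>J \<union> {w}\<close>. After
  normalisation the cycle condition on such a pair receives nothing from higher levels and becomes
  the hypothesis of \<open>fill\<close>. The resulting field on \<open>J \<union> {w}\<close> has
  the prescribed boundary on both members of the pair, and its remaining boundary terms lie at level
  \<open>p\<close>.\<close>

lemma retract_step:
  fixes X :: "('a, 'k::field_char_0) family"
  assumes I: "finite I" and w: "w \<in> I" and X: "alt_fam I m X" and cyc: "cycle_fam I m X"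
    and supp: "\<And>J l. J \<in> faces I \<Longrightarrow> card (J - {w}) > Suc p \<Longrightarrow> l \<in> words m J \<Longrightarrow> X J l \<in> P_ideal J"
  obtains X' Y where "alt_fam I m X'" "alt_fam I (Suc m) Y"
    and "\<And>J l. J \<in> faces I \<Longrightarrow> l \<in> words m J \<Longrightarrow> X J l - X' J l \<in> P_ideal J"
    and "\<And>J l. J \<in> faces I \<Longrightarrow> card (J - {w}) > p \<Longrightarrow> l \<in> words m J \<Longrightarrow> X' J l - Dv I m Y J l = 0"
proof -
  \<comment> \<open>The choice depends only on \<open>F - {w}\<close>, so a face and its join with
    \<open>w\<close> eliminate the same variable, as \<open>fill\<close> requires.\<close>
  define a where "a F = (SOME i. i \<in> F - {w})" for F
  have aF: "a F \<in> F - {w}" if "F - {w} \<noteq> {}" for F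
    unfolding a_def by (rule someI_ex) (use that in blast)
  \<comment> \<open>Elimination needs a vertex besides \<open>w\<close>; the face \<open>{w}\<close>
    has none and is left alone.\<close>
  define X' where "X' F l = (if F = {w} then X F l else eliminate F (a F) (X F l))" for F l
  have ne: "F - {w} \<noteq> {}" if "F \<in> faces I" "F \<noteq> {w}" for F
    using that by (auto simp: faces_def)
  have alt: "alt_tan m F (X F)" if "F \<in> faces I" for F using X that by (simp add: alt_fam_def)
  have elim: "X' F l \<in> P_tilde (F - {a F})" if "F \<in> faces I" "F \<noteq> {w}" "l \<in> words m F" for F l
  proof -
    have "finite F" using facesD[OF that(1) I] by simp
    from eliminate_P_tilde[OF this alt_tan_P[OF alt[OF that(1)] that(3)]] that(2) show ?thesis by (simp add: X'_def)
  qed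
  have X'alt: "alt_fam I m X'"
    unfolding alt_fam_def
  proof
    fix F assume F: "F \<in> faces I"
    have fin: "finite F" using facesD[OF F I] by simp
    have "eliminate F (a F) p \<in> P_tilde F" if "p \<in> P_tilde F" for p :: "('a, 'k) mpoly"
      by (rule subsetD[OF P_tilde_mono eliminate_P_tilde[OF fin that]]) auto
    then have "alt_tan m F (\<lambda>l. eliminate F (a F) (X F l))"
      by (rule alt_tan_linear[OF alt[OF F] linear_eliminate])
    then show "alt_tan m F (X' F)" using alt[OF F] by (cases "F = {w}") (simp_all add: X'_def[abs_def])
  qed
  have XX': "X J l - X' J l \<in> P_ideal J" if "J \<in> faces I" "l \<in> words m J" for J l
    using eliminate_cong_ideal[OF _ _ alt_tan_P[OF alt[OF that(1)] that(2)]] facesD[OF that(1) I] aF[OF ne[OF that(1)]]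
    by (auto simp: X'_def P_ideal_closed)
  have zero: "X' J l = 0" if J: "J \<in> faces I" "card (J - {w}) > Suc p" "l \<in> words m J" for J l
  proof (rule ideal_eliminated)
    have nw: "J \<noteq> {w}" using J(2) by auto
    show "finite J" "a J \<in> J" using facesD[OF J(1) I] aF[OF ne[OF J(1) nw]] by auto
    have "X J l - (X J l - X' J l) \<in> P_ideal J" by (intro P_ideal_closed supp XX' J)
    then show "X' J l \<in> P_ideal J" by simp
    show "X' J l \<in> P_tilde (J - {a J})" by (rule elim[OF J(1) nw J(3)])
  qed
  \<comment> \<open>By the cycle condition the current of \<open>Dv I n X'\<close> is zero, and
    \<open>Ev_injective\<close> transfers this to the single faces, at first only modulo the
    ideals.\<close>
  have Dideal: "Dv I n X' J l \<in> P_ideal J" if n: "m = Suc n" and J: "J \<in> faces I" "l \<in> words n J" for n J l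
  proof (rule Ev_injective[OF I _ _ J])
    have af: "alt_fam I (Suc n) X'" using X'alt n by simp
    show "Dv I n X' J l \<in> P_tilde J" if "J \<in> faces I" "l \<in> words n J" for J l
      by (rule alt_tan_P[OF _ that(2)]) (use alt_fam_Dv[OF I af] that(1) in \<open>simp add: alt_fam_def\<close>)
    show "Ev I (Dv I n X') q l = 0" if q: "q \<in> P_tilde I" and l: "l \<in> words n I" for q l
    proof -
      have "Ev I X' (pd i q) (i # l) = Ev I X (pd i q) (i # l)" if "i \<in> I" for i
      proof (rule Ev_cong[OF I])
        fix J assume J: "J \<in> faces I" "set (i # l) \<subseteq> J"
        then have "i # l \<in> words m J" using l n by (auto simp: words_def)
        from P_ideal_closed(5)[OF XX'[OF J(1) this]] show "X' J (i # l) - X J (i # l) \<in> P_ideal J" by simp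
      qed
      then show ?thesis using Ev_Dv[OF I af l] cyc n q l by (simp add: cycle_fam_def)
    qed
  qed
  define filling where "filling F Y \<longleftrightarrow> alt_tan (Suc m) F Y \<and>
      (\<forall>l\<in>words m F. (\<Sum>i\<in>F. pd i (Y (i # l))) = X' F l) \<and>
      (\<forall>l\<in>words m (F - {w}). rs (F - {w}) (Y (w # l)) = X' (F - {w}) l)" for F Y
  have ex: "\<exists>Y. filling F Y" if F: "F \<in> faces I" and True: "w \<in> F \<and> card (F - {w}) = Suc p" for F
  proof -
    let ?J = "F - {w}"
    have finF: "finite F" "F \<subseteq> I" using facesD[OF F I] by auto
    have J0: "?J \<noteq> {}" using True by (metis card.empty nat.distinct(1))
    have J: "?J \<in> faces I" using J0 finF by (auto simp: faces_def)
    have Fw: "F \<noteq> {w}" and Jw: "?J \<noteq> {w}" using J0 by auto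
    have aJ: "a ?J = a F" by (simp add: a_def)
    have aFF: "a F \<in> ?J" using aF[OF J0] .
    \<comment> \<open>Adding a vertex other than \<open>w\<close> leads to a level where
      \<open>X'\<close> vanishes. Hence \<open>F\<close> has no boundary contributions from larger
      faces, and \<open>F - {w}\<close> has one only from \<open>F\<close>.\<close>
    have big: "X' (insert i G) l = 0" if G: "G = F \<or> G = ?J" and i: "i \<in> I - G" "i \<noteq> w" and l: "set l \<subseteq> insert i G" "length l = m" for G i l
    proof (rule zero)
      show "insert i G \<in> faces I" using G i F by (auto simp: faces_def)
      have "insert i G - {w} = insert i ?J" "i \<notin> ?J" using G i True by auto
      then show "Suc p < card (insert i G - {w})" using True finF by simp
    qed (use l in \<open>simp add: words_def\<close>)
    obtain Y where Y: "alt_tan (Suc m) F Y" "\<And>l. l \<in> words m F \<Longrightarrow> (\<Sum>i\<in>F. pd i (Y (i # l))) = X' F l"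
      "\<And>l. l \<in> words m ?J \<Longrightarrow> rs ?J (Y (w # l)) = X' ?J l"
    proof (rule fill[of ?J w "a F" F m "X' F" "X' ?J"])
      show "alt_tan m F (X' F)" "alt_tan m ?J (X' ?J)" using X'alt F J by (auto simp: alt_fam_def)
      show "X' F l \<in> P_tilde (F - {a F})" if "l \<in> words m F" for l by (rule elim[OF F Fw that])
      show "X' ?J l \<in> P_tilde (?J - {a F})" if "l \<in> words m ?J" for l using elim[OF J Jw that] by (simp add: aJ)
      show "(\<Sum>i\<in>F. pd i (X' F (i # l))) = 0" if n: "m = Suc n" and l: "l \<in> words n F" for n l
      proof (rule ideal_eliminated[OF finF(1), of "a F"])
        show "a F \<in> F" using aFF by auto
        show "(\<Sum>i\<in>F. pd i (X' F (i # l))) \<in> P_tilde (F - {a F})"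
          by (intro P_tilde_closed pd_P_tilde elim[OF F Fw]) (use l n in simp)
        have "(\<Sum>i\<in>I - F. rs F (X' (insert i F) (i # l))) = 0"
        proof (intro sum.neutral ballI)
          fix i assume "i \<in> I - F"
          then have "X' (insert i F) (i # l) = 0" using True l n by (intro big) (auto simp: words_def)
          then show "rs F (X' (insert i F) (i # l)) = 0" by (simp add: pull_poly_linear)
        qed
        then have "scale ((-1) ^ n) (\<Sum>i\<in>F. pd i (X' F (i # l))) \<in> P_ideal F"
          using Dideal[OF n F l] by (simp add: Dv_def)
        from P_ideal_closed(3)[OF this, of "(-1) ^ n"] show "(\<Sum>i\<in>F. pd i (X' F (i # l))) \<in> P_ideal F"
          by (simp add: power_mult_distrib[symmetric])
      qed
      show "(\<Sum>i\<in>?J. pd i (X' ?J (i # l))) + rs ?J (X' F (w # l)) = 0" if n: "m = Suc n" and l: "l \<in> words n ?J" for n l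
      proof (rule ideal_eliminated[of ?J "a F"])
        show "finite ?J" "a F \<in> ?J" using finF aFF by auto
        have "rs ?J (X' F (w # l)) \<in> P_tilde ((F - {a F}) \<inter> ?J)"
          by (intro rs_P_tilde elim[OF F Fw]) (use l n True in \<open>auto simp: words_def\<close>)
        moreover have "(F - {a F}) \<inter> ?J = ?J - {a F}" by auto
        moreover have "(\<Sum>i\<in>?J. pd i (X' ?J (i # l))) \<in> P_tilde (?J - {a F})"
          unfolding aJ[symmetric] by (intro P_tilde_closed pd_P_tilde elim[OF J Jw]) (use l n in simp)
        ultimately show "(\<Sum>i\<in>?J. pd i (X' ?J (i # l))) + rs ?J (X' F (w # l)) \<in> P_tilde (?J - {a F})"
          by (simp add: P_tilde_closed)
        have "(\<Sum>i\<in>I - ?J. rs ?J (X' (insert i ?J) (i # l))) = (\<Sum>i\<in>{w}. rs ?J (X' (insert i ?J) (i # l)))"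
        proof (rule sum.mono_neutral_right)
          show "\<forall>i\<in>I - ?J - {w}. rs ?J (X' (insert i ?J) (i # l)) = 0"
          proof
            fix i assume "i \<in> I - ?J - {w}"
            then have "X' (insert i ?J) (i # l) = 0" using True l n by (intro big) (auto simp: words_def)
            then show "rs ?J (X' (insert i ?J) (i # l)) = 0" by (simp add: pull_poly_linear)
          qed
        qed (use I w in auto)
        then have "(\<Sum>i\<in>I - ?J. rs ?J (X' (insert i ?J) (i # l))) = rs ?J (X' F (w # l))"
          using True by (simp add: insert_absorb)
        then have "scale ((-1) ^ n) ((\<Sum>i\<in>?J. pd i (X' ?J (i # l))) + rs ?J (X' F (w # l))) \<in> P_ideal ?J"
          using Dideal[OF n J l] by (simp add: Dv_def)
        from P_ideal_closed(3)[OF this, of "(-1) ^ n"]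
        show "(\<Sum>i\<in>?J. pd i (X' ?J (i # l))) + rs ?J (X' F (w # l)) \<in> P_ideal ?J"
          by (simp add: power_mult_distrib[symmetric])
      qed
    qed (use finF aFF True in auto)
    then show ?thesis unfolding filling_def by blast
  qed
  define Y0 where "Y0 F = (SOME Y. filling F Y)" for F
  have Y0: "alt_tan (Suc m) F (Y0 F) \<and>
      (\<forall>l\<in>words m F. (\<Sum>i\<in>F. pd i (Y0 F (i # l))) = X' F l) \<and>
      (\<forall>l\<in>words m (F - {w}). rs (F - {w}) (Y0 F (w # l)) = X' (F - {w}) l)"
    if "F \<in> faces I" "w \<in> F" "card (F - {w}) = Suc p" for F
    using someI_ex[OF ex[OF that(1)]] that unfolding Y0_def filling_def by simp
  \<comment> \<open>The sign cancels the one in \<open>Dv\<close>.\<close>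
  define Y where "Y F l = (if w \<in> F \<and> card (F - {w}) = Suc p then scale ((-1) ^ m) (Y0 F l) else 0)" for F l
  have Yalt: "alt_fam I (Suc m) Y"
    unfolding alt_fam_def
  proof
    fix F assume F: "F \<in> faces I"
    show "alt_tan (Suc m) F (Y F)"
    proof (cases "w \<in> F \<and> card (F - {w}) = Suc p")
      case True
      then have "alt_tan (Suc m) F (\<lambda>l. scale ((-1) ^ m) (Y0 F l))" using Y0[OF F] by (intro alt_tan_scale) auto
      then show ?thesis using True by (simp add: Y_def[abs_def])
    next
      case False
      then have "Y F = (\<lambda>l. 0)" by (intro ext) (simp only: Y_def if_False)
      then show ?thesis by (simp add: alt_tan_zero)
    qed
  qed
  have sgn: "scale ((-1) ^ m) (scale ((-1) ^ m) p) = p" for p :: "('a, 'k) mpoly"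
    by (simp only: free.scale_scale minus_one_mult_self free.scale_one)
  have "X' F l - Dv I m Y F l = 0" if F: "F \<in> faces I" and c: "card (F - {w}) > p" and l: "l \<in> words m F" for F l
  proof -
    have finF: "finite F" "F \<subseteq> I" using facesD[OF F I] by auto
    \<comment> \<open>Inserting \<open>i\<close> raises the level above \<open>p + 1\<close>, the
      only level on which \<open>Y\<close> lives.\<close>
    have other: "rs F (Y (insert i F) (i # l)) = 0" if i: "i \<in> I - F" "i \<noteq> w" for i
    proof -
      have "insert i F - {w} = insert i (F - {w})" "i \<notin> F - {w}" using i by auto
      then have "card (insert i F - {w}) = Suc (card (F - {w}))" using finF by simp
      then have "Y (insert i F) (i # l) = 0" using c by (simp add: Y_def)
      then show ?thesis by (simp add: pull_poly_linear)
    qed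
    show ?thesis
    proof (cases "w \<in> F")
      case wF: True
      have "(\<Sum>i\<in>I - F. rs F (Y (insert i F) (i # l))) = 0"
        by (intro sum.neutral ballI other) (use wF in auto)
      then have D: "Dv I m Y F l = scale ((-1) ^ m) (\<Sum>i\<in>F. pd i (Y F (i # l)))" by (simp add: Dv_def)
      show ?thesis
      proof (cases "card (F - {w}) = Suc p")
        case True
        have "(\<Sum>i\<in>F. pd i (Y F (i # l))) = scale ((-1) ^ m) (\<Sum>i\<in>F. pd i (Y0 F (i # l)))"
          using True wF by (simp add: Y_def pd_simps free.scale_sum_right)
        also have "\<dots> = scale ((-1) ^ m) (X' F l)" using Y0[OF F wF True] l by simp
        finally show ?thesis unfolding D by (simp only: sgn) simp
      next
        case False
        then have "(\<Sum>i\<in>F. pd i (Y F (i # l))) = 0" by (simp add: Y_def pd_simps)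
        moreover have "X' F l = 0" using c False by (intro zero F l) simp
        ultimately show ?thesis unfolding D by simp
      qed
    next
      case wF: False
      let ?K = "insert w F"
      have "(\<Sum>i\<in>I - F. rs F (Y (insert i F) (i # l))) = (\<Sum>i\<in>{w}. rs F (Y (insert i F) (i # l)))"
        by (rule sum.mono_neutral_right) (use I w wF other in auto)
      moreover have "(\<Sum>i\<in>F. pd i (Y F (i # l))) = 0" using wF by (simp add: Y_def pd_simps)
      ultimately have D: "Dv I m Y F l = scale ((-1) ^ m) (rs F (Y ?K (w # l)))" by (simp add: Dv_def)
      have KF: "?K - {w} = F" "F - {w} = F" using wF by auto
      have K: "?K \<in> faces I" using F w by (auto simp: faces_def)
      show ?thesis
      proof (cases "card F = Suc p")
        case True
        have "rs F (Y ?K (w # l)) = scale ((-1) ^ m) (rs F (Y0 ?K (w # l)))"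
          using True by (simp add: Y_def KF pull_poly_linear)
        also have "\<dots> = scale ((-1) ^ m) (X' F l)" using Y0[OF K] l True by (simp add: KF)
        finally show ?thesis unfolding D by (simp only: sgn) simp
      next
        case False
        then have "Y ?K (w # l) = 0" by (simp add: Y_def KF)
        moreover have "X' F l = 0" using c False by (intro zero F l) (simp add: KF)
        ultimately show ?thesis unfolding D by (simp add: pull_poly_linear)
      qed
    qed
  qed
  then show thesis using that[OF X'alt Yalt XX'] by blast
qed

text \<open>Induction on a bound for the level, lowered by \<open>retract_step\<close>. Every family
  satisfies the bound \<open>card I\<close>, and at the bound 0 only the face \<open>{w}\<close> is
  left. What remains after a step is again a cycle by \<open>Ev_Dv_Dv\<close>, and the primitives of
  all steps are added.\<close>

theorem retract_to_vertex:
  fixes X :: "('a, 'k::field_char_0) family"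
  assumes I: "finite I" and w: "w \<in> I" and X: "alt_fam I m X" and cyc: "cycle_fam I m X"
  obtains Y where "alt_fam I (Suc m) Y"
    and "\<And>J l. J \<in> faces I \<Longrightarrow> J \<noteq> {w} \<Longrightarrow> l \<in> words m J \<Longrightarrow> X J l - Dv I m Y J l \<in> P_ideal J"
proof -
  have "\<exists>Y. alt_fam I (Suc m) Y \<and>
      (\<forall>J\<in>faces I. J \<noteq> {w} \<longrightarrow> (\<forall>l\<in>words m J. X J l - Dv I m Y J l \<in> P_ideal J))"
    if "alt_fam I m X" "cycle_fam I m X"
      "\<And>J l. J \<in> faces I \<Longrightarrow> card (J - {w}) > p \<Longrightarrow> l \<in> words m J \<Longrightarrow> X J l \<in> P_ideal J"
    for p and X :: "('a, 'k) family"
    using that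
  proof (induction p arbitrary: X)
    case 0
    have "X J l - Dv I m (\<lambda>J l. 0) J l \<in> P_ideal J" if J: "J \<in> faces I" "J \<noteq> {w}" "l \<in> words m J" for J l
    proof -
      have "J - {w} \<noteq> {}" "finite J" using J facesD[OF J(1) I] by auto
      then have "X J l \<in> P_ideal J" using J by (intro 0(3)) (auto simp: card_gt_0_iff)
      then show ?thesis by (simp add: Dv_zero)
    qed
    moreover have "alt_fam I (Suc m) (\<lambda>J l. 0 :: ('a, 'k) mpoly)" by (simp add: alt_fam_def alt_tan_zero)
    ultimately show ?case by blast
  next
    case (Suc p)
    obtain X' Y0 where X': "alt_fam I m X'" and Y0: "alt_fam I (Suc m) Y0"
      and XX': "\<And>J l. J \<in> faces I \<Longrightarrow> l \<in> words m J \<Longrightarrow> X J l - X' J l \<in> P_ideal J"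
      and z: "\<And>J l. J \<in> faces I \<Longrightarrow> card (J - {w}) > p \<Longrightarrow> l \<in> words m J \<Longrightarrow> X' J l - Dv I m Y0 J l = 0"
      using retract_step[OF I w Suc.prems] by blast
    define X1 where "X1 J l = X' J l - Dv I m Y0 J l" for J l
    have X1: "alt_fam I m X1"
      unfolding alt_fam_def X1_def[abs_def]
      by (intro ballI alt_tan_diff) (use X' alt_fam_Dv[OF I Y0] in \<open>simp_all add: alt_fam_def\<close>)
    have cyc1: "cycle_fam I m X1"
      unfolding cycle_fam_def
    proof (intro allI impI ballI)
      fix n l and q :: "('a, 'k) mpoly" assume m: "m = Suc n" and q: "q \<in> P_tilde I" and l: "l \<in> words n I"
      have "Ev I X' (pd i q) (i # l) = Ev I X (pd i q) (i # l)" if "i \<in> I" for i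
      proof (rule Ev_cong[OF I])
        fix J assume J: "J \<in> faces I" "set (i # l) \<subseteq> J"
        then have "i # l \<in> words m J" using l m by (auto simp: words_def)
        from P_ideal_closed(5)[OF XX'[OF J(1) this]] show "X' J (i # l) - X J (i # l) \<in> P_ideal J" by simp
      qed
      then have "(\<Sum>i\<in>I. Ev I X' (pd i q) (i # l)) = 0"
        using Suc.prems(2) m q l by (simp add: cycle_fam_def)
      moreover have "(\<Sum>i\<in>I. Ev I (Dv I m Y0) (pd i q) (i # l)) = 0"
        using Ev_Dv_Dv[OF I _ l, of Y0 q] Y0 m by simp
      ultimately show "(\<Sum>i\<in>I. Ev I X1 (pd i q) (i # l)) = 0"
        by (simp add: X1_def[abs_def] Ev_linear_family sum_subtractf)
    qed
    have supp1: "X1 J l \<in> P_ideal J" if "J \<in> faces I" "card (J - {w}) > p" "l \<in> words m J" for J l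
      using z[OF that] by (simp add: X1_def P_ideal_closed)
    obtain Y1 where Y1: "alt_fam I (Suc m) Y1"
      and d: "\<And>J l. J \<in> faces I \<Longrightarrow> J \<noteq> {w} \<Longrightarrow> l \<in> words m J \<Longrightarrow> X1 J l - Dv I m Y1 J l \<in> P_ideal J"
      using Suc.IH[OF X1 cyc1 supp1] by blast
    have "alt_fam I (Suc m) (\<lambda>J l. Y0 J l + Y1 J l)"
      using Y0 Y1 by (auto simp: alt_fam_def intro: alt_tan_add)
    moreover have "X J l - Dv I m (\<lambda>J l. Y0 J l + Y1 J l) J l \<in> P_ideal J"
      if J: "J \<in> faces I" "J \<noteq> {w}" "l \<in> words m J" for J l
    proof -
      have "(X J l - X' J l) + (X1 J l - Dv I m Y1 J l) \<in> P_ideal J"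
        by (intro P_ideal_closed XX' d J)
      then show ?thesis by (simp add: Dv_add X1_def algebra_simps)
    qed
    ultimately show ?case by blast
  qed
  note ex = this
  have big: "\<not> card (J - {w}) > card I" if "J \<in> faces I" for J
  proof -
    have "card (J - {w}) \<le> card I" using facesD[OF that] I by (intro card_mono) auto
    then show ?thesis by simp
  qed
  have "\<exists>Y. alt_fam I (Suc m) Y \<and>
      (\<forall>J\<in>faces I. J \<noteq> {w} \<longrightarrow> (\<forall>l\<in>words m J. X J l - Dv I m Y J l \<in> P_ideal J))"
    by (rule ex[where p = "card I", OF X cyc]) (simp add: big)
  then obtain Y where Y: "alt_fam I (Suc m) Y"
    "\<forall>J\<in>faces I. J \<noteq> {w} \<longrightarrow> (\<forall>l\<in>words m J. X J l - Dv I m Y J l \<in> P_ideal J)" by (elim exE conjE)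
  show thesis by (rule that[OF Y(1)]) (simp add: Y(2))
qed


section \<open>Tensors and exterior powers on representatives\<close>

lemma tens_add_left: "(x + y) \<otimes>\<^sub>t z = x \<otimes>\<^sub>t z + y \<otimes>\<^sub>t z"
  and tens_add_right: "z \<otimes>\<^sub>t (u + v) = z \<otimes>\<^sub>t u + z \<otimes>\<^sub>t v"
  and tens_scale_left: "scale c x \<otimes>\<^sub>t z = scale c (x \<otimes>\<^sub>t z)"
  and tens_scale_right: "z \<otimes>\<^sub>t scale c u = scale c (z \<otimes>\<^sub>t u)"
  by (rule poly_mapping_eqI; simp add: lookup_add algebra_simps split_paired_all)+

lemma linear_tens_left: "Vector_Spaces.linear scale scale (\<lambda>x. x \<otimes>\<^sub>t z)"
  by (rule free_linearI) (simp_all add: tens_add_left tens_scale_left)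

lemma linear_tens_right: "Vector_Spaces.linear scale scale (\<lambda>x. z \<otimes>\<^sub>t x)"
  by (rule free_linearI) (simp_all add: tens_add_right tens_scale_right)

lemma tens_basis: "basis a \<otimes>\<^sub>t basis b = basis (a, b)"
  by (rule poly_mapping_eqI) (auto simp: split_paired_all lookup_single when_def)

lemma lookup_lin_ext: "Poly_Mapping.lookup (lin_ext f x) b = (\<Sum>a\<in>Poly_Mapping.keys x. Poly_Mapping.lookup x a * Poly_Mapping.lookup (f a) b)"
  by (simp add: lin_ext_def lookup_sum)

lemma lookup_cons_ext:
  "Poly_Mapping.lookup (lin_ext (\<lambda>(a, l). basis (a # l)) z) [] = 0"
  "Poly_Mapping.lookup (lin_ext (\<lambda>(a, l). basis (a # l)) z) (a # l) = Poly_Mapping.lookup z (a, l)"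
proof -
  show "Poly_Mapping.lookup (lin_ext (\<lambda>(a, l). basis (a # l)) z) [] = 0"
    unfolding lookup_lin_ext by (intro sum.neutral) (auto simp: lookup_single)
  have "Poly_Mapping.lookup (lin_ext (\<lambda>(a, l). basis (a # l)) z) (a # l) =
      (\<Sum>x\<in>Poly_Mapping.keys z. if x = (a, l) then Poly_Mapping.lookup z x else 0)"
    unfolding lookup_lin_ext by (intro sum.cong refl) (auto simp: lookup_single when_def split: if_splits)
  then show "Poly_Mapping.lookup (lin_ext (\<lambda>(a, l). basis (a # l)) z) (a # l) = Poly_Mapping.lookup z (a, l)"
    by (auto simp: in_keys_iff split: if_splits)
qed

lemma lookup_word_tensor_Cons:
  "Poly_Mapping.lookup (word_tensor (v # vs)) [] = 0"
  "Poly_Mapping.lookup (word_tensor (v # vs)) (a # l) = Poly_Mapping.lookup v a * Poly_Mapping.lookup (word_tensor vs) l"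
  by (simp_all add: lookup_cons_ext)

lemma lookup_word_tensor:
  "Poly_Mapping.lookup (word_tensor vs) l =
    (if length l = length vs then \<Prod>i<length vs. Poly_Mapping.lookup (vs ! i) (l ! i) else 0)"
proof (induction vs arbitrary: l)
  case Nil
  then show ?case by (simp add: lookup_single when_def)
next
  case (Cons v vs)
  show ?case
  proof (cases l)
    case Nil
    then show ?thesis by (simp add: lookup_word_tensor_Cons del: word_tensor.simps)
  next
    case l: (Cons a l')
    have "(\<Prod>i<Suc (length vs). Poly_Mapping.lookup ((v # vs) ! i) ((a # l') ! i)) =
        Poly_Mapping.lookup v a * (\<Prod>i<length vs. Poly_Mapping.lookup (vs ! i) (l' ! i))"
      by (subst prod.lessThan_Suc_shift) simp
    then show ?thesis by (simp add: l lookup_word_tensor_Cons Cons.IH del: word_tensor.simps)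
  qed
qed

lemma word_tensor_basis: "word_tensor (map basis l) = basis l"
proof (induction l)
  case (Cons a l)
  show ?case by (simp only: list.map word_tensor.simps Cons tens_basis lin_ext_basis prod.case)
qed simp

lemma keys_word_tensor: "l \<in> Poly_Mapping.keys (word_tensor vs) \<Longrightarrow> (\<And>v. v \<in> set vs \<Longrightarrow> Poly_Mapping.keys v \<subseteq> J) \<Longrightarrow> set l \<subseteq> J"
proof
  fix a assume l: "l \<in> Poly_Mapping.keys (word_tensor vs)" and v: "\<And>v. v \<in> set vs \<Longrightarrow> Poly_Mapping.keys v \<subseteq> J"
    and a: "a \<in> set l"
  have len: "length l = length vs" by (rule word_tensor_length[OF l])
  obtain i where i: "i < length l" "a = l ! i" using a by (auto simp: in_set_conv_nth)
  have "(\<Prod>i<length vs. Poly_Mapping.lookup (vs ! i) (l ! i)) \<noteq> 0"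
    using l len by (simp add: in_keys_iff lookup_word_tensor)
  then have "Poly_Mapping.lookup (vs ! i) a \<noteq> 0" using i len by simp
  then show "a \<in> J" using v[of "vs ! i"] i len by (auto simp: in_keys_iff)
qed

lemma linear_word_tensor: "Vector_Spaces.linear scale scale (\<lambda>v. word_tensor (xs @ v # ys))"
proof (induction xs)
  case Nil
  have "Vector_Spaces.linear scale scale (\<lambda>v. lin_ext (\<lambda>(a, l). basis (a # l)) (v \<otimes>\<^sub>t word_tensor ys))"
    by (rule linear_comp[OF linear_tens_left linear_lin_ext])
  then show ?case by simp
next
  case (Cons x xs)
  have "Vector_Spaces.linear scale scale (\<lambda>v. lin_ext (\<lambda>(a, l). basis (a # l)) (x \<otimes>\<^sub>t word_tensor (xs @ v # ys)))"
    by (rule linear_comp[OF linear_comp[OF Cons linear_tens_right] linear_lin_ext])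
  then show ?case by simp
qed

text \<open>Tensor powers of a linear map: prescribed on letters, the map acts on every factor of a
  decomposable tensor. This carries \<open>pull_form\<close> and \<open>push_form\<close>, which are
  defined on words, to arbitrary decomposable elements.\<close>

lemma lin_ext_word_tensor:
  "lin_ext (\<lambda>l. word_tensor (map g l)) (word_tensor vs) = word_tensor (map (lin_ext g) vs)"
proof (induction vs)
  case (Cons v vs)
  let ?c = "lin_ext (\<lambda>(a, l). basis (a # l))"
  have "lin_ext (\<lambda>l. word_tensor (map g l)) (word_tensor (v # vs)) =
      lin_ext (\<lambda>a. lin_ext (\<lambda>l. ?c (g a \<otimes>\<^sub>t word_tensor (map g l))) (word_tensor vs)) v"
    by (simp add: lin_ext_lin_ext case_prod_unfold lin_ext_tens')
  also have "(\<lambda>a. lin_ext (\<lambda>l. ?c (g a \<otimes>\<^sub>t word_tensor (map g l))) (word_tensor vs)) =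
      (\<lambda>a. ?c (g a \<otimes>\<^sub>t word_tensor (map (lin_ext g) vs)))"
  proof
    fix a
    show "lin_ext (\<lambda>l. ?c (g a \<otimes>\<^sub>t word_tensor (map g l))) (word_tensor vs) =
        ?c (g a \<otimes>\<^sub>t word_tensor (map (lin_ext g) vs))"
      unfolding Cons[symmetric]
      by (rule linear_eq_on_basis[where x = "word_tensor vs", OF linear_lin_ext
            linear_comp[OF linear_lin_ext linear_comp[OF linear_tens_right linear_lin_ext]]]) simp
  qed
  also have "lin_ext (\<lambda>a. ?c (g a \<otimes>\<^sub>t word_tensor (map (lin_ext g) vs))) v =
      ?c (lin_ext g v \<otimes>\<^sub>t word_tensor (map (lin_ext g) vs))"
    by (rule linear_eq_on_basis[where x = v, OF linear_lin_ext
          linear_comp[OF linear_lin_ext linear_comp[OF linear_tens_left linear_lin_ext]]]) simp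
  finally show ?case by simp
qed simp

lemma lin_ext_tens_product:
  "lin_ext (\<lambda>(a, b). f a \<otimes>\<^sub>t g b) (x \<otimes>\<^sub>t y) = lin_ext f x \<otimes>\<^sub>t lin_ext g y"
proof -
  have "lin_ext (\<lambda>b. f a \<otimes>\<^sub>t g b) y = f a \<otimes>\<^sub>t lin_ext g y" for a
    by (rule linear_eq_on_basis[where x = y, OF linear_lin_ext linear_comp[OF linear_lin_ext linear_tens_right]]) simp
  then have "lin_ext (\<lambda>(a, b). f a \<otimes>\<^sub>t g b) (x \<otimes>\<^sub>t y) = lin_ext (\<lambda>a. f a \<otimes>\<^sub>t lin_ext g y) x"
    by (simp add: lin_ext_tens')
  also have "\<dots> = lin_ext f x \<otimes>\<^sub>t lin_ext g y"
    by (rule linear_eq_on_basis[where x = x, OF linear_lin_ext linear_comp[OF linear_lin_ext linear_tens_left]]) simp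
  finally show ?thesis .
qed

text \<open>Generators of the numerator or, with \<open>P\<close> an ideal, of the first kind of
  relations; \<open>degenerates\<close> supplies the second kind. Linear maps between the
  subquotients are checked on these two lists.\<close>

definition decomposables :: "nat \<Rightarrow> ('a \<Rightarrow>\<^sub>0 'k) set \<Rightarrow> ('b \<Rightarrow>\<^sub>0 'k::field) set \<Rightarrow> (('b \<times> 'a list) \<Rightarrow>\<^sub>0 'k) set" where
  "decomposables m V P = {p \<otimes>\<^sub>t word_tensor vs | p vs. p \<in> P \<and> length vs = m \<and> set vs \<subseteq> V}"

definition degenerates :: "nat \<Rightarrow> ('a \<Rightarrow>\<^sub>0 'k) set \<Rightarrow> ('a \<Rightarrow>\<^sub>0 'k) set \<Rightarrow> ('b \<Rightarrow>\<^sub>0 'k::field) set \<Rightarrow> (('b \<times> 'a list) \<Rightarrow>\<^sub>0 'k) set" where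
  "degenerates m V R P = {p \<otimes>\<^sub>t word_tensor vs | p vs. p \<in> P \<and> length vs = m \<and> set vs \<subseteq> V \<and>
     (\<not> distinct vs \<or> set vs \<inter> R \<noteq> {})}"

lemma tens_span_right: "y \<in> free.span B \<Longrightarrow> (\<And>b. b \<in> B \<Longrightarrow> p \<otimes>\<^sub>t b \<in> free.span G) \<Longrightarrow> p \<otimes>\<^sub>t y \<in> free.span G"
  by (rule linear_span_into[OF linear_tens_right free.subspace_span])

lemma fst_tensor_ext: "fst (tensor_sq X (ext_power m Y)) = free.span (decomposables m (fst Y) (fst X))"
proof
  show "fst (tensor_sq X (ext_power m Y)) \<subseteq> free.span (decomposables m (fst Y) (fst X))"
    unfolding tensor_sq_def ext_power_def fst_conv
  proof (rule free.span_minimal[OF _ free.subspace_span], safe)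
    fix x y assume "x \<in> fst X" "y \<in> free.span {word_tensor vs | vs. length vs = m \<and> set vs \<subseteq> fst Y}"
    then show "x \<otimes>\<^sub>t y \<in> free.span (decomposables m (fst Y) (fst X))"
      by (intro tens_span_right[of y "{word_tensor vs | vs. length vs = m \<and> set vs \<subseteq> fst Y}"])
         (auto intro!: free.span_base simp: decomposables_def)
  qed
  show "free.span (decomposables m (fst Y) (fst X)) \<subseteq> fst (tensor_sq X (ext_power m Y))"
    unfolding tensor_sq_def ext_power_def fst_conv
  proof (rule free.span_mono, safe)
    fix z assume "z \<in> decomposables m (fst Y) (fst X)"
    then obtain p vs where z: "z = p \<otimes>\<^sub>t word_tensor vs" "p \<in> fst X" "length vs = m" "set vs \<subseteq> fst Y"
      by (auto simp: decomposables_def)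
    then have "word_tensor vs \<in> free.span {word_tensor vs | vs. length vs = m \<and> set vs \<subseteq> fst Y}"
      by (intro free.span_base) auto
    then show "\<exists>x y. z = x \<otimes>\<^sub>t y \<and> x \<in> fst X \<and> y \<in> free.span {word_tensor vs | vs. length vs = m \<and> set vs \<subseteq> fst Y}"
      using z by blast
  qed
qed

text \<open>By bilinearity a tensor with a relation in one factor is a combination of generators
  with a relation in that same factor. Every later check of well-definedness reduces to a
  coefficient in the ideal, a repeated factor, or a factor among the relations.\<close>

lemma snd_tensor_ext:
  assumes "snd X \<subseteq> fst X"
  shows "snd (tensor_sq X (ext_power m Y)) =
    free.span (decomposables m (fst Y) (snd X) \<union> degenerates m (fst Y) (snd Y) (fst X))" (is "?L = free.span ?G")
proof
  let ?B = "{word_tensor vs | vs. length vs = m \<and> set vs \<subseteq> fst Y}"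
  let ?D = "{word_tensor vs | vs. length vs = m \<and> set vs \<subseteq> fst Y \<and> (\<not> distinct vs \<or> set vs \<inter> snd Y \<noteq> {})}"
  have L: "?L = free.span {x \<otimes>\<^sub>t y | x y. x \<in> fst X \<and> y \<in> free.span ?B \<and> (x \<in> snd X \<or> y \<in> free.span ?D)}"
    by (simp add: tensor_sq_def ext_power_def)
  show "?L \<subseteq> free.span ?G"
    unfolding L
  proof (rule free.span_minimal[OF _ free.subspace_span], safe)
    fix x y assume "x \<in> snd X" "y \<in> free.span ?B"
    then show "x \<otimes>\<^sub>t y \<in> free.span ?G"
      by (intro tens_span_right[of y ?B]) (auto intro!: free.span_base simp: decomposables_def)
  next
    fix x y assume "x \<in> fst X" "y \<in> free.span ?D"
    then show "x \<otimes>\<^sub>t y \<in> free.span ?G"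
      by (intro tens_span_right[of y ?D]) (auto intro!: free.span_base simp: degenerates_def)
  qed
  show "free.span ?G \<subseteq> ?L"
    unfolding L
  proof (rule free.span_mono, safe)
    fix z assume "z \<in> decomposables m (fst Y) (snd X)"
    then obtain p vs where z: "z = p \<otimes>\<^sub>t word_tensor vs" "p \<in> snd X" "length vs = m" "set vs \<subseteq> fst Y"
      by (auto simp: decomposables_def)
    then have "word_tensor vs \<in> free.span ?B"
      by (intro free.span_base) auto
    then show "\<exists>x y. z = x \<otimes>\<^sub>t y \<and> x \<in> fst X \<and> y \<in> free.span ?B \<and> (x \<in> snd X \<or> y \<in> free.span ?D)"
      using z assms by blast
  next
    fix z assume "z \<in> degenerates m (fst Y) (snd Y) (fst X)"
    then obtain p vs where z: "z = p \<otimes>\<^sub>t word_tensor vs" "p \<in> fst X" and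
      vs: "length vs = m" "set vs \<subseteq> fst Y" "\<not> distinct vs \<or> set vs \<inter> snd Y \<noteq> {}"
      unfolding degenerates_def by blast
    have "word_tensor vs \<in> ?B" using vs(1,2) by auto
    moreover have "word_tensor vs \<in> ?D" using vs by blast
    ultimately have "word_tensor vs \<in> free.span ?B" "word_tensor vs \<in> free.span ?D"
      by (simp_all add: free.span_base del: mem_Collect_eq)
    then show "\<exists>x y. z = x \<otimes>\<^sub>t y \<and> x \<in> fst X \<and> y \<in> free.span ?B \<and> (x \<in> snd X \<or> y \<in> free.span ?D)"
      using z by blast
  qed
qed


subsection \<open>Permutations\<close>

lemma alternating_transpose:
  fixes F :: "'x list \<Rightarrow> ('y \<Rightarrow>\<^sub>0 'k::field)"
  assumes U: "free.subspace U"
    and swap: "\<And>xs a b ys. length xs + length ys + 2 = m \<Longrightarrow> set (xs @ a # b # ys) \<subseteq> A \<Longrightarrow> F (xs @ a # b # ys) + F (xs @ b # a # ys) \<in> U"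
    and l: "length xs + length us + length vs + 2 = m" "set (xs @ a # us @ b # vs) \<subseteq> A"
  shows "F (xs @ a # us @ b # vs) + F (xs @ b # us @ a # vs) \<in> U"
  using l
proof (induction us arbitrary: xs)
  case Nil
  then show ?case using swap[of xs vs a b] by simp
next
  case (Cons y us)
  have 1: "F (xs @ a # y # us @ b # vs) + F (xs @ y # a # us @ b # vs) \<in> U"
    by (rule swap) (use Cons.prems in auto)
  have 2: "F (xs @ y # a # us @ b # vs) + F (xs @ y # b # us @ a # vs) \<in> U"
    using Cons.IH[of "xs @ [y]"] Cons.prems by simp
  have 3: "F (xs @ y # b # us @ a # vs) + F (xs @ b # y # us @ a # vs) \<in> U"
    by (rule swap) (use Cons.prems in auto)
  show ?case
    using free.subspace_add[OF U free.subspace_diff[OF U 1 2] 3] by (simp add: algebra_simps)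
qed

text \<open>Permutations are products of transpositions, which \<open>alternating_transpose\<close>
  treats one at a time. The subspace \<open>U\<close> is zero in the application to alternating
  functions, and the space of relations in that to decomposable tensors.\<close>

lemma alternating_permute:
  fixes F :: "'x list \<Rightarrow> ('y \<Rightarrow>\<^sub>0 'k::field)"
  assumes U: "free.subspace U"
    and swap: "\<And>xs a b ys. length xs + length ys + 2 = m \<Longrightarrow> set (xs @ a # b # ys) \<subseteq> A \<Longrightarrow> F (xs @ a # b # ys) + F (xs @ b # a # ys) \<in> U"
    and p: "p permutes {0..<m}" and l: "length l = m" "set l \<subseteq> A"
  shows "F (map (\<lambda>i. l ! p i) [0..<m]) - scale (of_int (sign p)) (F l) \<in> U"
proof -
  \<comment> \<open>The positions \<open>a < b\<close> cut \<open>l\<close> into the shape that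
    \<open>alternating_transpose\<close> needs.\<close>
  have tr: "F (map (\<lambda>i. l ! Transposition.transpose a b i) [0..<m]) + F l \<in> U"
    if ab: "a < b" "b < m" and l: "length l = m" "set l \<subseteq> A" for a b l
  proof -
    define xs us vs where "xs = take a l" and "us = take (b - Suc a) (drop (Suc a) l)" and "vs = drop (Suc b) l"
    have "l = take a l @ l ! a # drop (Suc a) l" using ab l by (intro id_take_nth_drop) auto
    moreover have "drop (Suc a) l = us @ l ! b # vs"
      using id_take_nth_drop[of "b - Suc a" "drop (Suc a) l"] ab l by (simp add: us_def vs_def)
    ultimately have l': "l = xs @ l ! a # us @ l ! b # vs" by (simp add: xs_def)
    obtain x y where xy: "x = l ! a" "y = l ! b" by blast
    have l'': "l = xs @ x # us @ y # vs" unfolding xy by (rule l')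
    have sA: "set (xs @ x # us @ y # vs) \<subseteq> A" using l(2) unfolding l'' .
    have lx: "length xs = a" "length us = b - Suc a" using ab l by (auto simp: xs_def us_def)
    have len: "length xs + length us + length vs + 2 = m"
      using l(1) unfolding l'' by simp
    have e: "map (\<lambda>i. l ! Transposition.transpose a b i) [0..<m] = xs @ y # us @ x # vs"
    proof (rule nth_equalityI)
      show "length (map (\<lambda>i. l ! Transposition.transpose a b i) [0..<m]) = length (xs @ y # us @ x # vs)"
        using len by simp
      fix i assume "i < length (map (\<lambda>i. l ! Transposition.transpose a b i) [0..<m])"
      then have im: "i < m" by simp
      have li: "l ! i = (xs @ x # us @ y # vs) ! i" by (simp only: l'')
      consider "i = a" | "i = b" | "i \<noteq> a" "i \<noteq> b" by blast
      then show "map (\<lambda>i. l ! Transposition.transpose a b i) [0..<m] ! i = (xs @ y # us @ x # vs) ! i"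
      proof cases
        case 1 then show ?thesis using im lx by (simp add: xy nth_append)
      next
        case 2 then show ?thesis using im lx ab by (simp add: xy nth_append nth_Cons')
      next
        case 3
        then show ?thesis using im lx ab li by (auto simp: nth_append nth_Cons')
      qed
    qed
    have "F (xs @ x # us @ y # vs) + F (xs @ y # us @ x # vs) \<in> U"
      by (rule alternating_transpose[where F = F and m = m and A = A, OF U swap len sA])
    then show ?thesis unfolding e l''[symmetric] by (simp only: add.commute)
  qed
  have tr': "F (map (\<lambda>i. l ! Transposition.transpose a b i) [0..<m]) + F l \<in> U"
    if "a \<noteq> b" "a < m" "b < m" "length l = m" "set l \<subseteq> A" for a b l
    using tr[of a b l] tr[of b a l] that by (cases "a < b") (auto simp: transpose_commute)
  have "\<forall>l. length l = m \<and> set l \<subseteq> A \<longrightarrow> F (map (\<lambda>i. l ! p i) [0..<m]) - scale (of_int (sign p)) (F l) \<in> U"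
    using p finite_atLeastLessThan[of 0 m]
  proof (induction p rule: permutes_induct)
    case id
    have "map (\<lambda>i. l ! id i) [0..<length l] = l" for l :: "'x list" by (simp add: map_nth)
    then show ?case using free.subspace_0[OF U] by (auto simp: sign_id)
  next
    case (swap a b p)
    show ?case
    proof (intro allI impI)
      fix l assume l: "length l = m \<and> set l \<subseteq> A"
      let ?t = "Transposition.transpose a b"
      let ?l = "map (\<lambda>i. l ! ?t i) [0..<m]"
      have ab: "a < m" "b < m" using swap.hyps(1,2) by auto
      have tm: "?t i < m" if "i < m" for i using that ab by (simp add: transpose_def)
      have "set ?l \<subseteq> set l"
      proof
        fix x assume "x \<in> set ?l"
        then obtain i where "i < m" "x = l ! ?t i" by auto
        then show "x \<in> set l" using nth_mem[of "?t i" l] l tm[of i] by simp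
      qed
      then have sl: "length ?l = m" "set ?l \<subseteq> A" using l by auto
      have pm: "p i < m" if "i < m" for i using permutes_in_image[OF swap.hyps(4), of i] that by simp
      have e: "map (\<lambda>i. l ! (?t \<circ> p) i) [0..<m] = map (\<lambda>i. ?l ! p i) [0..<m]" using pm by simp
      have s: "sign (?t \<circ> p) = - sign p"
        using sign_compose[of ?t p] permutes_imp_permutation[OF _ swap.hyps(4)] swap.hyps(3)
        by (simp add: sign_swap_id permutation_swap_id)
      have 1: "F (map (\<lambda>i. ?l ! p i) [0..<m]) - scale (of_int (sign p)) (F ?l) \<in> U"
        using swap.IH sl by blast
      have 2: "scale (of_int (sign p)) (F ?l + F l) \<in> U"
        by (rule free.subspace_scale[OF U tr']) (use swap.hyps(3) ab l in auto)
      show "F (map (\<lambda>i. l ! (?t \<circ> p) i) [0..<m]) - scale (of_int (sign (?t \<circ> p))) (F l) \<in> U"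
        unfolding e s using free.subspace_add[OF U 1 2]
        by (simp add: free.scale_right_distrib)
    qed
  qed
  then show ?thesis using l by blast
qed

text \<open>The Leibniz formula along the positions of the word, with the permutations moved outside
  so that each can be treated by itself.\<close>

lemma sum_det_words:
  fixes f :: "nat \<Rightarrow> 'a \<Rightarrow> 'k::field" and G :: "'a list \<Rightarrow> ('y \<Rightarrow>\<^sub>0 'k)"
  shows "(\<Sum>l\<in>L. scale (det (mat m m (\<lambda>(i, j). f i (l ! j)))) (G l)) =
    (\<Sum>p | p permutes {0..<m}. scale (of_int (sign p)) (\<Sum>l\<in>L. scale (\<Prod>j<m. f (p j) (l ! j)) (G l)))"
proof -
  have d: "det (mat m m (\<lambda>(i, j). f i (l ! j))) = (\<Sum>p | p permutes {0..<m}. of_int (sign p) * (\<Prod>j<m. f (p j) (l ! j)))" for l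
  proof -
    have "det (mat m m (\<lambda>(i, j). f i (l ! j))) = det (mat m m (\<lambda>(j, i). f i (l ! j)))"
      by (rule det_mat_swap)
    also have "\<dots> = (\<Sum>p | p permutes {0..<m}. of_int (sign p) * (\<Prod>j = 0..<m. mat m m (\<lambda>(j, i). f i (l ! j)) $$ (j, p j)))"
      by (rule det_def') simp
    also have "\<dots> = (\<Sum>p | p permutes {0..<m}. of_int (sign p) * (\<Prod>j<m. f (p j) (l ! j)))"
    proof (intro sum.cong refl arg_cong[where f = "(*) _"])
      fix p assume "p \<in> {p. p permutes {0..<m}}"
      then have "p j < m" if "j < m" for j using permutes_in_image[of p "{0..<m}" j] that by simp
      then show "(\<Prod>j = 0..<m. mat m m (\<lambda>(j, i). f i (l ! j)) $$ (j, p j)) = (\<Prod>j<m. f (p j) (l ! j))"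
        by (simp add: atLeast0LessThan)
    qed
    finally show ?thesis .
  qed
  show ?thesis
    unfolding d by (simp add: free.scale_sum_left free.scale_sum_right) (rule sum.swap)
qed


section \<open>Polyvector fields in coordinates\<close>

lemma apply_dual_sum: "apply_dual v w = (\<Sum>a\<in>Poly_Mapping.keys v. Poly_Mapping.lookup v a * Poly_Mapping.lookup w a)"
proof -
  have "apply_dual (basis a) w = Poly_Mapping.lookup w a" for a
    by (auto simp: apply_dual_def lookup_single when_def in_keys_iff if_distrib cong: if_cong)
  then show ?thesis by (simp add: apply_dual_expand_left[of v])
qed

lemma linear_apply_dual: "Vector_Spaces.linear scale (*) (apply_dual v)"
  by (rule free_functionalI) (simp_all add: apply_dual_sum lookup_add distrib_left sum.distrib sum_distrib_left mult.left_commute)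

text \<open>Pairing with the spanning relation, the sum of all \<open>dt_i\<close>, adds up the
  coordinates.\<close>

lemma W_dual_iff:
  assumes "finite J"
  shows "v \<in> fst (W_dual_sq J) \<longleftrightarrow> Poly_Mapping.keys v \<subseteq> J \<and> (\<Sum>j\<in>J. Poly_Mapping.lookup v j) = 0"
proof -
  have "apply_dual v (scale c (\<Sum>i\<in>J. basis i)) = c * (\<Sum>j\<in>J. Poly_Mapping.lookup v j)" for c
    by (simp only: linear_scale[OF linear_apply_dual] linear_sum[OF linear_apply_dual] apply_dual_basis_right)
  then show ?thesis
    by (auto simp: W_dual_sq_def W_rel_def intro: exI[of _ 1] dest: spec[of _ "scale 1 (\<Sum>i\<in>J. basis i)"])
qed

lemma W_dual_relation: "v \<in> fst (W_dual_sq J) \<Longrightarrow> w \<in> W_rel J \<Longrightarrow> apply_dual v w = 0"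
  by (simp add: W_dual_sq_def)

lemma subspace_W_dual: "finite J \<Longrightarrow> free.subspace (fst (W_dual_sq J))"
proof (rule free_subspaceI)
  fix x y :: "'a \<Rightarrow>\<^sub>0 'b" and c
  assume J: "finite J" and x: "x \<in> fst (W_dual_sq J)"
  show "scale c x \<in> fst (W_dual_sq J)"
    using x keys_scale[of c x] by (auto simp: W_dual_iff[OF J] sum_distrib_left[symmetric])
  assume "y \<in> fst (W_dual_sq J)"
  then show "x + y \<in> fst (W_dual_sq J)"
    using x Poly_Mapping.keys_add[of x y] by (auto simp: W_dual_iff[OF J] lookup_add sum.distrib)
qed (simp add: W_dual_iff)

lemma subspace_W_tilde: "free.subspace (W_tilde I :: ('a \<Rightarrow>\<^sub>0 'k::field) set)"
proof (rule free_subspaceI)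
  fix x y :: "'a \<Rightarrow>\<^sub>0 'k" and c
  show "scale c x \<in> W_tilde I" if "x \<in> W_tilde I"
    using that keys_scale[of c x] by (auto simp: W_tilde_def)
  show "x + y \<in> W_tilde I" if "x \<in> W_tilde I" "y \<in> W_tilde I"
    using that Poly_Mapping.keys_add[of x y] by (auto simp: W_tilde_def)
qed (simp add: W_tilde_def)

section \<open>Generators and relations for fields and forms\<close>

abbreviation TS :: "'a set \<Rightarrow> nat \<Rightarrow> ('a, 'k::field) pform set" where "TS J m \<equiv> fst (Theta_sq J m)"
abbreviation TU :: "'a set \<Rightarrow> nat \<Rightarrow> ('a, 'k::field) pform set" where "TU J m \<equiv> snd (Theta_sq J m)"
abbreviation OS :: "'a set \<Rightarrow> nat \<Rightarrow> ('a, 'k::field) pform set" where "OS J m \<equiv> fst (Omega_sq J m)"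
abbreviation OU :: "'a set \<Rightarrow> nat \<Rightarrow> ('a, 'k::field) pform set" where "OU J m \<equiv> snd (Omega_sq J m)"

lemma TS_span: "TS J m = free.span (decomposables m (fst (W_dual_sq J)) (P_tilde J))"
  by (simp add: Theta_sq_def fst_tensor_ext P_sq_def)

lemma OS_span: "OS J m = free.span (decomposables m (W_tilde J) (P_tilde J))"
  by (simp add: Omega_sq_def fst_tensor_ext P_sq_def W_sq_def)

lemma snd_P_sq: "finite J \<Longrightarrow> snd (P_sq J) \<subseteq> fst (P_sq J)"
  by (auto simp: P_sq_def P_ideal_subset)

lemma snd_W_dual: "snd (W_dual_sq J) = {0}"
  by (simp add: W_dual_sq_def)

lemma TU_span: "finite J \<Longrightarrow> TU J m = free.span (decomposables m (fst (W_dual_sq J)) (P_ideal J) \<union>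
    degenerates m (fst (W_dual_sq J)) {0} (P_tilde J))"
proof -
  assume J: "finite J"
  from snd_tensor_ext[OF snd_P_sq[OF J], of m "W_dual_sq J"] show ?thesis
    by (simp only: Theta_sq_def snd_W_dual) (simp only: P_sq_def fst_conv snd_conv)
qed

lemma OU_span: "finite J \<Longrightarrow> OU J m = free.span (decomposables m (W_tilde J) (P_ideal J) \<union>
    degenerates m (W_tilde J) (W_rel J) (P_tilde J))"
proof -
  assume J: "finite J"
  from snd_tensor_ext[OF snd_P_sq[OF J], of m "W_sq J"] show ?thesis
    by (simp only: Omega_sq_def) (simp only: P_sq_def W_sq_def fst_conv snd_conv)
qed

lemma subspace_TS: "free.subspace (TS J m)" and subspace_OS: "free.subspace (OS J m)"
  by (simp_all add: TS_span OS_span)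

lemma subspace_TU: "finite J \<Longrightarrow> free.subspace (TU J m)" and subspace_OU: "finite J \<Longrightarrow> free.subspace (OU J m)"
  by (simp_all add: TU_span OU_span)

lemma TS_I: "p \<in> P_tilde J \<Longrightarrow> length vs = m \<Longrightarrow> set vs \<subseteq> fst (W_dual_sq J) \<Longrightarrow> p \<otimes>\<^sub>t word_tensor vs \<in> TS J m"
  unfolding TS_span by (rule free.span_base) (auto simp: decomposables_def)

lemma OS_I: "p \<in> P_tilde J \<Longrightarrow> length vs = m \<Longrightarrow> set vs \<subseteq> W_tilde J \<Longrightarrow> p \<otimes>\<^sub>t word_tensor vs \<in> OS J m"
  unfolding OS_span by (rule free.span_base) (auto simp: decomposables_def)

lemma TU_I: "finite J \<Longrightarrow> p \<in> P_ideal J \<Longrightarrow> length vs = m \<Longrightarrow> set vs \<subseteq> fst (W_dual_sq J) \<Longrightarrow> p \<otimes>\<^sub>t word_tensor vs \<in> TU J m"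
  unfolding TU_span by (rule free.span_base) (auto simp: decomposables_def)

lemma OU_I: "finite J \<Longrightarrow> p \<in> P_ideal J \<Longrightarrow> length vs = m \<Longrightarrow> set vs \<subseteq> W_tilde J \<Longrightarrow> p \<otimes>\<^sub>t word_tensor vs \<in> OU J m"
  unfolding OU_span by (rule free.span_base) (auto simp: decomposables_def)

lemma OU_degenerate: "finite J \<Longrightarrow> p \<in> P_tilde J \<Longrightarrow> length vs = m \<Longrightarrow> set vs \<subseteq> W_tilde J \<Longrightarrow>
    \<not> distinct vs \<or> set vs \<inter> W_rel J \<noteq> {} \<Longrightarrow> p \<otimes>\<^sub>t word_tensor vs \<in> OU J m"
  unfolding OU_span by (rule free.span_base) (auto simp: degenerates_def)

lemma TU_subset_TS: "finite J \<Longrightarrow> TU J m \<subseteq> TS J m"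
proof -
  assume J: "finite J"
  have "decomposables m (fst (W_dual_sq J)) (P_ideal J) \<union> degenerates m (fst (W_dual_sq J)) {0} (P_tilde J) \<subseteq> decomposables m (fst (W_dual_sq J)) (P_tilde J)"
    using P_ideal_subset[OF J] unfolding degenerates_def decomposables_def by blast
  then show ?thesis unfolding TS_span TU_span[OF J] by (rule free.span_mono)
qed

text \<open>Polarisation: a tensor with \<open>a + b\<close> in both places is degenerate, and so
  are the two diagonal terms of its expansion.\<close>

lemma swap_degenerates:
  assumes V: "free.subspace V" and p: "p \<in> P" and m: "length xs + length ys + 2 = m" "set (xs @ a # b # ys) \<subseteq> V"
  shows "p \<otimes>\<^sub>t word_tensor (xs @ a # b # ys) + p \<otimes>\<^sub>t word_tensor (xs @ b # a # ys) \<in> free.span (degenerates m V R P)"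
proof -
  let ?w = "\<lambda>a b. p \<otimes>\<^sub>t word_tensor (xs @ a # b # ys)"
  have l1: "Vector_Spaces.linear scale scale (\<lambda>a. ?w a b)" for b
    by (rule linear_comp[OF linear_word_tensor linear_tens_right])
  have l2: "Vector_Spaces.linear scale scale (\<lambda>b. ?w a b)" for a
  proof -
    have "Vector_Spaces.linear scale scale (\<lambda>b. word_tensor (xs @ a # b # ys))"
      using linear_word_tensor[of "xs @ [a]" ys] by simp
    then show ?thesis by (rule linear_comp[OF _ linear_tens_right])
  qed
  have d: "?w c c \<in> free.span (degenerates m V R P)" if "c \<in> V" for c
  proof (rule free.span_base)
    have "length (xs @ c # c # ys) = m" "set (xs @ c # c # ys) \<subseteq> V" "\<not> distinct (xs @ c # c # ys)"
      using m that by auto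
    then show "?w c c \<in> degenerates m V R P" using p unfolding degenerates_def by blast
  qed
  have ab: "a \<in> V" "b \<in> V" using m by auto
  have "?w (a + b) (a + b) = ?w a a + ?w a b + (?w b a + ?w b b)"
    using linear_add[OF l1[of "a + b"], of a b] linear_add[OF l2[of a], of a b] linear_add[OF l2[of b], of a b] by simp
  then have "?w a b + ?w b a = ?w (a + b) (a + b) - ?w a a - ?w b b" by (simp add: algebra_simps)
  then show ?thesis
    using d ab free.subspace_add[OF V ab] by (simp add: free.span_diff)
qed

lemma linear_pair_form_left: "Vector_Spaces.linear scale scale (\<lambda>x. pair_form x y)"
  unfolding pair_form_def by (rule linear_comp[OF linear_tens_left linear_lin_ext])

lemma linear_pair_form_right: "Vector_Spaces.linear scale scale (\<lambda>y. pair_form x y)"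
  unfolding pair_form_def by (rule linear_comp[OF linear_tens_right linear_lin_ext])

text \<open>The coordinates of a polyvector field, its pairings with the forms \<open>dt_l\<close>.
  They form the alternating family that represents the field, signs of the pairing included.\<close>

definition coef :: "('a, 'k::field) pform \<Rightarrow> 'a list \<Rightarrow> ('a, 'k) mpoly" where
  "coef x l = pair_form x (1 \<otimes>\<^sub>t basis l)"

lemma linear_coef: "Vector_Spaces.linear scale scale (\<lambda>x. coef x l)"
  unfolding coef_def by (rule linear_pair_form_left)

lemmas coef_linear = linear_0[OF linear_coef] linear_add[OF linear_coef] linear_diff[OF linear_coef]
  linear_scale[OF linear_coef] linear_sum[OF linear_coef]

lemma pair_form_coef:
  fixes x :: "('a, 'b::field) pform"
  shows "pair_form x (q \<otimes>\<^sub>t basis l) = q * coef x l"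
proof (rule linear_eq_on_basis[where x = x, OF linear_pair_form_left linear_comp[OF linear_coef linear_mult_right]])
  fix b :: "('a \<Rightarrow>\<^sub>0 nat) \<times> 'a list"
  obtain \<mu> la where b: "b = (\<mu>, la)" by (cases b)
  have one: "(1 :: ('a, 'b) mpoly) \<otimes>\<^sub>t basis l = basis (0, l)"
    by (simp only: single_one[symmetric] tens_basis)
  have B: "pair_form (basis b) (basis \<nu> \<otimes>\<^sub>t basis l) = (basis \<nu> * coef (basis b) l :: ('a, 'b) mpoly)" for \<nu>
  proof -
    have "coef (basis b) l = (pair_form (basis b) (basis (0, l)) :: ('a, 'b) mpoly)" unfolding coef_def one by (rule refl)
    moreover have "(pair_form (basis b) (basis (\<kappa>, l)) :: ('a, 'b) mpoly) = Poly_Mapping.single (\<mu> + \<kappa>) ((-1) ^ (length la * (length la - 1) div 2) *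
       det (mat (length la) (length la) (\<lambda>(i, j). apply_dual (basis (la ! i)) (basis (l ! j)))))" for \<kappa>
      by (simp only: pair_form_def b tens_basis lin_ext_basis prod.case)
    ultimately show ?thesis by (simp only: tens_basis mult_single) (simp add: add.commute)
  qed
  show "pair_form (basis b) (q \<otimes>\<^sub>t basis l) = q * coef (basis b) l"
    by (rule linear_eq_on_basis[where x = q, OF linear_comp[OF linear_tens_left linear_pair_form_right] linear_mult_left B])
qed

abbreviation sg :: "nat \<Rightarrow> 'k::field" where "sg m \<equiv> (-1) ^ (m * (m - 1) div 2)"

lemma coef_decomposable:
  assumes "length vs = m" "length l = m"
  shows "coef (p \<otimes>\<^sub>t word_tensor vs) l = scale (sg m * det (mat m m (\<lambda>(i, j). Poly_Mapping.lookup (vs ! i) (l ! j)))) p"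
proof -
  have "coef (p \<otimes>\<^sub>t word_tensor vs) l = scale (sg m * det (mat m m (\<lambda>(i, j). apply_dual (vs ! i) (map basis l ! j)))) (p * 1)"
    unfolding coef_def word_tensor_basis[symmetric] by (rule pair_form_word) (use assms in auto)
  also have "mat m m (\<lambda>(i, j). apply_dual (vs ! i) (map basis l ! j)) = mat m m (\<lambda>(i, j). Poly_Mapping.lookup (vs ! i) (l ! j))"
    by (rule eq_matI) (use assms in \<open>auto simp: apply_dual_basis_right\<close>)
  finally show ?thesis by simp
qed

lemma det_zero_col:
  assumes "k < m" "\<And>i. i < m \<Longrightarrow> h i k = (0 :: 'k::field)"
  shows "det (mat m m (\<lambda>(i, j). h i j)) = 0"
  using det_col_comb[of k m "{}" h] assms by simp

lemma det_zero_row: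
  assumes "k < m" "\<And>i. i < m \<Longrightarrow> h k i = (0 :: 'k::field)"
  shows "det (mat m m (\<lambda>(i, j). h i j)) = 0"
  using det_row_comb[of k m "{}" h] assms by simp

lemma det_equal_rows:
  assumes "i \<noteq> i'" "i < m" "i' < m" "\<And>j. j < m \<Longrightarrow> h i j = (h i' j :: 'k::field)"
  shows "det (mat m m (\<lambda>(i, j). h i j)) = 0"
  by (rule det_identical_rows[of _ m i i']) (use assms in \<open>auto intro!: eq_vecI\<close>)

lemma det_equal_cols:
  assumes "i \<noteq> i'" "i < m" "i' < m" "\<And>j. j < m \<Longrightarrow> h j i = (h j i' :: 'k::field)"
  shows "det (mat m m (\<lambda>(i, j). h i j)) = 0"
  by (subst det_mat_swap) (rule det_equal_rows[OF assms])

text \<open>On decomposable elements \<open>coef\<close> is a determinant whose columns belong to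
  the letters. Swapping letters swaps columns; summing over a letter replaces its column by the
  coordinate sums of tangent vectors, which are zero.\<close>

lemma alt_tan_coef:
  fixes x :: "('a, 'k::field) pform"
  assumes J: "finite J" and x: "x \<in> TS J m"
  shows "alt_tan m J (coef x)"
proof -
  let ?G = "decomposables m (fst (W_dual_sq J)) (P_tilde J) :: ('a, 'k) pform set"
  have xs: "x \<in> free.span ?G" using x by (simp add: TS_span)
  have gen: "\<exists>p vs. b = p \<otimes>\<^sub>t word_tensor vs \<and> p \<in> P_tilde J \<and> length vs = m \<and> set vs \<subseteq> fst (W_dual_sq J)" if "b \<in> ?G" for b
    using that by (auto simp: decomposables_def)
  show ?thesis
  proof (rule alt_tanI)
    fix l assume l: "l \<in> words m J"
    show "coef x l \<in> P_tilde J"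
    proof (rule linear_span_into[OF linear_coef subspace_P_tilde xs])
      fix b assume "b \<in> ?G"
      then obtain p vs where b: "b = p \<otimes>\<^sub>t word_tensor vs" "p \<in> P_tilde J" "length vs = m" using gen by blast
      then show "coef b l \<in> P_tilde J"
        using l by (simp add: coef_decomposable[of vs m] words_def P_tilde_closed)
    qed
  next
    fix xs a b ys assume l: "xs @ a # b # ys \<in> words m J"
    have lin: "Vector_Spaces.linear scale scale (\<lambda>x. - coef x (xs @ b # a # ys) :: ('a, 'k) mpoly)"
      by (rule free_linearI) (simp_all add: coef_linear)
    show "coef x (xs @ a # b # ys) = - coef x (xs @ b # a # ys)"
    proof (rule linear_eq_on_span[OF linear_coef lin xs])
      fix z assume "z \<in> ?G"
      then obtain p vs where z: "z = p \<otimes>\<^sub>t word_tensor vs" "p \<in> P_tilde J" "length vs = m" using gen by blast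
      let ?k = "length xs"
      have k: "?k < m" "Suc ?k < m" using l by (auto simp: words_def)
      let ?M = "\<lambda>l. mat m m (\<lambda>(i, j). Poly_Mapping.lookup (vs ! i) (l ! j))"
      have "swapcols ?k (Suc ?k) (?M (xs @ b # a # ys)) = ?M (xs @ a # b # ys)"
        by (rule eq_matI) (use k in \<open>auto simp: nth_append nth_Cons' mat_swapcols_def\<close>)
      then have "det (?M (xs @ a # b # ys)) = - det (?M (xs @ b # a # ys))"
        using det_swapcols[of ?k m "Suc ?k" "?M (xs @ b # a # ys)"] k by simp
      then show "coef z (xs @ a # b # ys) = - coef z (xs @ b # a # ys)"
        using l by (simp add: z coef_decomposable[of vs m] words_def)
    qed
  next
    fix xs ys assume l: "length xs + length ys + 1 = m" "set xs \<subseteq> J" "set ys \<subseteq> J"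
    have lin: "Vector_Spaces.linear scale scale (\<lambda>x. \<Sum>j\<in>J. coef x (xs @ j # ys) :: ('a, 'k) mpoly)"
      by (rule free_linearI) (simp_all add: coef_linear sum.distrib free.scale_sum_right)
    have lin0: "Vector_Spaces.linear scale scale (\<lambda>x :: ('a, 'k) pform. 0 :: ('a, 'k) mpoly)" by (rule free_linearI) simp_all
    show "(\<Sum>j\<in>J. coef x (xs @ j # ys)) = 0"
    proof (rule linear_eq_on_span[OF lin lin0 xs])
      fix z assume "z \<in> ?G"
      then obtain p vs where z: "z = p \<otimes>\<^sub>t word_tensor vs" "p \<in> P_tilde J" "length vs = m" "set vs \<subseteq> fst (W_dual_sq J)"
        using gen by blast
      let ?k = "length xs"
      have k: "?k < m" using l by simp
      let ?D = "\<lambda>l. det (mat m m (\<lambda>(i, j). Poly_Mapping.lookup (vs ! i) (l ! j)))"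
      \<comment> \<open>A matrix with zero in column \<open>?k\<close>, to be written as a sum over
        the columns of all vertices. The entry \<open>undefined\<close> only keeps the positions of
        the other letters; it is never read.\<close>
      let ?h = "\<lambda>i j. if j = ?k then 0 else Poly_Mapping.lookup (vs ! i) ((xs @ undefined # ys) ! j)"
      have "0 = det (mat m m (\<lambda>(i, j). ?h i j))" by (rule det_zero_col[OF k, symmetric]) simp
      also have "\<dots> = (\<Sum>a\<in>J. 1 * det (mat m m (\<lambda>(i, j). if j = ?k then Poly_Mapping.lookup (vs ! i) a else ?h i j)))"
      proof (rule det_col_comb[OF k J])
        fix i assume "i < m"
        then have "vs ! i \<in> fst (W_dual_sq J)" using z by auto
        then show "?h i ?k = (\<Sum>a\<in>J. 1 * Poly_Mapping.lookup (vs ! i) a)" by (simp add: W_dual_iff[OF J])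
      qed
      also have "\<dots> = (\<Sum>a\<in>J. ?D (xs @ a # ys))"
      proof (intro sum.cong refl)
        fix a
        have "mat m m (\<lambda>(i, j). if j = ?k then Poly_Mapping.lookup (vs ! i) a else ?h i j) =
            mat m m (\<lambda>(i, j). Poly_Mapping.lookup (vs ! i) ((xs @ a # ys) ! j))"
          by (rule eq_matI) (auto simp: nth_append nth_Cons')
        then show "1 * det (mat m m (\<lambda>(i, j). if j = ?k then Poly_Mapping.lookup (vs ! i) a else ?h i j)) = ?D (xs @ a # ys)"
          by (simp only: mult_1)
      qed
      finally have D: "(\<Sum>a\<in>J. ?D (xs @ a # ys)) = 0" by simp
      have "(\<Sum>j\<in>J. coef z (xs @ j # ys)) = (\<Sum>j\<in>J. scale (sg m * ?D (xs @ j # ys)) p)"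
        unfolding z(1) by (intro sum.cong refl coef_decomposable) (use z l in auto)
      also have "\<dots> = scale (sg m * (\<Sum>a\<in>J. ?D (xs @ a # ys))) p"
        by (simp only: free.scale_sum_left sum_distrib_left)
      finally show "(\<Sum>j\<in>J. coef z (xs @ j # ys)) = 0" by (simp add: D)
    qed
  qed
qed

section \<open>Rebuilding a polyvector field from its pairings\<close>

lemma sum_const_scale: "(\<Sum>a\<in>A. x) = scale (of_nat (card A)) (x :: 'x \<Rightarrow>\<^sub>0 'k::field)"
  by (induction A rule: infinite_finite_induct) (simp_all add: free.scale_left_distrib)

text \<open>Inverse to \<open>coef\<close> up to relations, by \<open>coef_realize\<close> and
  \<open>realize_coef\<close>. In the pairing with \<open>dt_l\<close> every permutation of the
  letters contributes equally, hence the division by \<open>m!\<close>; the factor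
  \<open>sg m\<close> undoes the sign of the pairing.\<close>

definition realize :: "nat \<Rightarrow> 'a set \<Rightarrow> ('a list \<Rightarrow> ('a, 'k) mpoly) \<Rightarrow> ('a, 'k::field_char_0) pform" where
  "realize m J X = scale (sg m / fact m) (\<Sum>l\<in>words m J. X l \<otimes>\<^sub>t basis l)"

text \<open>In the Leibniz expansion each permutation selects exactly one word, the letters of
  \<open>l\<close> in permuted order. There \<open>X\<close> differs from \<open>X l\<close> by the
  sign of the permutation, which cancels that of the determinant, and \<open>m!\<close> equal terms
  remain.\<close>

lemma coef_realize:
  fixes X :: "'a list \<Rightarrow> ('a, 'k::field_char_0) mpoly"
  assumes J: "finite J" and X: "alt_tan m J X" and l: "l \<in> words m J"
  shows "coef (realize m J X) l = X l"
proof -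
  have len: "length l = m" "set l \<subseteq> J" using l by (auto simp: words_def)
  have c: "coef (X l' \<otimes>\<^sub>t basis l') l = scale (sg m * det (mat m m (\<lambda>(i, j). if l' ! i = l ! j then 1 else 0))) (X l')"
    if l': "l' \<in> words m J" for l'
  proof -
    have "coef (X l' \<otimes>\<^sub>t word_tensor (map basis l')) l = scale (sg m * det (mat m m (\<lambda>(i, j). Poly_Mapping.lookup (map basis l' ! i) (l ! j)))) (X l')"
      by (rule coef_decomposable) (use l' len in \<open>auto simp: words_def\<close>)
    also have "mat m m (\<lambda>(i, j). Poly_Mapping.lookup (map basis l' ! i) (l ! j) :: 'k) = mat m m (\<lambda>(i, j). if l' ! i = l ! j then 1 else 0)"
      by (rule eq_matI) (use l' in \<open>auto simp: words_def lookup_single when_def\<close>)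
    finally show ?thesis by (simp only: word_tensor_basis)
  qed
  have dt: "det (mat m m (\<lambda>(i, j). if l' ! i = l ! j then 1 else 0)) = det (mat m m (\<lambda>(i, j). if l ! i = l' ! j then 1 else (0 :: 'k)))" for l'
    by (subst det_mat_swap) (simp add: eq_commute)
  have "(\<Sum>l'\<in>words m J. scale (det (mat m m (\<lambda>(i, j). if l' ! i = l ! j then 1 else 0))) (X l')) =
      (\<Sum>p | p permutes {0..<m}. scale (of_int (sign p)) (\<Sum>l'\<in>words m J. scale (\<Prod>j<m. if l ! p j = l' ! j then 1 else 0) (X l')))"
    unfolding dt by (rule sum_det_words[where f = "\<lambda>i a. if l ! i = a then 1 else 0"])
  also have "\<dots> = (\<Sum>p | p permutes {0..<m}. X l)"
  proof (intro sum.cong refl)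
    fix p assume "p \<in> {p. p permutes {0..<m}}"
    then have p: "p permutes {0..<m}" by simp
    have pm: "p i < m" if "i < m" for i using permutes_in_image[OF p, of i] that by simp
    let ?lp = "map (\<lambda>i. l ! p i) [0..<m]"
    have "set ?lp \<subseteq> J" using pm len by (auto simp: subset_iff)
    then have lp: "?lp \<in> words m J" by (simp add: words_def)
    have pr: "(\<Prod>j<m. if l ! p j = l' ! j then 1 else (0 :: 'k)) = (if l' = ?lp then 1 else 0)" if l': "l' \<in> words m J" for l'
    proof (cases "l' = ?lp")
      case False
      have len': "length l' = length ?lp" using l' by (simp add: words_def)
      then obtain j where "j < length l'" "l' ! j \<noteq> ?lp ! j"
        using False nth_equalityI by blast
      then have "j < m" "l ! p j \<noteq> l' ! j" using len' by auto
      then have "(\<Prod>j<m. if l ! p j = l' ! j then 1 else (0 :: 'k)) = 0"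
        by (intro prod_zero) auto
      then show ?thesis using False by simp
    qed simp
    have "(\<Sum>l'\<in>words m J. scale (\<Prod>j<m. if l ! p j = l' ! j then 1 else 0) (X l')) = (\<Sum>l'\<in>words m J. if l' = ?lp then X l' else 0)"
      by (intro sum.cong refl) (simp add: pr)
    also have "\<dots> = X ?lp" using lp finite_words[OF J] by simp
    also have "X ?lp = scale (of_int (sign p)) (X l)"
    proof -
      have "X ?lp - scale (of_int (sign p)) (X l) \<in> {0}"
      proof (rule alternating_permute[where A = J])
        fix xs a b ys assume "length xs + length ys + 2 = m" "set (xs @ a # b # ys) \<subseteq> J"
        then show "X (xs @ a # b # ys) + X (xs @ b # a # ys) \<in> {0}"
          using alt_tan_swap[OF X, of xs a b ys] by (simp add: words_def)
      qed (use p len in auto)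
      then show ?thesis by simp
    qed
    finally show "scale (of_int (sign p)) (\<Sum>l'\<in>words m J. scale (\<Prod>j<m. if l ! p j = l' ! j then 1 else 0) (X l')) = X l"
      by (simp add: sign_def)
  qed
  also have "\<dots> = scale (fact m) (X l)"
  proof -
    have "card {p. p permutes {0..<m}} = fact m" by (rule card_permutations) auto
    then show ?thesis by (simp only: sum_const_scale of_nat_fact)
  qed
  finally have S: "(\<Sum>l'\<in>words m J. scale (det (mat m m (\<lambda>(i, j). if l' ! i = l ! j then 1 else 0))) (X l')) = scale (fact m) (X l)" .
  have "coef (realize m J X) l = scale (sg m / fact m) (\<Sum>l'\<in>words m J. scale (sg m * det (mat m m (\<lambda>(i, j). if l' ! i = l ! j then 1 else 0))) (X l'))"
    unfolding realize_def by (simp only: coef_linear c cong: sum.cong)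
  also have "\<dots> = scale (sg m / fact m) (scale (sg m) (scale (fact m) (X l)))"
    by (simp only: S[symmetric] free.scale_sum_right free.scale_scale)
  also have "\<dots> = X l"
  proof -
    have "sg m / fact m * (sg m * fact m) = (sg m * sg m :: 'k)" by (simp add: field_simps)
    also have "\<dots> = 1" by (rule minus_one_mult_self)
    finally show ?thesis by (simp only: free.scale_scale free.scale_one)
  qed
  finally show ?thesis .
qed

text \<open>The projections of the coordinate vectors along \<open>(1, \<dots>, 1)\<close>.\<close>

definition uvec :: "'a set \<Rightarrow> 'a \<Rightarrow> ('a \<Rightarrow>\<^sub>0 'k::field_char_0)" where
  "uvec J j = basis j - scale (1 / of_nat (card J)) (\<Sum>k\<in>J. basis k)"

lemma lookup_uvec: "finite J \<Longrightarrow> Poly_Mapping.lookup (uvec J j) k = (if k = j then 1 else 0) - (if k \<in> J then 1 / of_nat (card J) else 0)"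
  by (auto simp: uvec_def lookup_minus lookup_sum lookup_single when_def)

lemma uvec_W_dual: "finite J \<Longrightarrow> j \<in> J \<Longrightarrow> uvec J j \<in> fst (W_dual_sq J)"
proof -
  assume J: "finite J" "j \<in> J"
  have "of_nat (card J) \<noteq> (0 :: 'b)" using J by auto
  then have "(\<Sum>k\<in>J. Poly_Mapping.lookup (uvec J j) k :: 'b) = 0"
    using J by (simp add: lookup_uvec sum_subtractf)
  then show ?thesis using J by (auto simp: W_dual_iff in_keys_iff lookup_uvec split: if_splits)
qed

lemma sum_words_Suc: "finite J \<Longrightarrow> (\<Sum>l\<in>words (Suc m) J. f l) = (\<Sum>j\<in>J. \<Sum>l\<in>words m J. f (j # l))"
proof -
  assume J: "finite J"
  have "(\<Sum>j\<in>J. \<Sum>l\<in>words m J. f (j # l)) = (\<Sum>(j, l)\<in>J \<times> words m J. f (j # l))"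
    by (rule sum.cartesian_product)
  also have "\<dots> = (\<Sum>l\<in>words (Suc m) J. f l)"
    by (rule sum.reindex_bij_witness[where i = "\<lambda>l. (hd l, tl l)" and j = "\<lambda>(j, l). j # l"])
       (auto simp: words_def length_Suc_conv)
  finally show ?thesis ..
qed

text \<open>Replacing a letter by its projection adds a multiple of the sum of \<open>y\<close> over
  that letter, which is zero. The positions are treated one after the other.\<close>

lemma sum_tangent_words:
  fixes y :: "'a list \<Rightarrow> 'k::field_char_0"
  assumes J: "finite J" "J \<noteq> {}"
    and "\<And>xs ys. length xs + length ys + 1 = m \<Longrightarrow> set xs \<subseteq> J \<Longrightarrow> set ys \<subseteq> J \<Longrightarrow> (\<Sum>j\<in>J. y (xs @ j # ys)) = 0"
  shows "(\<Sum>l\<in>words m J. y l * Poly_Mapping.lookup (word_tensor (map (uvec J) l)) l') = (if l' \<in> words m J then y l' else 0)"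
  using assms(3)
proof (induction m arbitrary: y l')
  case 0
  have "words 0 J = {[]}" by (auto simp: words_def)
  then show ?case by (auto simp: lookup_single when_def)
next
  case (Suc m)
  show ?case
  proof (cases l')
    case Nil
    then show ?thesis using J by (simp add: sum_words_Suc lookup_word_tensor_Cons del: word_tensor.simps)
      (simp add: words_def)
  next
    case (Cons k l'')
    let ?w = "\<lambda>l. Poly_Mapping.lookup (word_tensor (map (uvec J) l)) l''"
    have "(\<Sum>l\<in>words (Suc m) J. y l * Poly_Mapping.lookup (word_tensor (map (uvec J) l)) l') =
        (\<Sum>l\<in>words m J. (\<Sum>j\<in>J. y (j # l) * Poly_Mapping.lookup (uvec J j) k) * ?w l)"
      using J by (simp add: sum_words_Suc Cons lookup_word_tensor_Cons del: word_tensor.simps)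
        (subst sum.swap, simp add: sum_distrib_right mult.assoc)
    also have "\<dots> = (\<Sum>l\<in>words m J. (if k \<in> J then y (k # l) else 0) * ?w l)"
    proof (intro sum.cong refl arg_cong2[where f = "(*)"])
      fix l assume "l \<in> words m J"
      then have t: "(\<Sum>j\<in>J. y (j # l)) = 0" using Suc.prems[of "[]" l] by (simp add: words_def)
      have "(\<Sum>j\<in>J. y (j # l) * Poly_Mapping.lookup (uvec J j) k) =
          (\<Sum>j\<in>J. if k = j then y (j # l) else 0) - (\<Sum>j\<in>J. y (j # l)) * (if k \<in> J then 1 / of_nat (card J) else 0)"
        unfolding lookup_uvec[OF J(1)] right_diff_distrib sum_subtractf sum_distrib_right
        by (intro arg_cong2[where f = "(-)"] sum.cong refl) auto
      then show "(\<Sum>j\<in>J. y (j # l) * Poly_Mapping.lookup (uvec J j) k) = (if k \<in> J then y (k # l) else 0)"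
        using J t by simp
    qed
    also have "\<dots> = (if k \<in> J then if l'' \<in> words m J then y (k # l'') else 0 else 0)"
    proof (cases "k \<in> J")
      case True
      have "(\<Sum>l\<in>words m J. y (k # l) * ?w l) = (if l'' \<in> words m J then y (k # l'') else 0)"
      proof (rule Suc.IH[of "\<lambda>l. y (k # l)"])
        fix xs ys assume "length xs + length ys + 1 = m" "set xs \<subseteq> J" "set ys \<subseteq> J"
        then show "(\<Sum>j\<in>J. y (k # xs @ j # ys)) = 0" using Suc.prems[of "k # xs" ys] True by simp
      qed
      then show ?thesis using True by simp
    qed simp
    finally show ?thesis by (simp add: Cons)
  qed
qed

text \<open>The words in \<open>realize\<close> are tensors of coordinate vectors, which are not
  tangent one by one. Projecting them leaves the whole sum unchanged and exhibits it as a
  combination of tensors of tangent vectors.\<close>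

lemma realize_uvec:
  assumes J: "finite J" "J \<noteq> {}" and X: "alt_tan m J X"
  shows "realize m J X = scale (sg m / fact m) (\<Sum>l\<in>words m J. X l \<otimes>\<^sub>t word_tensor (map (uvec J) l))"
proof -
  have "(\<Sum>l\<in>words m J. X l \<otimes>\<^sub>t basis l) = (\<Sum>l\<in>words m J. X l \<otimes>\<^sub>t word_tensor (map (uvec J) l))"
  proof (rule poly_mapping_eqI)
    fix b :: "('a \<Rightarrow>\<^sub>0 nat) \<times> 'a list"
    obtain \<mu> l' where b: "b = (\<mu>, l')" by (cases b)
    have "(\<Sum>l\<in>words m J. Poly_Mapping.lookup (X l) \<mu> * Poly_Mapping.lookup (word_tensor (map (uvec J) l)) l') =
        (if l' \<in> words m J then Poly_Mapping.lookup (X l') \<mu> else 0)"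
    proof (rule sum_tangent_words[OF J])
      fix xs ys assume "length xs + length ys + 1 = m" "set xs \<subseteq> J" "set ys \<subseteq> J"
      from alt_tan_sum[OF X this] show "(\<Sum>j\<in>J. Poly_Mapping.lookup (X (xs @ j # ys)) \<mu>) = 0"
        by (metis lookup_sum lookup_zero)
    qed
    moreover have "(\<Sum>l\<in>words m J. Poly_Mapping.lookup (X l) \<mu> * Poly_Mapping.lookup (basis l) l') =
        (\<Sum>l\<in>words m J. if l = l' then Poly_Mapping.lookup (X l) \<mu> else 0)"
      by (intro sum.cong refl) (simp add: lookup_single when_def)
    ultimately show "Poly_Mapping.lookup (\<Sum>l\<in>words m J. X l \<otimes>\<^sub>t basis l) b = Poly_Mapping.lookup (\<Sum>l\<in>words m J. X l \<otimes>\<^sub>t word_tensor (map (uvec J) l)) b"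
      using finite_words[OF J(1)] by (simp add: b lookup_sum)
  qed
  then show ?thesis by (simp add: realize_def)
qed

lemma realize_TS:
  assumes J: "finite J" "J \<noteq> {}" and X: "alt_tan m J X"
  shows "realize m J X \<in> TS J m"
  unfolding realize_uvec[OF assms]
proof (intro free.subspace_scale[OF subspace_TS] free.subspace_sum[OF subspace_TS] TS_I)
  fix l assume l: "l \<in> words m J"
  show "X l \<in> P_tilde J" by (rule alt_tan_P[OF X l])
qed (auto simp: words_def intro!: uvec_W_dual[OF J(1)])

lemma realize_TU:
  assumes J: "finite J" "J \<noteq> {}" and X: "alt_tan m J X" and U: "\<And>l. l \<in> words m J \<Longrightarrow> X l \<in> P_ideal J"
  shows "realize m J X \<in> TU J m"
  unfolding realize_uvec[OF J X]
  by (intro free.subspace_scale[OF subspace_TU[OF J(1)]] free.subspace_sum[OF subspace_TU[OF J(1)]] TU_I J U)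
     (auto simp: words_def intro!: uvec_W_dual[OF J(1)])

text \<open>On a decomposable \<open>z\<close> the right-hand construction is the average of the
  signed permutations of its factors, by the Leibniz formula. Modulo degenerate tensors each of
  these equals \<open>z\<close>.\<close>

lemma realize_coef:
  fixes x :: "('a, 'k::field_char_0) pform"
  assumes J: "finite J" "J \<noteq> {}" and x: "x \<in> TS J m"
  shows "x - realize m J (coef x) \<in> TU J m"
proof -
  have lin: "Vector_Spaces.linear scale scale (\<lambda>x. x - realize m J (coef x) :: ('a, 'k) pform)"
    by (rule free_linearI)
       (simp_all add: realize_def coef_linear tens_add_left tens_scale_left sum.distrib free.scale_right_distrib
         free.scale_sum_right free.scale_right_diff_distrib mult.commute)
  show ?thesis
  proof (rule linear_span_into[OF lin subspace_TU[OF J(1)] x[unfolded TS_span]])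
    fix z :: "('a, 'k) pform" assume "z \<in> decomposables m (fst (W_dual_sq J)) (P_tilde J)"
    then obtain p vs where z: "z = p \<otimes>\<^sub>t word_tensor vs" and p: "p \<in> P_tilde J" and vs: "length vs = m" "set vs \<subseteq> fst (W_dual_sq J)"
      by (auto simp: decomposables_def)
    let ?D = "\<lambda>l. det (mat m m (\<lambda>(i, j). Poly_Mapping.lookup (vs ! i) (l ! j)))"
    let ?perm = "\<lambda>s. map (\<lambda>i. vs ! s i) [0..<m]"
    have wt: "word_tensor ws = (\<Sum>l\<in>words m J. scale (\<Prod>j<m. Poly_Mapping.lookup (ws ! j) (l ! j)) (basis l))"
      if ws: "length ws = m" "set ws \<subseteq> fst (W_dual_sq J)" for ws :: "('a \<Rightarrow>\<^sub>0 'k) list"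
    proof -
      have "Poly_Mapping.keys (word_tensor ws) \<subseteq> words m J"
      proof
        fix l assume l: "l \<in> Poly_Mapping.keys (word_tensor ws)"
        have "set l \<subseteq> J" by (rule keys_word_tensor[OF l]) (use ws W_dual_iff[OF J(1)] in blast)
        then show "l \<in> words m J" using word_tensor_length[OF l] ws by (simp add: words_def)
      qed
      then have "lin_ext basis (word_tensor ws) = (\<Sum>l\<in>words m J. scale (Poly_Mapping.lookup (word_tensor ws) l) (basis l))"
        by (rule lin_ext_superset[OF finite_words[OF J(1)]])
      also have "\<dots> = (\<Sum>l\<in>words m J. scale (\<Prod>j<m. Poly_Mapping.lookup (ws ! j) (l ! j)) (basis l))"
        by (intro sum.cong refl arg_cong2[where f = scale]) (use ws in \<open>auto simp: lookup_word_tensor words_def\<close>)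
      finally show ?thesis by (simp only: lin_ext_basis_id)
    qed
    have "(\<Sum>l\<in>words m J. coef z l \<otimes>\<^sub>t basis l) = (\<Sum>l\<in>words m J. scale (sg m) (p \<otimes>\<^sub>t scale (?D l) (basis l)))"
      by (intro sum.cong refl) (use vs in \<open>simp add: z coef_decomposable[of vs m] words_def tens_scale_left tens_scale_right del: scale_single\<close>)
    also have "\<dots> = scale (sg m) (p \<otimes>\<^sub>t (\<Sum>l\<in>words m J. scale (?D l) (basis l)))"
      by (simp only: linear_sum[OF linear_tens_right] free.scale_sum_right)
    also have "(\<Sum>l\<in>words m J. scale (?D l) (basis l)) =
        (\<Sum>s | s permutes {0..<m}. scale (of_int (sign s)) (\<Sum>l\<in>words m J. scale (\<Prod>j<m. Poly_Mapping.lookup (vs ! s j) (l ! j)) (basis l)))"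
      by (rule sum_det_words[where f = "\<lambda>i. Poly_Mapping.lookup (vs ! i)"])
    also have "\<dots> = (\<Sum>s | s permutes {0..<m}. scale (of_int (sign s)) (word_tensor (?perm s)))"
    proof (intro sum.cong refl arg_cong2[where f = scale])
      fix s assume "s \<in> {s. s permutes {0..<m}}"
      then have sm: "s i < m" if "i < m" for i using permutes_in_image[of s "{0..<m}" i] that by simp
      have "word_tensor (?perm s) = (\<Sum>l\<in>words m J. scale (\<Prod>j<m. Poly_Mapping.lookup (?perm s ! j) (l ! j)) (basis l))"
      proof (rule wt)
        show "set (?perm s) \<subseteq> fst (W_dual_sq J)"
        proof
          fix v assume "v \<in> set (?perm s)"
          then obtain i where "i < m" "v = vs ! s i" by auto
          then show "v \<in> fst (W_dual_sq J)" using vs sm[of i] nth_mem[of "s i" vs] by auto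
        qed
      qed simp
      then show "(\<Sum>l\<in>words m J. scale (\<Prod>j<m. Poly_Mapping.lookup (vs ! s j) (l ! j)) (basis l)) = word_tensor (?perm s)"
        by simp
    qed
    finally have R: "realize m J (coef z) = scale (1 / fact m) (\<Sum>s | s permutes {0..<m}. scale (of_int (sign s)) (p \<otimes>\<^sub>t word_tensor (?perm s)))"
    proof -
      assume e: "(\<Sum>l\<in>words m J. coef z l \<otimes>\<^sub>t basis l) = scale (sg m) (p \<otimes>\<^sub>t (\<Sum>s | s permutes {0..<m}. scale (of_int (sign s)) (word_tensor (?perm s))))"
      have "sg m / fact m * sg m = (1 / fact m :: 'k)"
        using minus_one_mult_self[of "m * (m - 1) div 2", where 'a = 'k] by simp
      then show ?thesis
        unfolding realize_def e by (simp only: free.scale_scale linear_sum[OF linear_tens_right] tens_scale_right)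
    qed
    have sgn: "scale (of_int (sign s)) (p \<otimes>\<^sub>t word_tensor (?perm s)) - z \<in> TU J m" if s: "s permutes {0..<m}" for s
    proof -
      have "p \<otimes>\<^sub>t word_tensor (?perm s) - scale (of_int (sign s)) (p \<otimes>\<^sub>t word_tensor vs) \<in> TU J m"
      proof (rule alternating_permute[OF subspace_TU[OF J(1)] _ s vs])
        fix a b :: "'a \<Rightarrow>\<^sub>0 'k" and xs ys assume "length xs + length ys + 2 = m" "set (xs @ a # b # ys) \<subseteq> fst (W_dual_sq J)"
        from swap_degenerates[OF subspace_W_dual[OF J(1)] p this, of "{0}"]
        show "p \<otimes>\<^sub>t word_tensor (xs @ a # b # ys) + p \<otimes>\<^sub>t word_tensor (xs @ b # a # ys) \<in> TU J m"
          unfolding TU_span[OF J(1)] using free.span_mono[of "degenerates m (fst (W_dual_sq J)) {0} (P_tilde J)"] by blast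
      qed
      from free.subspace_scale[OF subspace_TU[OF J(1)] this, of "of_int (sign s)"]
      show ?thesis by (simp add: z free.scale_right_diff_distrib sign_def split: if_splits)
    qed
    have "z - realize m J (coef z) = scale (- 1 / fact m) (\<Sum>s | s permutes {0..<m}. scale (of_int (sign s)) (p \<otimes>\<^sub>t word_tensor (?perm s)) - z)"
    proof -
      have "card {s. s permutes {0..<m}} = fact m" by (rule card_permutations) auto
      then have "(\<Sum>s | s permutes {0..<m}. z) = scale (fact m) z" by (simp only: sum_const_scale of_nat_fact)
      then show ?thesis unfolding R sum_subtractf by (simp add: free.scale_right_diff_distrib)
    qed
    moreover have "scale (- 1 / fact m) (\<Sum>s | s permutes {0..<m}. scale (of_int (sign s)) (p \<otimes>\<^sub>t word_tensor (?perm s)) - z) \<in> TU J m"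
      by (intro free.subspace_scale[OF subspace_TU[OF J(1)]] free.subspace_sum[OF subspace_TU[OF J(1)]] sgn) simp
    ultimately show "z - realize m J (coef z) \<in> TU J m" by metis
  qed
qed

text \<open>Independence of the pairing from the representative of the form. A repeated factor gives
  equal columns of the determinant, and a factor among the relations gives a zero column, since
  tangent vectors annihilate it.\<close>

lemma pair_form_TS_OU:
  fixes x :: "('a, 'k::field) pform"
  assumes J: "finite J" and x: "x \<in> TS J m" and w: "w \<in> OU J m"
  shows "pair_form x w \<in> P_ideal J"
proof (rule linear_span_into[OF linear_pair_form_left subspace_P_ideal x[unfolded TS_span]])
  fix z :: "('a, 'k) pform" assume "z \<in> decomposables m (fst (W_dual_sq J)) (P_tilde J)"
  then obtain p vs where z: "z = p \<otimes>\<^sub>t word_tensor vs" and p: "p \<in> P_tilde J" and vs: "length vs = m" "set vs \<subseteq> fst (W_dual_sq J)"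
    by (auto simp: decomposables_def)
  show "pair_form z w \<in> P_ideal J"
  proof (rule linear_span_into[OF linear_pair_form_right subspace_P_ideal w[unfolded OU_span[OF J]]])
    fix b :: "('a, 'k) pform"
    assume "b \<in> decomposables m (W_tilde J) (P_ideal J) \<union> degenerates m (W_tilde J) (W_rel J) (P_tilde J)"
    then consider q ws where "b = q \<otimes>\<^sub>t word_tensor ws" "q \<in> P_ideal J" "length ws = m"
      | q ws where "b = q \<otimes>\<^sub>t word_tensor ws" "length ws = m" "\<not> distinct ws \<or> set ws \<inter> W_rel J \<noteq> {}"
      unfolding decomposables_def degenerates_def by blast
    then show "pair_form z b \<in> P_ideal J"
    proof cases
      case 1
      then show ?thesis unfolding z 1(1) pair_form_word[OF vs(1) 1(3)]
        by (intro P_ideal_closed P_ideal_mult' p)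
    next
      case 2
      have "det (mat m m (\<lambda>(i, j). apply_dual (vs ! i) (ws ! j))) = 0"
      proof (cases "distinct ws")
        case True
        then obtain u where "u \<in> set ws" "u \<in> W_rel J" using 2 by blast
        then obtain k where k: "k < m" "ws ! k \<in> W_rel J" using 2(2) by (auto simp: in_set_conv_nth)
        show ?thesis
          by (rule det_zero_col[OF k(1)]) (use k vs in \<open>auto intro!: W_dual_relation\<close>)
      next
        case False
        then obtain i j where ij: "i < m" "j < m" "i \<noteq> j" "ws ! i = ws ! j"
          using 2(2) by (auto simp: distinct_conv_nth)
        show ?thesis by (rule det_equal_cols[OF ij(3,1,2)]) (simp add: ij(4))
      qed
      then show ?thesis unfolding z 2(1) pair_form_word[OF vs(1) 2(2)] by (simp add: P_ideal_closed)
    qed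
  qed
qed

text \<open>The same independence for the representative of the field, with rows in place of
  columns.\<close>

lemma pair_form_TU_OS:
  fixes x :: "('a, 'k::field) pform"
  assumes J: "finite J" and x: "x \<in> TU J m" and w: "w \<in> OS J m"
  shows "pair_form x w \<in> P_ideal J"
proof (rule linear_span_into[OF linear_pair_form_left subspace_P_ideal x[unfolded TU_span[OF J]]])
  fix z :: "('a, 'k) pform"
  assume "z \<in> decomposables m (fst (W_dual_sq J)) (P_ideal J) \<union> degenerates m (fst (W_dual_sq J)) {0} (P_tilde J)"
  then consider p vs where "z = p \<otimes>\<^sub>t word_tensor vs" "p \<in> P_ideal J" "length vs = m"
    | p vs where "z = p \<otimes>\<^sub>t word_tensor vs" "length vs = m" "\<not> distinct vs \<or> 0 \<in> set vs"
    unfolding decomposables_def degenerates_def by blast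
  then show "pair_form z w \<in> P_ideal J"
  proof cases
    case 1
    show ?thesis
    proof (rule linear_span_into[OF linear_pair_form_right subspace_P_ideal w[unfolded OS_span]])
      fix b :: "('a, 'k) pform" assume "b \<in> decomposables m (W_tilde J) (P_tilde J)"
      then obtain q ws where b: "b = q \<otimes>\<^sub>t word_tensor ws" "q \<in> P_tilde J" "length ws = m"
        by (auto simp: decomposables_def)
      show "pair_form z b \<in> P_ideal J"
        unfolding 1(1) b(1) pair_form_word[OF 1(3) b(3)] by (intro P_ideal_closed P_ideal_mult 1 b)
    qed
  next
    case 2
    show ?thesis
    proof (rule linear_span_into[OF linear_pair_form_right subspace_P_ideal w[unfolded OS_span]])
      fix b :: "('a, 'k) pform" assume "b \<in> decomposables m (W_tilde J) (P_tilde J)"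
      then obtain q ws where b: "b = q \<otimes>\<^sub>t word_tensor ws" "length ws = m"
        by (auto simp: decomposables_def)
      have "det (mat m m (\<lambda>(i, j). apply_dual (vs ! i) (ws ! j))) = 0"
      proof (cases "distinct vs")
        case True
        then obtain k where k: "k < m" "vs ! k = 0" using 2 by (auto simp: in_set_conv_nth)
        show ?thesis by (rule det_zero_row[OF k(1)]) (simp add: k(2) apply_dual_sum)
      next
        case False
        then obtain i j where ij: "i < m" "j < m" "i \<noteq> j" "vs ! i = vs ! j"
          using 2(2) by (auto simp: distinct_conv_nth)
        show ?thesis by (rule det_equal_rows[OF ij(3,1,2)]) (simp add: ij(4))
      qed
      then show "pair_form z b \<in> P_ideal J" unfolding 2(1) b(1) pair_form_word[OF 2(2) b(2)] by (simp add: P_ideal_closed)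
    qed
  qed
qed

lemma OS_basis: "q \<in> P_tilde J \<Longrightarrow> l \<in> words m J \<Longrightarrow> q \<otimes>\<^sub>t basis l \<in> OS J m"
  unfolding word_tensor_basis[symmetric] by (rule OS_I) (auto simp: words_def W_tilde_def)

text \<open>The bridge between the quotient \<open>Theta\<close> and coefficient families modulo
  ideals. One direction pairs with \<open>dt_l\<close>; the other rebuilds \<open>x\<close> from its
  coefficients by \<open>realize_coef\<close>.\<close>

lemma TU_iff:
  fixes x :: "('a, 'k::field_char_0) pform"
  assumes J: "finite J" "J \<noteq> {}" and x: "x \<in> TS J m"
  shows "x \<in> TU J m \<longleftrightarrow> (\<forall>l\<in>words m J. coef x l \<in> P_ideal J)"
proof
  assume "x \<in> TU J m"
  then show "\<forall>l\<in>words m J. coef x l \<in> P_ideal J"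
    unfolding coef_def by (auto intro!: pair_form_TU_OS[OF J(1)] OS_basis P_tilde_1)
next
  assume "\<forall>l\<in>words m J. coef x l \<in> P_ideal J"
  then have "realize m J (coef x) \<in> TU J m"
    by (intro realize_TU[OF J alt_tan_coef[OF J(1) x]]) auto
  from free.subspace_add[OF subspace_TU[OF J(1)] realize_coef[OF J x] this] show "x \<in> TU J m" by simp
qed


section \<open>Differential, pullback and pushforward on representatives\<close>

lemma linear_d_form: "Vector_Spaces.linear scale scale d_form"
  unfolding d_form_def by (rule linear_lin_ext)

lemma linear_pull_form: "Vector_Spaces.linear scale scale (pull_form I \<alpha>)"
  unfolding pull_form_def by (rule linear_lin_ext)

lemma linear_push_form: "Vector_Spaces.linear scale scale (push_form I J \<sigma>)"
  unfolding push_form_def by (rule linear_lin_ext)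

lemma linear_sum_maps:
  assumes "\<And>i. i \<in> A \<Longrightarrow> Vector_Spaces.linear scale scale (f i :: ('x \<Rightarrow>\<^sub>0 'k::field) \<Rightarrow> ('y \<Rightarrow>\<^sub>0 'k))"
  shows "Vector_Spaces.linear scale scale (\<lambda>x. \<Sum>i\<in>A. f i x)"
  by (rule free_linearI)
     (simp_all add: linear_add[OF assms] linear_scale[OF assms] sum.distrib free.scale_sum_right cong: sum.cong)

section \<open>The de Rham differential\<close>

definition cons_word :: "'a \<Rightarrow> ('a list \<Rightarrow>\<^sub>0 'k::field) \<Rightarrow> ('a list \<Rightarrow>\<^sub>0 'k)" where
  "cons_word i = lin_ext (\<lambda>l. basis (i # l))"

lemma cons_word_word_tensor: "cons_word i (word_tensor vs) = word_tensor (basis i # vs)"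
proof -
  have "lin_ext (\<lambda>l. basis (i # l)) y = lin_ext (\<lambda>(a, l). basis (a # l)) (basis i \<otimes>\<^sub>t y)" for y :: "'a list \<Rightarrow>\<^sub>0 'b"
    by (rule linear_eq_on_basis[where x = y, OF linear_lin_ext linear_comp[OF linear_tens_right linear_lin_ext]])
       (simp only: tens_basis lin_ext_basis prod.case)
  then show ?thesis by (simp add: cons_word_def)
qed

text \<open>\<open>I\<close> may be any finite set that contains the variables of \<open>p\<close>,
  as the remaining derivatives vanish; for constants it may be empty.\<close>

lemma d_form_tens:
  fixes p :: "('a, 'k::field) mpoly"
  assumes I: "finite I" and p: "p \<in> P_tilde I"
  shows "d_form (p \<otimes>\<^sub>t y) = (\<Sum>i\<in>I. pd i p \<otimes>\<^sub>t cons_word i y)"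
proof (rule linear_eq_on_basis[where x = p])
  show "Vector_Spaces.linear scale scale (\<lambda>p. d_form (p \<otimes>\<^sub>t y))"
    by (rule linear_comp[OF linear_tens_left linear_d_form])
  show "Vector_Spaces.linear scale scale (\<lambda>p. \<Sum>i\<in>I. pd i p \<otimes>\<^sub>t cons_word i y)"
    by (rule linear_sum_maps) (rule linear_comp[OF linear_pd linear_tens_left])
  fix \<mu> assume "\<mu> \<in> Poly_Mapping.keys p"
  then have mu: "Poly_Mapping.keys \<mu> \<subseteq> I" using p by (auto simp: P_tilde_def)
  show "d_form (basis \<mu> \<otimes>\<^sub>t y) = (\<Sum>i\<in>I. pd i (basis \<mu>) \<otimes>\<^sub>t cons_word i y)"
  proof (rule linear_eq_on_basis[where x = y])
    show "Vector_Spaces.linear scale scale (\<lambda>y. d_form (basis \<mu> \<otimes>\<^sub>t y))"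
      by (rule linear_comp[OF linear_tens_right linear_d_form])
    show "Vector_Spaces.linear scale scale (\<lambda>y. \<Sum>i\<in>I. pd i (basis \<mu>) \<otimes>\<^sub>t cons_word i y)"
      unfolding cons_word_def by (rule linear_sum_maps) (rule linear_comp[OF linear_lin_ext linear_tens_right])
    fix l
    have t: "pd i (basis \<mu>) \<otimes>\<^sub>t cons_word i (basis l) =
        Poly_Mapping.single (\<mu> - Poly_Mapping.single i 1, i # l) (of_nat (Poly_Mapping.lookup \<mu> i) :: 'k)" for i
    proof -
      have "pd i (basis \<mu>) = scale (of_nat (Poly_Mapping.lookup \<mu> i)) (basis (\<mu> - Poly_Mapping.single i 1) :: ('a, 'k) mpoly)"
        by (simp add: pd_basis)
      then have "pd i (basis \<mu>) \<otimes>\<^sub>t cons_word i (basis l) =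
          scale (of_nat (Poly_Mapping.lookup \<mu> i) :: 'k) (basis (\<mu> - Poly_Mapping.single i 1, i # l))"
        by (simp only: cons_word_def lin_ext_basis tens_scale_left tens_basis)
      then show ?thesis by (simp only: single_eq_scale[symmetric])
    qed
    have "d_form (basis \<mu> \<otimes>\<^sub>t basis l) = (\<Sum>i\<in>Poly_Mapping.keys \<mu>.
        Poly_Mapping.single (\<mu> - Poly_Mapping.single i 1, i # l) (of_nat (Poly_Mapping.lookup \<mu> i) :: 'k))"
      by (simp only: d_form_def tens_basis lin_ext_basis prod.case)
    also have "\<dots> = (\<Sum>i\<in>I. Poly_Mapping.single (\<mu> - Poly_Mapping.single i 1, i # l) (of_nat (Poly_Mapping.lookup \<mu> i) :: 'k))"
      by (rule sum.mono_neutral_left[OF I mu]) (auto simp: in_keys_iff)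
    finally show "d_form (basis \<mu> \<otimes>\<^sub>t basis l) = (\<Sum>i\<in>I. pd i (basis \<mu>) \<otimes>\<^sub>t cons_word i (basis l) :: ('a, 'k) pform)"
      by (simp only: t)
  qed
qed

lemma d_form_word:
  "finite I \<Longrightarrow> p \<in> P_tilde I \<Longrightarrow> d_form (p \<otimes>\<^sub>t word_tensor vs) = (\<Sum>i\<in>I. pd i p \<otimes>\<^sub>t word_tensor (basis i # vs))"
  by (simp only: d_form_tens cons_word_word_tensor)

lemma W_tilde_basis: "i \<in> I \<Longrightarrow> basis i \<in> W_tilde I"
  by (simp add: W_tilde_def)

lemma d_form_OS:
  fixes x :: "('a, 'k::field) pform"
  assumes I: "finite I" and x: "x \<in> OS I k"
  shows "d_form x \<in> OS I (Suc k)"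
proof (rule linear_span_into[OF linear_d_form subspace_OS x[unfolded OS_span]])
  fix b :: "('a, 'k) pform" assume "b \<in> decomposables k (W_tilde I) (P_tilde I)"
  then obtain p vs where b: "b = p \<otimes>\<^sub>t word_tensor vs" "p \<in> P_tilde I" "length vs = k" "set vs \<subseteq> W_tilde I"
    by (auto simp: decomposables_def)
  show "d_form b \<in> OS I (Suc k)"
    unfolding b(1) d_form_word[OF I b(2)]
    by (intro free.subspace_sum[OF subspace_OS] OS_I pd_P_tilde b(2)) (use b W_tilde_basis in auto)
qed

text \<open>The differential of \<open>(1 - \<Sum>t_i) q\<close> has a part in the ideal and the
  part \<open>- q\<close> times the sum of all \<open>dt_i\<close>. The latter is a relation of
  \<open>W\<close>, so it becomes a degenerate word.\<close>

lemma d_form_OU: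
  fixes x :: "('a, 'k::field) pform"
  assumes I: "finite I" and x: "x \<in> OU I k"
  shows "d_form x \<in> OU I (Suc k)"
proof (rule linear_span_into[OF linear_d_form subspace_OU[OF I] x[unfolded OU_span[OF I]]])
  fix b :: "('a, 'k) pform"
  assume "b \<in> decomposables k (W_tilde I) (P_ideal I) \<union> degenerates k (W_tilde I) (W_rel I) (P_tilde I)"
  then consider q vs where "b = ((1 - (\<Sum>i\<in>I. tvar i)) * q) \<otimes>\<^sub>t word_tensor vs" "q \<in> P_tilde I" "length vs = k" "set vs \<subseteq> W_tilde I"
    | p vs where "b = p \<otimes>\<^sub>t word_tensor vs" "p \<in> P_tilde I" "length vs = k" "set vs \<subseteq> W_tilde I" "\<not> distinct vs \<or> set vs \<inter> W_rel I \<noteq> {}"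
    unfolding decomposables_def degenerates_def P_ideal_def by blast
  then show "d_form b \<in> OU I (Suc k)"
  proof cases
    case 1
    let ?c = "1 - (\<Sum>i\<in>I. tvar i) :: ('a, 'k) mpoly"
    have P: "?c * q \<in> P_tilde I" by (rule P_ideal_subset[OF I P_ideal_generator[OF 1(2)]])
    have pc: "pd i ?c = - 1" if "i \<in> I" for i
      using I that by (simp add: pd_simps pd_tvar)
    have "d_form b = (\<Sum>i\<in>I. (?c * pd i q - q) \<otimes>\<^sub>t word_tensor (basis i # vs))"
    proof -
      have "pd i (?c * q) = ?c * pd i q - q" if "i \<in> I" for i
        unfolding pd_mult pc[OF that] by simp
      then show ?thesis unfolding 1(1) d_form_word[OF I P] by (intro sum.cong refl) (simp only:)
    qed
    also have "\<dots> = (\<Sum>i\<in>I. (?c * pd i q) \<otimes>\<^sub>t word_tensor (basis i # vs)) - q \<otimes>\<^sub>t word_tensor ((\<Sum>i\<in>I. basis i) # vs)"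
    proof -
      have lw: "Vector_Spaces.linear scale scale (\<lambda>v. q \<otimes>\<^sub>t word_tensor (v # vs))"
        using linear_comp[OF linear_word_tensor[of "[]" vs] linear_tens_right[of q]] by simp
      show ?thesis
        by (simp only: linear_sum[OF lw] linear_diff[OF linear_tens_left] sum_subtractf)
    qed
    also have "\<dots> \<in> OU I (Suc k)"
    proof (intro free.subspace_diff[OF subspace_OU[OF I]] free.subspace_sum[OF subspace_OU[OF I]])
      show "(?c * pd i q) \<otimes>\<^sub>t word_tensor (basis i # vs) \<in> OU I (Suc k)" if "i \<in> I" for i
        by (rule OU_I[OF I P_ideal_generator[OF pd_P_tilde[OF 1(2)]]]) (use 1 that W_tilde_basis in auto)
      have "(\<Sum>i\<in>I. basis i) \<in> W_tilde I"
        by (intro free.subspace_sum[OF subspace_W_tilde] W_tilde_basis)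
      moreover have "(\<Sum>i\<in>I. basis i) \<in> W_rel I" unfolding W_rel_def using free.scale_one by (metis (mono_tags, lifting) mem_Collect_eq)
      ultimately show "q \<otimes>\<^sub>t word_tensor ((\<Sum>i\<in>I. basis i) # vs) \<in> OU I (Suc k)"
        by (intro OU_degenerate[OF I 1(2)]) (use 1 in auto)
    qed
    finally show ?thesis .
  next
    case 2
    show ?thesis
      unfolding 2(1) d_form_word[OF I 2(2)]
      by (intro free.subspace_sum[OF subspace_OU[OF I]] OU_degenerate[OF I] pd_P_tilde 2(2)) (use 2 in \<open>auto simp: W_tilde_basis\<close>)
  qed
qed

text \<open>On representatives the square is zero only modulo relations: second derivatives commute,
  and swapping the two new factors costs a degenerate tensor. Symmetrising doubles the sum, hence
  the factor \<open>1 / 2\<close>.\<close>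

lemma d_form_d_form:
  fixes x :: "('a, 'k::field_char_0) pform"
  assumes I: "finite I" and x: "x \<in> OS I k"
  shows "d_form (d_form x) \<in> OU I (Suc (Suc k))"
proof (rule linear_span_into[OF linear_comp[OF linear_d_form linear_d_form] subspace_OU[OF I] x[unfolded OS_span]])
  fix b :: "('a, 'k) pform" assume "b \<in> decomposables k (W_tilde I) (P_tilde I)"
  then obtain p vs where b: "b = p \<otimes>\<^sub>t word_tensor vs" "p \<in> P_tilde I" "length vs = k" "set vs \<subseteq> W_tilde I"
    by (auto simp: decomposables_def)
  let ?z = "\<lambda>i j. pd j (pd i p) \<otimes>\<^sub>t word_tensor (basis j # basis i # vs)"
  have "d_form (d_form b) = (\<Sum>i\<in>I. d_form (pd i p \<otimes>\<^sub>t word_tensor (basis i # vs)))"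
    unfolding b(1) d_form_word[OF I b(2)] by (rule linear_sum[OF linear_d_form])
  also have "\<dots> = (\<Sum>i\<in>I. \<Sum>j\<in>I. ?z i j)"
    by (intro sum.cong refl d_form_word I pd_P_tilde b)
  finally have d: "d_form (d_form b) = (\<Sum>i\<in>I. \<Sum>j\<in>I. ?z i j)" .
  have "?z i j + ?z j i \<in> OU I (Suc (Suc k))" if "i \<in> I" "j \<in> I" for i j
  proof -
    have "pd j (pd i p) \<otimes>\<^sub>t word_tensor ([] @ basis j # basis i # vs) + pd j (pd i p) \<otimes>\<^sub>t word_tensor ([] @ basis i # basis j # vs)
        \<in> free.span (degenerates (Suc (Suc k)) (W_tilde I) (W_rel I) (P_tilde I))"
      by (rule swap_degenerates[OF subspace_W_tilde]) (use b that W_tilde_basis in \<open>auto intro!: pd_P_tilde\<close>)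
    moreover have "free.span (degenerates (Suc (Suc k)) (W_tilde I) (W_rel I) (P_tilde I)) \<subseteq> OU I (Suc (Suc k))"
      unfolding OU_span[OF I] by (rule free.span_mono) simp
    ultimately show ?thesis unfolding pd_commute[of i j p] by auto
  qed
  then have "(\<Sum>i\<in>I. \<Sum>j\<in>I. ?z i j + ?z j i) \<in> OU I (Suc (Suc k))"
    by (intro free.subspace_sum[OF subspace_OU[OF I]])
  moreover have "(\<Sum>i\<in>I. \<Sum>j\<in>I. ?z i j + ?z j i) = d_form (d_form b) + d_form (d_form b)"
    unfolding d sum.distrib by (rule arg_cong2[where f = "(+)", OF refl sum.swap])
  ultimately have "scale (1 / 2) (d_form (d_form b) + d_form (d_form b)) \<in> OU I (Suc (Suc k))"
    using free.subspace_scale[OF subspace_OU[OF I]] by metis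
  moreover have "scale (1 / 2) (d_form (d_form b) + d_form (d_form b)) = d_form (d_form b)"
    by (simp add: free.scale_right_distrib free.scale_left_distrib[symmetric])
  ultimately show "d_form (d_form b) \<in> OU I (Suc (Suc k))" by simp
qed

section \<open>Pullback of forms\<close>

definition pull_vec :: "'a set \<Rightarrow> ('a \<Rightarrow> 'b) \<Rightarrow> ('b \<Rightarrow>\<^sub>0 'k::field) \<Rightarrow> ('a \<Rightarrow>\<^sub>0 'k)" where
  "pull_vec I \<alpha> = lin_ext (\<lambda>j. \<Sum>i | i \<in> I \<and> \<alpha> i = j. basis i)"

lemma linear_pull_vec: "Vector_Spaces.linear scale scale (pull_vec I \<alpha>)"
  unfolding pull_vec_def by (rule linear_lin_ext)

lemma pull_vec_basis: "pull_vec I \<alpha> (basis j) = (\<Sum>i | i \<in> I \<and> \<alpha> i = j. basis i)"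
  by (simp add: pull_vec_def)

lemma pull_vec_W_tilde: "finite I \<Longrightarrow> pull_vec I \<alpha> v \<in> W_tilde I"
  unfolding pull_vec_def lin_ext_def
  by (intro free.subspace_sum[OF subspace_W_tilde] free.subspace_scale[OF subspace_W_tilde] W_tilde_basis) auto

lemma pull_vec_W_rel:
  fixes v :: "'b \<Rightarrow>\<^sub>0 'k::field"
  assumes "finite I" "finite J" "\<alpha> \<in> I \<rightarrow> J" "v \<in> W_rel J"
  shows "pull_vec I \<alpha> v \<in> W_rel I"
proof -
  obtain c where v: "v = scale c (\<Sum>j\<in>J. basis j)" using assms(4) by (auto simp: W_rel_def)
  have "(\<Sum>j\<in>J. \<Sum>i | i \<in> I \<and> \<alpha> i = j. basis i) = (\<Sum>i\<in>I. basis i :: 'a \<Rightarrow>\<^sub>0 'k)"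
    by (rule sum.group) (use assms in auto)
  then have "pull_vec I \<alpha> v = scale c (\<Sum>i\<in>I. basis i)"
    by (simp only: v linear_scale[OF linear_pull_vec] linear_sum[OF linear_pull_vec] pull_vec_basis)
  then show ?thesis by (auto simp: W_rel_def)
qed

lemma pull_form_word:
  "pull_form I \<alpha> (p \<otimes>\<^sub>t word_tensor vs) = pull_poly I \<alpha> p \<otimes>\<^sub>t word_tensor (map (pull_vec I \<alpha>) vs)"
  unfolding pull_form_def lin_ext_tens_product lin_ext_word_tensor pull_poly_def ev_def pull_vec_def ..

lemma pull_form_OS:
  fixes x :: "('b, 'k::field) pform"
  assumes I: "finite I" and x: "x \<in> OS J k"
  shows "pull_form I \<alpha> x \<in> OS I k"
proof (rule linear_span_into[OF linear_pull_form subspace_OS x[unfolded OS_span]])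
  fix b :: "('b, 'k) pform" assume "b \<in> decomposables k (W_tilde J) (P_tilde J)"
  then obtain p vs where b: "b = p \<otimes>\<^sub>t word_tensor vs" "length vs = k"
    by (auto simp: decomposables_def)
  show "pull_form I \<alpha> b \<in> OS I k"
    unfolding b(1) pull_form_word
    by (intro OS_I pull_poly_P_tilde) (use b(2) pull_vec_W_tilde[OF I] in auto)
qed

lemma pull_form_OU:
  fixes x :: "('b, 'k::field) pform"
  assumes I: "finite I" "finite J" "\<alpha> \<in> I \<rightarrow> J" and x: "x \<in> OU J k"
  shows "pull_form I \<alpha> x \<in> OU I k"
proof (rule linear_span_into[OF linear_pull_form subspace_OU[OF I(1)] x[unfolded OU_span[OF I(2)]]])
  fix b :: "('b, 'k) pform"
  assume "b \<in> decomposables k (W_tilde J) (P_ideal J) \<union> degenerates k (W_tilde J) (W_rel J) (P_tilde J)"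
  then consider p vs where "b = p \<otimes>\<^sub>t word_tensor vs" "p \<in> P_ideal J" "length vs = k"
    | p vs where "b = p \<otimes>\<^sub>t word_tensor vs" "length vs = k" "\<not> distinct vs \<or> set vs \<inter> W_rel J \<noteq> {}"
    unfolding decomposables_def degenerates_def by blast
  then show "pull_form I \<alpha> b \<in> OU I k"
  proof cases
    case 1
    then show ?thesis unfolding 1(1) pull_form_word
      by (intro OU_I pull_poly_ideal[OF I] I(1)) (use pull_vec_W_tilde[OF I(1)] in auto)
  next
    case 2
    have "\<not> distinct (map (pull_vec I \<alpha>) vs) \<or> set (map (pull_vec I \<alpha>) vs) \<inter> W_rel I \<noteq> {}"
      using 2(3) pull_vec_W_rel[OF I] by (auto simp: distinct_map)
    then show ?thesis unfolding 2(1) pull_form_word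
      by (intro OU_degenerate[OF I(1)] pull_poly_P_tilde) (use 2 pull_vec_W_tilde[OF I(1)] in auto)
  qed
qed

lemma pull_vec_pull_vec:
  fixes v :: "'c \<Rightarrow>\<^sub>0 'k::field"
  assumes "finite I" "finite J" "\<alpha> \<in> I \<rightarrow> J"
  shows "pull_vec I \<alpha> (pull_vec J \<beta> v) = pull_vec I (\<beta> \<circ> \<alpha>) v"
proof (rule linear_eq_on_basis[where x = v, OF linear_comp[OF linear_pull_vec linear_pull_vec] linear_pull_vec])
  fix l
  have "(\<Sum>j | j \<in> J \<and> \<beta> j = l. \<Sum>i | i \<in> I \<and> \<alpha> i = j. basis i) = (\<Sum>i | i \<in> I \<and> \<beta> (\<alpha> i) = l. basis i :: 'a \<Rightarrow>\<^sub>0 'k)"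
  proof -
    have "(\<Sum>i | i \<in> I \<and> \<beta> (\<alpha> i) = l. basis i :: 'a \<Rightarrow>\<^sub>0 'k) =
      (\<Sum>j\<in>{j \<in> J. \<beta> j = l}. \<Sum>i\<in>{i \<in> {i \<in> I. \<beta> (\<alpha> i) = l}. \<alpha> i = j}. basis i)"
      by (rule sum.group[symmetric]) (use assms in auto)
    also have "\<dots> = (\<Sum>j | j \<in> J \<and> \<beta> j = l. \<Sum>i | i \<in> I \<and> \<alpha> i = j. basis i)"
      by (intro sum.cong refl) auto
    finally show ?thesis ..
  qed
  then show "pull_vec I \<alpha> (pull_vec J \<beta> (basis l)) = (pull_vec I (\<beta> \<circ> \<alpha>) (basis l) :: 'a \<Rightarrow>\<^sub>0 'k)"
    by (simp add: pull_vec_basis linear_sum[OF linear_pull_vec])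
qed

lemma pull_form_pull_form:
  fixes x :: "('c, 'k::field) pform"
  assumes I: "finite I" "finite J" "\<alpha> \<in> I \<rightarrow> J" and x: "x \<in> OS L k"
  shows "pull_form I \<alpha> (pull_form J \<beta> x) = pull_form I (\<beta> \<circ> \<alpha>) x"
proof (rule linear_eq_on_span[OF linear_comp[OF linear_pull_form linear_pull_form] linear_pull_form x[unfolded OS_span]])
  fix b :: "('c, 'k) pform" assume "b \<in> decomposables k (W_tilde L) (P_tilde L)"
  then obtain p vs where b: "b = p \<otimes>\<^sub>t word_tensor vs" by (auto simp: decomposables_def)
  have "pull_vec I \<alpha> \<circ> pull_vec J \<beta> = (pull_vec I (\<beta> \<circ> \<alpha>) :: ('c \<Rightarrow>\<^sub>0 'k) \<Rightarrow> _)"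
    by (rule ext) (simp add: pull_vec_pull_vec[OF I])
  then show "pull_form I \<alpha> (pull_form J \<beta> b) = pull_form I (\<beta> \<circ> \<alpha>) b"
    by (simp add: b pull_form_word pull_poly_pull_poly[OF I(1,3,2)] del: word_tensor.simps)
qed

lemma pull_form_cong:
  assumes "\<And>i. i \<in> I \<Longrightarrow> \<alpha> i = \<beta> i"
  shows "pull_form I \<alpha> x = pull_form I \<beta> x"
proof -
  have "{i. i \<in> I \<and> \<alpha> i = j} = {i. i \<in> I \<and> \<beta> i = j}" for j using assms by auto
  then show ?thesis by (simp add: pull_form_def)
qed

lemma pull_form_id:
  fixes x :: "('a, 'k::field) pform"
  assumes x: "x \<in> OS I k"
  shows "pull_form I (\<lambda>i. i) x = x"
proof (rule linear_eq_on_span[OF linear_pull_form linear_id x[unfolded OS_span]])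
  fix b :: "('a, 'k) pform" assume "b \<in> decomposables k (W_tilde I) (P_tilde I)"
  then obtain p vs where b: "b = p \<otimes>\<^sub>t word_tensor vs" "p \<in> P_tilde I" "set vs \<subseteq> W_tilde I" by (auto simp: decomposables_def)
  have "pull_vec I (\<lambda>i. i) v = v" if "v \<in> W_tilde I" for v :: "'a \<Rightarrow>\<^sub>0 'k"
  proof (rule linear_eq_on_basis[where x = v, OF linear_pull_vec linear_id])
    fix j assume "j \<in> Poly_Mapping.keys v"
    then have "{i. i \<in> I \<and> i = j} = {j}" using that by (auto simp: W_tilde_def)
    then show "pull_vec I (\<lambda>i. i) (basis j) = (basis j :: 'a \<Rightarrow>\<^sub>0 'k)" by (simp add: pull_vec_basis)
  qed
  then have "map (pull_vec I (\<lambda>i. i)) vs = vs" using b(3) by (intro map_idI) auto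
  then show "pull_form I (\<lambda>i. i) b = b" by (simp add: b(1) pull_form_word rs_id[OF b(2)])
qed

text \<open>By the chain rule both sides are sums over \<open>I\<close>; on the left they arrive
  grouped by the fibres of \<open>\<alpha>\<close>.\<close>

lemma pull_form_d_form:
  fixes x :: "('b, 'k::field) pform"
  assumes I: "finite I" "finite J" "\<alpha> \<in> I \<rightarrow> J" and x: "x \<in> OS J k"
  shows "pull_form I \<alpha> (d_form x) = d_form (pull_form I \<alpha> x)"
proof (rule linear_eq_on_span[OF linear_comp[OF linear_d_form linear_pull_form] linear_comp[OF linear_pull_form linear_d_form] x[unfolded OS_span]])
  fix b :: "('b, 'k) pform" assume "b \<in> decomposables k (W_tilde J) (P_tilde J)"
  then obtain p vs where b: "b = p \<otimes>\<^sub>t word_tensor vs" "p \<in> P_tilde J" by (auto simp: decomposables_def)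
  let ?vs = "map (pull_vec I \<alpha>) vs"
  have lw: "Vector_Spaces.linear scale scale (\<lambda>v. q \<otimes>\<^sub>t word_tensor (v # ?vs))" for q :: "('a, 'k) mpoly"
    using linear_comp[OF linear_word_tensor[of "[]" ?vs] linear_tens_right[of q]] by simp
  have "pull_form I \<alpha> (d_form b) = (\<Sum>j\<in>J. pull_poly I \<alpha> (pd j p) \<otimes>\<^sub>t word_tensor (pull_vec I \<alpha> (basis j) # ?vs))"
    unfolding b(1) d_form_word[OF I(2) b(2)] by (simp only: linear_sum[OF linear_pull_form] pull_form_word list.map)
  also have "\<dots> = (\<Sum>j\<in>J. \<Sum>i | i \<in> I \<and> \<alpha> i = j. pull_poly I \<alpha> (pd j p) \<otimes>\<^sub>t word_tensor (basis i # ?vs))"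
    by (simp only: pull_vec_basis linear_sum[OF lw])
  also have "\<dots> = (\<Sum>j\<in>J. \<Sum>i | i \<in> I \<and> \<alpha> i = j. pull_poly I \<alpha> (pd (\<alpha> i) p) \<otimes>\<^sub>t word_tensor (basis i # ?vs))"
    by (intro sum.cong refl) auto
  also have "\<dots> = (\<Sum>i\<in>I. pull_poly I \<alpha> (pd (\<alpha> i) p) \<otimes>\<^sub>t word_tensor (basis i # ?vs))"
    by (rule sum.group) (use I in auto)
  also have "\<dots> = (\<Sum>i\<in>I. pd i (pull_poly I \<alpha> p) \<otimes>\<^sub>t word_tensor (basis i # ?vs))"
    by (intro sum.cong refl) (simp add: pd_pull_poly[OF I(1)])
  also have "\<dots> = d_form (pull_form I \<alpha> b)"
    unfolding b(1) pull_form_word by (rule d_form_word[OF I(1) pull_poly_P_tilde, symmetric])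
  finally show "pull_form I \<alpha> (d_form b) = d_form (pull_form I \<alpha> b)" .
qed


subsection \<open>Pushforward\<close>

text \<open>The polynomial part of \<open>push_form\<close>. The factorial converts
  \<open>t^\<nu>\<close> into the divided power on which the pushforward is prescribed.\<close>

definition push_poly :: "'a set \<Rightarrow> 'b set \<Rightarrow> ('a \<Rightarrow> 'b) \<Rightarrow> ('a, 'k::field_char_0) mpoly \<Rightarrow> ('b, 'k) mpoly" where
  "push_poly I J \<sigma> = lin_ext (\<lambda>\<nu>. scale (fact_mon \<nu>) (divided (push_exp I J \<sigma> \<nu>)))"

definition push_vec :: "('a \<Rightarrow> 'b) \<Rightarrow> ('a \<Rightarrow>\<^sub>0 'k::field) \<Rightarrow> ('b \<Rightarrow>\<^sub>0 'k)" where
  "push_vec \<sigma> = lin_ext (\<lambda>i. basis (\<sigma> i))"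

lemma linear_push_poly: "Vector_Spaces.linear scale scale (push_poly I J \<sigma>)"
  unfolding push_poly_def by (rule linear_lin_ext)

lemma push_form_word:
  fixes p :: "('a, 'k::field_char_0) mpoly"
  shows "push_form I J \<sigma> (p \<otimes>\<^sub>t word_tensor vs) = push_poly I J \<sigma> p \<otimes>\<^sub>t word_tensor (map (push_vec \<sigma>) vs)"
proof -
  have "basis (map \<sigma> l) = (word_tensor (map (\<lambda>i. basis (\<sigma> i)) l) :: _ \<Rightarrow>\<^sub>0 'k)" for l
    using word_tensor_basis[of "map \<sigma> l", where 'b = 'k] by (simp add: comp_def)
  then show ?thesis
    unfolding push_form_def by (simp only: lin_ext_tens_product lin_ext_word_tensor push_poly_def push_vec_def)
qed

lemma lookup_push_exp:
  assumes "finite J"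
  shows "Poly_Mapping.lookup (push_exp I J \<sigma> \<nu>) j =
    (if j \<in> J then (\<Sum>i | i \<in> I \<and> \<sigma> i = j. Poly_Mapping.lookup \<nu> i + 1) - 1 else 0)"
  using assms by (simp add: push_exp_def lookup_sum lookup_single when_def)

lemma keys_push_exp: "finite J \<Longrightarrow> Poly_Mapping.keys (push_exp I J \<sigma> \<nu>) \<subseteq> J"
  by (auto simp: in_keys_iff lookup_push_exp split: if_splits)

lemma push_poly_P_tilde: "finite J \<Longrightarrow> push_poly I J \<sigma> p \<in> P_tilde J"
  unfolding push_poly_def lin_ext_def divided_def
  by (intro P_tilde_closed P_tildeI) (auto simp: lookup_single when_def dest: subsetD[OF keys_push_exp] split: if_splits)

lemma push_vec_W_dual:
  fixes v :: "'a \<Rightarrow>\<^sub>0 'k::field"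
  assumes I: "finite I" "\<sigma> ` I = J" and v: "v \<in> fst (W_dual_sq I)"
  shows "push_vec \<sigma> v \<in> fst (W_dual_sq J)"
proof -
  have J: "finite J" using I by auto
  have k: "Poly_Mapping.keys v \<subseteq> I" "(\<Sum>i\<in>I. Poly_Mapping.lookup v i) = 0" using v W_dual_iff[OF I(1)] by auto
  have e: "push_vec \<sigma> v = (\<Sum>i\<in>I. scale (Poly_Mapping.lookup v i) (basis (\<sigma> i)))"
    unfolding push_vec_def by (rule lin_ext_superset[OF I(1) k(1)])
  have "Poly_Mapping.keys (push_vec \<sigma> v) \<subseteq> J"
  proof -
    have "push_vec \<sigma> v \<in> W_tilde J" unfolding e
      by (intro free.subspace_sum[OF subspace_W_tilde] free.subspace_scale[OF subspace_W_tilde] W_tilde_basis) (use I in auto)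
    then show ?thesis by (simp add: W_tilde_def)
  qed
  moreover have "(\<Sum>j\<in>J. Poly_Mapping.lookup (push_vec \<sigma> v) j) = (\<Sum>i\<in>I. \<Sum>j\<in>J. if \<sigma> i = j then Poly_Mapping.lookup v i else 0)"
    unfolding e lookup_sum by (subst sum.swap) (intro sum.cong refl, simp add: lookup_single when_def)
  moreover have "(\<Sum>i\<in>I. \<Sum>j\<in>J. if \<sigma> i = j then Poly_Mapping.lookup v i else 0) = (\<Sum>i\<in>I. Poly_Mapping.lookup v i)"
    by (intro sum.cong refl) (use J I in auto)
  ultimately show ?thesis using k by (simp add: W_dual_iff[OF J])
qed

lemma push_form_TS:
  fixes x :: "('a, 'k::field_char_0) pform"
  assumes I: "finite I" "\<sigma> ` I = J" and x: "x \<in> TS I m"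
  shows "push_form I J \<sigma> x \<in> TS J m"
proof (rule linear_span_into[OF linear_push_form subspace_TS x[unfolded TS_span]])
  have J: "finite J" using I by auto
  fix b :: "('a, 'k) pform" assume "b \<in> decomposables m (fst (W_dual_sq I)) (P_tilde I)"
  then obtain p vs where b: "b = p \<otimes>\<^sub>t word_tensor vs" "length vs = m" "set vs \<subseteq> fst (W_dual_sq I)"
    by (auto simp: decomposables_def)
  show "push_form I J \<sigma> b \<in> TS J m"
    unfolding b(1) push_form_word
    by (intro TS_I push_poly_P_tilde J) (use b push_vec_W_dual[OF I] in auto)
qed

text \<open>Integration over the fibres. Induction on \<open>\<mu>\<close>: a further
  \<open>t_j\<close> pulls back to the sum of the \<open>t_i\<close> over its fibre, and absorbing
  any one of these into \<open>t^\<nu>\<close> raises the pushed exponent at \<open>j\<close> by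
  one.\<close>

lemma integral_push_monomial:
  fixes \<nu> :: "'a \<Rightarrow>\<^sub>0 nat"
  assumes I: "finite I" "I \<noteq> {}" "\<sigma> ` I = J" and nu: "Poly_Mapping.keys \<nu> \<subseteq> I"
    and mu: "Poly_Mapping.keys \<mu> \<subseteq> J"
  shows "simplex_integral_tilde I (basis \<nu> * pull_poly I \<sigma> (basis \<mu>)) =
    fact_mon \<nu> * (simplex_integral_tilde J (divided (push_exp I J \<sigma> \<nu>) * basis \<mu>) :: 'k::field_char_0)"
  using nu mu
proof (induction \<mu> arbitrary: \<nu> rule: exp_induct)
  \<comment> \<open>Because of the shift by one at every vertex, the degree of the pushed exponent
    plus \<open>|J|\<close> is the degree of \<open>\<nu>\<close> plus \<open>|I|\<close>, so both
    integrals have the same factorial.\<close>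
  case zero
  have J: "finite J" "J \<noteq> {}" using I by auto
  have "(\<Sum>j\<in>J. \<Sum>i | i \<in> I \<and> \<sigma> i = j. Poly_Mapping.lookup \<nu> i + 1) = (\<Sum>i\<in>I. Poly_Mapping.lookup \<nu> i + 1)"
    by (rule sum.group) (use I J in auto)
  moreover have "(\<Sum>j\<in>J. \<Sum>i | i \<in> I \<and> \<sigma> i = j. Poly_Mapping.lookup \<nu> i + 1) =
      (\<Sum>j\<in>J. Poly_Mapping.lookup (push_exp I J \<sigma> \<nu>) j + 1)"
  proof (intro sum.cong refl)
    fix j assume j: "j \<in> J"
    then obtain i where "i \<in> I" "\<sigma> i = j" using I by auto
    then have "(\<Sum>i | i \<in> I \<and> \<sigma> i = j. Poly_Mapping.lookup \<nu> i + 1) \<ge> 1"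
      using member_le_sum[of i "{i. i \<in> I \<and> \<sigma> i = j}" "\<lambda>i. Poly_Mapping.lookup \<nu> i + 1"] I(1) by auto
    then show "(\<Sum>i | i \<in> I \<and> \<sigma> i = j. Poly_Mapping.lookup \<nu> i + 1) = Poly_Mapping.lookup (push_exp I J \<sigma> \<nu>) j + 1"
      using j by (simp add: lookup_push_exp[OF J(1)])
  qed
  ultimately have "(\<Sum>j\<in>J. Poly_Mapping.lookup (push_exp I J \<sigma> \<nu>) j) + card J = (\<Sum>i\<in>I. Poly_Mapping.lookup \<nu> i) + card I"
    by (simp only: sum.distrib card_eq_sum)
  moreover have "card J \<ge> 1" "card I \<ge> 1" using I J by (simp_all add: Suc_leI card_gt_0_iff)
  ultimately have "card J - 1 + (\<Sum>j\<in>J. Poly_Mapping.lookup (push_exp I J \<sigma> \<nu>) j) = card I - 1 + (\<Sum>i\<in>I. Poly_Mapping.lookup \<nu> i)"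
    by linarith
  then have "simplex_integral_tilde I (basis \<nu>) = fact_mon \<nu> * (simplex_integral_tilde J (divided (push_exp I J \<sigma> \<nu>)) :: 'k)"
    by (simp only: simplex_integral_tilde_divided integral_basis) simp
  then show ?case by simp
next
  case (step \<mu> j)
  have fin: "finite {i. i \<in> I \<and> \<sigma> i = j}" using I by simp
  have J: "finite J" using I by auto
  have jJ: "j \<in> J" and muJ: "Poly_Mapping.keys \<mu> \<subseteq> J" using step.prems(2) by (auto simp: keys_add_nat)
  have b: "basis (\<mu> + Poly_Mapping.single j 1) = (tvar j * basis \<mu> :: ('b, 'k) mpoly)"
    by (simp add: tvar_def mult_basis add.commute)
  let ?\<pi> = "push_exp I J \<sigma> \<nu>"
  have trm: "simplex_integral_tilde I (basis \<nu> * (tvar i * pull_poly I \<sigma> (basis \<mu>))) =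
      of_nat (Poly_Mapping.lookup \<nu> i + 1) * fact_mon \<nu> *
        (simplex_integral_tilde J (divided (?\<pi> + Poly_Mapping.single j 1) * basis \<mu>) :: 'k)"
    if i: "i \<in> I" "\<sigma> i = j" for i
  proof -
    let ?\<nu> = "\<nu> + Poly_Mapping.single i 1"
    have "basis \<nu> * (tvar i * pull_poly I \<sigma> (basis \<mu>)) = basis ?\<nu> * (pull_poly I \<sigma> (basis \<mu>) :: ('a, 'k) mpoly)"
      by (simp add: tvar_def mult.assoc[symmetric] mult_basis)
    moreover have "simplex_integral_tilde I (basis ?\<nu> * pull_poly I \<sigma> (basis \<mu>)) =
        fact_mon ?\<nu> * (simplex_integral_tilde J (divided (push_exp I J \<sigma> ?\<nu>) * basis \<mu>) :: 'k)"
      by (rule step.IH[OF _ muJ]) (use step.prems i in \<open>simp add: keys_add_nat\<close>)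
    moreover have "push_exp I J \<sigma> ?\<nu> = ?\<pi> + Poly_Mapping.single j 1"
    proof (rule poly_mapping_eqI)
      fix k
      show "Poly_Mapping.lookup (push_exp I J \<sigma> ?\<nu>) k = Poly_Mapping.lookup (?\<pi> + Poly_Mapping.single j 1) k"
      proof (cases "k = j")
        case True
        let ?A = "{i. i \<in> I \<and> \<sigma> i = j}"
        have "(\<Sum>i'\<in>?A. Poly_Mapping.lookup ?\<nu> i' + 1) = (\<Sum>i'\<in>?A. Poly_Mapping.lookup \<nu> i' + 1) + (\<Sum>i'\<in>?A. if i' = i then 1 else 0)"
          unfolding sum.distrib[symmetric] by (intro sum.cong refl) (simp add: lookup_add lookup_single when_def)
        moreover have "(\<Sum>i'\<in>?A. if i' = i then 1 else 0 :: nat) = 1" using fin i by simp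
        moreover have "(\<Sum>i'\<in>?A. Poly_Mapping.lookup \<nu> i' + 1) \<ge> 1"
          using member_le_sum[of i ?A "\<lambda>i. Poly_Mapping.lookup \<nu> i + 1"] fin i by auto
        ultimately show ?thesis using True i I(3)
          by (auto simp: lookup_push_exp[OF J] lookup_add)
      next
        case False
        have "(\<Sum>i' | i' \<in> I \<and> \<sigma> i' = k. Poly_Mapping.lookup ?\<nu> i' + 1) = (\<Sum>i' | i' \<in> I \<and> \<sigma> i' = k. Poly_Mapping.lookup \<nu> i' + 1)"
          by (intro sum.cong refl) (use False i in \<open>auto simp: lookup_add lookup_single when_def\<close>)
        then show ?thesis using False by (simp add: lookup_push_exp[OF J] lookup_add lookup_single)
      qed
    qed
    ultimately show ?thesis by (simp only: fact_mon_add_single)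
  qed
  \<comment> \<open>The factors \<open>\<nu>_i + 1\<close> over the fibre add up to the pushed
    exponent at \<open>j\<close> plus one, which is the factor by which multiplication with
    \<open>t_j\<close> changes a divided power.\<close>
  have cnt: "(\<Sum>i | i \<in> I \<and> \<sigma> i = j. of_nat (Poly_Mapping.lookup \<nu> i + 1) :: 'k) *
      simplex_integral_tilde J (divided (?\<pi> + Poly_Mapping.single j 1) * basis \<mu>) =
      simplex_integral_tilde J (divided ?\<pi> * (tvar j * basis \<mu>))"
  proof -
    let ?A = "{i. i \<in> I \<and> \<sigma> i = j}"
    obtain i where i: "i \<in> ?A" using jJ I(3) by auto
    have "(\<Sum>i\<in>?A. Poly_Mapping.lookup \<nu> i + 1) \<ge> 1"
      using member_le_sum[of i ?A "\<lambda>i. Poly_Mapping.lookup \<nu> i + 1"] fin i by auto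
    then have s: "(\<Sum>i\<in>?A. Poly_Mapping.lookup \<nu> i + 1) = Poly_Mapping.lookup ?\<pi> j + 1"
      using jJ by (simp add: lookup_push_exp[OF J])
    have "(\<Sum>i\<in>?A. of_nat (Poly_Mapping.lookup \<nu> i + 1) :: 'k) = of_nat (\<Sum>i\<in>?A. Poly_Mapping.lookup \<nu> i + 1)"
      by (rule of_nat_sum[symmetric])
    then have s': "(\<Sum>i\<in>?A. of_nat (Poly_Mapping.lookup \<nu> i + 1) :: 'k) = of_nat (Poly_Mapping.lookup ?\<pi> j + 1)"
      by (simp only: s)
    have n: "of_nat (Poly_Mapping.lookup ?\<pi> j + 1) \<noteq> (0 :: 'k)" using of_nat_neq_0[of "Poly_Mapping.lookup ?\<pi> j"] by simp
    have e: "scale (of_nat (Poly_Mapping.lookup ?\<pi> j + 1)) (divided (?\<pi> + Poly_Mapping.single j 1)) = (divided ?\<pi> * tvar j :: ('b, 'k) mpoly)"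
      unfolding divided_def fact_mon_add_single tvar_def mult_single scale_single using n by simp
    have "divided ?\<pi> * (tvar j * basis \<mu>) =
        (scale (of_nat (Poly_Mapping.lookup ?\<pi> j + 1)) (divided (?\<pi> + Poly_Mapping.single j 1) * basis \<mu>) :: ('b, 'k) mpoly)"
      by (simp only: mult.assoc[symmetric] e[symmetric] scale_mult_left)
    then show ?thesis by (simp only: s' linear_scale[OF linear_integral])
  qed
  have "simplex_integral_tilde I (basis \<nu> * pull_poly I \<sigma> (basis (\<mu> + Poly_Mapping.single j 1))) =
      (\<Sum>i | i \<in> I \<and> \<sigma> i = j. simplex_integral_tilde I (basis \<nu> * (tvar i * pull_poly I \<sigma> (basis \<mu>))) :: 'k)"
    unfolding b pull_poly_mult pull_poly_tvar sum_distrib_right sum_distrib_left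
    by (rule linear_sum[OF linear_integral])
  also have "\<dots> = (\<Sum>i | i \<in> I \<and> \<sigma> i = j. of_nat (Poly_Mapping.lookup \<nu> i + 1) * (fact_mon \<nu> *
        simplex_integral_tilde J (divided (?\<pi> + Poly_Mapping.single j 1) * basis \<mu>)))"
    by (intro sum.cong refl) (simp only: trm mem_Collect_eq mult.assoc)
  also have "\<dots> = fact_mon \<nu> * simplex_integral_tilde J (divided ?\<pi> * (tvar j * basis \<mu>))"
    unfolding cnt[symmetric] sum_distrib_right[symmetric] by (rule mult.left_commute)
  finally show ?case unfolding b .
qed

lemma integral_push:
  fixes p :: "('a, 'k::field_char_0) mpoly"
  assumes I: "finite I" "I \<noteq> {}" "\<sigma> ` I = J" and p: "p \<in> P_tilde I" and q: "q \<in> P_tilde J"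
  shows "simplex_integral_tilde J (push_poly I J \<sigma> p * q) = simplex_integral_tilde I (p * pull_poly I \<sigma> q)"
proof (rule linear_eq_on_basis[where x = p])
  show "Vector_Spaces.linear scale (*) (\<lambda>p. simplex_integral_tilde J (push_poly I J \<sigma> p * q) :: 'k)"
    by (rule linear_comp[OF linear_push_poly linear_comp[OF linear_mult_left linear_integral]])
  show "Vector_Spaces.linear scale (*) (\<lambda>p. simplex_integral_tilde I (p * pull_poly I \<sigma> q) :: 'k)"
    by (rule linear_comp[OF linear_mult_left linear_integral])
  fix \<nu> assume "\<nu> \<in> Poly_Mapping.keys p"
  then have nu: "Poly_Mapping.keys \<nu> \<subseteq> I" using p by (auto simp: P_tilde_def)
  show "simplex_integral_tilde J (push_poly I J \<sigma> (basis \<nu>) * q) = (simplex_integral_tilde I (basis \<nu> * pull_poly I \<sigma> q) :: 'k)"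
  proof (rule linear_eq_on_basis[where x = q])
    show "Vector_Spaces.linear scale (*) (\<lambda>q. simplex_integral_tilde J (push_poly I J \<sigma> (basis \<nu>) * q) :: 'k)"
      by (rule linear_comp[OF linear_mult_right linear_integral])
    show "Vector_Spaces.linear scale (*) (\<lambda>q. simplex_integral_tilde I (basis \<nu> * pull_poly I \<sigma> q) :: 'k)"
      by (rule linear_comp[OF linear_pull_poly linear_comp[OF linear_mult_right linear_integral]])
    fix \<mu> assume "\<mu> \<in> Poly_Mapping.keys q"
    then have mu: "Poly_Mapping.keys \<mu> \<subseteq> J" using q by (auto simp: P_tilde_def)
    have "push_poly I J \<sigma> (basis \<nu>) = (scale (fact_mon \<nu>) (divided (push_exp I J \<sigma> \<nu>)) :: ('b, 'k) mpoly)"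
      by (simp only: push_poly_def lin_ext_basis)
    then show "simplex_integral_tilde J (push_poly I J \<sigma> (basis \<nu>) * basis \<mu>) = (simplex_integral_tilde I (basis \<nu> * pull_poly I \<sigma> (basis \<mu>)) :: 'k)"
      by (simp only: integral_push_monomial[OF I nu mu] scale_mult_left linear_scale[OF linear_integral])
  qed
qed

lemma apply_dual_push_vec:
  fixes v :: "'a \<Rightarrow>\<^sub>0 'k::field"
  assumes "finite I" "Poly_Mapping.keys v \<subseteq> I"
  shows "apply_dual (push_vec \<sigma> v) w = apply_dual v (pull_vec I \<sigma> w)"
proof (rule linear_eq_on_basis[where x = w, OF linear_apply_dual linear_comp[OF linear_pull_vec linear_apply_dual]])
  fix j
  show "apply_dual (push_vec \<sigma> v) (basis j) = apply_dual v (pull_vec I \<sigma> (basis j))"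
    unfolding push_vec_def pull_vec_basis by (rule apply_dual_push[OF assms])
qed

text \<open>On decomposable elements the determinants agree, since \<open>push_vec\<close> is dual
  to \<open>pull_vec\<close>, and the polynomial factors are compared by
  \<open>integral_push\<close>.\<close>

lemma integral_pair_push:
  fixes x :: "('a, 'k::field_char_0) pform"
  assumes I: "finite I" "I \<noteq> {}" "\<sigma> ` I = J" and x: "x \<in> TS I m" and w: "w \<in> OS J m"
  shows "simplex_integral_tilde J (pair_form (push_form I J \<sigma> x) w) =
    simplex_integral_tilde I (pair_form x (pull_form I \<sigma> w))"
proof (rule linear_eq_on_span[OF _ _ x[unfolded TS_span]])
  show "Vector_Spaces.linear scale (*) (\<lambda>x. simplex_integral_tilde J (pair_form (push_form I J \<sigma> x) w) :: 'k)"
    by (rule linear_comp[OF linear_push_form linear_comp[OF linear_pair_form_left linear_integral]])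
  show "Vector_Spaces.linear scale (*) (\<lambda>x. simplex_integral_tilde I (pair_form x (pull_form I \<sigma> w)) :: 'k)"
    by (rule linear_comp[OF linear_pair_form_left linear_integral])
  fix z :: "('a, 'k) pform" assume "z \<in> decomposables m (fst (W_dual_sq I)) (P_tilde I)"
  then obtain p vs where z: "z = p \<otimes>\<^sub>t word_tensor vs" and p: "p \<in> P_tilde I" and vs: "length vs = m" "set vs \<subseteq> fst (W_dual_sq I)"
    by (auto simp: decomposables_def)
  show "simplex_integral_tilde J (pair_form (push_form I J \<sigma> z) w) = simplex_integral_tilde I (pair_form z (pull_form I \<sigma> w))"
  proof (rule linear_eq_on_span[OF _ _ w[unfolded OS_span]])
    show "Vector_Spaces.linear scale (*) (\<lambda>w. simplex_integral_tilde J (pair_form (push_form I J \<sigma> z) w) :: 'k)"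
      by (rule linear_comp[OF linear_pair_form_right linear_integral])
    show "Vector_Spaces.linear scale (*) (\<lambda>w. simplex_integral_tilde I (pair_form z (pull_form I \<sigma> w)) :: 'k)"
      by (rule linear_comp[OF linear_pull_form linear_comp[OF linear_pair_form_right linear_integral]])
    fix b :: "('b, 'k) pform" assume "b \<in> decomposables m (W_tilde J) (P_tilde J)"
    then obtain q ws where b: "b = q \<otimes>\<^sub>t word_tensor ws" "q \<in> P_tilde J" "length ws = m"
      by (auto simp: decomposables_def)
    have "mat m m (\<lambda>(i, j). apply_dual (map (push_vec \<sigma>) vs ! i) (ws ! j)) =
        mat m m (\<lambda>(i, j). apply_dual (vs ! i) (map (pull_vec I \<sigma>) ws ! j))"
    proof (rule eq_matI, goal_cases)
      case (1 i j)
      then have "vs ! i \<in> fst (W_dual_sq I)" using vs by auto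
      then have "Poly_Mapping.keys (vs ! i) \<subseteq> I" by (simp add: W_dual_iff[OF I(1)])
      then show ?case using 1 vs b by (simp add: apply_dual_push_vec[OF I(1)])
    qed simp_all
    moreover have "length (map (push_vec \<sigma>) vs) = m" "length (map (pull_vec I \<sigma>) ws) = m" using vs b by auto
    ultimately show "simplex_integral_tilde J (pair_form (push_form I J \<sigma> z) b) = simplex_integral_tilde I (pair_form z (pull_form I \<sigma> b))"
      unfolding z b(1) push_form_word pull_form_word
      by (simp only: pair_form_word[OF _ b(3)] pair_form_word[OF vs(1)] linear_scale[OF linear_integral] integral_push[OF I p b(2)])
  qed
qed


section \<open>Modules over the ground field\<close>

lemma ground_simps [simp]:
  "carrier ground = UNIV" "x \<oplus>\<^bsub>ground\<^esub> y = x + y" "x \<otimes>\<^bsub>ground\<^esub> y = x * y" "\<zero>\<^bsub>ground\<^esub> = 0" "\<one>\<^bsub>ground\<^esub> = 1"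
  "c \<odot>\<^bsub>ground\<^esub> x = c * x"
  by (simp_all add: ground_def)

lemma cring_ground: "cring (ground :: ('k::field, 'k) module)"
proof (rule cringI)
  show "abelian_group (ground :: ('k, 'k) module)"
    by (rule abelian_groupI) (auto simp: algebra_simps intro: exI[of _ "- _"])
  show "comm_monoid (ground :: ('k, 'k) module)"
    by (rule comm_monoidI) (auto simp: algebra_simps)
qed (simp add: algebra_simps)

text \<open>The laws are verified on representatives \<open>C\<close> with operations
  \<open>pl\<close> and \<open>sc\<close> and carried along the surjection \<open>r\<close>. With
  \<open>r\<close> the coset map, the class map \<open>phi\<close> or the identity, this covers
  subquotients, \<open>Phi\<close> and dual spaces.\<close>

lemma quotient_module:
  fixes M :: "('k::field, 'v) module" and r :: "'r \<Rightarrow> 'v"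
  assumes car: "carrier M = r ` C" and z: "z \<in> C" "\<zero>\<^bsub>M\<^esub> = r z"
    and pl: "\<And>x y. x \<in> C \<Longrightarrow> y \<in> C \<Longrightarrow> pl x y \<in> C" "\<And>x y. x \<in> C \<Longrightarrow> y \<in> C \<Longrightarrow> r x \<oplus>\<^bsub>M\<^esub> r y = r (pl x y)"
    and sc: "\<And>c x. x \<in> C \<Longrightarrow> sc c x \<in> C" "\<And>c x. x \<in> C \<Longrightarrow> c \<odot>\<^bsub>M\<^esub> r x = r (sc c x)"
    and laws: "\<And>x y w. x \<in> C \<Longrightarrow> y \<in> C \<Longrightarrow> w \<in> C \<Longrightarrow> pl (pl x y) w = pl x (pl y w)"
      "\<And>x y. x \<in> C \<Longrightarrow> y \<in> C \<Longrightarrow> pl x y = pl y x" "\<And>x. x \<in> C \<Longrightarrow> pl z x = x"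
      "\<And>x. x \<in> C \<Longrightarrow> pl (sc (-1) x) x = z" "\<And>a b x. x \<in> C \<Longrightarrow> sc (a + b) x = pl (sc a x) (sc b x)"
      "\<And>a x y. x \<in> C \<Longrightarrow> y \<in> C \<Longrightarrow> sc a (pl x y) = pl (sc a x) (sc a y)"
      "\<And>a b x. x \<in> C \<Longrightarrow> sc (a * b) x = sc a (sc b x)" "\<And>x. x \<in> C \<Longrightarrow> sc 1 x = x"
  shows "module ground M"
proof (rule moduleI)
  show "abelian_group M"
  proof (rule abelian_groupI)
    fix x assume "x \<in> carrier M"
    then obtain a where a: "a \<in> C" "x = r a" by (auto simp: car)
    then have "r (sc (-1) a) \<oplus>\<^bsub>M\<^esub> x = \<zero>\<^bsub>M\<^esub>" by (simp only: pl(2)[OF sc(1)[OF a(1)] a(1)] a(2) laws(4)[OF a(1)] z(2))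
    then show "\<exists>y\<in>carrier M. y \<oplus>\<^bsub>M\<^esub> x = \<zero>\<^bsub>M\<^esub>" using a sc by (auto simp: car)
    show "x \<oplus>\<^bsub>M\<^esub> y = y \<oplus>\<^bsub>M\<^esub> x" if xy: "x \<in> carrier M" "y \<in> carrier M" for x y
    proof -
      obtain a b where "a \<in> C" "x = r a" "b \<in> C" "y = r b" using xy by (auto simp: car)
      then show ?thesis using laws(2)[of a b] by (simp add: pl(2))
    qed
  qed (auto simp: car pl z laws(1,3))
  show "a \<odot>\<^bsub>M\<^esub> (x \<oplus>\<^bsub>M\<^esub> y) = a \<odot>\<^bsub>M\<^esub> x \<oplus>\<^bsub>M\<^esub> a \<odot>\<^bsub>M\<^esub> y" if "a \<in> carrier ground" "x \<in> carrier M" "y \<in> carrier M" for a x y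
    using that by (auto simp: car pl sc laws(6))
qed (auto simp: cring_ground car pl sc laws)

lemma module_minus:
  assumes "module (ground :: ('k::field, 'k) module) M" "x \<in> carrier M"
  shows "\<ominus>\<^bsub>M\<^esub> x = (-1) \<odot>\<^bsub>M\<^esub> x"
proof -
  interpret module "ground :: ('k, 'k) module" M by fact
  have "(-1) \<odot>\<^bsub>M\<^esub> x \<oplus>\<^bsub>M\<^esub> x = ((-1) + 1) \<odot>\<^bsub>M\<^esub> x"
    using smult_l_distr[of "-1" 1 x] smult_one[OF assms(2)] assms(2) by simp
  also have "\<dots> = \<zero>\<^bsub>M\<^esub>" using smult_l_null[OF assms(2)] by simp
  finally show ?thesis using M.minus_equality[of "(-1) \<odot>\<^bsub>M\<^esub> x" x] smult_closed[of "-1" x] assms(2) by simp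
qed

lemma lin_map_zero:
  assumes "module (ground :: ('k::field, 'k) module) M" "module (ground :: ('k, 'k) module) N" "lin_map M N f"
  shows "f \<zero>\<^bsub>M\<^esub> = \<zero>\<^bsub>N\<^esub>"
proof -
  interpret M: module "ground :: ('k, 'k) module" M by fact
  interpret N: module "ground :: ('k, 'k) module" N by fact
  have f: "f \<in> carrier M \<rightarrow> carrier N" "\<And>c x. x \<in> carrier M \<Longrightarrow> f (c \<odot>\<^bsub>M\<^esub> x) = c \<odot>\<^bsub>N\<^esub> f x"
    using assms(3) by (auto simp: lin_map_def)
  have "f (0 \<odot>\<^bsub>M\<^esub> \<zero>\<^bsub>M\<^esub>) = 0 \<odot>\<^bsub>N\<^esub> f \<zero>\<^bsub>M\<^esub>" by (rule f(2)) simp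
  moreover have "0 \<odot>\<^bsub>M\<^esub> \<zero>\<^bsub>M\<^esub> = \<zero>\<^bsub>M\<^esub>" using M.smult_l_null[of "\<zero>\<^bsub>M\<^esub>"] by simp
  moreover have "0 \<odot>\<^bsub>N\<^esub> f \<zero>\<^bsub>M\<^esub> = \<zero>\<^bsub>N\<^esub>" using N.smult_l_null[of "f \<zero>\<^bsub>M\<^esub>"] f(1) by auto
  ultimately show ?thesis by simp
qed

lemma lin_map_image_submodule:
  assumes M: "module (ground :: ('k::field, 'k) module) M" and N: "module (ground :: ('k, 'k) module) N" and f: "lin_map M N f"
  shows "submodule (f ` carrier M) ground N"
proof -
  interpret M: module "ground :: ('k, 'k) module" M by fact
  interpret N: module "ground :: ('k, 'k) module" N by fact
  have f': "f \<in> carrier M \<rightarrow> carrier N" "\<And>c x. x \<in> carrier M \<Longrightarrow> f (c \<odot>\<^bsub>M\<^esub> x) = c \<odot>\<^bsub>N\<^esub> f x"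
    "\<And>x y. x \<in> carrier M \<Longrightarrow> y \<in> carrier M \<Longrightarrow> f (x \<oplus>\<^bsub>M\<^esub> y) = f x \<oplus>\<^bsub>N\<^esub> f y"
    using f by (auto simp: lin_map_def)
  have sm: "c \<odot>\<^bsub>N\<^esub> y \<in> f ` carrier M" if y: "y \<in> f ` carrier M" for c y
  proof -
    obtain x where x: "x \<in> carrier M" "y = f x" using y by blast
    then have "c \<odot>\<^bsub>N\<^esub> y = f (c \<odot>\<^bsub>M\<^esub> x)" by (simp add: f'(2))
    then show ?thesis using M.smult_closed[of c x] x by auto
  qed
  show ?thesis
  proof (rule N.submoduleI)
    show "f ` carrier M \<subseteq> carrier N" using f'(1) by auto
    show "\<zero>\<^bsub>N\<^esub> \<in> f ` carrier M" using lin_map_zero[OF M N f] M.zero_closed by (metis imageI)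
    show "\<ominus>\<^bsub>N\<^esub> y \<in> f ` carrier M" if "y \<in> f ` carrier M" for y
    proof -
      have "y \<in> carrier N" using that f'(1) by auto
      then show ?thesis unfolding module_minus[OF N \<open>y \<in> carrier N\<close>] by (intro sm that)
    qed
    show "y \<oplus>\<^bsub>N\<^esub> w \<in> f ` carrier M" if yw: "y \<in> f ` carrier M" "w \<in> f ` carrier M" for y w
    proof -
      obtain a b where "a \<in> carrier M" "y = f a" "b \<in> carrier M" "w = f b" using yw by blast
      then have "y \<oplus>\<^bsub>N\<^esub> w = f (a \<oplus>\<^bsub>M\<^esub> b)" "a \<oplus>\<^bsub>M\<^esub> b \<in> carrier M" by (simp_all add: f'(3))
      then show ?thesis by blast
    qed
  qed (use sm in auto)
qed

lemma dual_module_simps [simp]: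
  "carrier (dual_module M) = {f \<in> extensional (carrier M). lin_map M ground f}"
  "f \<oplus>\<^bsub>dual_module M\<^esub> g = (\<lambda>x\<in>carrier M. f x + g x)"
  "\<zero>\<^bsub>dual_module M\<^esub> = (\<lambda>x\<in>carrier M. 0)"
  "c \<odot>\<^bsub>dual_module M\<^esub> f = (\<lambda>x\<in>carrier M. c * f x)"
  by (simp_all add: dual_module_def)

lemma module_dual:
  assumes "module (ground :: ('k::field, 'k) module) M"
  shows "module ground (dual_module M)"
proof -
  interpret module "ground :: ('k, 'k) module" M by fact
  have cl: "x \<in> carrier M \<Longrightarrow> c \<odot>\<^bsub>M\<^esub> x \<in> carrier M" for c x using smult_closed[of c x] by simp
  show ?thesis
  proof (rule quotient_module[where r = "\<lambda>f. f" and C = "carrier (dual_module M)" and z = "\<lambda>x\<in>carrier M. 0"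
        and pl = "\<lambda>f g. \<lambda>x\<in>carrier M. f x + g x" and sc = "\<lambda>c f. \<lambda>x\<in>carrier M. c * f x"])
    show "(\<lambda>x\<in>carrier M. f x + g x) \<in> carrier (dual_module M)" if "f \<in> carrier (dual_module M)" "g \<in> carrier (dual_module M)" for f g
      using that by (auto simp: lin_map_def cl algebra_simps)
    show "(\<lambda>x\<in>carrier M. c * f x) \<in> carrier (dual_module M)" if "f \<in> carrier (dual_module M)" for c f
      using that by (auto simp: lin_map_def cl algebra_simps)
    show "(\<lambda>x\<in>carrier M. 0) \<in> carrier (dual_module M)" by (auto simp: lin_map_def cl)
  qed (auto simp: fun_eq_iff extensional_def algebra_simps)
qed


section \<open>Subquotients\<close>

lemma coset_mem: "y \<in> x +o U \<longleftrightarrow> y - x \<in> U" for x :: "'x \<Rightarrow>\<^sub>0 'k::field"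
  using set_minus_plus[of y x U] by simp

lemma coset_eq_iff:
  fixes x :: "'x \<Rightarrow>\<^sub>0 'k::field"
  assumes "free.subspace U"
  shows "x +o U = y +o U \<longleftrightarrow> x - y \<in> U"
proof
  assume "x +o U = y +o U"
  moreover have "x \<in> x +o U" using free.subspace_0[OF assms] by (simp add: coset_mem)
  ultimately show "x - y \<in> U" by (simp add: coset_mem)
next
  assume xy: "x - y \<in> U"
  have "z - x \<in> U \<longleftrightarrow> z - y \<in> U" for z
    using free.subspace_add[OF assms _ xy, of "z - x"] free.subspace_diff[OF assms _ xy, of "z - y"]
    by (auto simp: algebra_simps)
  then show "x +o U = y +o U" by (auto simp: set_eq_iff coset_mem)
qed

lemma set_plus_mem: "y \<in> A + B \<longleftrightarrow> (\<exists>a\<in>A. \<exists>b\<in>B. y = a + b)" for A :: "'x::plus set"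
  by (auto simp: set_plus_def)

lemma subspace_plus_self: "free.subspace U \<Longrightarrow> U + U = (U :: ('x \<Rightarrow>\<^sub>0 'k::field) set)"
proof
  assume U: "free.subspace U"
  show "U + U \<subseteq> U" using free.subspace_add[OF U] by (auto simp: set_plus_mem)
  show "U \<subseteq> U + U" using set_zero_plus2[OF free.subspace_0[OF U]] .
qed

lemma induced_coset:
  assumes F: "Vector_Spaces.linear scale scale F" and U': "free.subspace U'" and U: "0 \<in> U" "\<And>u. u \<in> U \<Longrightarrow> F u \<in> U'"
  shows "induced U' F (x +o U) = F x +o U'"
proof
  show "induced U' F (x +o U) \<subseteq> F x +o U'"
  proof
    fix y assume "y \<in> induced U' F (x +o U)"
    then obtain u u' where "u \<in> U" "u' \<in> U'" "y = F (x + u) + u'"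
      by (auto simp: induced_def set_plus_mem elt_set_plus_def)
    then show "y \<in> F x +o U'"
      using free.subspace_add[OF U' U(2)] by (simp add: coset_mem linear_add[OF F] add.assoc)
  qed
  show "F x +o U' \<subseteq> induced U' F (x +o U)"
  proof
    fix y assume "y \<in> F x +o U'"
    then have "y - F x \<in> U'" "y = F x + (y - F x)" by (simp_all add: coset_mem)
    moreover have "F x \<in> F ` (x +o U)" using U(1) by (auto simp: coset_mem)
    ultimately show "y \<in> induced U' F (x +o U)" unfolding induced_def by (metis set_plus_intro)
  qed
qed

lemma image_coset_functional:
  assumes f: "Vector_Spaces.linear scale (*) f" and U: "0 \<in> U" "\<And>u. u \<in> U \<Longrightarrow> f u = 0"
  shows "f ` (x +o U) = {f x}"
  using U by (auto simp: elt_set_plus_def linear_add[OF f] image_iff intro!: bexI[of _ 0])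

context
  fixes X :: "('x, 'k::field) subquot"
  assumes S: "free.subspace (fst X)" and U: "free.subspace (snd X)"
begin

lemma quot_carrier: "carrier (quot X) = (\<lambda>x. x +o snd X) ` fst X"
  and quot_zero: "\<zero>\<^bsub>quot X\<^esub> = 0 +o snd X"
  by (simp_all add: quot_def)

lemma quot_add: "(x +o snd X) \<oplus>\<^bsub>quot X\<^esub> (y +o snd X) = (x + y) +o snd X"
  by (simp add: quot_def set_plus_rearrange subspace_plus_self[OF U])

lemma quot_smult: "c \<odot>\<^bsub>quot X\<^esub> (x +o snd X) = scale c x +o snd X"
proof -
  have "induced (snd X) (scale c) (x +o snd X) = scale c x +o snd X"
    by (rule induced_coset[OF _ U free.subspace_0[OF U] free.subspace_scale[OF U]])
       (simp_all add: free_linearI free.scale_right_distrib mult.commute)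
  then show ?thesis by (simp add: quot_def induced_def)
qed

lemma module_quot: "module ground (quot X)"
  by (rule quotient_module[where r = "\<lambda>x. x +o snd X" and C = "fst X" and z = 0 and pl = "(+)" and sc = scale])
     (auto simp: quot_carrier quot_zero quot_add quot_smult free.subspace_0[OF S] free.subspace_add[OF S]
       free.subspace_scale[OF S] algebra_simps free.scale_right_distrib free.scale_left_distrib)

lemma quot_finsum:
  assumes "finite A" "\<And>a. a \<in> A \<Longrightarrow> g a \<in> fst X"
  shows "(\<Oplus>\<^bsub>quot X\<^esub>a\<in>A. g a +o snd X) = (\<Sum>a\<in>A. g a) +o snd X"
proof -
  interpret module "ground :: ('k, 'k) module" "quot X" by (rule module_quot)
  show ?thesis
    using assms
  proof (induction A rule: finite_induct)
    case empty
    then show ?case by (simp add: quot_zero)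
  next
    case (insert a A)
    then have "(\<lambda>a. g a +o snd X) \<in> A \<rightarrow> carrier (quot X)" "g a +o snd X \<in> carrier (quot X)"
      by (auto simp: quot_carrier)
    then show ?case using insert by (simp add: M.finsum_insert quot_add)
  qed
qed

end


section \<open>Quasi-isomorphisms\<close>

lemma coset_def_module: "H +>\<^bsub>M\<^esub> a = (\<lambda>h. h \<oplus>\<^bsub>M\<^esub> a) ` H"
  unfolding a_r_coset_def' by auto

lemma submodule_coset_absorb:
  assumes M: "module (ground :: ('k::field, 'k) module) M" and H: "submodule H (ground :: ('k, 'k) module) M"
    and b: "b \<in> H" and y: "y \<in> carrier M"
  shows "H +>\<^bsub>M\<^esub> (b \<oplus>\<^bsub>M\<^esub> y) = H +>\<^bsub>M\<^esub> y"
proof -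
  interpret M: module "ground :: ('k, 'k) module" M by fact
  interpret H: submodule H "ground :: ('k, 'k) module" M by fact
  have sub: "H \<subseteq> carrier M" using H.subset by simp
  have "(\<lambda>h. h \<oplus>\<^bsub>M\<^esub> (b \<oplus>\<^bsub>M\<^esub> y)) ` H = (\<lambda>h. h \<oplus>\<^bsub>M\<^esub> y) ` H"
  proof
    show "(\<lambda>h. h \<oplus>\<^bsub>M\<^esub> (b \<oplus>\<^bsub>M\<^esub> y)) ` H \<subseteq> (\<lambda>h. h \<oplus>\<^bsub>M\<^esub> y) ` H"
    proof
      fix w assume "w \<in> (\<lambda>h. h \<oplus>\<^bsub>M\<^esub> (b \<oplus>\<^bsub>M\<^esub> y)) ` H"
      then obtain h where h: "h \<in> H" "w = h \<oplus>\<^bsub>M\<^esub> (b \<oplus>\<^bsub>M\<^esub> y)" by blast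
      then have "w = (h \<oplus>\<^bsub>M\<^esub> b) \<oplus>\<^bsub>M\<^esub> y" using sub b y by (simp add: M.M.a_assoc subset_iff)
      moreover have "h \<oplus>\<^bsub>M\<^esub> b \<in> H" using H.m_closed[OF h(1) b] by simp
      ultimately show "w \<in> (\<lambda>h. h \<oplus>\<^bsub>M\<^esub> y) ` H" by blast
    qed
    show "(\<lambda>h. h \<oplus>\<^bsub>M\<^esub> y) ` H \<subseteq> (\<lambda>h. h \<oplus>\<^bsub>M\<^esub> (b \<oplus>\<^bsub>M\<^esub> y)) ` H"
    proof
      fix w assume "w \<in> (\<lambda>h. h \<oplus>\<^bsub>M\<^esub> y) ` H"
      then obtain h where h: "h \<in> H" "w = h \<oplus>\<^bsub>M\<^esub> y" by blast
      have bm: "\<ominus>\<^bsub>M\<^esub> b \<in> H" using H.m_inv_closed[OF b] by (simp add: a_inv_def)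
      have c: "h \<in> carrier (M)" "b \<in> carrier (M)" using h b sub by auto
      have "(h \<oplus>\<^bsub>M\<^esub> \<ominus>\<^bsub>M\<^esub> b) \<oplus>\<^bsub>M\<^esub> (b \<oplus>\<^bsub>M\<^esub> y) = h \<oplus>\<^bsub>M\<^esub> ((\<ominus>\<^bsub>M\<^esub> b \<oplus>\<^bsub>M\<^esub> b) \<oplus>\<^bsub>M\<^esub> y)"
        using c y by (simp add: M.M.a_assoc)
      also have "\<dots> = w" using c y by (simp add: M.M.l_neg h(2))
      finally have "w = (h \<oplus>\<^bsub>M\<^esub> \<ominus>\<^bsub>M\<^esub> b) \<oplus>\<^bsub>M\<^esub> (b \<oplus>\<^bsub>M\<^esub> y)" ..
      moreover have "h \<oplus>\<^bsub>M\<^esub> \<ominus>\<^bsub>M\<^esub> b \<in> H" using H.m_closed[OF h(1) bm] by simp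
      ultimately show "w \<in> (\<lambda>h. h \<oplus>\<^bsub>M\<^esub> (b \<oplus>\<^bsub>M\<^esub> y)) ` H" by blast
    qed
  qed
  then show ?thesis by (simp only: coset_def_module)
qed

text \<open>Bijectivity on homology stated for elements. A condition on the kernel suffices for
  injectivity, because differences of cycles are cycles.\<close>

lemma quasi_isoI:
  fixes C :: "nat \<Rightarrow> ('k::field, 'v) module" and D :: "nat \<Rightarrow> ('k, 'w) module"
  assumes C: "chain_complex C d" and D: "chain_complex D e" and f: "chain_map C d D e f"
    and inj: "\<And>m z. z \<in> cycles C d m \<Longrightarrow> f m z \<in> boundaries D e m \<Longrightarrow> z \<in> boundaries C d m"
    and surj: "\<And>m y. y \<in> cycles D e m \<Longrightarrow> \<exists>z\<in>cycles C d m. \<exists>b\<in>boundaries D e m. y = b \<oplus>\<^bsub>D m\<^esub> f m z"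
  shows "quasi_iso C d D e f"
  unfolding quasi_iso_def
proof
  fix m
  have mC: "module ground (C n)" and mD: "module ground (D n)" for n using C D by (auto simp: chain_complex_def)
  interpret C: module "ground :: ('k, 'k) module" "C m" by (rule mC)
  interpret D: module "ground :: ('k, 'k) module" "D m" by (rule mD)
  have dl: "lin_map (C (Suc n)) (C n) (d n)" and el: "lin_map (D (Suc n)) (D n) (e n)" and fl: "lin_map (C n) (D n) (f n)" for n
    using C D f by (auto simp: chain_complex_def chain_map_def)
  let ?B = "boundaries C d m" and ?E = "boundaries D e m" and ?Z = "cycles C d m" and ?Y = "cycles D e m"
  have Bsub: "submodule ?B (ground :: ('k, 'k) module) (C m)" and Esub: "submodule ?E (ground :: ('k, 'k) module) (D m)"
    unfolding boundaries_def by (rule lin_map_image_submodule[OF mC mC dl], rule lin_map_image_submodule[OF mD mD el])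
  interpret B: submodule ?B "ground :: ('k, 'k) module" "C m" by (rule Bsub)
  interpret E: submodule ?E "ground :: ('k, 'k) module" "D m" by (rule Esub)
  have Zc: "?Z \<subseteq> carrier (C m)" and Yc: "?Y \<subseteq> carrier (D m)" by (auto simp: cycles_def split: nat.splits)
  have flin: "f m (x \<oplus>\<^bsub>C m\<^esub> y) = f m x \<oplus>\<^bsub>D m\<^esub> f m y" "f m x \<in> carrier (D m)" if "x \<in> carrier (C m)" "y \<in> carrier (C m)" for x y
    using fl[of m] that by (auto simp: lin_map_def)
  have Bc: "?B \<subseteq> carrier (C m)" and Ec: "?E \<subseteq> carrier (D m)" using B.subset E.subset by auto
  have fB: "f m b \<in> ?E" if b: "b \<in> ?B" for b
  proof -
    obtain x where x: "x \<in> carrier (C (Suc m))" "b = d m x" using b by (auto simp: boundaries_def)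
    then have "f m b = e m (f (Suc m) x)" using f by (simp add: chain_map_def)
    moreover have "f (Suc m) x \<in> carrier (D (Suc m))" using fl[of "Suc m"] x by (auto simp: lin_map_def)
    ultimately show ?thesis by (auto simp: boundaries_def)
  qed
  let ?\<Phi> = "\<lambda>X. \<Union>x\<in>X. ?E +>\<^bsub>D m\<^esub> f m x"
  \<comment> \<open>Boundaries go to boundaries, so all members of a class give the same coset and
    the union in \<open>quasi_iso\<close> is that coset.\<close>
  have Phi: "?\<Phi> (?B +>\<^bsub>C m\<^esub> z) = ?E +>\<^bsub>D m\<^esub> f m z" if z: "z \<in> ?Z" for z
  proof -
    have zc: "z \<in> carrier (C m)" using z Zc by auto
    have "?E +>\<^bsub>D m\<^esub> f m (b \<oplus>\<^bsub>C m\<^esub> z) = ?E +>\<^bsub>D m\<^esub> f m z" if b: "b \<in> ?B" for b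
    proof -
      have "f m (b \<oplus>\<^bsub>C m\<^esub> z) = f m b \<oplus>\<^bsub>D m\<^esub> f m z" using b Bc zc by (intro flin) auto
      then show ?thesis using submodule_coset_absorb[OF mD Esub fB[OF b] flin(2)[OF zc zc]] by simp
    qed
    moreover have "?B \<noteq> {}" using B.one_closed by auto
    ultimately show ?thesis unfolding coset_def_module[where H = ?B] by auto
  qed
  have self: "z \<in> ?B +>\<^bsub>C m\<^esub> z" if "z \<in> ?Z" for z
    unfolding coset_def_module using that Zc B.one_closed by (auto intro!: image_eqI[of _ _ "\<zero>\<^bsub>C m\<^esub>"])
  show "bij_betw ?\<Phi> (homology C d m) (homology D e m)"
  proof (rule bij_betwI')
    fix X X' assume "X \<in> homology C d m" "X' \<in> homology C d m"
    then obtain z z' where z: "z \<in> ?Z" "X = ?B +>\<^bsub>C m\<^esub> z" and z': "z' \<in> ?Z" "X' = ?B +>\<^bsub>C m\<^esub> z'"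
      by (auto simp: homology_def)
    have c: "z \<in> carrier (C m)" "z' \<in> carrier (C m)" using z z' Zc by auto
    show "(?\<Phi> X = ?\<Phi> X') = (X = X')"
    proof
      assume "?\<Phi> X = ?\<Phi> X'"
      then have eq: "?E +>\<^bsub>D m\<^esub> f m z = ?E +>\<^bsub>D m\<^esub> f m z'" using Phi z z' by simp
      have "f m z \<in> ?E +>\<^bsub>D m\<^esub> f m z"
        unfolding coset_def_module using flin(2)[OF c(1) c(1)] E.one_closed by (auto intro!: image_eqI[of _ _ "\<zero>\<^bsub>D m\<^esub>"])
      then obtain h where h: "h \<in> ?E" "f m z = h \<oplus>\<^bsub>D m\<^esub> f m z'" using eq by (auto simp: coset_def_module)
      let ?w = "z \<oplus>\<^bsub>C m\<^esub> (-1) \<odot>\<^bsub>C m\<^esub> z'"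
      have nz': "(-1) \<odot>\<^bsub>C m\<^esub> z' \<in> carrier (C m)" using C.smult_closed[of "-1" z'] c by simp
      have fsc: "f m (c \<odot>\<^bsub>C m\<^esub> x) = c \<odot>\<^bsub>D m\<^esub> f m x" if "x \<in> carrier (C m)" for c x
        using fl[of m] that by (simp add: lin_map_def)
      have fz': "f m z' \<in> carrier (D m)" by (rule flin(2)[OF c(2) c(2)])
      have "f m ?w = f m z \<oplus>\<^bsub>D m\<^esub> \<ominus>\<^bsub>D m\<^esub> f m z'"
        by (simp add: flin(1)[OF c(1) nz'] fsc[OF c(2)] module_minus[OF mD fz'])
      also have "\<dots> = h" using h Ec fz' by (simp add: D.M.a_assoc D.M.r_neg subset_iff)
      finally have fw: "f m ?w \<in> ?E" using h by simp
      have wc: "?w \<in> carrier (C m)" by (rule C.M.a_closed[OF c(1) nz'])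
      have wZ: "?w \<in> ?Z"
      proof (cases m)
        case 0
        then show ?thesis using wc by (simp add: cycles_def)
      next
        case (Suc n)
        interpret Cn: module "ground :: ('k, 'k) module" "C n" by (rule mC)
        have dz: "d n z = \<zero>\<^bsub>C n\<^esub>" "d n z' = \<zero>\<^bsub>C n\<^esub>" using z z' Suc by (auto simp: cycles_def)
        have dn: "\<And>x y. x \<in> carrier (C m) \<Longrightarrow> y \<in> carrier (C m) \<Longrightarrow> d n (x \<oplus>\<^bsub>C m\<^esub> y) = d n x \<oplus>\<^bsub>C n\<^esub> d n y"
          "\<And>a x. x \<in> carrier (C m) \<Longrightarrow> d n (a \<odot>\<^bsub>C m\<^esub> x) = a \<odot>\<^bsub>C n\<^esub> d n x"
          using dl[of n] Suc by (auto simp: lin_map_def)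
        have "d n ?w = \<zero>\<^bsub>C n\<^esub>"
          using Cn.smult_r_null[of "-1"] by (simp add: dn(1)[OF c(1) nz'] dn(2)[OF c(2)] dz)
        then show ?thesis using wc Suc by (simp add: cycles_def)
      qed
      have wB: "?w \<in> ?B" by (rule inj[OF wZ fw])
      have zw: "z = ?w \<oplus>\<^bsub>C m\<^esub> z'"
      proof -
        have "?w \<oplus>\<^bsub>C m\<^esub> z' = z \<oplus>\<^bsub>C m\<^esub> (\<ominus>\<^bsub>C m\<^esub> z' \<oplus>\<^bsub>C m\<^esub> z')"
          using c nz' by (simp add: C.M.a_assoc module_minus[OF mC c(2)])
        also have "\<dots> = z" using c by (simp add: C.M.l_neg)
        finally show ?thesis ..
      qed
      have "?B +>\<^bsub>C m\<^esub> z = ?B +>\<^bsub>C m\<^esub> z'"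
        by (subst zw) (rule submodule_coset_absorb[OF mC Bsub wB c(2)])
      then show "X = X'" by (simp add: z z')
    qed simp
  next
    fix X assume "X \<in> homology C d m"
    then obtain z where z: "z \<in> ?Z" "X = ?B +>\<^bsub>C m\<^esub> z" by (auto simp: homology_def)
    have "f m z \<in> ?Y"
    proof (cases m)
      case 0
      then show ?thesis using flin(2)[of z z] z Zc by (auto simp: cycles_def)
    next
      case (Suc n)
      have dz: "z \<in> carrier (C (Suc n))" "d n z = \<zero>\<^bsub>C n\<^esub>" using z Suc by (auto simp: cycles_def)
      have "f n (d n z) = e n (f (Suc n) z)" using f dz(1) unfolding chain_map_def by blast
      then have "e n (f m z) = \<zero>\<^bsub>D n\<^esub>" using lin_map_zero[OF mC mD fl, of n] by (simp add: Suc dz(2))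
      moreover have "f m z \<in> carrier (D m)" using flin(2)[of z z] z Zc by auto
      ultimately show ?thesis using Suc by (simp add: cycles_def)
    qed
    then show "?\<Phi> X \<in> homology D e m" using Phi[OF z(1)] z(2) by (auto simp: homology_def)
  next
    fix Y assume "Y \<in> homology D e m"
    then obtain y where y: "y \<in> ?Y" "Y = ?E +>\<^bsub>D m\<^esub> y" by (auto simp: homology_def)
    obtain z b where z: "z \<in> ?Z" "b \<in> ?E" "y = b \<oplus>\<^bsub>D m\<^esub> f m z" using surj[OF y(1)] by blast
    have "f m z \<in> carrier (D m)" using flin(2)[of z z] z Zc by auto
    then have "Y = ?E +>\<^bsub>D m\<^esub> f m z" unfolding y(2) z(3) by (rule submodule_coset_absorb[OF mD Esub z(2)])
    then have "Y = ?\<Phi> (?B +>\<^bsub>C m\<^esub> z)" using Phi[OF z(1)] by simp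
    then show "\<exists>X\<in>homology C d m. Y = ?\<Phi> X" using z(1) by (auto simp: homology_def)
  qed
qed


section \<open>The complexes in terms of representatives\<close>

lemma module_Omega: "finite I \<Longrightarrow> module ground (Omega I k)"
  unfolding Omega_def by (intro module_quot subspace_OS subspace_OU)

lemma carrier_Omega: "carrier (Omega I k) = (\<lambda>x. x +o OU I k) ` OS I k"
  by (simp add: Omega_def quot_def)

lemma Omega_add: "finite I \<Longrightarrow> (x +o OU I k) \<oplus>\<^bsub>Omega I k\<^esub> (y +o OU I k) = (x + y) +o OU I k"
  unfolding Omega_def by (intro quot_add subspace_OS subspace_OU)

lemma Omega_smult: "finite I \<Longrightarrow> c \<odot>\<^bsub>Omega I k\<^esub> (x +o OU I k) = scale c x +o OU I k"
  unfolding Omega_def by (intro quot_smult subspace_OS subspace_OU)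

lemma carrier_Theta: "carrier (Theta J m) = (\<lambda>x. x +o TU J m) ` TS J m"
  by (simp add: Theta_def quot_def)

lemma Theta_zero: "\<zero>\<^bsub>Theta J m\<^esub> = 0 +o TU J m"
  by (simp add: Theta_def quot_def)

lemma Theta_add: "finite J \<Longrightarrow> (x +o TU J m) \<oplus>\<^bsub>Theta J m\<^esub> (y +o TU J m) = (x + y) +o TU J m"
  unfolding Theta_def by (intro quot_add subspace_TS subspace_TU)

lemma Theta_smult: "finite J \<Longrightarrow> c \<odot>\<^bsub>Theta J m\<^esub> (x +o TU J m) = scale c x +o TU J m"
  unfolding Theta_def by (intro quot_smult subspace_TS subspace_TU)

lemma module_Theta: "finite J \<Longrightarrow> module ground (Theta J m)"
  unfolding Theta_def by (intro module_quot subspace_TS subspace_TU)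

lemma Theta_finsum:
  "finite J \<Longrightarrow> finite A \<Longrightarrow> (\<And>a. a \<in> A \<Longrightarrow> g a \<in> TS J m) \<Longrightarrow>
    (\<Oplus>\<^bsub>Theta J m\<^esub>a\<in>A. g a +o TU J m) = (\<Sum>a\<in>A. g a) +o TU J m"
  unfolding Theta_def by (intro quot_finsum subspace_TS subspace_TU)

section \<open>Families of representatives and their currents\<close>

definition fam :: "'a set \<Rightarrow> nat \<Rightarrow> ('a set \<Rightarrow> ('a, 'k::field) pform) \<Rightarrow> bool" where
  "fam I m x \<longleftrightarrow> (\<forall>J\<in>faces I. x J \<in> TS J m)"

definition phi :: "'a set \<Rightarrow> nat \<Rightarrow> ('a set \<Rightarrow> ('a, 'k::field) pform) \<Rightarrow> ('a, 'k) phi" where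
  "phi I m x = (\<lambda>J\<in>faces I. x J +o TU J m)"

text \<open>The map \<open>xi\<close> before passing to classes, see \<open>xi_phi\<close>.\<close>

definition Xi :: "'a set \<Rightarrow> ('a set \<Rightarrow> ('a, 'k::field_char_0) pform) \<Rightarrow> ('a, 'k) pform \<Rightarrow> 'k" where
  "Xi I x w = (\<Sum>J\<in>faces I. simplex_integral_tilde J (pair_form (x J) (pull_form J (\<lambda>j. j) w)))"

lemma fam_TS: "fam I m x \<Longrightarrow> J \<in> faces I \<Longrightarrow> x J \<in> TS J m"
  by (simp add: fam_def)

lemma fam_zero: "fam I m (\<lambda>J. 0)"
  and fam_add: "fam I m x \<Longrightarrow> fam I m y \<Longrightarrow> fam I m (\<lambda>J. x J + y J)"
  and fam_diff: "fam I m x \<Longrightarrow> fam I m y \<Longrightarrow> fam I m (\<lambda>J. x J - y J)"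
  and fam_scale: "fam I m x \<Longrightarrow> fam I m (\<lambda>J. scale c (x J))"
  by (simp_all add: fam_def free.subspace_0[OF subspace_TS] free.subspace_add[OF subspace_TS]
      free.subspace_diff[OF subspace_TS] free.subspace_scale[OF subspace_TS])

lemma carrier_Phi: "carrier (Phi I m :: ('k::field, ('a, 'k) phi) module) = phi I m ` {x. fam I m x}"
proof
  show "carrier (Phi I m :: ('k, ('a, 'k) phi) module) \<subseteq> phi I m ` {x. fam I m x}"
  proof
    fix f :: "('a, 'k) phi" assume "f \<in> carrier (Phi I m)"
    then have f: "f \<in> (\<Pi>\<^sub>E J\<in>faces I. (\<lambda>x. x +o TU J m) ` TS J m)" by (simp add: Phi_def carrier_Theta)
    have "\<exists>y. y \<in> TS J m \<and> f J = y +o TU J m" if "J \<in> faces I" for J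
      using PiE_mem[OF f that] by auto
    then obtain x where x: "\<And>J. J \<in> faces I \<Longrightarrow> x J \<in> TS J m \<and> f J = x J +o TU J m" by metis
    have "f = phi I m x"
      by (rule extensionalityI[of _ "faces I"]) (use f x in \<open>auto simp: phi_def PiE_def\<close>)
    then show "f \<in> phi I m ` {x. fam I m x}" using x by (auto simp: fam_def)
  qed
  show "phi I m ` {x. fam I m x} \<subseteq> carrier (Phi I m :: ('k, ('a, 'k) phi) module)"
    by (auto simp: Phi_def carrier_Theta phi_def fam_def)
qed

lemma phi_in_carrier: "fam I m x \<Longrightarrow> phi I m x \<in> carrier (Phi I m)"
  by (auto simp: carrier_Phi)

lemma phi_zero: "\<zero>\<^bsub>Phi I m\<^esub> = phi I m (\<lambda>J. 0)"
  by (simp add: Phi_def phi_def Theta_zero)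

lemma phi_add: "finite I \<Longrightarrow> phi I m x \<oplus>\<^bsub>Phi I m\<^esub> phi I m y = phi I m (\<lambda>J. x J + y J)"
  by (rule extensionalityI[of _ "faces I"]) (auto simp: Phi_def phi_def Theta_add dest: facesD)

lemma phi_smult: "finite I \<Longrightarrow> c \<odot>\<^bsub>Phi I m\<^esub> phi I m x = phi I m (\<lambda>J. scale c (x J))"
  by (rule extensionalityI[of _ "faces I"]) (auto simp: Phi_def phi_def Theta_smult dest: facesD)

lemma module_Phi: "finite I \<Longrightarrow> module ground (Phi I m)"
  by (rule quotient_module[where r = "phi I m" and C = "{x. fam I m x}" and z = "\<lambda>J. 0"
        and pl = "\<lambda>x y J. x J + y J" and sc = "\<lambda>c x J. scale c (x J)"])
     (auto simp: carrier_Phi phi_zero phi_add phi_smult fam_zero fam_add fam_scale ac_simps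
       free.scale_right_distrib free.scale_left_distrib)

lemma phi_eq_iff:
  assumes "finite I"
  shows "phi I m x = phi I m y \<longleftrightarrow> (\<forall>J\<in>faces I. x J - y J \<in> TU J m)"
proof -
  have "x J +o TU J m = y J +o TU J m \<longleftrightarrow> x J - y J \<in> TU J m" if "J \<in> faces I" for J
    using facesD[OF that assms] by (intro coset_eq_iff subspace_TU) auto
  moreover have "phi I m x = phi I m y \<longleftrightarrow> (\<forall>J\<in>faces I. x J +o TU J m = y J +o TU J m)"
    by (auto simp: phi_def fun_eq_iff restrict_def)
  ultimately show ?thesis by simp
qed

lemma linear_Xi: "Vector_Spaces.linear scale (*) (Xi I x)"
proof -
  have l: "Vector_Spaces.linear scale (*) (\<lambda>w. simplex_integral_tilde J (pair_form (x J) (pull_form J (\<lambda>j. j) w)))" for J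
    by (rule linear_comp[OF linear_pull_form linear_comp[OF linear_pair_form_right linear_integral]])
  show ?thesis
    by (rule free_functionalI) (simp_all only: Xi_def linear_add[OF l] linear_scale[OF l] sum.distrib sum_distrib_left)
qed

lemma Xi_add: "Xi I (\<lambda>J. x J + y J) w = Xi I x w + Xi I y w"
  and Xi_diff: "Xi I (\<lambda>J. x J - y J) w = Xi I x w - Xi I y w"
  and Xi_scale: "Xi I (\<lambda>J. scale c (x J)) w = c * Xi I x w"
  by (simp_all add: Xi_def linear_add[OF linear_comp[OF linear_pair_form_left linear_integral]]
      linear_diff[OF linear_comp[OF linear_pair_form_left linear_integral]]
      linear_scale[OF linear_comp[OF linear_pair_form_left linear_integral]] sum.distrib sum_subtractf sum_distrib_left)

lemma Xi_zero: "Xi I (\<lambda>J. 0) w = 0"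
  using Xi_diff[of I "\<lambda>J. 0" "\<lambda>J. 0" w] by simp

lemma id_funcset: "J \<subseteq> I \<Longrightarrow> (\<lambda>j. j) \<in> J \<rightarrow> I"
  by auto

lemma Xi_OU:
  assumes I: "finite I" and x: "fam I m x" and w: "w \<in> OU I m"
  shows "Xi I x w = 0"
  unfolding Xi_def
proof (rule sum.neutral, rule ballI)
  fix J assume J: "J \<in> faces I"
  have fJ: "finite J" "J \<noteq> {}" "J \<subseteq> I" using facesD[OF J I] by auto
  show "simplex_integral_tilde J (pair_form (x J) (pull_form J (\<lambda>j. j) w)) = 0"
    by (rule integral_ideal[OF fJ(1,2) pair_form_TS_OU[OF fJ(1) fam_TS[OF x J] pull_form_OU[OF fJ(1) I id_funcset[OF fJ(3)] w]]])
qed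

lemma Xi_TU:
  assumes I: "finite I" and x: "\<And>J. J \<in> faces I \<Longrightarrow> x J \<in> TU J m" and w: "w \<in> OS I m"
  shows "Xi I x w = 0"
  unfolding Xi_def
proof (rule sum.neutral, rule ballI)
  fix J assume J: "J \<in> faces I"
  have fJ: "finite J" "J \<noteq> {}" "J \<subseteq> I" using facesD[OF J I] by auto
  show "simplex_integral_tilde J (pair_form (x J) (pull_form J (\<lambda>j. j) w)) = 0"
    by (rule integral_ideal[OF fJ(1,2) pair_form_TU_OS[OF fJ(1) x[OF J] pull_form_OS[OF fJ(1) w]]])
qed

text \<open>If a letter of \<open>l\<close> lies outside \<open>J\<close>, its factor
  \<open>dt_j\<close> restricts to zero. This is why \<open>Ev\<close> sums only over faces that
  contain the letters.\<close>

lemma pull_form_basis_id: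
  assumes "finite J"
  shows "pull_form J (\<lambda>j. j) (q \<otimes>\<^sub>t basis l) = (if set l \<subseteq> J then rs J q \<otimes>\<^sub>t basis l else (0 :: ('a, 'k::field) pform))"
proof -
  have b: "pull_vec J (\<lambda>j. j) (basis j) = (if j \<in> J then basis j else 0 :: 'a \<Rightarrow>\<^sub>0 'k)" for j
  proof -
    have "{i. i \<in> J \<and> i = j} = (if j \<in> J then {j} else {})" by auto
    then show ?thesis by (simp add: pull_vec_basis)
  qed
  have e: "pull_form J (\<lambda>j. j) (q \<otimes>\<^sub>t basis l) = rs J q \<otimes>\<^sub>t word_tensor (map (pull_vec J (\<lambda>j. j)) (map basis l))"
    by (simp only: pull_form_word[symmetric] word_tensor_basis)
  show ?thesis
  proof (cases "set l \<subseteq> J")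
    case True
    then have "map (pull_vec J (\<lambda>j. j)) (map basis l) = (map basis l :: ('a \<Rightarrow>\<^sub>0 'k) list)"
      by (auto simp: b)
    then show ?thesis unfolding e using True by (simp only: word_tensor_basis if_True)
  next
    case False
    then obtain j where j: "j \<in> set l" "j \<notin> J" by auto
    then obtain xs ys where "l = xs @ j # ys" by (meson split_list)
    then have "map (pull_vec J (\<lambda>j. j)) (map basis l) =
        map (pull_vec J (\<lambda>j. j)) (map basis xs) @ (0 :: 'a \<Rightarrow>\<^sub>0 'k) # map (pull_vec J (\<lambda>j. j)) (map basis ys)"
      using j by (simp add: b)
    then have "word_tensor (map (pull_vec J (\<lambda>j. j)) (map basis l)) = (0 :: 'a list \<Rightarrow>\<^sub>0 'k)"
      by (simp only: linear_0[OF linear_word_tensor])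
    then show ?thesis unfolding e using False by (simp only: linear_0[OF linear_tens_right] if_False)
  qed
qed

lemma Xi_Ev:
  fixes x :: "'a set \<Rightarrow> ('a, 'k::field_char_0) pform"
  assumes "finite I"
  shows "Xi I x (q \<otimes>\<^sub>t basis l) = Ev I (\<lambda>J. coef (x J)) q l"
proof -
  have t: "simplex_integral_tilde J (pair_form (x J) (pull_form J (\<lambda>j. j) (q \<otimes>\<^sub>t basis l))) =
      (if set l \<subseteq> J then simplex_integral_tilde J (rs J q * coef (x J) l) else 0)" if "J \<in> faces I" for J
    using facesD[OF that assms]
    by (simp add: pull_form_basis_id pair_form_coef linear_0[OF linear_pair_form_right] linear_0[OF linear_integral])
  have "Xi I x (q \<otimes>\<^sub>t basis l) = (\<Sum>J\<in>faces I. if set l \<subseteq> J then simplex_integral_tilde J (rs J q * coef (x J) l) else 0)"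
    unfolding Xi_def by (intro sum.cong refl t)
  also have "\<dots> = Ev I (\<lambda>J. coef (x J)) q l"
    unfolding Ev_def by (rule sum.inter_filter[symmetric]) (rule finite_faces[OF assms])
  finally show ?thesis .
qed

lemma alt_fam_coef: "finite I \<Longrightarrow> fam I m x \<Longrightarrow> alt_fam I m (\<lambda>J. coef (x J))"
  unfolding alt_fam_def by (intro ballI alt_tan_coef fam_TS) (auto dest: facesD)

lemma OS_eq_on:
  fixes w :: "('a, 'k::field) pform"
  assumes f: "Vector_Spaces.linear scale (*) f" and g: "Vector_Spaces.linear scale (*) g" and w: "w \<in> OS I m"
    and eq: "\<And>q l. q \<in> P_tilde I \<Longrightarrow> l \<in> words m I \<Longrightarrow> f (q \<otimes>\<^sub>t basis l) = g (q \<otimes>\<^sub>t basis l)"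
  shows "f w = g w"
proof (rule linear_eq_on_span[OF f g w[unfolded OS_span]])
  fix b :: "('a, 'k) pform" assume "b \<in> decomposables m (W_tilde I) (P_tilde I)"
  then obtain p vs where b: "b = p \<otimes>\<^sub>t word_tensor vs" "p \<in> P_tilde I" "length vs = m" "set vs \<subseteq> W_tilde I"
    by (auto simp: decomposables_def)
  have "f (p \<otimes>\<^sub>t word_tensor vs) = g (p \<otimes>\<^sub>t word_tensor vs)"
  proof (rule linear_eq_on_basis[where x = "word_tensor vs", OF linear_comp[OF linear_tens_right f] linear_comp[OF linear_tens_right g]])
    fix l assume l: "l \<in> Poly_Mapping.keys (word_tensor vs)"
    have "set l \<subseteq> I" by (rule keys_word_tensor[OF l]) (use b(4) in \<open>auto simp: W_tilde_def\<close>)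
    then show "f (p \<otimes>\<^sub>t basis l) = g (p \<otimes>\<^sub>t basis l)"
      using word_tensor_length[OF l] b by (intro eq) (auto simp: words_def)
  qed
  then show "f b = g b" by (simp only: b(1))
qed

text \<open>Injectivity of \<open>xi\<close> on the level of representatives, from
  \<open>Ev_injective\<close> and \<open>TU_iff\<close>. From here on equations in
  \<open>Phi\<close> are proved by testing currents on forms, where boundary and pushforward are
  adjoint to differential and pullback.\<close>

lemma phi_eq_Xi:
  fixes x y :: "'a set \<Rightarrow> ('a, 'k::field_char_0) pform"
  assumes I: "finite I" and x: "fam I m x" and y: "fam I m y"
  shows "phi I m x = phi I m y \<longleftrightarrow> (\<forall>w\<in>OS I m. Xi I x w = Xi I y w)"
proof
  assume "phi I m x = phi I m y"
  then have "\<And>J. J \<in> faces I \<Longrightarrow> x J - y J \<in> TU J m" using phi_eq_iff[OF I, of m x y] by blast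
  then have "Xi I (\<lambda>J. x J - y J) w = 0" if "w \<in> OS I m" for w by (rule Xi_TU[OF I _ that])
  then show "\<forall>w\<in>OS I m. Xi I x w = Xi I y w" by (simp add: Xi_diff)
next
  assume eq: "\<forall>w\<in>OS I m. Xi I x w = Xi I y w"
  let ?z = "\<lambda>J. x J - y J"
  have z: "fam I m ?z" by (rule fam_diff[OF x y])
  have "x J - y J \<in> TU J m" if J: "J \<in> faces I" for J
  proof -
    have fJ: "finite J" "J \<noteq> {}" using facesD[OF J I] by auto
    have "coef (?z J) l \<in> P_ideal J" if l: "l \<in> words m J" for l
    proof (rule Ev_injective[OF I _ _ J l, of "\<lambda>J. coef (?z J)"])
      show "coef (?z J) l \<in> P_tilde J" if "J \<in> faces I" "l \<in> words m J" for J l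
        by (rule alt_tan_P[OF _ that(2)]) (use alt_fam_coef[OF I z] that(1) in \<open>simp add: alt_fam_def\<close>)
      show "Ev I (\<lambda>J. coef (?z J)) q l = 0" if "q \<in> P_tilde I" "l \<in> words m I" for q l
        using eq OS_basis[OF that] by (simp add: Xi_Ev[OF I, symmetric] Xi_diff)
    qed
    then show ?thesis using TU_iff[OF fJ fam_TS[OF z J]] by blast
  qed
  then show "phi I m x = phi I m y" by (simp add: phi_eq_iff[OF I])
qed

lemma realize_fam: "finite I \<Longrightarrow> alt_fam I m X \<Longrightarrow> fam I m (\<lambda>J. realize m J (X J))"
  unfolding fam_def alt_fam_def by (intro ballI realize_TS) (auto dest: facesD)

lemma Xi_realize:
  fixes X :: "('a, 'k::field_char_0) family"
  assumes I: "finite I" and X: "alt_fam I m X" and l: "l \<in> words m I"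
  shows "Xi I (\<lambda>J. realize m J (X J)) (q \<otimes>\<^sub>t basis l) = Ev I X q l"
  unfolding Xi_Ev[OF I]
proof (rule Ev_cong[OF I])
  fix J assume J: "J \<in> faces I" "set l \<subseteq> J"
  then have "coef (realize m J (X J)) l = X J l"
    using facesD[OF J(1) I] X l by (intro coef_realize) (auto simp: alt_fam_def words_def)
  then show "coef (realize m J (X J)) l - X J l \<in> P_ideal J" by (simp add: P_ideal_closed)
qed

lemma Xi_d_form:
  fixes x :: "'a set \<Rightarrow> ('a, 'k::field_char_0) pform"
  assumes I: "finite I" and q: "q \<in> P_tilde I"
  shows "Xi I x (d_form (q \<otimes>\<^sub>t basis l)) = (\<Sum>i\<in>I. Ev I (\<lambda>J. coef (x J)) (pd i q) (i # l))"
proof -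
  have "d_form (q \<otimes>\<^sub>t basis l) = (\<Sum>i\<in>I. pd i q \<otimes>\<^sub>t basis (i # l))"
  proof -
    have "word_tensor (basis i # map basis l) = (basis (i # l) :: _ \<Rightarrow>\<^sub>0 'k)" for i
      using word_tensor_basis[of "i # l"] by (simp only: list.map)
    then show ?thesis using d_form_word[OF I q, of "map basis l"] by (simp only: word_tensor_basis)
  qed
  then show ?thesis by (simp only: linear_sum[OF linear_Xi] Xi_Ev[OF I])
qed

definition boundary_rep :: "'a set \<Rightarrow> nat \<Rightarrow> ('a set \<Rightarrow> ('a, 'k::field_char_0) pform) \<Rightarrow> ('a set \<Rightarrow> ('a, 'k) pform)" where
  "boundary_rep I m x = (\<lambda>J. realize m J (Dv I m (\<lambda>J. coef (x J)) J))"

text \<open>A representative of the boundary, rebuilt from \<open>Dv\<close>. The sign is that of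
  \<open>d_Phi_hat\<close>, so this shows that the boundary of a current in the image of
  \<open>xi\<close> is again in the image.\<close>

lemma
  fixes x :: "'a set \<Rightarrow> ('a, 'k::field_char_0) pform"
  assumes I: "finite I" and x: "fam I (Suc m) x"
  shows fam_boundary_rep: "fam I m (boundary_rep I m x)"
    and Xi_boundary_rep: "w \<in> OS I m \<Longrightarrow> Xi I (boundary_rep I m x) w = (-1) ^ (m + 1) * Xi I x (d_form w)"
proof -
  let ?X = "\<lambda>J. coef (x J)"
  have X: "alt_fam I (Suc m) ?X" by (rule alt_fam_coef[OF I x])
  have D: "alt_fam I m (Dv I m ?X)" by (rule alt_fam_Dv[OF I X])
  show "fam I m (boundary_rep I m x)" unfolding boundary_rep_def by (rule realize_fam[OF I D])
  assume w: "w \<in> OS I m"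
  have lin: "Vector_Spaces.linear scale (*) (\<lambda>w. (-1) ^ (m + 1) * Xi I x (d_form w))"
    by (rule free_functionalI)
       (simp_all only: linear_add[OF linear_comp[OF linear_d_form linear_Xi]] linear_scale[OF linear_comp[OF linear_d_form linear_Xi]]
         distrib_left mult.left_commute)
  show "Xi I (boundary_rep I m x) w = (-1) ^ (m + 1) * Xi I x (d_form w)"
  proof (rule OS_eq_on[OF linear_Xi lin w])
    fix q :: "('a, 'k) mpoly" and l assume q: "q \<in> P_tilde I" and l: "l \<in> words m I"
    show "Xi I (boundary_rep I m x) (q \<otimes>\<^sub>t basis l) = (-1) ^ (m + 1) * Xi I x (d_form (q \<otimes>\<^sub>t basis l))"
      unfolding boundary_rep_def Xi_realize[OF I D l] Xi_d_form[OF I q] by (rule Ev_Dv[OF I X l])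
  qed
qed

section \<open>The value of a current on the form 1\<close>

abbreviation unit_form :: "('a, 'k::field) pform" where
  "unit_form \<equiv> 1 \<otimes>\<^sub>t basis []"

lemma unit_form_OS: "unit_form \<in> OS I 0"
  by (rule OS_basis[OF P_tilde_1]) (simp add: words_def)

lemma d_unit_form: "d_form unit_form = (0 :: ('a, 'k::field) pform)"
proof -
  \<comment> \<open>The constant 1 lies in the polynomial ring on no variables, so the formula may
    be used with the empty set.\<close>
  have "d_form ((1 :: ('a, 'k) mpoly) \<otimes>\<^sub>t basis []) = (\<Sum>i\<in>{}. pd i (1 :: ('a, 'k) mpoly) \<otimes>\<^sub>t cons_word i (basis []))"
    by (rule d_form_tens) (simp_all add: P_tilde_1)
  then show ?thesis by simp
qed

text \<open>By adjunction the pushforward therefore preserves the value of a current on the form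
  1.\<close>

lemma pull_unit_form: "pull_form I \<alpha> unit_form = (unit_form :: ('a, 'k::field) pform)"
proof -
  have "pull_form I \<alpha> ((1 :: ('b, 'k) mpoly) \<otimes>\<^sub>t word_tensor []) =
      pull_poly I \<alpha> 1 \<otimes>\<^sub>t (word_tensor (map (pull_vec I \<alpha>) []) :: 'a list \<Rightarrow>\<^sub>0 'k)"
    by (rule pull_form_word)
  then show ?thesis by simp
qed

lemma integral_vertex_one: "simplex_integral_tilde {w} (1 :: ('a, 'k::field_char_0) mpoly) = 1"
proof -
  have "simplex_integral_tilde {w} (basis 0 :: ('a, 'k) mpoly) = 1"
    unfolding integral_basis by (simp add: fact_mon_def)
  then show ?thesis by simp
qed

text \<open>A vertex has no tangent vectors: the vanishing sum over \<open>{w}\<close> consists of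
  one term.\<close>

lemma alt_tan_singleton:
  assumes "alt_tan (Suc n) {w} X" "l \<in> words (Suc n) {w}"
  shows "X l = 0"
proof -
  obtain l' where l: "l = w # l'" "l' \<in> words n {w}" using assms(2) by (auto simp: words_def length_Suc_conv)
  have "(\<Sum>j\<in>{w}. X ([] @ j # l')) = 0"
    by (rule alt_tan_sum[OF assms(1)]) (use l in \<open>auto simp: words_def\<close>)
  then show ?thesis by (simp add: l)
qed

text \<open>Eliminating the only variable leaves a constant, and the integral over a vertex reads
  off that constant.\<close>

lemma vertex_ideal:
  fixes r :: "('a, 'k::field_char_0) mpoly"
  assumes r: "r \<in> P_tilde {w}" and z: "simplex_integral_tilde {w} r = 0"
  shows "r \<in> P_ideal {w}"
proof -
  let ?c = "eliminate {w} w r"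
  have rc: "r - ?c \<in> P_ideal {w}" by (rule eliminate_cong_ideal[OF _ _ r]) auto
  have "?c \<in> P_tilde {}" using eliminate_P_tilde[OF _ r, of w] by simp
  then have "Poly_Mapping.keys ?c \<subseteq> {0}" by (auto simp: P_tilde_def)
  then have c: "?c = scale (Poly_Mapping.lookup ?c 0) (basis 0)"
    using lin_ext_superset[of "{0}" ?c basis] lin_ext_basis_id[of ?c] by simp
  have "simplex_integral_tilde {w} (r - ?c) = 0" by (rule integral_ideal[OF _ _ rc]) auto
  then have "simplex_integral_tilde {w} ?c = 0" using z by (simp add: linear_diff[OF linear_integral])
  moreover have "simplex_integral_tilde {w} ?c = Poly_Mapping.lookup ?c 0"
    by (subst c) (simp only: linear_scale[OF linear_integral] single_one integral_vertex_one mult_1_right)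
  ultimately have "Poly_Mapping.lookup ?c 0 = 0" by simp
  then have "?c = 0" using c by simp
  then show ?thesis using rc by simp
qed

text \<open>After \<open>retract_to_vertex\<close> a remainder is left on \<open>{w}\<close> only.
  In positive degree it is zero for lack of tangent vectors; in degree zero it is a constant, which
  the condition on the form 1 forces to vanish.\<close>

lemma contract_cycle:
  fixes x :: "'a set \<Rightarrow> ('a, 'k::field_char_0) pform"
  assumes I: "finite I" "I \<noteq> {}" and x: "fam I m x"
    and cyc: "\<And>n v. m = Suc n \<Longrightarrow> v \<in> OS I n \<Longrightarrow> Xi I x (d_form v) = 0"
    and aug: "m = 0 \<Longrightarrow> Xi I x unit_form = 0"
  obtains y where "fam I (Suc m) y" "phi I m x = phi I m (boundary_rep I m y)"
proof -
  obtain w where w: "w \<in> I" using I by auto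
  let ?X = "\<lambda>J. coef (x J)"
  have X: "alt_fam I m ?X" by (rule alt_fam_coef[OF I(1) x])
  have "cycle_fam I m ?X"
    unfolding cycle_fam_def
  proof (intro allI impI ballI)
    fix n l and q :: "('a, 'k) mpoly" assume m: "m = Suc n" and q: "q \<in> P_tilde I" and l: "l \<in> words n I"
    show "(\<Sum>i\<in>I. Ev I ?X (pd i q) (i # l)) = 0"
      using cyc[OF m OS_basis[OF q l]] by (simp add: Xi_d_form[OF I(1) q])
  qed
  from retract_to_vertex[OF I(1) w X this] obtain Y where Y: "alt_fam I (Suc m) Y"
    and off: "\<And>J l. J \<in> faces I \<Longrightarrow> J \<noteq> {w} \<Longrightarrow> l \<in> words m J \<Longrightarrow> ?X J l - Dv I m Y J l \<in> P_ideal J"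
    by blast
  have DY: "alt_fam I m (Dv I m Y)" by (rule alt_fam_Dv[OF I(1) Y])
  have wF: "{w} \<in> faces I" using w by (simp add: faces_def)
  have R: "alt_tan m {w} (\<lambda>l. ?X {w} l - Dv I m Y {w} l)"
    using X DY wF by (intro alt_tan_diff) (auto simp: alt_fam_def)
  have on: "?X {w} l - Dv I m Y {w} l \<in> P_ideal {w}" if l: "l \<in> words m {w}" for l
  proof (cases m)
    case (Suc n)
    then show ?thesis using alt_tan_singleton[of n w "\<lambda>l. ?X {w} l - Dv I m Y {w} l" l] R l
      by (simp add: P_ideal_closed)
  next
    case 0
    let ?r = "?X {w} [] - Dv I m Y {w} []"
    have l0: "l = []" using l 0 by (simp add: words_def)
    have rP: "?r \<in> P_tilde {w}" using alt_tan_P[OF R, of "[]"] 0 by (simp add: words_def)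
    \<comment> \<open>Boundaries vanish on the form 1 too, so the remainder does, and only its
      component on \<open>{w}\<close> contributes.\<close>
    have "Ev I ?X 1 [] = 0" using aug[OF 0] by (simp add: Xi_Ev[OF I(1)])
    moreover have "Ev I (Dv I m Y) 1 [] = 0"
      using Ev_Dv[OF I(1) Y, of "[]" 1] 0 by (simp add: words_def linear_0[OF linear_Ev])
    ultimately have "Ev I (\<lambda>J l. ?X J l - Dv I m Y J l) 1 [] = 0" by (simp add: Ev_linear_family)
    also have "Ev I (\<lambda>J l. ?X J l - Dv I m Y J l) 1 [] = (\<Sum>J\<in>{{w}}. simplex_integral_tilde J (rs J 1 * (?X J [] - Dv I m Y J [])))"
      unfolding Ev_def
    proof (rule sum.mono_neutral_right)
      show "\<forall>J\<in>{J. J \<in> faces I \<and> set [] \<subseteq> J} - {{w}}. simplex_integral_tilde J (rs J 1 * (?X J [] - Dv I m Y J [])) = 0"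
      proof
        fix J assume "J \<in> {J. J \<in> faces I \<and> set [] \<subseteq> J} - {{w}}"
        then have J: "J \<in> faces I" "J \<noteq> {w}" by auto
        have "?X J [] - Dv I m Y J [] \<in> P_ideal J" using off[OF J, of "[]"] 0 by (simp add: words_def)
        then show "simplex_integral_tilde J (rs J 1 * (?X J [] - Dv I m Y J [])) = 0"
          using facesD[OF J(1) I(1)] by (simp add: integral_ideal)
      qed
    qed (use wF finite_faces[OF I(1)] in auto)
    finally have "simplex_integral_tilde {w} ?r = 0" by simp
    then show ?thesis unfolding l0 by (rule vertex_ideal[OF rP])
  qed
  let ?y = "\<lambda>J. realize (Suc m) J (Y J)"
  have y: "fam I (Suc m) ?y" by (rule realize_fam[OF I(1) Y])
  have "phi I m x = phi I m (boundary_rep I m ?y)"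
    unfolding phi_eq_Xi[OF I(1) x fam_boundary_rep[OF I(1) y]]
  proof
    fix v :: "('a, 'k) pform" assume v: "v \<in> OS I m"
    show "Xi I x v = Xi I (boundary_rep I m ?y) v"
    proof (rule OS_eq_on[OF linear_Xi linear_Xi v])
      fix q :: "('a, 'k) mpoly" and l assume q: "q \<in> P_tilde I" and l: "l \<in> words m I"
      have "Xi I x (q \<otimes>\<^sub>t basis l) = Ev I (Dv I m Y) q l"
        unfolding Xi_Ev[OF I(1)]
      proof (rule Ev_cong[OF I(1)])
        fix J assume J: "J \<in> faces I" "set l \<subseteq> J"
        then have lJ: "l \<in> words m J" using l by (auto simp: words_def)
        show "?X J l - Dv I m Y J l \<in> P_ideal J"
          using off[OF J(1) _ lJ] on[of l] lJ by (cases "J = {w}") auto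
      qed
      also have "\<dots> = (-1) ^ (m + 1) * (\<Sum>i\<in>I. Ev I Y (pd i q) (i # l))" by (rule Ev_Dv[OF I(1) Y l])
      also have "(\<Sum>i\<in>I. Ev I Y (pd i q) (i # l)) = (\<Sum>i\<in>I. Xi I ?y (pd i q \<otimes>\<^sub>t basis (i # l)))"
        by (intro sum.cong refl Xi_realize[OF I(1) Y, symmetric]) (use l in simp)
      also have "\<dots> = Xi I ?y (d_form (q \<otimes>\<^sub>t basis l))"
        unfolding Xi_d_form[OF I(1) q] Xi_Ev[OF I(1)] ..
      also have "(-1) ^ (m + 1) * \<dots> = Xi I (boundary_rep I m ?y) (q \<otimes>\<^sub>t basis l)"
        by (rule Xi_boundary_rep[OF I(1) y OS_basis[OF q l], symmetric])
      finally show "Xi I x (q \<otimes>\<^sub>t basis l) = Xi I (boundary_rep I m ?y) (q \<otimes>\<^sub>t basis l)" .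
    qed
  qed
  then show thesis using that[OF y] by blast
qed

definition point_rep :: "'a \<Rightarrow> 'k \<Rightarrow> 'a set \<Rightarrow> ('a, 'k::field) pform" where
  "point_rep w c J = (if J = {w} then scale c unit_form else 0)"

lemma fam_point_rep: "fam I 0 (point_rep w c)"
proof -
  have "(1 :: ('a, 'b) mpoly) \<otimes>\<^sub>t word_tensor [] \<in> TS J 0" for J
    by (rule TS_I) (auto simp: P_tilde_1)
  then show ?thesis
    by (auto simp: fam_def point_rep_def free.subspace_0[OF subspace_TS] intro!: free.subspace_scale[OF subspace_TS])
qed

lemma Xi_point_rep:
  fixes c :: "'k::field_char_0"
  assumes I: "finite I" "w \<in> I"
  shows "Xi I (point_rep w c) unit_form = c"
proof -
  have "coef unit_form [] = (1 :: ('a, 'k) mpoly)"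
    using coef_decomposable[of "[]" 0 "[]" "1 :: ('a, 'k) mpoly"] by simp
  then have "coef (scale c unit_form) [] = scale c (1 :: ('a, 'k) mpoly)" by (simp add: coef_linear)
  moreover have "simplex_integral_tilde {w} (scale c 1) = c"
    by (simp only: linear_scale[OF linear_integral] integral_vertex_one mult_1_right)
  moreover have "Xi I (point_rep w c) unit_form = (\<Sum>J\<in>{{w}}. simplex_integral_tilde J (rs J 1 * coef (point_rep w c J) []))"
    unfolding Xi_Ev[OF I(1)] Ev_def
    by (rule sum.mono_neutral_right)
       (use I finite_faces[OF I(1)] in \<open>auto simp: faces_def point_rep_def coef_linear linear_0[OF linear_integral]\<close>)
  ultimately show ?thesis by (simp add: point_rep_def)
qed


section \<open>The maps on classes\<close>

lemma integral_coset:
  assumes "finite J" "J \<noteq> {}"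
  shows "simplex_integral J (p +o P_ideal J) = simplex_integral_tilde J (p :: ('a, 'k::field_char_0) mpoly)"
proof -
  have "simplex_integral_tilde J ` (p +o P_ideal J) = {simplex_integral_tilde J p}"
    by (rule image_coset_functional[OF linear_integral]) (use assms in \<open>auto simp: P_ideal_closed integral_ideal\<close>)
  then show ?thesis by (simp add: simplex_integral_def)
qed

lemma pairing_coset:
  fixes x y :: "('a, 'k::field) pform"
  assumes J: "finite J" and x: "x \<in> TS J m" and y: "y \<in> OS J m"
  shows "pairing J (x +o TU J m) (y +o OU J m) = pair_form x y +o P_ideal J"
proof
  show "pairing J (x +o TU J m) (y +o OU J m) \<subseteq> pair_form x y +o P_ideal J"
  proof
    fix z assume "z \<in> pairing J (x +o TU J m) (y +o OU J m)"
    then obtain u v p where u: "u \<in> TU J m" and v: "v \<in> OU J m" and p: "p \<in> P_ideal J"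
      and z: "z = pair_form (x + u) (y + v) + p"
      by (auto simp: pairing_def elt_set_plus_def)
    have xu: "x + u \<in> TS J m" using free.subspace_add[OF subspace_TS x] TU_subset_TS[OF J] u by blast
    have e: "z - pair_form x y = pair_form (x + u) v + pair_form u y + p"
      by (simp add: z linear_add[OF linear_pair_form_left] linear_add[OF linear_pair_form_right])
    show "z \<in> pair_form x y +o P_ideal J"
      unfolding coset_mem e by (intro P_ideal_closed(2) pair_form_TS_OU[OF J xu v] pair_form_TU_OS[OF J u y] p)
  qed
  show "pair_form x y +o P_ideal J \<subseteq> pairing J (x +o TU J m) (y +o OU J m)"
  proof
    fix z assume "z \<in> pair_form x y +o P_ideal J"
    then obtain p where "p \<in> P_ideal J" "z = pair_form x y + p" by (auto simp: elt_set_plus_def)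
    moreover have "x \<in> x +o TU J m" "y \<in> y +o OU J m"
      using free.subspace_0[OF subspace_TU[OF J]] free.subspace_0[OF subspace_OU[OF J]] by (simp_all add: coset_mem)
    ultimately show "z \<in> pairing J (x +o TU J m) (y +o OU J m)" unfolding pairing_def by blast
  qed
qed

lemma d_Omega_coset: "finite I \<Longrightarrow> d_Omega I k (w +o OU I k) = d_form w +o OU I (Suc k)"
  unfolding d_Omega_def
  by (rule induced_coset[OF linear_d_form subspace_OU _ d_form_OU]) (simp_all add: free.subspace_0[OF subspace_OU])

lemma res_form_coset:
  assumes "finite I" "J \<subseteq> I"
  shows "res_form J k (w +o OU I k) = pull_form J (\<lambda>j. j) w +o OU J k"
  unfolding res_form_def pull_def
  by (rule induced_coset[OF linear_pull_form subspace_OU _ pull_form_OU])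
     (use assms finite_subset[of J I] in \<open>auto simp: free.subspace_0[OF subspace_OU]\<close>)

text \<open>Restriction and pairing send cosets to single cosets and the integral is constant on
  them, so the set operations in \<open>xi\<close> reduce to a computation with
  representatives.\<close>

lemma xi_phi:
  fixes x :: "'a set \<Rightarrow> ('a, 'k::field_char_0) pform"
  assumes I: "finite I" and x: "fam I m x" and w: "w \<in> OS I m"
  shows "xi I m (phi I m x) (w +o OU I m) = Xi I x w"
proof -
  have "w +o OU I m \<in> carrier (Omega I m)" using w by (simp add: carrier_Omega)
  then have "xi I m (phi I m x) (w +o OU I m) =
      (\<Sum>J\<in>faces I. simplex_integral J (pairing J (phi I m x J) (res_form J m (w +o OU I m))))"
    by (simp add: xi_def)
  also have "\<dots> = Xi I x w"
    unfolding Xi_def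
  proof (rule sum.cong[OF refl])
    fix J assume J: "J \<in> faces I"
    have fJ: "finite J" "J \<noteq> {}" "J \<subseteq> I" using facesD[OF J I] by auto
    have p: "phi I m x J = x J +o TU J m" using J by (simp add: phi_def)
    show "simplex_integral J (pairing J (phi I m x J) (res_form J m (w +o OU I m))) =
        simplex_integral_tilde J (pair_form (x J) (pull_form J (\<lambda>j. j) w))"
      unfolding p res_form_coset[OF I fJ(3)] pairing_coset[OF fJ(1) fam_TS[OF x J] pull_form_OS[OF fJ(1) w]]
      by (rule integral_coset[OF fJ(1,2)])
  qed
  finally show ?thesis .
qed

lemma Omega_fun_eqI:
  assumes "f \<in> extensional (carrier (Omega I m))" "g \<in> extensional (carrier (Omega I m))"
    and "\<And>w. w \<in> OS I m \<Longrightarrow> f (w +o OU I m) = g (w +o OU I m)"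
  shows "f = g"
  by (rule extensionalityI[OF assms(1,2)]) (auto simp: carrier_Omega assms(3))

lemma xi_extensional: "xi I m x \<in> extensional (carrier (Omega I m))"
  by (simp add: xi_def)

lemma Omega_add_closed: "finite I \<Longrightarrow> v \<in> OS I m \<Longrightarrow> w \<in> OS I m \<Longrightarrow> (v + w) +o OU I m \<in> carrier (Omega I m)"
  and Omega_scale_closed: "finite I \<Longrightarrow> v \<in> OS I m \<Longrightarrow> scale c v +o OU I m \<in> carrier (Omega I m)"
  and Omega_closed: "v \<in> OS I m \<Longrightarrow> v +o OU I m \<in> carrier (Omega I m)"
  by (auto simp: carrier_Omega free.subspace_add[OF subspace_OS] free.subspace_scale[OF subspace_OS])

lemma lin_map_xi_phi:
  fixes x :: "'a set \<Rightarrow> ('a, 'k::field_char_0) pform"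
  assumes I: "finite I" and x: "fam I m x"
  shows "lin_map (Omega I m) ground (xi I m (phi I m x))"
  unfolding lin_map_def
proof (intro conjI ballI allI)
  fix \<omega> \<eta> :: "('a, 'k) pform set" and c assume "\<omega> \<in> carrier (Omega I m)"
  then obtain v where v: "v \<in> OS I m" "\<omega> = v +o OU I m" by (auto simp: carrier_Omega)
  show "xi I m (phi I m x) (c \<odot>\<^bsub>Omega I m\<^esub> \<omega>) = c \<odot>\<^bsub>ground\<^esub> xi I m (phi I m x) \<omega>"
    unfolding v(2) Omega_smult[OF I] xi_phi[OF I x v(1)] xi_phi[OF I x free.subspace_scale[OF subspace_OS v(1)]]
    by (simp add: linear_scale[OF linear_Xi])
  assume "\<eta> \<in> carrier (Omega I m)"
  then obtain w where w: "w \<in> OS I m" "\<eta> = w +o OU I m" by (auto simp: carrier_Omega)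
  show "xi I m (phi I m x) (\<omega> \<oplus>\<^bsub>Omega I m\<^esub> \<eta>) = xi I m (phi I m x) \<omega> \<oplus>\<^bsub>ground\<^esub> xi I m (phi I m x) \<eta>"
    unfolding v(2) w(2) Omega_add[OF I] xi_phi[OF I x v(1)] xi_phi[OF I x w(1)]
      xi_phi[OF I x free.subspace_add[OF subspace_OS v(1) w(1)]]
    by (simp add: linear_add[OF linear_Xi])
qed simp

lemma lin_map_xi:
  assumes I: "finite I"
  shows "lin_map (Phi I m :: ('k::field_char_0, ('a, 'k) phi) module) (Phi_hat I m) (xi I m)"
  unfolding lin_map_def
proof (intro conjI ballI allI)
  show "xi I m \<in> carrier (Phi I m :: ('k, ('a, 'k) phi) module) \<rightarrow> carrier (Phi_hat I m)"
    by (auto simp: carrier_Phi Phi_hat_def xi_extensional lin_map_xi_phi[OF I])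
  fix f g :: "('a, 'k) phi" and c assume "f \<in> carrier (Phi I m)"
  then obtain x where x: "fam I m x" "f = phi I m x" by (auto simp: carrier_Phi)
  show "xi I m (c \<odot>\<^bsub>Phi I m\<^esub> f) = c \<odot>\<^bsub>Phi_hat I m\<^esub> xi I m f"
    by (rule Omega_fun_eqI[where I = I and m = m])
       (simp_all add: x(2) Phi_hat_def phi_smult[OF I] xi_extensional Omega_closed xi_phi[OF I] x(1) fam_scale Xi_scale)
  assume "g \<in> carrier (Phi I m)"
  then obtain y where y: "fam I m y" "g = phi I m y" by (auto simp: carrier_Phi)
  show "xi I m (f \<oplus>\<^bsub>Phi I m\<^esub> g) = xi I m f \<oplus>\<^bsub>Phi_hat I m\<^esub> xi I m g"
    by (rule Omega_fun_eqI[where I = I and m = m])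
       (simp_all add: x(2) y(2) Phi_hat_def phi_add[OF I] xi_extensional Omega_closed xi_phi[OF I] x(1) y(1) fam_add Xi_add)
qed

lemma inj_on_xi:
  assumes I: "finite I"
  shows "inj_on (xi I m) (carrier (Phi I m :: ('k::field_char_0, ('a, 'k) phi) module))"
proof (rule inj_onI)
  fix f g :: "('a, 'k) phi" assume "f \<in> carrier (Phi I m)" "g \<in> carrier (Phi I m)" and eq: "xi I m f = xi I m g"
  then obtain x y where x: "fam I m x" "f = phi I m x" and y: "fam I m y" "g = phi I m y" by (auto simp: carrier_Phi)
  have "Xi I x w = Xi I y w" if w: "w \<in> OS I m" for w
    using eq by (simp add: x(2) y(2) xi_phi[OF I x(1) w, symmetric] xi_phi[OF I y(1) w, symmetric])
  then show "f = g" unfolding x(2) y(2) phi_eq_Xi[OF I x(1) y(1)] by blast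
qed

lemma chain_complex_Phi_hat:
  assumes I: "finite I"
  shows "chain_complex (Phi_hat I :: nat \<Rightarrow> ('k::field_char_0, ('a, 'k) pform set \<Rightarrow> 'k) module) (d_Phi_hat I)"
  unfolding chain_complex_def
proof (intro conjI allI ballI)
  fix m
  show "module ground (Phi_hat I m :: ('k, ('a, 'k) pform set \<Rightarrow> 'k) module)"
    unfolding Phi_hat_def by (rule module_dual[OF module_Omega[OF I]])
  have d: "d_Omega I m (v +o OU I m) = d_form v +o OU I (Suc m)" "d_form v +o OU I (Suc m) \<in> carrier (Omega I (Suc m))"
    if "v \<in> OS I m" for v :: "('a, 'k) pform" and m
    using that by (simp_all add: d_Omega_coset[OF I] Omega_closed d_form_OS[OF I])
  show "lin_map (Phi_hat I (Suc m) :: ('k, ('a, 'k) pform set \<Rightarrow> 'k) module) (Phi_hat I m) (d_Phi_hat I m)"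
    unfolding lin_map_def
  proof (intro conjI ballI allI)
    fix f g :: "('a, 'k) pform set \<Rightarrow> 'k" and c
    show "d_Phi_hat I m (c \<odot>\<^bsub>Phi_hat I (Suc m)\<^esub> f) = c \<odot>\<^bsub>Phi_hat I m\<^esub> d_Phi_hat I m f"
      by (rule Omega_fun_eqI[where I = I and m = m]) (simp_all add: d_Phi_hat_def Phi_hat_def Omega_closed d)
    show "d_Phi_hat I m (f \<oplus>\<^bsub>Phi_hat I (Suc m)\<^esub> g) = d_Phi_hat I m f \<oplus>\<^bsub>Phi_hat I m\<^esub> d_Phi_hat I m g"
      by (rule Omega_fun_eqI[where I = I and m = m]) (simp_all add: d_Phi_hat_def Phi_hat_def Omega_closed d algebra_simps)
  next
    show "d_Phi_hat I m \<in> carrier (Phi_hat I (Suc m)) \<rightarrow> carrier (Phi_hat I m :: ('k, ('a, 'k) pform set \<Rightarrow> 'k) module)"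
    proof
      fix f :: "('a, 'k) pform set \<Rightarrow> 'k" assume "f \<in> carrier (Phi_hat I (Suc m))"
      then have f: "lin_map (Omega I (Suc m)) ground f" by (simp add: Phi_hat_def)
      have "lin_map (Omega I m) ground (d_Phi_hat I m f)"
        unfolding lin_map_def
      proof (intro conjI ballI allI)
        fix \<omega> \<eta> :: "('a, 'k) pform set" and c assume "\<omega> \<in> carrier (Omega I m)"
        then obtain v where v: "v \<in> OS I m" "\<omega> = v +o OU I m" by (auto simp: carrier_Omega)
        have "f (scale c (d_form v) +o OU I (Suc m)) = c * f (d_form v +o OU I (Suc m))"
          using f d(2)[OF v(1)] unfolding lin_map_def Omega_smult[OF I, symmetric] by simp
        then show "d_Phi_hat I m f (c \<odot>\<^bsub>Omega I m\<^esub> \<omega>) = c \<odot>\<^bsub>ground\<^esub> d_Phi_hat I m f \<omega>"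
          by (simp add: v d_Phi_hat_def Omega_smult[OF I] Omega_scale_closed[OF I] Omega_closed d_Omega_coset[OF I]
              linear_scale[OF linear_d_form])
        assume "\<eta> \<in> carrier (Omega I m)"
        then obtain w where w: "w \<in> OS I m" "\<eta> = w +o OU I m" by (auto simp: carrier_Omega)
        have "f ((d_form v + d_form w) +o OU I (Suc m)) = f (d_form v +o OU I (Suc m)) + f (d_form w +o OU I (Suc m))"
          using f d(2)[OF v(1)] d(2)[OF w(1)] unfolding lin_map_def Omega_add[OF I, symmetric] by simp
        then show "d_Phi_hat I m f (\<omega> \<oplus>\<^bsub>Omega I m\<^esub> \<eta>) = d_Phi_hat I m f \<omega> \<oplus>\<^bsub>ground\<^esub> d_Phi_hat I m f \<eta>"
          by (simp add: v w d_Phi_hat_def Omega_add[OF I] Omega_add_closed[OF I] Omega_closed d_Omega_coset[OF I]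
              linear_add[OF linear_d_form] algebra_simps)
      qed simp
      then show "d_Phi_hat I m f \<in> carrier (Phi_hat I m)" by (simp add: Phi_hat_def d_Phi_hat_def)
    qed
  qed
  fix f :: "('a, 'k) pform set \<Rightarrow> 'k" assume "f \<in> carrier (Phi_hat I (Suc (Suc m)))"
  then have "lin_map (Omega I (Suc (Suc m))) ground f" by (simp add: Phi_hat_def)
  moreover have "(0 :: ('a, 'k) pform) +o OU I (Suc (Suc m)) \<in> carrier (Omega I (Suc (Suc m)))"
    by (rule Omega_closed[OF free.subspace_0[OF subspace_OS]])
  ultimately have "f (0 \<odot>\<^bsub>Omega I (Suc (Suc m))\<^esub> (0 +o OU I (Suc (Suc m)))) = 0"
    unfolding lin_map_def by simp
  then have f0: "f (0 +o OU I (Suc (Suc m))) = 0" unfolding Omega_smult[OF I] free.scale_zero_left .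
  show "d_Phi_hat I m (d_Phi_hat I (Suc m) f) = \<zero>\<^bsub>Phi_hat I m\<^esub>"
  proof (rule Omega_fun_eqI[where I = I and m = m])
    fix w :: "('a, 'k) pform" assume w: "w \<in> OS I m"
    have "d_form (d_form w) +o OU I (Suc (Suc m)) = 0 +o OU I (Suc (Suc m))"
      using d_form_d_form[OF I w] unfolding coset_eq_iff[OF subspace_OU[OF I]] diff_zero .
    then show "d_Phi_hat I m (d_Phi_hat I (Suc m) f) (w +o OU I m) = \<zero>\<^bsub>Phi_hat I m\<^esub> (w +o OU I m)"
      using d[OF w] d[OF d_form_OS[OF I w]] f0 w by (simp add: d_Phi_hat_def Phi_hat_def Omega_closed)
  qed (simp_all add: d_Phi_hat_def Phi_hat_def)
qed

lemma d_Phi_hat_xi: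
  fixes x :: "'a set \<Rightarrow> ('a, 'k::field_char_0) pform"
  assumes I: "finite I" and x: "fam I (Suc m) x"
  shows "d_Phi_hat I m (xi I (Suc m) (phi I (Suc m) x)) = xi I m (phi I m (boundary_rep I m x))"
proof (rule Omega_fun_eqI[where I = I and m = m])
  fix w :: "('a, 'k) pform" assume w: "w \<in> OS I m"
  show "d_Phi_hat I m (xi I (Suc m) (phi I (Suc m) x)) (w +o OU I m) = xi I m (phi I m (boundary_rep I m x)) (w +o OU I m)"
    unfolding xi_phi[OF I fam_boundary_rep[OF I x] w] Xi_boundary_rep[OF I x w]
    using xi_phi[OF I x d_form_OS[OF I w]] by (simp add: d_Phi_hat_def Omega_closed w d_Omega_coset[OF I])
qed (simp_all add: d_Phi_hat_def xi_extensional)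

text \<open>\<open>boundary_rep\<close> supplies an explicit preimage under the injective map
  \<open>xi\<close>, so the inverse in \<open>d_Phi\<close> can be evaluated.\<close>

lemma d_Phi_phi:
  assumes I: "finite I" and x: "fam I (Suc m) x"
  shows "d_Phi I m (phi I (Suc m) x) = phi I m (boundary_rep I m x)"
  unfolding d_Phi_def d_Phi_hat_xi[OF I x]
  by (rule inv_into_f_f[OF inj_on_xi[OF I] phi_in_carrier[OF fam_boundary_rep[OF I x]]])

lemma subcomplex_xi:
  assumes I: "finite I"
  shows "subcomplex (Phi_hat I :: nat \<Rightarrow> ('k::field_char_0, ('a, 'k) pform set \<Rightarrow> 'k) module) (d_Phi_hat I)
    (\<lambda>m. xi I m ` carrier (Phi I m))"
  unfolding subcomplex_def
proof (intro conjI allI)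
  show "chain_complex (Phi_hat I :: nat \<Rightarrow> ('k, ('a, 'k) pform set \<Rightarrow> 'k) module) (d_Phi_hat I)"
    by (rule chain_complex_Phi_hat[OF I])
  then have "module ground (Phi_hat I m :: ('k, ('a, 'k) pform set \<Rightarrow> 'k) module)" for m by (simp add: chain_complex_def)
  then show "submodule (xi I m ` carrier (Phi I m)) ground (Phi_hat I m :: ('k, ('a, 'k) pform set \<Rightarrow> 'k) module)" for m
    by (rule lin_map_image_submodule[OF module_Phi[OF I] _ lin_map_xi[OF I]])
  show "d_Phi_hat I m ` xi I (Suc m) ` carrier (Phi I (Suc m)) \<subseteq> (xi I m ` carrier (Phi I m) :: (('a, 'k) pform set \<Rightarrow> 'k) set)" for m
  proof
    fix g :: "('a, 'k) pform set \<Rightarrow> 'k" assume "g \<in> d_Phi_hat I m ` xi I (Suc m) ` carrier (Phi I (Suc m))"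
    then obtain x where x: "fam I (Suc m) x" "g = d_Phi_hat I m (xi I (Suc m) (phi I (Suc m) x))" by (auto simp: carrier_Phi)
    then have "g = xi I m (phi I m (boundary_rep I m x))" by (simp add: d_Phi_hat_xi[OF I])
    then show "g \<in> xi I m ` carrier (Phi I m)" using phi_in_carrier[OF fam_boundary_rep[OF I x(1)]] by blast
  qed
qed

lemma chain_complex_Phi:
  assumes I: "finite I"
  shows "chain_complex (Phi I :: nat \<Rightarrow> ('k::field_char_0, ('a, 'k) phi) module) (d_Phi I)"
  unfolding chain_complex_def
proof (intro conjI allI ballI)
  fix m
  show "module ground (Phi I m :: ('k, ('a, 'k) phi) module)" by (rule module_Phi[OF I])
  show "lin_map (Phi I (Suc m) :: ('k, ('a, 'k) phi) module) (Phi I m) (d_Phi I m)"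
    unfolding lin_map_def
  proof (intro conjI ballI allI)
    show "d_Phi I m \<in> carrier (Phi I (Suc m) :: ('k, ('a, 'k) phi) module) \<rightarrow> carrier (Phi I m)"
      by (auto simp: carrier_Phi d_Phi_phi[OF I] fam_boundary_rep[OF I])
    fix f g :: "('a, 'k) phi" and c assume "f \<in> carrier (Phi I (Suc m))"
    then obtain x where x: "fam I (Suc m) x" "f = phi I (Suc m) x" by (auto simp: carrier_Phi)
    have cx: "fam I (Suc m) (\<lambda>J. scale c (x J))" by (rule fam_scale[OF x(1)])
    show "d_Phi I m (c \<odot>\<^bsub>Phi I (Suc m)\<^esub> f) = c \<odot>\<^bsub>Phi I m\<^esub> d_Phi I m f"
      unfolding x(2) phi_smult[OF I] d_Phi_phi[OF I x(1)] d_Phi_phi[OF I cx]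
        phi_eq_Xi[OF I fam_boundary_rep[OF I cx] fam_scale[OF fam_boundary_rep[OF I x(1)]]]
      by (simp add: Xi_boundary_rep[OF I x(1)] Xi_boundary_rep[OF I cx] Xi_scale)
    assume "g \<in> carrier (Phi I (Suc m))"
    then obtain y where y: "fam I (Suc m) y" "g = phi I (Suc m) y" by (auto simp: carrier_Phi)
    have xy: "fam I (Suc m) (\<lambda>J. x J + y J)" by (rule fam_add[OF x(1) y(1)])
    show "d_Phi I m (f \<oplus>\<^bsub>Phi I (Suc m)\<^esub> g) = d_Phi I m f \<oplus>\<^bsub>Phi I m\<^esub> d_Phi I m g"
      unfolding x(2) y(2) phi_add[OF I] d_Phi_phi[OF I x(1)] d_Phi_phi[OF I y(1)] d_Phi_phi[OF I xy]
        phi_eq_Xi[OF I fam_boundary_rep[OF I xy] fam_add[OF fam_boundary_rep[OF I x(1)] fam_boundary_rep[OF I y(1)]]]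
      by (simp add: Xi_boundary_rep[OF I x(1)] Xi_boundary_rep[OF I y(1)] Xi_boundary_rep[OF I xy] Xi_add algebra_simps)
  qed
  fix f :: "('a, 'k) phi" assume "f \<in> carrier (Phi I (Suc (Suc m)))"
  then obtain x where x: "fam I (Suc (Suc m)) x" "f = phi I (Suc (Suc m)) x" by (auto simp: carrier_Phi)
  note bx = fam_boundary_rep[OF I x(1)]
  show "d_Phi I m (d_Phi I (Suc m) f) = \<zero>\<^bsub>Phi I m\<^esub>"
    unfolding x(2) d_Phi_phi[OF I x(1)] d_Phi_phi[OF I bx] phi_zero phi_eq_Xi[OF I fam_boundary_rep[OF I bx] fam_zero]
    by (simp add: Xi_boundary_rep[OF I bx] Xi_boundary_rep[OF I x(1)] d_form_OS[OF I] Xi_OU[OF I x(1) d_form_d_form[OF I]] Xi_zero)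
qed


section \<open>Functoriality\<close>

text \<open>The monomial formula does not show that relations go to relations. By adjunction the
  pushed element pairs to zero with every form under the integral; nondegeneracy and
  \<open>TU_iff\<close> turn this into membership in the relations.\<close>

lemma push_form_TU:
  fixes u :: "('a, 'k::field_char_0) pform"
  assumes F: "finite F" "F \<noteq> {}" "\<alpha> ` F = L" and u: "u \<in> TU F m"
  shows "push_form F L \<alpha> u \<in> TU L m"
proof -
  have L: "finite L" "L \<noteq> {}" using F by auto
  have uS: "u \<in> TS F m" using TU_subset_TS[OF F(1)] u by blast
  have pS: "push_form F L \<alpha> u \<in> TS L m" by (rule push_form_TS[OF F(1,3) uS])
  have "coef (push_form F L \<alpha> u) l \<in> P_ideal L" if l: "l \<in> words m L" for l
  proof (rule integral_nondegenerate[OF L])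
    show "coef (push_form F L \<alpha> u) l \<in> P_tilde L" by (rule alt_tan_P[OF alt_tan_coef[OF L(1) pS] l])
    fix g :: "('b, 'k) mpoly" assume g: "g \<in> P_tilde L"
    let ?w = "(basis (face_monomial L) * g) \<otimes>\<^sub>t basis l :: ('b, 'k) pform"
    have w: "?w \<in> OS L m"
      by (intro OS_basis P_tilde_mult g l) (simp add: keys_face_monomial[OF L(1)])
    have "simplex_integral_tilde L (basis (face_monomial L) * g * coef (push_form F L \<alpha> u) l) =
        simplex_integral_tilde L (pair_form (push_form F L \<alpha> u) ?w)"
      by (simp only: pair_form_coef)
    also have "\<dots> = simplex_integral_tilde F (pair_form u (pull_form F \<alpha> ?w))" by (rule integral_pair_push[OF F uS w])
    also have "\<dots> = 0" by (rule integral_ideal[OF F(1,2) pair_form_TU_OS[OF F(1) u pull_form_OS[OF F(1) w]]])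
    finally show "simplex_integral_tilde L (basis (face_monomial L) * g * coef (push_form F L \<alpha> u) l) = 0" .
  qed
  then show ?thesis using TU_iff[OF L pS] by blast
qed

definition push_fam ::
    "'a set \<Rightarrow> ('a \<Rightarrow> 'b) \<Rightarrow> ('a set \<Rightarrow> ('a, 'k::field_char_0) pform) \<Rightarrow> ('b set \<Rightarrow> ('b, 'k) pform)" where
  "push_fam I \<alpha> x L = (\<Sum>F | F \<in> faces I \<and> \<alpha> ` F = L. push_form F L \<alpha> (x F))"

lemma fam_push:
  assumes I: "finite I" and x: "fam I m x"
  shows "fam J m (push_fam I \<alpha> x)"
  unfolding fam_def push_fam_def
  by (intro ballI free.subspace_sum[OF subspace_TS] push_form_TS) (auto dest: facesD[OF _ I] simp: fam_TS[OF x])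

lemma push_phi:
  fixes x :: "'a set \<Rightarrow> ('a, 'k::field_char_0) pform" and \<alpha> :: "'a \<Rightarrow> 'b"
  assumes I: "finite I" and J: "finite J" and x: "fam I m x"
  shows "push I J \<alpha> m (phi I m x) = phi J m (push_fam I \<alpha> x)"
proof (rule extensionalityI[of _ "faces J"])
  fix L assume L: "L \<in> faces J"
  have fL: "finite L" using facesD[OF L J] by auto
  let ?A = "{F \<in> faces I. \<alpha> ` F = L}"
  interpret module "ground :: ('k, 'k) module" "Theta L m" by (rule module_Theta[OF fL])
  have A: "finite ?A" using finite_faces[OF I] by auto
  have pS: "push_form F L \<alpha> (x F) \<in> TS L m" if "F \<in> ?A" for F
    using that facesD[of F I] I by (intro push_form_TS fam_TS[OF x]) auto
  have e: "push_Theta F L \<alpha> m (phi I m x F) = push_form F L \<alpha> (x F) +o TU L m" if F: "F \<in> ?A" for F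
  proof -
    have fF: "finite F" "F \<noteq> {}" "\<alpha> ` F = L" "F \<in> faces I" using F facesD[of F I] I by auto
    have "phi I m x F = x F +o TU F m" using fF(4) by (simp add: phi_def)
    then show ?thesis
      unfolding push_Theta_def
      using induced_coset[OF linear_push_form subspace_TU[OF fL] free.subspace_0[OF subspace_TU[OF fF(1)]] push_form_TU[OF fF(1-3)]]
      by simp
  qed
  have "push I J \<alpha> m (phi I m x) L = (\<Oplus>\<^bsub>Theta L m\<^esub>F\<in>?A. push_Theta F L \<alpha> m (phi I m x F))"
    using L by (simp add: push_def)
  also have "\<dots> = (\<Oplus>\<^bsub>Theta L m\<^esub>F\<in>?A. push_form F L \<alpha> (x F) +o TU L m)"
    by (rule M.finsum_cong') (use pS in \<open>auto simp: e carrier_Theta\<close>)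
  also have "\<dots> = (\<Sum>F\<in>?A. push_form F L \<alpha> (x F)) +o TU L m" by (rule Theta_finsum[OF fL A pS])
  finally show "push I J \<alpha> m (phi I m x) L = phi J m (push_fam I \<alpha> x) L"
    using L by (simp add: phi_def push_fam_def)
qed (simp_all add: push_def phi_def)

text \<open>Each face of \<open>I\<close> contributes to exactly one face of \<open>J\<close>, its
  image. On it the adjunction replaces the pushforward by a pullback, and pulling back to
  \<open>F\<close> through its image is the same as through \<open>I\<close>.\<close>

lemma Xi_push:
  fixes x :: "'a set \<Rightarrow> ('a, 'k::field_char_0) pform" and \<alpha> :: "'a \<Rightarrow> 'b"
  assumes I: "finite I" and J: "finite J" and al: "\<alpha> \<in> I \<rightarrow> J" and x: "fam I m x" and w: "w \<in> OS J m"
  shows "Xi J (push_fam I \<alpha> x) w = Xi I x (pull_form I \<alpha> w)"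
proof -
  let ?h = "\<lambda>F. simplex_integral_tilde F (pair_form (x F) (pull_form F \<alpha> w))"
  have s: "simplex_integral_tilde L (pair_form (push_fam I \<alpha> x L) (pull_form L (\<lambda>j. j) w)) = (\<Sum>F | F \<in> faces I \<and> \<alpha> ` F = L. ?h F)"
    if L: "L \<in> faces J" for L
  proof -
    have fL: "finite L" "L \<subseteq> J" using facesD[OF L J] by auto
    have "simplex_integral_tilde L (pair_form (push_form F L \<alpha> (x F)) (pull_form L (\<lambda>j. j) w)) = ?h F"
      if F: "F \<in> faces I" "\<alpha> ` F = L" for F
    proof -
      have fF: "finite F" "F \<noteq> {}" "\<alpha> \<in> F \<rightarrow> L" using facesD[OF F(1) I] F by auto
      have "pull_form F \<alpha> (pull_form L (\<lambda>j. j) w) = pull_form F ((\<lambda>j. j) \<circ> \<alpha>) w"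
        by (rule pull_form_pull_form[OF fF(1) fL(1) fF(3) w])
      then show ?thesis
        using integral_pair_push[OF fF(1,2) F(2) fam_TS[OF x F(1)] pull_form_OS[OF fL(1) w]] by (simp add: comp_def)
    qed
    then show ?thesis
      by (simp add: push_fam_def linear_sum[OF linear_comp[OF linear_pair_form_left linear_integral]])
  qed
  have "Xi J (push_fam I \<alpha> x) w = (\<Sum>L\<in>faces J. \<Sum>F | F \<in> faces I \<and> \<alpha> ` F = L. ?h F)"
    unfolding Xi_def by (rule sum.cong[OF refl s])
  also have "\<dots> = (\<Sum>F\<in>faces I. ?h F)"
    by (rule sum.group[OF finite_faces[OF I] finite_faces[OF J]]) (use al in \<open>auto simp: faces_def\<close>)
  also have "\<dots> = Xi I x (pull_form I \<alpha> w)"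
    unfolding Xi_def
  proof (rule sum.cong[OF refl])
    fix F assume "F \<in> faces I"
    then have fF: "finite F" "(\<lambda>j. j) \<in> F \<rightarrow> I" using facesD[of F I] I by auto
    show "?h F = simplex_integral_tilde F (pair_form (x F) (pull_form F (\<lambda>j. j) (pull_form I \<alpha> w)))"
      using pull_form_pull_form[OF fF(1) I fF(2) w, of \<alpha>] by (simp add: comp_def)
  qed
  finally show ?thesis .
qed

text \<open>All functoriality statements go through this rule and thus reduce to identities for
  pullbacks of forms.\<close>

lemma push_phi_eqI:
  fixes x :: "'a set \<Rightarrow> ('a, 'k::field_char_0) pform" and \<alpha> :: "'a \<Rightarrow> 'b"
  assumes I: "finite I" and J: "finite J" and al: "\<alpha> \<in> I \<rightarrow> J" and x: "fam I m x" and y: "fam J m y"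
    and eq: "\<And>w. w \<in> OS J m \<Longrightarrow> Xi I x (pull_form I \<alpha> w) = Xi J y w"
  shows "push I J \<alpha> m (phi I m x) = phi J m y"
  unfolding push_phi[OF I J x] phi_eq_Xi[OF J fam_push[OF I x] y] using eq by (simp add: Xi_push[OF I J al x])

lemma push_id:
  assumes I: "finite I" and f: "f \<in> carrier (Phi I m)"
  shows "push I I (\<lambda>i. i) m f = f"
proof -
  obtain x where x: "fam I m x" "f = phi I m x" using f by (auto simp: carrier_Phi)
  show ?thesis unfolding x(2) by (rule push_phi_eqI[OF I I _ x(1) x(1)]) (auto simp: pull_form_id)
qed

lemma push_cong:
  assumes I: "finite I" and J: "finite J" and al: "\<alpha> \<in> I \<rightarrow> J" and eq: "\<And>i. i \<in> I \<Longrightarrow> \<alpha>' i = \<alpha> i"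
    and f: "f \<in> carrier (Phi I m)"
  shows "push I J \<alpha>' m f = push I J \<alpha> m f"
proof -
  obtain x where x: "fam I m x" "f = phi I m x" using f by (auto simp: carrier_Phi)
  have "\<alpha>' \<in> I \<rightarrow> J" using al eq by auto
  then show ?thesis
    unfolding x(2) push_phi[OF I J x(1), of \<alpha>]
    by (rule push_phi_eqI[OF I J _ x(1) fam_push[OF I x(1)]])
       (simp add: Xi_push[OF I J al x(1)] pull_form_cong[OF eq])
qed

lemma push_comp:
  assumes I: "finite I" and J: "finite J" and L: "finite L" and al: "\<alpha> \<in> I \<rightarrow> J" and be: "\<beta> \<in> J \<rightarrow> L"
    and f: "f \<in> carrier (Phi I m)"
  shows "push I L (\<beta> \<circ> \<alpha>) m f = push J L \<beta> m (push I J \<alpha> m f)"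
proof -
  obtain x where x: "fam I m x" "f = phi I m x" using f by (auto simp: carrier_Phi)
  have ab: "\<beta> \<circ> \<alpha> \<in> I \<rightarrow> L" using al be by auto
  note px = fam_push[OF I x(1)]
  show ?thesis
    unfolding x(2) push_phi[OF I J x(1), of \<alpha>] push_phi[OF J L px]
    by (rule push_phi_eqI[OF I L ab x(1) fam_push[OF J px]])
       (simp add: Xi_push[OF J L be px] Xi_push[OF I J al x(1)] pull_form_OS[OF J] pull_form_pull_form[OF I J al])
qed

lemma chain_map_push:
  fixes \<alpha> :: "'a \<Rightarrow> 'b"
  assumes I: "finite I" and J: "finite J" and al: "\<alpha> \<in> I \<rightarrow> J"
  shows "chain_map (Phi I :: nat \<Rightarrow> ('k::field_char_0, ('a, 'k) phi) module) (d_Phi I) (Phi J) (d_Phi J) (push I J \<alpha>)"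
  unfolding chain_map_def
proof (intro conjI allI ballI)
  fix m
  show "lin_map (Phi I m :: ('k, ('a, 'k) phi) module) (Phi J m) (push I J \<alpha> m)"
    unfolding lin_map_def
  proof (intro conjI ballI allI)
    show "push I J \<alpha> m \<in> carrier (Phi I m :: ('k, ('a, 'k) phi) module) \<rightarrow> carrier (Phi J m)"
      by (auto simp: carrier_Phi push_phi[OF I J] fam_push[OF I])
    fix f g :: "('a, 'k) phi" and c assume "f \<in> carrier (Phi I m)"
    then obtain x where x: "fam I m x" "f = phi I m x" by (auto simp: carrier_Phi)
    show "push I J \<alpha> m (c \<odot>\<^bsub>Phi I m\<^esub> f) = c \<odot>\<^bsub>Phi J m\<^esub> push I J \<alpha> m f"
      unfolding x(2) phi_smult[OF I] push_phi[OF I J x(1)] phi_smult[OF J]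
      by (rule push_phi_eqI[OF I J al fam_scale[OF x(1)] fam_scale[OF fam_push[OF I x(1)]]])
         (simp add: Xi_scale Xi_push[OF I J al x(1)])
    assume "g \<in> carrier (Phi I m)"
    then obtain y where y: "fam I m y" "g = phi I m y" by (auto simp: carrier_Phi)
    show "push I J \<alpha> m (f \<oplus>\<^bsub>Phi I m\<^esub> g) = push I J \<alpha> m f \<oplus>\<^bsub>Phi J m\<^esub> push I J \<alpha> m g"
      unfolding x(2) y(2) phi_add[OF I] push_phi[OF I J x(1)] push_phi[OF I J y(1)] phi_add[OF J]
      by (rule push_phi_eqI[OF I J al fam_add[OF x(1) y(1)] fam_add[OF fam_push[OF I x(1)] fam_push[OF I y(1)]]])
         (simp add: Xi_add Xi_push[OF I J al x(1)] Xi_push[OF I J al y(1)])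
  qed
  fix f :: "('a, 'k) phi" assume "f \<in> carrier (Phi I (Suc m))"
  then obtain x where x: "fam I (Suc m) x" "f = phi I (Suc m) x" by (auto simp: carrier_Phi)
  note px = fam_push[OF I x(1)]
  show "push I J \<alpha> m (d_Phi I m f) = d_Phi J m (push I J \<alpha> (Suc m) f)"
    unfolding x(2) d_Phi_phi[OF I x(1)] push_phi[OF I J x(1)] d_Phi_phi[OF J px]
    by (rule push_phi_eqI[OF I J al fam_boundary_rep[OF I x(1)] fam_boundary_rep[OF J px]])
       (simp add: Xi_boundary_rep[OF I x(1)] Xi_boundary_rep[OF J px] pull_form_OS[OF I] Xi_push[OF I J al x(1)]
         d_form_OS[OF J] pull_form_d_form[OF I J al])
qed


section \<open>Homology\<close>

text \<open>Vanishing of the boundary is tested on forms, where the boundary is adjoint to the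
  differential.\<close>

lemma cycle_iff:
  fixes x :: "'a set \<Rightarrow> ('a, 'k::field_char_0) pform"
  assumes I: "finite I" and x: "fam I (Suc n) x"
  shows "phi I (Suc n) x \<in> cycles (Phi I) (d_Phi I) (Suc n) \<longleftrightarrow> (\<forall>v\<in>OS I n. Xi I x (d_form v) = 0)"
proof -
  have "phi I (Suc n) x \<in> cycles (Phi I) (d_Phi I) (Suc n) \<longleftrightarrow> phi I n (boundary_rep I n x) = phi I n (\<lambda>J. 0)"
    by (simp add: cycles_def d_Phi_phi[OF I x] phi_zero phi_in_carrier[OF x])
  also have "\<dots> \<longleftrightarrow> (\<forall>v\<in>OS I n. Xi I x (d_form v) = 0)"
    unfolding phi_eq_Xi[OF I fam_boundary_rep[OF I x] fam_zero] by (simp add: Xi_boundary_rep[OF I x] Xi_zero)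
  finally show ?thesis .
qed

lemma cycle_contract:
  fixes x :: "'a set \<Rightarrow> ('a, 'k::field_char_0) pform"
  assumes I: "finite I" "I \<noteq> {}" and x: "fam I m x" and cyc: "phi I m x \<in> cycles (Phi I) (d_Phi I) m"
    and aug: "m = 0 \<Longrightarrow> Xi I x unit_form = 0"
  shows "phi I m x \<in> boundaries (Phi I) (d_Phi I) m"
proof -
  have c: "Xi I x (d_form v) = 0" if m: "m = Suc n" and v: "v \<in> OS I n" for n v
    using cyc x v cycle_iff[OF I(1), of n x] unfolding m by blast
  obtain y where y: "fam I (Suc m) y" "phi I m x = phi I m (boundary_rep I m y)"
    by (rule contract_cycle[OF I x]) (use c aug in blast)+
  then show ?thesis
    by (auto simp: boundaries_def d_Phi_phi[OF I(1) y(1), symmetric] intro!: phi_in_carrier)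
qed

text \<open>The form 1 is closed, so boundaries vanish on it and its value is an invariant of
  homology classes in degree zero.\<close>

lemma boundary_augmentation:
  fixes x :: "'a set \<Rightarrow> ('a, 'k::field_char_0) pform"
  assumes I: "finite I" and x: "fam I 0 x" and b: "phi I 0 x \<in> boundaries (Phi I) (d_Phi I) 0"
  shows "Xi I x unit_form = 0"
proof -
  obtain y where y: "fam I (Suc 0) y" "phi I 0 x = d_Phi I 0 (phi I (Suc 0) y)"
    using b by (auto simp: boundaries_def carrier_Phi)
  then have "phi I 0 x = phi I 0 (boundary_rep I 0 y)" by (simp add: d_Phi_phi[OF I])
  then have "Xi I x unit_form = Xi I (boundary_rep I 0 y) unit_form"
    unfolding phi_eq_Xi[OF I x fam_boundary_rep[OF I y(1)]] using unit_form_OS by blast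
  also have "\<dots> = 0" by (simp add: Xi_boundary_rep[OF I y(1) unit_form_OS] d_unit_form linear_0[OF linear_Xi])
  finally show ?thesis .
qed

text \<open>A cycle bounds as soon as, in degree zero, its value on the form 1 vanishes, and the
  pushforward preserves that value. This gives injectivity; for surjectivity a multiple of a vertex
  of \<open>I\<close> realises any given value.\<close>

lemma quasi_iso_push:
  fixes \<alpha> :: "'a \<Rightarrow> 'b"
  assumes I: "finite I" "I \<noteq> {}" and J: "finite J" "J \<noteq> {}" and al: "\<alpha> \<in> I \<rightarrow> J"
  shows "quasi_iso (Phi I :: nat \<Rightarrow> ('k::field_char_0, ('a, 'k) phi) module) (d_Phi I) (Phi J) (d_Phi J) (push I J \<alpha>)"
proof (rule quasi_isoI[OF chain_complex_Phi[OF I(1)] chain_complex_Phi[OF J(1)] chain_map_push[OF I(1) J(1) al]])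
  have aug: "Xi J (push_fam I \<alpha> x) unit_form = Xi I x unit_form" if "fam I 0 x" for x :: "'a set \<Rightarrow> ('a, 'k) pform"
    using Xi_push[OF I(1) J(1) al that unit_form_OS] by (simp only: pull_unit_form)
  have cc: "cycles (Phi K) (d_Phi K) m \<subseteq> carrier (Phi K m)" for K m
    by (auto simp: cycles_def split: nat.splits)
  fix m
  show "z \<in> boundaries (Phi I) (d_Phi I) m"
    if z: "z \<in> cycles (Phi I) (d_Phi I) m" and b: "push I J \<alpha> m z \<in> boundaries (Phi J) (d_Phi J) m" for z :: "('a, 'k) phi"
  proof -
    obtain x where x: "fam I m x" "z = phi I m x" using z cc by (force simp: carrier_Phi)
    have "Xi I x unit_form = 0" if m: "m = 0"
    proof -
      have x0: "fam I 0 x" using x(1) m by simp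
      have "phi J 0 (push_fam I \<alpha> x) \<in> boundaries (Phi J) (d_Phi J) 0" using b m by (simp add: x(2) push_phi[OF I(1) J(1) x0])
      from boundary_augmentation[OF J(1) fam_push[OF I(1) x0] this] show ?thesis by (simp add: aug[OF x0])
    qed
    then show ?thesis using z unfolding x(2) by (intro cycle_contract[OF I x(1)])
  qed
  show "\<exists>z\<in>cycles (Phi I) (d_Phi I) m. \<exists>b\<in>boundaries (Phi J) (d_Phi J) m. f = b \<oplus>\<^bsub>Phi J m\<^esub> push I J \<alpha> m z"
    if f: "f \<in> cycles (Phi J) (d_Phi J) m" for f :: "('b, 'k) phi"
  proof -
    obtain y where y: "fam J m y" "f = phi J m y" using f cc by (force simp: carrier_Phi)
    obtain w where w: "w \<in> I" using I by auto
    \<comment> \<open>In degree zero the preimage is the vertex \<open>w\<close> weighted by the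
      value of \<open>y\<close> on the form 1; in positive degree all cycles bound and zero will
      do.\<close>
    let ?x = "\<lambda>F. if m = 0 then point_rep w (Xi J y unit_form) F else 0"
    have x: "fam I m ?x" using fam_point_rep[of I w] fam_zero[of I m] by (cases "m = 0") simp_all
    note px = fam_push[OF I(1) x, of J \<alpha>]
    let ?r = "\<lambda>L. y L - push_fam I \<alpha> ?x L"
    have r: "fam J m ?r" by (rule fam_diff[OF y(1) px])
    have zC: "phi I m ?x \<in> cycles (Phi I) (d_Phi I) m"
    proof (cases m)
      case 0
      then show ?thesis using phi_in_carrier[OF x] by (simp add: cycles_def)
    next
      case (Suc n)
      have "Xi I ?x v = 0" for v using Xi_zero[of I v] Suc by simp
      then show ?thesis using cycle_iff[OF I(1), of n ?x] x unfolding Suc by blast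
    qed
    have rC: "phi J m ?r \<in> cycles (Phi J) (d_Phi J) m"
    proof (cases m)
      case 0
      then show ?thesis using phi_in_carrier[OF r] by (simp add: cycles_def)
    next
      case (Suc n)
      have "Xi J ?r (d_form v) = 0" if v: "v \<in> OS J n" for v
      proof -
        have "Xi J y (d_form v) = 0" using f y v cycle_iff[OF J(1), of n y] unfolding Suc by blast
        moreover have "Xi J (push_fam I \<alpha> ?x) (d_form v) = Xi I (\<lambda>F. 0) (pull_form I \<alpha> (d_form v))"
          using Xi_push[OF I(1) J(1) al x, of "d_form v"] d_form_OS[OF J(1) v] Suc by simp
        ultimately show ?thesis by (simp add: Xi_diff Xi_zero)
      qed
      then show ?thesis using cycle_iff[OF J(1), of n ?r] r unfolding Suc by blast
    qed
    have "phi J m ?r \<in> boundaries (Phi J) (d_Phi J) m"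
    proof (rule cycle_contract[OF J r rC])
      assume m: "m = 0"
      have "Xi J (push_fam I \<alpha> ?x) unit_form = Xi J y unit_form"
        using x by (simp add: m aug Xi_point_rep[OF I(1) w])
      then show "Xi J ?r unit_form = 0" by (simp add: Xi_diff)
    qed
    moreover have "f = phi J m ?r \<oplus>\<^bsub>Phi J m\<^esub> push I J \<alpha> m (phi I m ?x)"
      by (simp only: y(2) push_phi[OF I(1) J(1) x] phi_add[OF J(1)] diff_add_cancel)
    ultimately show ?thesis using zC by blast
  qed
qed


section \<open>The point\<close>

lemma fam_point_Suc:
  fixes x :: "'a set \<Rightarrow> ('a, 'k::field_char_0) pform"
  assumes x: "fam {a} (Suc m) x"
  shows "phi {a} (Suc m) x = phi {a} (Suc m) (\<lambda>J. 0)"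
proof -
  have "x J \<in> TU J (Suc m)" if J: "J \<in> faces {a}" for J
  proof -
    have e: "J = {a}" using J by (auto simp: faces_def)
    have "alt_tan (Suc m) {a} (coef (x J))" using fam_TS[OF x J] unfolding e by (intro alt_tan_coef) auto
    then show ?thesis
      using TU_iff[OF _ _ fam_TS[OF x J]] by (simp add: e alt_tan_singleton P_ideal_closed)
  qed
  then show ?thesis by (simp add: phi_eq_iff)
qed

lemma Phi_point_rep: "Phi_point a c = phi {a} 0 (point_rep a c)"
  by (auto simp: Phi_point_def Phi_incl_def phi_def point_rep_def fun_eq_iff faces_def)

text \<open>The value on the form 1 recovers the constant, which gives injectivity. For
  surjectivity, an element minus the constant with the same value is a boundary, and boundaries
  vanish because degree one is zero.\<close>

lemma lin_iso_point: "lin_iso (ground :: ('k::field_char_0, 'k) module) (Phi {a} 0) (Phi_point a)"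
proof -
  have p: "fam {a} 0 (point_rep a c)" for c :: 'k by (rule fam_point_rep)
  have "lin_map (ground :: ('k, 'k) module) (Phi {a} 0) (Phi_point a)"
    by (simp add: lin_map_def Phi_point_rep phi_in_carrier p phi_add phi_smult)
       (simp add: phi_def point_rep_def free.scale_left_distrib fun_eq_iff restrict_def)
  moreover have "inj (Phi_point a :: 'k \<Rightarrow> _)"
  proof (rule injI)
    fix c d :: 'k assume "Phi_point a c = Phi_point a d"
    then have "\<forall>w\<in>OS {a} 0. Xi {a} (point_rep a c) w = Xi {a} (point_rep a d) w"
      using phi_eq_Xi[OF _ p p, of c d] by (simp add: Phi_point_rep)
    then have "Xi {a} (point_rep a c) unit_form = Xi {a} (point_rep a d) unit_form"
      by (rule bspec[OF _ unit_form_OS])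
    then show "c = d" by (simp add: Xi_point_rep)
  qed
  moreover have "f \<in> range (Phi_point a)" if f: "f \<in> carrier (Phi {a} 0)" for f :: "('a, 'k) phi"
  proof -
    obtain x where x: "fam {a} 0 x" "f = phi {a} 0 x" using f by (auto simp: carrier_Phi)
    let ?c = "Xi {a} x unit_form"
    let ?r = "\<lambda>J. x J - point_rep a ?c J"
    have r: "fam {a} 0 ?r" by (rule fam_diff[OF x(1) p])
    have "Xi {a} ?r unit_form = 0" by (simp add: Xi_diff Xi_point_rep)
    then obtain y where y: "fam {a} (Suc 0) y" "phi {a} 0 ?r = phi {a} 0 (boundary_rep {a} 0 y)"
      using contract_cycle[of "{a}" 0 ?r] r by blast
    \<comment> \<open>\<open>y\<close> represents zero in degree one, so its current, and with it
      the boundary of \<open>y\<close>, vanishes on all forms.\<close>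
    have "Xi {a} ?r v = 0" if v: "v \<in> OS {a} 0" for v
    proof -
      have "Xi {a} ?r v = Xi {a} (boundary_rep {a} 0 y) v"
        using y(2) v phi_eq_Xi[OF _ r fam_boundary_rep[OF _ y(1)]] by auto
      also have "\<dots> = 0"
        using fam_point_Suc[OF y(1)] d_form_OS[OF _ v] phi_eq_Xi[OF _ y(1) fam_zero]
        by (simp add: Xi_boundary_rep[OF _ y(1) v] Xi_zero)
      finally show ?thesis .
    qed
    then have "f = phi {a} 0 (point_rep a ?c)"
      unfolding x(2) using phi_eq_Xi[OF _ x(1) p[of ?c]] by (simp add: Xi_diff)
    then show ?thesis by (auto simp: Phi_point_rep)
  qed
  ultimately show ?thesis by (auto simp: lin_iso_def bij_betw_def lin_map_def)
qed

lemma Phi_point_pos: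
  "m > 0 \<Longrightarrow> carrier (Phi {a} m :: ('k::field_char_0, ('a, 'k) phi) module) = {\<zero>\<^bsub>Phi {a} m\<^esub>}"
  using fam_zero fam_point_Suc by (cases m) (auto simp: carrier_Phi phi_zero)


text \<open>HOL functions are total, so \<open>\<alpha>\<close> also has values outside
  \<open>I\<close>; the clause on \<open>\<alpha>'\<close> records that \<open>push\<close> depends
  only on the map from \<open>I\<close> to \<open>J\<close>.\<close>

theorem theorem2p7:
  shows
    "(\<forall>I :: 'a set. finite I \<and> I \<noteq> {} \<longrightarrow>
        (\<forall>m. lin_map (Phi I m :: ('k::field_char_0, ('a, 'k) phi) module) (Phi_hat I m) (xi I m)) \<and>
        (\<forall>m. inj_on (xi I m) (carrier (Phi I m :: ('k, ('a, 'k) phi) module))) \<and>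
        subcomplex (Phi_hat I :: nat \<Rightarrow> ('k, ('a, 'k) pform set \<Rightarrow> 'k) module) (d_Phi_hat I)
          (\<lambda>m. xi I m ` carrier (Phi I m)))
   \<and> (\<forall>I :: 'a set. finite I \<and> I \<noteq> {} \<longrightarrow>
        chain_complex (Phi I :: nat \<Rightarrow> ('k, ('a, 'k) phi) module) (d_Phi I) \<and>
        (\<forall>m. \<forall>x\<in>carrier (Phi I m :: ('k, ('a, 'k) phi) module). push I I (\<lambda>i. i) m x = x))
   \<and> (\<forall>(I :: 'a set) (J :: 'b set) \<alpha>.
        finite I \<and> I \<noteq> {} \<and> finite J \<and> J \<noteq> {} \<and> \<alpha> \<in> I \<rightarrow> J \<longrightarrow>
        chain_map (Phi I :: nat \<Rightarrow> ('k, ('a, 'k) phi) module) (d_Phi I) (Phi J) (d_Phi J) (push I J \<alpha>) \<and>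
        quasi_iso (Phi I :: nat \<Rightarrow> ('k, ('a, 'k) phi) module) (d_Phi I) (Phi J) (d_Phi J) (push I J \<alpha>) \<and>
        (\<forall>\<alpha>'. (\<forall>i\<in>I. \<alpha>' i = \<alpha> i) \<longrightarrow>
          (\<forall>m. \<forall>x\<in>carrier (Phi I m :: ('k, ('a, 'k) phi) module). push I J \<alpha>' m x = push I J \<alpha> m x)))
   \<and> (\<forall>(I :: 'a set) (J :: 'b set) (L :: 'c set) \<alpha> \<beta>.
        finite I \<and> I \<noteq> {} \<and> finite J \<and> J \<noteq> {} \<and> finite L \<and> L \<noteq> {} \<and>
        \<alpha> \<in> I \<rightarrow> J \<and> \<beta> \<in> J \<rightarrow> L \<longrightarrow>
        (\<forall>m. \<forall>x\<in>carrier (Phi I m :: ('k, ('a, 'k) phi) module).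
          push I L (\<beta> \<circ> \<alpha>) m x = push J L \<beta> m (push I J \<alpha> m x)))
   \<and> (lin_iso (ground :: ('k, 'k) module) (Phi {0::nat} 0) (Phi_point 0) \<and>
      (\<forall>m>0. carrier (Phi {0::nat} m :: ('k, (nat, 'k) phi) module) = {\<zero>\<^bsub>Phi {0} m\<^esub>}))"
  by (intro conjI allI impI ballI; (elim conjE)?)
    ((rule Phi_point_pos, assumption) |
      blast intro: lin_map_xi inj_on_xi subcomplex_xi chain_complex_Phi push_id chain_map_push quasi_iso_push
        push_cong push_comp lin_iso_point)+

end
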